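(* Let $F$ be a non-Archimedean local field (of characteristic $0$ or positive), $K_1/F$ the unramified quadratic field extension, $K_2/F$ a quadratic Galois field extension not isomorphic to $K_1$, and $K_0,K_3$ the associated quadratic $F$-algebras. Let $n\ge1$ and let $\alpha:(K_1,K_2)\to\mathrm{Mat}_{2n}(F)$ and $\beta:(K_0,K_3)\to\mathrm{Mat}_{2n}(F)$ be matching regular semisimple pairs such that $\mathbf z_\alpha\in\mathrm{GL}_{2n}(\mathcal O_F)$. Then, for $\mathbf 1$ the characteristic function of $\mathrm{GL}_{2n}(\mathcal O_F)$, $$\mathrm{Orb}(\mathbf 1,\alpha)=\mathrm{Orb}(\mathbf 1,\beta,0).$$
   Context: Notation. $\mathcal O_F$ is the ring of integers, $\pi$ a uniformizer, $q$ the cardinality of the residue field; put $h=n$. $\sigma_i$ is the nontrivial automorphism of $K_i/F$ ($i=1,2$). Fix $\zeta_1\in\mathcal O_{K_1}$ with $(\zeta_1-\zeta_1^{\sigma_1})(\zeta_1+\zeta_1^{\sigma_1})\in\mathcal O_{K_1}^\times$ and $\varpi_2$ with $\mathcal O_{K_2}=\mathcal O_F[\varpi_2]$. $K_0\subset K_1\otimes_FK_1$ is the fixed subring of $\sigma_1\otimes\sigma_1$; it is identified with $F\times F$ via $x\otimes y\mapsto(xy,xy^{\sigma_1})$, and $\zeta_0=(1,0)$, $\zeta_0^{\sigma_0}=(0,1)$, $\mathcal O_{K_0}=\mathcal O_F\times\mathcal O_F$. $K_3\subset K_1\otimes_FK_2$ is the fixed subring of $\sigma_1\otimes\sigma_2$,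 $\varpi_3=\zeta_1\otimes\varpi_2+\zeta_1^{\sigma_1}\otimes\varpi_2^{\sigma_2}$, $\varpi_3^{\sigma_3}=\zeta_1^{\sigma_1}\otimes\varpi_2+\zeta_1\otimes\varpi_2^{\sigma_2}$, so $K_3=F[\varpi_3]$; $\mathcal O_{K_3}$ is its maximal order. A pair $\gamma=(\gamma_1,\gamma_2):(A_1,A_2)\to\mathrm{Mat}_{2h}(F)$ means two $F$-algebra homomorphisms. Its canonical elements, with respect to generators $a_1\in A_1,a_2\in A_2$ and the involutions of $A_1,A_2$ (written $\bar{\ }$), are $\mathbf w_\gamma=\gamma_1(a_1)\gamma_2(a_2)+\gamma_2(\bar a_2)\gamma_1(\bar a_1)$ and $\mathbf z_\gamma=\gamma_2(a_2)\gamma_1(a_1)-\gamma_1(a_1)\gamma_2(a_2)$. Use $(a_1,a_2)=(\zeta_1,\varpi_2)$ for $(K_1,K_2)$ and $(\zeta_0,\varpi_3)$ for $(K_0,K_3)$; write $\beta=(\beta_0,\beta_3)$ in the latter case. All embeddings are assumed free: $F^{2h}$ is a free module of rank $h$ over each of the two algebras. The pair is regular semisimple if $\mathbf w_\gamma$, as an element of the centralizer $\cong\mathrm{Mat}_h(A_1)$ of the image of $\gamma_1$, has $h$ distinct eigenvalues over the algebraic closure, and $\mathbf z_\gamma$ is invertible. Then $L:=F[\mathbf w_\gamma]$ is an étale $F$-algebra of degree $h$ with maximal order $\mathcal O_L$. Matching. $\alpha$ and $\beta$ match if there is a $K_1$-algebra automorphism $j$ of $K_1\otimes_F\mathrm{Mat}_{2h}(F)$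 with $j(1\otimes\beta_0(x))=(\mathrm{id}\otimes\alpha_1)(x)$ for all $x\in K_0\subset K_1\otimes K_1$ and $j(1\otimes\beta_3(y))=(\mathrm{id}\otimes\alpha_2)(y)$ for all $y\in K_3\subset K_1\otimes K_2$. Orbital integrals. Fix reference pairs $\alpha^{\rm ref}:(\mathcal O_{K_1},\mathcal O_{K_2})\to\mathrm{Mat}_{2h}(\mathcal O_F)$, $\beta^{\rm ref}:(\mathcal O_{K_0},\mathcal O_{K_3})\to\mathrm{Mat}_{2h}(\mathcal O_F)$; let $H_i\subset\mathrm{GL}_{2h}(F)$ be the centralizer of $\alpha^{\rm ref}_i$ ($i=1,2$), resp. $\beta^{\rm ref}_i$ ($i=0,3$), with Haar measure giving $H_i\cap\mathrm{GL}_{2h}(\mathcal O_F)$ volume $1$; give $L^\times$ the Haar measure with $\mathrm{Vol}(\mathcal O_L^\times)=1$. Write $\alpha_i=g_i\alpha_i^{\rm ref}g_i^{-1}$, $\beta_i=g_i\beta_i^{\rm ref}g_i^{-1}$. With $L^\times$ embedded via $l\mapsto(g_1^{-1}lg_1,g_2^{-1}lg_2)$ (similarly for $\beta$), for $f$ bi-$\mathrm{GL}_{2h}(\mathcal O_F)$-invariant, $$\mathrm{Orb}(f,\alpha)=\int_{(H_1\times H_2)/L^\times}f(h_1^{-1}g_1^{-1}g_2h_2)\,dh_1dh_2,$$ $$\mathrm{Orb}(f,\beta,s)=\int_{(H_0\times H_3)/L^\times}f(h_0^{-1}g_0^{-1}g_3h_3)\,\Omega(g_0h_0\mathcal O_F^{2h},s)\,dh_0dh_3.$$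 Here for a $\beta_0(\mathcal O_{K_0})$-stable lattice $\Lambda$, $\Lambda_+=\beta_0(\zeta_0)\Lambda$, $\Lambda_-=\beta_0(\zeta_0^{\sigma_0})\Lambda$, $\Omega(\Lambda,s)=(-q^s)^{\log_q[\Lambda_-:\mathbf z_\beta\Lambda_+]}$, with $[\Lambda_1:\Lambda_2]=\#(\Lambda_1/\Lambda_1\cap\Lambda_2)/\#(\Lambda_2/\Lambda_1\cap\Lambda_2)$ and $(-q^s)^m=(-1)^mq^{sm}$. For $f=\mathbf 1$, choosing a subgroup $\Gamma_L\subset L^\times$ with $L^\times=\mathcal O_L^\times\times\Gamma_L$, these unfold to: $\mathrm{Orb}(\mathbf 1,\alpha)$ is the number of $\Gamma_L$-orbits of full $\mathcal O_F$-lattices in $F^{2h}$ stable under $\alpha_1(\mathcal O_{K_1})$ and $\alpha_2(\mathcal O_{K_2})$; $\mathrm{Orb}(\mathbf 1,\beta,s)=\sum_\Lambda\Omega(\Lambda,s)$ over $\Gamma_L$-orbits of lattices stable under $\beta_0(\mathcal O_{K_0})$ and $\beta_3(\mathcal O_{K_3})$. *)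

theory Defs
  imports "HOL-Analysis.Analysis" "HOL-Algebra.Algebraic_Closure_Type"
begin

text \<open>
  The absolute value is \<open>\<lambda>x. dist x 0\<close>. A nontrivially valued ultrametric field with compact unit
  ball is complete, discretely valued and has finite residue field.
\<close>

class nonarch_local_field = field + metric_space +
  assumes dist_translate: "dist (x + z) (y + z) = dist x y"
    and dist_mult_0: "dist (x * y) 0 = dist x 0 * dist y 0"
    and dist_ultrametric: "dist (x + y) 0 \<le> max (dist x 0) (dist y 0)"
    and dist_nontrivial: "\<exists>x. x \<noteq> 0 \<and> dist x 0 \<noteq> 1"
    and compact_unit_ball: "compact {x. dist x 0 \<le> 1}"

definition int_ring :: "'f::nonarch_local_field set" where
  "int_ring = {x. dist x 0 \<le> 1}"

definition max_ideal :: "'f::nonarch_local_field set" where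
  "max_ideal = {x. dist x 0 < 1}"

definition quot_card :: "'a::plus set \<Rightarrow> 'a set \<Rightarrow> nat" where
  "quot_card M N = card ((\<lambda>x. (+) x ` N) ` M)"

definition residue_card :: "'f::nonarch_local_field itself \<Rightarrow> nat" where
  "residue_card _ = quot_card (int_ring :: 'f set) max_ideal"

definition unital_hom :: "('a::ring_1 \<Rightarrow> 'b::ring_1) \<Rightarrow> bool" where
  "unital_hom f \<longleftrightarrow> f 1 = 1 \<and> (\<forall>x y. f (x + y) = f x + f y) \<and> (\<forall>x y. f (x * y) = f x * f y)"

text \<open>An \<open>F\<close>-algebra is given by its structure map \<open>\<iota>\<close>.\<close>

definition alg_scale :: "('f \<Rightarrow> 'a::comm_ring_1) \<Rightarrow> 'f \<Rightarrow> 'a \<Rightarrow> 'a" where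
  "alg_scale \<iota> c x = \<iota> c * x"

definition quadratic_galois :: "('f::field \<Rightarrow> 'k::field) \<Rightarrow> ('k \<Rightarrow> 'k) \<Rightarrow> bool" where
  "quadratic_galois \<iota> \<sigma> \<longleftrightarrow>
     unital_hom \<iota> \<and> vector_space.dim (alg_scale \<iota>) (UNIV :: 'k set) = 2 \<and>
     unital_hom \<sigma> \<and> bij \<sigma> \<and> \<sigma> \<noteq> id \<and> {x. \<sigma> x = x} = range \<iota>"

definition integral_over :: "('f::nonarch_local_field \<Rightarrow> 'a::comm_ring_1) \<Rightarrow> 'a \<Rightarrow> bool" where
  "integral_over \<iota> x \<longleftrightarrow>
     (\<exists>p. Polynomial.lead_coeff p = 1 \<and> (\<forall>k. Polynomial.coeff p k \<in> int_ring) \<and>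
        poly (map_poly \<iota> p) x = 0)"

definition max_order :: "'a set \<Rightarrow> ('f::nonarch_local_field \<Rightarrow> 'a::comm_ring_1) \<Rightarrow> 'a set" where
  "max_order A \<iota> = {x \<in> A. integral_over \<iota> x}"

definition ring_units :: "'a::comm_ring_1 set \<Rightarrow> 'a set" where
  "ring_units R = {x \<in> R. \<exists>y\<in>R. x * y = 1}"

text \<open>Residue fields are finite, so separability of the residue extension is automatic.\<close>

definition unramified :: "('f::nonarch_local_field \<Rightarrow> 'k::field) \<Rightarrow> bool" where
  "unramified \<iota> \<longleftrightarrow>
     max_order UNIV \<iota> - ring_units (max_order UNIV \<iota>) =
       {\<iota> a * y | a y. a \<in> max_ideal \<and> y \<in> max_order UNIV \<iota>}"

definition alg_isomorphic :: "('f \<Rightarrow> 'a::comm_ring_1) \<Rightarrow> ('f \<Rightarrow> 'b::comm_ring_1) \<Rightarrow> bool" where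
  "alg_isomorphic \<iota> \<iota>' \<longleftrightarrow> (\<exists>\<phi>. unital_hom \<phi> \<and> bij \<phi> \<and> \<phi> \<circ> \<iota> = \<iota>')"

definition int_adjoin :: "('f::nonarch_local_field \<Rightarrow> 'a::comm_ring_1) \<Rightarrow> 'a \<Rightarrow> 'a set" where
  "int_adjoin \<iota> x = {poly (map_poly \<iota> p) x | p. \<forall>k. Polynomial.coeff p k \<in> int_ring}"

definition alg_basis :: "('f::field \<Rightarrow> 'a::comm_ring_1) \<Rightarrow> 'a set \<Rightarrow> bool" where
  "alg_basis \<iota> B \<longleftrightarrow>
     \<not> Modules.module.dependent (alg_scale \<iota>) B \<and> Modules.module.span (alg_scale \<iota>) B = UNIV"

text \<open>
  The ring \<open>'t\<close> with \<open>i x = x \<otimes> 1\<close> and \<open>j y = 1 \<otimes> y\<close> is a model of the tensor product over \<open>F\<close> of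
  \<open>'a\<close> and the finite-dimensional algebra \<open>'b\<close>.
\<close>

definition is_tensor_product ::
  "('f::field \<Rightarrow> 'a::comm_ring_1) \<Rightarrow> ('f \<Rightarrow> 'b::comm_ring_1) \<Rightarrow>
   ('a \<Rightarrow> 't::comm_ring_1) \<Rightarrow> ('b \<Rightarrow> 't) \<Rightarrow> bool" where
  "is_tensor_product \<iota> \<iota>' i j \<longleftrightarrow>
     unital_hom i \<and> unital_hom j \<and> i \<circ> \<iota> = j \<circ> \<iota>' \<and>
     (\<forall>B. alg_basis \<iota>' B \<longrightarrow>
        (\<forall>t. \<exists>!c. (\<forall>b. b \<notin> B \<longrightarrow> c b = 0) \<and> t = (\<Sum>b\<in>B. i (c b) * j b)))"

text \<open>
  The additive map \<open>x \<otimes> y \<mapsto> \<phi> x y\<close> attached to an \<open>F\<close>-balanced biadditive \<open>\<phi>\<close>.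
\<close>

definition tensor_lift ::
  "('a \<Rightarrow> 't::comm_ring_1) \<Rightarrow> ('b \<Rightarrow> 't) \<Rightarrow> ('a \<Rightarrow> 'b \<Rightarrow> 's::comm_monoid_add) \<Rightarrow> 't \<Rightarrow> 's" where
  "tensor_lift i j \<phi> t =
     (THE s. \<exists>xys. t = (\<Sum>(x, y)\<leftarrow>xys. i x * j y) \<and> s = (\<Sum>(x, y)\<leftarrow>xys. \<phi> x y))"

definition tensor_fixed ::
  "('a \<Rightarrow> 't::comm_ring_1) \<Rightarrow> ('b \<Rightarrow> 't) \<Rightarrow> ('a \<Rightarrow> 'a) \<Rightarrow> ('b \<Rightarrow> 'b) \<Rightarrow> 't set" where
  "tensor_fixed i j \<sigma> \<sigma>' = {t. tensor_lift i j (\<lambda>x y. i (\<sigma> x) * j (\<sigma>' y)) t = t}"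

text \<open>
  On \<open>K\<^sub>0 = tensor_fixed i j \<sigma> \<sigma>\<close> the map below takes values in (the image of) \<open>F \<times> F\<close> and is the
  identification of \<open>K\<^sub>0\<close> with \<open>F \<times> F\<close>.
\<close>

definition K0_coords ::
  "('k \<Rightarrow> 't::comm_ring_1) \<Rightarrow> ('k \<Rightarrow> 't) \<Rightarrow> ('k::field \<Rightarrow> 'k) \<Rightarrow> 't \<Rightarrow> 'k \<times> 'k" where
  "K0_coords i j \<sigma> = tensor_lift i j (\<lambda>x y. (x * y, x * \<sigma> y))"

definition K0_elem ::
  "('k \<Rightarrow> 't::comm_ring_1) \<Rightarrow> ('k \<Rightarrow> 't) \<Rightarrow> ('k::field \<Rightarrow> 'k) \<Rightarrow> 'k \<times> 'k \<Rightarrow> 't" where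
  "K0_elem i j \<sigma> ab = (THE t. t \<in> tensor_fixed i j \<sigma> \<sigma> \<and> K0_coords i j \<sigma> t = ab)"

definition K0_order ::
  "('f::nonarch_local_field \<Rightarrow> 'k::field) \<Rightarrow>
   ('k \<Rightarrow> 't::comm_ring_1) \<Rightarrow> ('k \<Rightarrow> 't) \<Rightarrow> ('k \<Rightarrow> 'k) \<Rightarrow> 't set" where
  "K0_order \<iota> i j \<sigma> =
     {t \<in> tensor_fixed i j \<sigma> \<sigma>. K0_coords i j \<sigma> t \<in> (\<iota> ` int_ring) \<times> (\<iota> ` int_ring)}"

text \<open>
  Matrices are multiplied with \<open>**\<close>; the operation \<open>*\<close> on \<open>'f^'m^'m\<close> is componentwise and plays no
  role. Scalar multiplication by \<open>c\<close> is multiplication by \<open>mat c\<close>.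
\<close>

definition mat_over :: "'a set \<Rightarrow> ('a^'m^'m) set" where
  "mat_over R = {M. \<forall>i j. M $ i $ j \<in> R}"

definition mat_units :: "('a::semiring_1^'m^'m) set \<Rightarrow> ('a^'m^'m) set" where
  "mat_units R = {x \<in> R. \<exists>y\<in>R. x ** y = mat 1 \<and> y ** x = mat 1}"

definition GL_int :: "('f::nonarch_local_field^'m^'m) set" where
  "GL_int = mat_units (mat_over int_ring)"

definition mat_poly :: "'a::comm_ring_1 poly \<Rightarrow> 'a^'m^'m \<Rightarrow> 'a^'m^'m" where
  "mat_poly p M = (\<Sum>k\<le>Polynomial.degree p. mat (Polynomial.coeff p k) ** ((\<lambda>N. M ** N) ^^ k) (mat 1))"

text \<open>Here and below \<open>A\<close> is a subalgebra of the ring \<open>'a\<close>.\<close>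

definition alg_embedding ::
  "'a set \<Rightarrow> ('f::field \<Rightarrow> 'a::comm_ring_1) \<Rightarrow> ('a \<Rightarrow> 'f^'m^'m) \<Rightarrow> bool" where
  "alg_embedding A \<iota> \<gamma> \<longleftrightarrow>
     (\<forall>c. \<gamma> (\<iota> c) = mat c) \<and>
     (\<forall>x\<in>A. \<forall>y\<in>A. \<gamma> (x + y) = \<gamma> x + \<gamma> y \<and> \<gamma> (x * y) = \<gamma> x ** \<gamma> y)"

definition module_basis ::
  "'a set \<Rightarrow> ('a::comm_ring_1 \<Rightarrow> 'f::field^'m^'m) \<Rightarrow> ('n::finite \<Rightarrow> 'f^'m) \<Rightarrow> bool" where
  "module_basis A \<gamma> e \<longleftrightarrow>
     (\<forall>v. \<exists>!x::'a^'n. (\<forall>i. x $ i \<in> A) \<and> v = (\<Sum>i\<in>UNIV. \<gamma> (x $ i) *v e i))"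

definition free_embedding ::
  "'n::finite itself \<Rightarrow> 'a set \<Rightarrow> ('f::field \<Rightarrow> 'a::comm_ring_1) \<Rightarrow> ('a \<Rightarrow> 'f^'m^'m) \<Rightarrow> bool" where
  "free_embedding _ A \<iota> \<gamma> \<longleftrightarrow>
     alg_embedding A \<iota> \<gamma> \<and> (\<exists>e::'n \<Rightarrow> 'f^'m. module_basis A \<gamma> e)"

text \<open>The canonical elements; \<open>a\<^sub>1'\<close> and \<open>a\<^sub>2'\<close> are the conjugates of \<open>a\<^sub>1\<close> and \<open>a\<^sub>2\<close>.\<close>

definition w_elem ::
  "('a \<Rightarrow> 'f::field^'m^'m) \<Rightarrow> ('b \<Rightarrow> 'f^'m^'m) \<Rightarrow> 'a \<Rightarrow> 'a \<Rightarrow> 'b \<Rightarrow> 'b \<Rightarrow> 'f^'m^'m" where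
  "w_elem \<gamma>\<^sub>1 \<gamma>\<^sub>2 a\<^sub>1 a\<^sub>1' a\<^sub>2 a\<^sub>2' = \<gamma>\<^sub>1 a\<^sub>1 ** \<gamma>\<^sub>2 a\<^sub>2 + \<gamma>\<^sub>2 a\<^sub>2' ** \<gamma>\<^sub>1 a\<^sub>1'"

definition z_elem ::
  "('a \<Rightarrow> 'f::field^'m^'m) \<Rightarrow> ('b \<Rightarrow> 'f^'m^'m) \<Rightarrow> 'a \<Rightarrow> 'b \<Rightarrow> 'f^'m^'m" where
  "z_elem \<gamma>\<^sub>1 \<gamma>\<^sub>2 a\<^sub>1 a\<^sub>2 = \<gamma>\<^sub>2 a\<^sub>2 ** \<gamma>\<^sub>1 a\<^sub>1 - \<gamma>\<^sub>1 a\<^sub>1 ** \<gamma>\<^sub>2 a\<^sub>2"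

definition eigenvalues :: "'a::field^'n^'n \<Rightarrow> 'a set" where
  "eigenvalues M = {c. \<exists>v. v \<noteq> 0 \<and> M *v v = c *s v}"

definition geometric_point ::
  "'a set \<Rightarrow> ('f::field \<Rightarrow> 'a::comm_ring_1) \<Rightarrow> ('a \<Rightarrow> 'f alg_closure) \<Rightarrow> bool" where
  "geometric_point A \<iota> \<tau> \<longleftrightarrow>
     (\<forall>c. \<tau> (\<iota> c) = to_ac c) \<and>
     (\<forall>x\<in>A. \<forall>y\<in>A. \<tau> (x + y) = \<tau> x + \<tau> y \<and> \<tau> (x * y) = \<tau> x * \<tau> y)"

text \<open>
  \<open>W\<close> is the matrix, with respect to an \<open>A\<close>-basis \<open>e\<close> of \<open>F\<^sup>2\<^sup>h\<close>, of \<open>w\<close> viewed in the centralizer of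
  the image of \<open>\<gamma>\<close>. When \<open>A\<close> is not a field its eigenvalues over the algebraic closure are those of
  its specializations along the \<open>F\<close>-algebra maps from \<open>A\<close> to the algebraic closure.
\<close>

definition regular_semisimple ::
  "'n::finite itself \<Rightarrow> 'a set \<Rightarrow> ('f::field \<Rightarrow> 'a::comm_ring_1) \<Rightarrow> ('a \<Rightarrow> 'f^'m^'m) \<Rightarrow>
   'f^'m^'m \<Rightarrow> 'f^'m^'m \<Rightarrow> bool" where
  "regular_semisimple _ A \<iota> \<gamma> w z \<longleftrightarrow>
     invertible z \<and>
     (\<exists>(e::'n \<Rightarrow> 'f^'m) (W::'a^'n^'n).
        module_basis A \<gamma> e \<and> W \<in> mat_over A \<and>
        (\<forall>j. w *v e j = (\<Sum>i\<in>UNIV. \<gamma> (W $ i $ j) *v e i)) \<and>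
        (\<forall>\<tau>. geometric_point A \<iota> \<tau> \<longrightarrow> card (eigenvalues (map_matrix \<tau> W)) = CARD('n)))"

text \<open>\<open>K\<^sub>1 \<otimes> Mat(F)\<close> is \<open>Mat(K\<^sub>1)\<close>, with \<open>1 \<otimes> M = map_matrix \<iota> M\<close>.\<close>

definition mat_automorphism :: "('k::field^'m^'m \<Rightarrow> 'k^'m^'m) \<Rightarrow> bool" where
  "mat_automorphism J \<longleftrightarrow>
     bij J \<and> J (mat 1) = mat 1 \<and> (\<forall>M N. J (M + N) = J M + J N) \<and>
     (\<forall>M N. J (M ** N) = J M ** J N) \<and> (\<forall>c M. J (mat c ** M) = mat c ** J M)"

definition base_change ::
  "('f::field \<Rightarrow> 'k::field) \<Rightarrow> ('k \<Rightarrow> 't::comm_ring_1) \<Rightarrow> ('a \<Rightarrow> 't) \<Rightarrow> ('a \<Rightarrow> 'f^'m^'m) \<Rightarrow>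
   't \<Rightarrow> 'k^'m^'m" where
  "base_change \<iota> i j \<gamma> = tensor_lift i j (\<lambda>x y. mat x ** map_matrix \<iota> (\<gamma> y))"

definition matching ::
  "('f::field \<Rightarrow> 'k1::field) \<Rightarrow> ('k1 \<Rightarrow> 'k1) \<Rightarrow> ('k2::field \<Rightarrow> 'k2) \<Rightarrow>
   ('k1 \<Rightarrow> 't::comm_ring_1) \<Rightarrow> ('k1 \<Rightarrow> 't) \<Rightarrow> ('k1 \<Rightarrow> 'u::comm_ring_1) \<Rightarrow> ('k2 \<Rightarrow> 'u) \<Rightarrow>
   ('k1 \<Rightarrow> 'f^'m^'m) \<Rightarrow> ('k2 \<Rightarrow> 'f^'m^'m) \<Rightarrow> ('t \<Rightarrow> 'f^'m^'m) \<Rightarrow> ('u \<Rightarrow> 'f^'m^'m) \<Rightarrow> bool" where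
  "matching \<iota>\<^sub>1 \<sigma>\<^sub>1 \<sigma>\<^sub>2 i j i' j' \<alpha>\<^sub>1 \<alpha>\<^sub>2 \<beta>\<^sub>0 \<beta>\<^sub>3 \<longleftrightarrow>
     (\<exists>J. mat_automorphism J \<and>
        (\<forall>x\<in>tensor_fixed i j \<sigma>\<^sub>1 \<sigma>\<^sub>1. J (map_matrix \<iota>\<^sub>1 (\<beta>\<^sub>0 x)) = base_change \<iota>\<^sub>1 i j \<alpha>\<^sub>1 x) \<and>
        (\<forall>y\<in>tensor_fixed i' j' \<sigma>\<^sub>1 \<sigma>\<^sub>2. J (map_matrix \<iota>\<^sub>1 (\<beta>\<^sub>3 y)) = base_change \<iota>\<^sub>1 i' j' \<alpha>\<^sub>2 y))"

definition centralizer :: "'a set \<Rightarrow> ('a \<Rightarrow> 'f::field^'m^'m) \<Rightarrow> ('f^'m^'m) set" where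
  "centralizer A \<gamma> = {g. invertible g \<and> (\<forall>x\<in>A. g ** \<gamma> x = \<gamma> x ** g)}"

definition adjoin :: "'f::field^'m^'m \<Rightarrow> ('f^'m^'m) set" where
  "adjoin w = range (\<lambda>p. mat_poly p w)"

definition adjoin_max_order :: "'f::nonarch_local_field^'m^'m \<Rightarrow> ('f^'m^'m) set" where
  "adjoin_max_order w =
     {x \<in> adjoin w.
       \<exists>p. Polynomial.lead_coeff p = 1 \<and> (\<forall>k. Polynomial.coeff p k \<in> int_ring) \<and> mat_poly p x = 0}"

text \<open>
  \<open>M\<close> is the Haar measure on the matrix group \<open>G\<close> that gives \<open>U\<close> volume 1. All groups in question are
  second countable and unimodular, so regularity is automatic and left-invariance is invariance.
\<close>

definition haar_measure ::
  "('f::nonarch_local_field^'m^'m) set \<Rightarrow> ('f^'m^'m) set \<Rightarrow> ('f^'m^'m) measure \<Rightarrow> bool" where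
  "haar_measure G U M \<longleftrightarrow>
     space M = G \<and> sets M = sets (restrict_space borel G) \<and>
     (\<forall>g\<in>G. \<forall>S\<in>sets M. emeasure M ((\<lambda>h. g ** h) ` S) = emeasure M S) \<and>
     (\<forall>C. C \<subseteq> G \<and> compact C \<longrightarrow> emeasure M C < \<infinity>) \<and>
     emeasure M U = 1"

text \<open>
  \<open>l\<close> acts through \<open>(g\<^sub>1\<^sup>-\<^sup>1 l g\<^sub>1, g\<^sub>2\<^sup>-\<^sup>1 l g\<^sub>2)\<close> by left translation, which is the action under which
  \<open>h\<^sub>1\<^sup>-\<^sup>1 g\<^sub>1\<^sup>-\<^sup>1 g\<^sub>2 h\<^sub>2\<close> is invariant. The quotient \<open>(H\<^sub>1 \<times> H\<^sub>2)/L\<^sup>\<times>\<close> is the space of its orbits.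
\<close>

definition pair_action ::
  "'f::field^'m^'m \<Rightarrow> 'f^'m^'m \<Rightarrow> 'f^'m^'m \<Rightarrow> ('f^'m^'m) \<times> ('f^'m^'m) \<Rightarrow> ('f^'m^'m) \<times> ('f^'m^'m)" where
  "pair_action g\<^sub>1 g\<^sub>2 l = (\<lambda>(h\<^sub>1, h\<^sub>2).
     (matrix_inv g\<^sub>1 ** l ** g\<^sub>1 ** h\<^sub>1, matrix_inv g\<^sub>2 ** l ** g\<^sub>2 ** h\<^sub>2))"

definition orbit_space :: "('l \<Rightarrow> 'x \<Rightarrow> 'x) \<Rightarrow> 'l set \<Rightarrow> 'x set \<Rightarrow> 'x set set" where
  "orbit_space act G S = (\<lambda>x. (\<lambda>l. act l x) ` G) ` S"

text \<open>The value on an orbit of a function that is constant on orbits.\<close>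

definition descend :: "('x \<Rightarrow> 'y) \<Rightarrow> 'x set \<Rightarrow> 'y" where
  "descend \<phi> C = (THE y. \<forall>x\<in>C. \<phi> x = y)"

text \<open>
  \<open>Q\<close> is the quotient of the measure \<open>M\<close> by the measure \<open>N\<close> on the acting group: it lives on the
  quotient \<open>\<sigma>\<close>-algebra and satisfies Weil's integration formula.
\<close>

definition quotient_measure ::
  "('l \<Rightarrow> 'x \<Rightarrow> 'x) \<Rightarrow> 'l measure \<Rightarrow> 'x measure \<Rightarrow> 'x set measure \<Rightarrow> bool" where
  "quotient_measure act N M Q \<longleftrightarrow>
     space Q = orbit_space act (space N) (space M) \<and>
     sets Q = {S. S \<subseteq> space Q \<and> \<Union>S \<in> sets M} \<and>
     (\<forall>\<phi> \<in> borel_measurable M.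
        (\<integral>\<^sup>+x. \<phi> x \<partial>M) = (\<integral>\<^sup>+C. descend (\<lambda>x. \<integral>\<^sup>+l. \<phi> (act l x) \<partial>N) C \<partial>Q))"

text \<open>
  The normalized measure on \<open>(H\<^sub>1 \<times> H\<^sub>2)/L\<^sup>\<times>\<close>, where \<open>H\<^sub>i\<close> is the centralizer of the reference
  embedding \<open>\<rho>\<^sub>i\<close> and \<open>L = F[w]\<close>.
\<close>

definition orbital_measure ::
  "'a set \<Rightarrow> ('a \<Rightarrow> 'f::nonarch_local_field^'m^'m) \<Rightarrow> 'b set \<Rightarrow> ('b \<Rightarrow> 'f^'m^'m) \<Rightarrow>
   'f^'m^'m \<Rightarrow> 'f^'m^'m \<Rightarrow> 'f^'m^'m \<Rightarrow> (('f^'m^'m) \<times> ('f^'m^'m)) set measure \<Rightarrow> bool" where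
  "orbital_measure A\<^sub>1 \<rho>\<^sub>1 A\<^sub>2 \<rho>\<^sub>2 w g\<^sub>1 g\<^sub>2 Q \<longleftrightarrow>
     (\<exists>\<mu>\<^sub>1 \<mu>\<^sub>2 \<nu>.
        haar_measure (centralizer A\<^sub>1 \<rho>\<^sub>1) (centralizer A\<^sub>1 \<rho>\<^sub>1 \<inter> GL_int) \<mu>\<^sub>1 \<and>
        haar_measure (centralizer A\<^sub>2 \<rho>\<^sub>2) (centralizer A\<^sub>2 \<rho>\<^sub>2 \<inter> GL_int) \<mu>\<^sub>2 \<and>
        haar_measure (mat_units (adjoin w)) (mat_units (adjoin_max_order w)) \<nu> \<and>
        quotient_measure (pair_action g\<^sub>1 g\<^sub>2) \<nu> (\<mu>\<^sub>1 \<Otimes>\<^sub>M \<mu>\<^sub>2) Q)"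

definition Orb ::
  "(('f::nonarch_local_field^'m^'m) \<times> ('f^'m^'m)) set measure \<Rightarrow> ('f^'m^'m \<Rightarrow> complex) \<Rightarrow>
   'f^'m^'m \<Rightarrow> 'f^'m^'m \<Rightarrow> complex" where
  "Orb Q f g\<^sub>1 g\<^sub>2 =
     (\<integral>C. descend (\<lambda>(h\<^sub>1, h\<^sub>2). f (matrix_inv h\<^sub>1 ** matrix_inv g\<^sub>1 ** g\<^sub>2 ** h\<^sub>2)) C \<partial>Q)"

definition std_lattice :: "('f::nonarch_local_field^'m) set" where
  "std_lattice = {v. \<forall>i. v $ i \<in> int_ring}"

definition lattice_index :: "('a::plus) set \<Rightarrow> 'a set \<Rightarrow> real" where
  "lattice_index \<Lambda>\<^sub>1 \<Lambda>\<^sub>2 =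
     real (quot_card \<Lambda>\<^sub>1 (\<Lambda>\<^sub>1 \<inter> \<Lambda>\<^sub>2)) / real (quot_card \<Lambda>\<^sub>2 (\<Lambda>\<^sub>1 \<inter> \<Lambda>\<^sub>2))"

text \<open>The transfer factor; \<open>p\<close>, \<open>p'\<close> are the idempotents \<open>\<beta>\<^sub>0 \<zeta>\<^sub>0\<close>, \<open>\<beta>\<^sub>0 \<zeta>\<^sub>0'\<close>.\<close>

definition Omega ::
  "'f::nonarch_local_field^'m^'m \<Rightarrow> 'f^'m^'m \<Rightarrow> 'f^'m^'m \<Rightarrow> ('f^'m) set \<Rightarrow> complex \<Rightarrow> complex" where
  "Omega p p' z \<Lambda> s =
     (let \<Lambda>p = (*v) p ` \<Lambda>; \<Lambda>m = (*v) p' ` \<Lambda>; q = residue_card TYPE('f);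
          m = (THE m::int. real q powi m = lattice_index \<Lambda>m ((*v) z ` \<Lambda>p))
      in (-1) powi m * of_nat q powr (s * of_int m))"

definition Orb_s ::
  "(('f::nonarch_local_field^'m^'m) \<times> ('f^'m^'m)) set measure \<Rightarrow> ('f^'m^'m \<Rightarrow> complex) \<Rightarrow>
   'f^'m^'m \<Rightarrow> 'f^'m^'m \<Rightarrow> 'f^'m^'m \<Rightarrow> 'f^'m^'m \<Rightarrow> 'f^'m^'m \<Rightarrow> complex \<Rightarrow> complex" where
  "Orb_s Q f g\<^sub>0 g\<^sub>3 p p' z s =
     (\<integral>C. descend (\<lambda>(h\<^sub>0, h\<^sub>3).
        f (matrix_inv h\<^sub>0 ** matrix_inv g\<^sub>0 ** g\<^sub>3 ** h\<^sub>3) *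
        Omega p p' z ((*v) (g\<^sub>0 ** h\<^sub>0) ` std_lattice) s) C \<partial>Q)"

text \<open>
  An integral reference embedding, recorded through its extension from the order \<open>R\<close> to \<open>A\<close>.
\<close>

definition reference_embedding ::
  "'n::finite itself \<Rightarrow> 'a set \<Rightarrow> 'a set \<Rightarrow> ('f::nonarch_local_field \<Rightarrow> 'a::comm_ring_1) \<Rightarrow>
   ('a \<Rightarrow> 'f^'m^'m) \<Rightarrow> bool" where
  "reference_embedding T A R \<iota> \<rho> \<longleftrightarrow> free_embedding T A \<iota> \<rho> \<and> \<rho> ` R \<subseteq> mat_over int_ring"

definition conjugate_by :: "'a set \<Rightarrow> 'f::field^'m^'m \<Rightarrow> ('a \<Rightarrow> 'f^'m^'m) \<Rightarrow> ('a \<Rightarrow> 'f^'m^'m) \<Rightarrow> bool" where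
  "conjugate_by A g \<rho> \<gamma> \<longleftrightarrow> invertible g \<and> (\<forall>x\<in>A. \<gamma> x = g ** \<rho> x ** matrix_inv g)"

end

theory Submission
  imports Defs
begin

text \<open>
  Write \<open>a = \<alpha>\<^sub>1(\<zeta>\<^sub>1)\<close>, \<open>b = \<alpha>\<^sub>2(\<pi>\<^sub>2)\<close>, \<open>p = \<beta>\<^sub>0(\<zeta>\<^sub>0)\<close>, \<open>b\<^sub>3 = \<beta>\<^sub>3(\<pi>\<^sub>3)\<close>, and let a prime denote conjugation.
  Weil's formula unfolds both orbital integrals to lattice counts (\<open>equal_orbits_measure\<close>): a pair of
  cosets at which the integrand is nonzero amounts to a lattice stable under both orders, and a representative
  \<open>\<Lambda>\<close> of an \<open>L\<^sup>\<times>\<close>-orbit contributes the size of its orbit under the units of \<open>O\<^sub>L\<close>. That every stable lattice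
  occurs means that the centralizer of \<open>\<alpha>\<^sub>i\<close> acts transitively on the lattices stable under the
  order of \<open>K\<^sub>i\<close>: over the valuation ring \<open>O\<^sub>i\<close> such lattices are free, and for \<open>K\<^sub>0\<close> both components
  are free (\<open>transitive_quadratic\<close>, \<open>transitive_idempotent\<close>). It remains to find an invertible
  \<open>T\<close> with \<open>w\<^sub>\<alpha> T = T w\<^sub>\<beta>\<close> such that \<open>\<Lambda> \<mapsto> T \<Lambda>\<close> maps the lattices stable under \<open>p, b\<^sub>3\<close> onto those
  stable under \<open>a, b\<close>, and to see that the transfer factor is trivial.

  The algebra generated by \<open>a, b\<close> is governed by the relations \<open>z a = a' z\<close>, \<open>w\<close> central, and
  \<open>z\<^sup>2 = w\<^sup>2 - t\<^sub>1 t\<^sub>2 w + n\<^sub>1 t\<^sub>2\<^sup>2 + t\<^sub>1\<^sup>2 n\<^sub>2 - 4 n\<^sub>1 n\<^sub>2\<close>, where \<open>t\<^sub>i, n\<^sub>i\<close> are the traces and norms of the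
  generators. The discriminant of \<open>a\<close> is a unit, so that a lattice stable under \<open>a\<close> is stable
  under \<open>b\<close> if and only if it is stable under \<open>w\<close> and \<open>z\<close>. The same holds for \<open>p, b\<^sub>3\<close>. Matching says
  that over \<open>K\<^sub>1\<close> a matrix \<open>P\<close> carries \<open>w\<^sub>\<beta>, z\<^sub>\<beta>\<close> to \<open>w\<^sub>\<alpha>, z\<^sub>\<alpha>\<close> and the image of \<open>p\<close> to an eigenspace of \<open>a\<close>
  (\<open>matching_operator\<close>).

  Since \<open>K\<^sub>2\<close> is not the unramified extension, \<open>X\<^sup>2 - t\<^sub>2 X + n\<^sub>2\<close> is the square of a linear polynomial
  modulo the uniformizer (\<open>residually_square\<close>). Hence \<open>z\<^sub>\<alpha>\<^sup>2\<close> is congruent to the square of an element of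
  \<open>O\<^sub>F[w\<^sub>\<alpha>]\<close>, and when \<open>z\<^sub>\<alpha>\<close> is invertible over \<open>O\<^sub>F\<close>, Hensel's lemma makes it a norm \<open>U U'\<close> of a unit of
  the ring generated by \<open>w\<^sub>\<alpha>\<close> and \<open>a\<close>. So \<open>U\<^sup>-\<^sup>1 z\<^sub>\<alpha>\<close> is an involution, semilinear for \<open>a\<close> and commuting with \<open>w\<^sub>\<alpha>\<close>
  (\<open>semilinear_involution\<close>). By unramified descent a lattice stable under \<open>a\<close>, \<open>w\<^sub>\<alpha>\<close> and \<open>z\<^sub>\<alpha>\<close>
  is \<open>M + a M\<close> with \<open>M\<close> a \<open>w\<^sub>\<alpha>\<close>-stable lattice in the space fixed by the involution. On the other
  side \<open>z\<^sub>\<beta>\<close> has unit determinant, exchanges \<open>p\<close> and \<open>1 - p\<close>, and thus a stable lattice is \<open>N + z\<^sub>\<beta> N\<close> with \<open>N\<close> a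
  \<open>w\<^sub>\<beta>\<close>-stable lattice in the image of \<open>p\<close>. The map \<open>T\<close> identifies the image of \<open>p\<close> with the fixed space,
  compatibly with \<open>w\<close>, and satisfies \<open>T z\<^sub>\<beta> = a T\<close> there; such a map exists over \<open>K\<^sub>1\<close> by matching and over
  \<open>F\<close> because the conditions are linear (\<open>intertwiner_exists\<close>, \<open>descend_solution\<close>). Finally \<open>\<Lambda>\<^sub>- = z\<^sub>\<beta> \<Lambda>\<^sub>+\<close> for
  every stable \<open>\<Lambda>\<close>, which makes the transfer factor equal to 1 at \<open>s = 0\<close>.
\<close>

no_notation fps_nth (infixl \<open>$\<close> 75)

section \<open>Nonarchimedean local fields\<close>

abbreviation aval :: "'f::nonarch_local_field \<Rightarrow> real" where
  "aval x \<equiv> dist x 0"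

lemma dist_eq_aval: "dist x y = aval (x - y)" for x y :: "'f::nonarch_local_field"
  using dist_translate[of "x - y" y 0] by simp

lemma aval_mult: "aval (x * y) = aval x * aval y" for x y :: "'f::nonarch_local_field"
  by (rule dist_mult_0)

lemma aval_eq_0_iff: "aval x = 0 \<longleftrightarrow> x = 0" for x :: "'f::nonarch_local_field"
  by simp

lemma aval_one [simp]: "aval (1 :: 'f::nonarch_local_field) = 1"
proof -
  have "aval (1 :: 'f) * aval (1 :: 'f) = aval (1 :: 'f)"
    using aval_mult[of "1::'f" 1] by simp
  then show ?thesis by (metis aval_eq_0_iff mult_cancel_right1 zero_neq_one)
qed

lemma aval_minus [simp]: "aval (- x) = aval x" for x :: "'f::nonarch_local_field"
proof -
  have "aval (-1 :: 'f) * aval (-1 :: 'f) = 1"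
    using aval_mult[of "-1::'f" "-1"] by simp
  then have "aval (-1 :: 'f) = 1"
    by (metis abs_of_nonneg power2_eq_square power2_eq_1_iff zero_le_dist abs_1 abs_minus_cancel)
  then show ?thesis using aval_mult[of "-1" x] by simp
qed

lemma aval_power: "aval (x ^ k) = aval x ^ k" for x :: "'f::nonarch_local_field"
  by (induction k) (simp_all add: aval_mult)

lemma aval_inverse: "aval (inverse x) = inverse (aval x)" for x :: "'f::nonarch_local_field"
proof (cases "x = 0")
  case False
  then have "aval x * aval (inverse x) = 1" by (simp add: aval_mult[symmetric])
  then show ?thesis by (simp add: inverse_unique)
qed simp

lemma aval_divide: "aval (x / y) = aval x / aval y" for x y :: "'f::nonarch_local_field"
  by (simp add: divide_inverse aval_mult aval_inverse)

lemma aval_add: "aval (x + y) \<le> max (aval x) (aval y)" for x y :: "'f::nonarch_local_field"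
  by (rule dist_ultrametric)

lemma aval_diff: "aval (x - y) \<le> max (aval x) (aval y)" for x y :: "'f::nonarch_local_field"
  using aval_add[of x "- y"] by simp

lemma aval_add_le: "aval x \<le> B \<Longrightarrow> aval y \<le> B \<Longrightarrow> aval (x + y) \<le> B" for x y :: "'f::nonarch_local_field"
  using aval_add[of x y] by auto

lemma aval_diff_le: "aval x \<le> B \<Longrightarrow> aval y \<le> B \<Longrightarrow> aval (x - y) \<le> B" for x y :: "'f::nonarch_local_field"
  using aval_diff[of x y] by auto

lemma aval_add_less: "aval x < B \<Longrightarrow> aval y < B \<Longrightarrow> aval (x + y) < B" for x y :: "'f::nonarch_local_field"
  using aval_add[of x y] by auto

lemma aval_diff_less: "aval x < B \<Longrightarrow> aval y < B \<Longrightarrow> aval (x - y) < B" for x y :: "'f::nonarch_local_field"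
  using aval_diff[of x y] by auto

lemma aval_add_eq: "aval y < aval x \<Longrightarrow> aval (x + y) = aval x" for x y :: "'f::nonarch_local_field"
  using aval_add[of x y] aval_diff[of "x + y" y] by auto

lemma aval_sum_le:
  fixes f :: "'a \<Rightarrow> 'f::nonarch_local_field"
  assumes "0 \<le> B" "\<And>i. i \<in> A \<Longrightarrow> aval (f i) \<le> B"
  shows "aval (sum f A) \<le> B"
  using assms by (induction A rule: infinite_finite_induct) (auto intro: aval_add_le)

lemma aval_diff_lt_1_eq: "aval (x - y) < 1 \<Longrightarrow> aval x = 1 \<Longrightarrow> aval y = 1"
  for x y :: "'f::nonarch_local_field"
  using aval_add_eq[of "y - x" x] dist_eq_aval[of x y] dist_eq_aval[of y x]
  by (simp add: dist_commute)

lemma int_ring_iff: "x \<in> int_ring \<longleftrightarrow> aval x \<le> 1"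
  by (simp add: int_ring_def)

lemma int_ring_0 [simp]: "0 \<in> (int_ring :: 'f::nonarch_local_field set)"
  and int_ring_1 [simp]: "1 \<in> (int_ring :: 'f::nonarch_local_field set)"
  by (simp_all add: int_ring_def)

lemma int_ring_add: "x \<in> int_ring \<Longrightarrow> y \<in> int_ring \<Longrightarrow> x + y \<in> int_ring"
  and int_ring_diff: "x \<in> int_ring \<Longrightarrow> y \<in> int_ring \<Longrightarrow> x - y \<in> int_ring"
  and int_ring_mult: "x \<in> int_ring \<Longrightarrow> y \<in> int_ring \<Longrightarrow> x * y \<in> int_ring"
  and int_ring_uminus: "x \<in> int_ring \<Longrightarrow> - x \<in> int_ring"
  and int_ring_power: "x \<in> int_ring \<Longrightarrow> x ^ k \<in> int_ring" for x y :: "'f::nonarch_local_field"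
  by (auto simp: int_ring_def aval_mult aval_power power_le_one intro: aval_add_le aval_diff_le mult_le_one)

lemma int_ring_sum: "(\<And>i. i \<in> A \<Longrightarrow> f i \<in> int_ring) \<Longrightarrow> sum f A \<in> int_ring"
  for f :: "'a \<Rightarrow> 'f::nonarch_local_field"
  by (induction A rule: infinite_finite_induct) (auto intro: int_ring_add)

lemma int_ring_prod: "(\<And>i. i \<in> A \<Longrightarrow> f i \<in> int_ring) \<Longrightarrow> prod f A \<in> int_ring"
  for f :: "'a \<Rightarrow> 'f::nonarch_local_field"
  by (induction A rule: infinite_finite_induct) (auto intro: int_ring_mult)

lemma int_ring_of_nat: "of_nat k \<in> (int_ring :: 'f::nonarch_local_field set)"
  by (induction k) (auto intro: int_ring_add)

lemma int_ring_numeral [simp]: "numeral k \<in> (int_ring :: 'f::nonarch_local_field set)"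
  by (metis int_ring_of_nat of_nat_numeral)

lemmas int_ring_intros = int_ring_add int_ring_diff int_ring_mult int_ring_uminus int_ring_power
  int_ring_0 int_ring_1 int_ring_numeral

lemma aval_mult_less_1: "aval x < 1 \<Longrightarrow> y \<in> int_ring \<Longrightarrow> aval (x * y) < 1" for x y :: "'f::nonarch_local_field"
  by (simp add: aval_mult int_ring_def) (meson le_less_trans mult_left_le zero_le_dist)

instance nonarch_local_field < topological_group_add
proof
  fix a b :: 'a
  show "((\<lambda>x. fst x + snd x) \<longlongrightarrow> a + b) (nhds a \<times>\<^sub>F nhds b)"
  proof (rule tendstoI)
    fix e :: real assume e: "0 < e"
    have near: "\<forall>\<^sub>F x in nhds c. dist x c < e" for c :: 'a
      unfolding eventually_nhds_metric using e by auto
    have "\<forall>\<^sub>F x in nhds a \<times>\<^sub>F nhds b. dist (fst x) a < e \<and> dist (snd x) b < e"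
      unfolding eventually_prod_filter using near[of a] near[of b]
      by (intro exI[of _ "\<lambda>x. dist x a < e"] exI[of _ "\<lambda>x. dist x b < e"]) auto
    then show "\<forall>\<^sub>F x in nhds a \<times>\<^sub>F nhds b. dist (fst x + snd x) (a + b) < e"
    proof (rule eventually_mono)
      fix x :: "'a \<times> 'a" assume "dist (fst x) a < e \<and> dist (snd x) b < e"
      then have "aval ((fst x - a) + (snd x - b)) < e"
        by (intro aval_add_less) (simp_all add: dist_eq_aval[symmetric])
      then show "dist (fst x + snd x) (a + b) < e"
        by (simp add: dist_eq_aval[of _ "a + b"] algebra_simps)
    qed
  qed
next
  fix a :: 'a
  show "(uminus \<longlongrightarrow> - a) (nhds a)"
  proof (rule tendstoI)
    fix e :: real assume e: "0 < e"
    have "dist (- x) (- a) = dist x a" for x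
      using aval_minus[of "x - a"] by (simp add: dist_eq_aval[of "-x"] dist_eq_aval[of x])
    then show "\<forall>\<^sub>F x in nhds a. dist (- x) (- a) < e"
      unfolding eventually_nhds_metric using e by auto
  qed
qed

instance nonarch_local_field < topological_semigroup_mult
proof
  fix a b :: 'a
  show "((\<lambda>x. fst x * snd x) \<longlongrightarrow> a * b) (nhds a \<times>\<^sub>F nhds b)"
  proof (rule tendstoI)
    fix e :: real assume e: "0 < e"
    define d where "d = min 1 (e / (1 + aval a + aval b))"
    have pos: "0 < 1 + aval a + aval b" by (simp add: add_pos_nonneg)
    have d: "0 < d" "d \<le> 1" using e pos by (auto simp: d_def)
    have "d \<le> e / (1 + aval a + aval b)" by (simp add: d_def)
    then have d3: "d * (1 + aval a + aval b) \<le> e" using pos by (simp only: pos_le_divide_eq)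
    have near: "\<forall>\<^sub>F x in nhds c. dist x c < d" for c :: 'a
      unfolding eventually_nhds_metric using d by auto
    have "\<forall>\<^sub>F x in nhds a \<times>\<^sub>F nhds b. dist (fst x) a < d \<and> dist (snd x) b < d"
      unfolding eventually_prod_filter using near[of a] near[of b]
      by (intro exI[of _ "\<lambda>x. dist x a < d"] exI[of _ "\<lambda>x. dist x b < d"]) auto
    then show "\<forall>\<^sub>F x in nhds a \<times>\<^sub>F nhds b. dist (fst x * snd x) (a * b) < e"
    proof (rule eventually_mono)
      fix x :: "'a \<times> 'a" assume "dist (fst x) a < d \<and> dist (snd x) b < d"
      then have x: "aval (fst x - a) < d" "aval (snd x - b) < d"
        by (simp_all add: dist_eq_aval[symmetric])
      have small: "c < e" if "0 \<le> c" "c \<le> k * l" "k < d" "l < 1 + aval a + aval b" "0 \<le> k" for c k l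
      proof -
        have "k * l \<le> k * (1 + aval a + aval b)" using that by (intro mult_left_mono) auto
        also have "\<dots> < d * (1 + aval a + aval b)" using that pos by (intro mult_strict_right_mono) auto
        finally show ?thesis using that d3 by linarith
      qed
      have "aval (snd x - b) < 1 + aval a + aval b"
        using x(2) d(2) zero_le_dist[of a 0] zero_le_dist[of b 0] by linarith
      then have "aval ((fst x - a) * (snd x - b)) < e"
        using x small[of "aval ((fst x - a) * (snd x - b))" "aval (fst x - a)" "aval (snd x - b)"]
        by (simp add: aval_mult)
      moreover have "aval ((fst x - a) * b) < e"
        by (rule small[where k = "aval (fst x - a)" and l = "aval b"])
           (use x in \<open>auto simp: aval_mult add_pos_nonneg\<close>)
      moreover have "aval (a * (snd x - b)) < e"
        by (rule small[where k = "aval (snd x - b)" and l = "aval a"])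
           (use x in \<open>auto simp: aval_mult add_pos_nonneg mult.commute\<close>)
      ultimately have "aval ((fst x - a) * (snd x - b) + ((fst x - a) * b + a * (snd x - b))) < e"
        by (intro aval_add_less)
      then show "dist (fst x * snd x) (a * b) < e"
        by (simp add: dist_eq_aval[of _ "a * b"] algebra_simps)
    qed
  qed
qed

instance nonarch_local_field < topological_comm_monoid_add ..

instance nonarch_local_field < topological_comm_monoid_mult ..

text \<open>
  The value group is discrete: the open unit ball is a closed subset of the compact unit ball, so
  the absolute value attains its maximum there.
\<close>

lemma uniformizer_exists:
  "\<exists>\<pi> :: 'f::nonarch_local_field. \<pi> \<noteq> 0 \<and> aval \<pi> < 1 \<and> (\<forall>x::'f. aval x < 1 \<longrightarrow> aval x \<le> aval \<pi>)"
proof -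
  let ?m = "{x :: 'f. aval x < 1}"
  have "closed ?m"
    unfolding closed_def open_dist
  proof (intro ballI)
    fix x :: 'f assume "x \<in> - ?m"
    then have x: "\<not> aval x < 1" by simp
    have "\<not> aval y < 1" if "dist y x < 1" for y
    proof -
      have "x = y - (y - x)" by simp
      then show ?thesis using that x aval_diff_less[of y 1 "y - x"] by (auto simp: dist_eq_aval[of y x])
    qed
    then show "\<exists>e>0. \<forall>y. dist y x < e \<longrightarrow> y \<in> - ?m" by (intro exI[of _ 1]) auto
  qed
  moreover have "?m = {x :: 'f. aval x \<le> 1} \<inter> ?m" by auto
  ultimately have "compact ?m" using compact_Int_closed[OF compact_unit_ball] by metis
  moreover have "0 \<in> ?m" by simp
  moreover have "continuous_on ?m aval" by (intro continuous_intros)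
  moreover have "?m \<noteq> {}" using dist_self[of "0::'f"] by (auto intro: exI[of _ 0])
  ultimately have "\<exists>p\<in>?m. \<forall>x\<in>?m. aval x \<le> aval p" by (intro continuous_attains_sup)
  then obtain p :: 'f where p: "p \<in> ?m" "\<And>x. x \<in> ?m \<Longrightarrow> aval x \<le> aval p" by blast
  obtain x :: 'f where x: "x \<noteq> 0" "aval x \<noteq> 1" using dist_nontrivial by blast
  define y where "y = (if aval x < 1 then x else inverse x)"
  have "y \<noteq> 0" "aval y < 1" using x by (auto simp: y_def aval_inverse inverse_less_1_iff)
  then have "p \<noteq> 0" using p(2)[of y] by auto
  then show ?thesis using p by auto
qed

definition uniformizer :: "'f::nonarch_local_field" where
  "uniformizer = (SOME \<pi>. \<pi> \<noteq> 0 \<and> aval \<pi> < 1 \<and> (\<forall>x::'f. aval x < 1 \<longrightarrow> aval x \<le> aval \<pi>))"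

lemma uniformizer_props:
  "(uniformizer :: 'f::nonarch_local_field) \<noteq> 0 \<and> aval (uniformizer :: 'f) < 1 \<and>
    (\<forall>x::'f. aval x < 1 \<longrightarrow> aval x \<le> aval (uniformizer :: 'f))"
  unfolding uniformizer_def by (rule someI_ex[OF uniformizer_exists])

lemma uniformizer_nonzero [simp]: "(uniformizer :: 'f::nonarch_local_field) \<noteq> 0"
  using uniformizer_props by blast

lemma aval_uniformizer_less: "aval (uniformizer :: 'f::nonarch_local_field) < 1"
  using uniformizer_props by blast

lemma aval_le_uniformizer: "aval x < 1 \<Longrightarrow> aval x \<le> aval (uniformizer :: 'f)"
  for x :: "'f::nonarch_local_field"
  using uniformizer_props by blast

lemma aval_uniformizer_pos: "0 < aval (uniformizer :: 'f::nonarch_local_field)"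
  by simp

lemma uniformizer_int [simp]: "uniformizer \<in> int_ring"
  by (simp add: int_ring_def less_imp_le aval_uniformizer_less)

lemma aval_greater_1_imp:
  fixes x :: "'f::nonarch_local_field"
  assumes "1 < aval x" shows "1 \<le> aval (uniformizer :: 'f) * aval x"
proof -
  have "aval (inverse x) < 1" using assms by (simp add: aval_inverse inverse_less_1_iff)
  then have "inverse (aval x) \<le> aval (uniformizer :: 'f)" using aval_le_uniformizer by (metis aval_inverse)
  then have "inverse (aval x) * aval x \<le> aval (uniformizer :: 'f) * aval x"
    using assms by (intro mult_right_mono) auto
  moreover have "inverse (aval x) * aval x = 1" using assms by (intro left_inverse) linarith
  ultimately show ?thesis by simp
qed

lemma divide_uniformizer:
  fixes x :: "'f::nonarch_local_field"
  assumes "aval x < 1" obtains y where "y \<in> int_ring" "x = uniformizer * y"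
proof
  show "x / uniformizer \<in> int_ring" "x = uniformizer * (x / uniformizer)"
    using aval_le_uniformizer[OF assms] aval_uniformizer_pos[where ?'f = 'f]
    by (auto simp: int_ring_def aval_divide)
qed

lemma uniformizer_power_below:
  fixes e :: real assumes "0 < e"
  obtains k where "aval ((uniformizer :: 'f::nonarch_local_field) ^ k) < e"
  using real_arch_pow_inv[OF assms aval_uniformizer_less[where ?'f = 'f]] by (auto simp: aval_power)

lemma infinite_nonarch_local_field: "infinite (UNIV :: 'f::nonarch_local_field set)"
proof
  let ?p = "uniformizer :: 'f"
  assume "finite (UNIV :: 'f set)"
  then have "finite (range (\<lambda>k::nat. ?p ^ k))" using finite_subset subset_UNIV by blast
  then have "\<not> inj (\<lambda>k::nat. ?p ^ k)" using finite_imageD infinite_UNIV_nat by blast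
  then obtain k l :: nat where "k < l" "?p ^ k = ?p ^ l"
    unfolding inj_def by (metis linorder_neqE_nat)
  then have "aval ?p ^ k = aval ?p ^ l" by (metis aval_power)
  then show False
    using power_strict_decreasing[OF \<open>k < l\<close>, of "aval ?p"] aval_uniformizer_less[where ?'f='f] by simp
qed

text \<open>
  Balls are dilations of the compact unit ball. With the ultrametric inequality this gives the
  Heine-Borel property, which transfers to spaces of matrices.
\<close>

lemma compact_aval_le: "compact {x :: 'f::nonarch_local_field. aval x \<le> B}"
proof -
  let ?p = "uniformizer :: 'f"
  have "0 < inverse (\<bar>B\<bar> + 1)" by simp
  then obtain k where k: "aval (?p ^ k) < inverse (\<bar>B\<bar> + 1)"
    by (rule uniformizer_power_below)
  have c: "compact ((\<lambda>x. x / ?p ^ k) ` int_ring)"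
    unfolding int_ring_def divide_inverse
    by (intro compact_continuous_image compact_unit_ball continuous_intros)
  have "{x :: 'f. aval x \<le> B} \<subseteq> (\<lambda>x. x / ?p ^ k) ` int_ring"
  proof
    fix x :: 'f assume "x \<in> {x. aval x \<le> B}"
    then have "aval (x * ?p ^ k) \<le> (\<bar>B\<bar> + 1) * inverse (\<bar>B\<bar> + 1)"
      unfolding aval_mult using k by (intro mult_mono) auto
    then have "x * ?p ^ k \<in> int_ring" by (simp add: int_ring_def)
    then show "x \<in> (\<lambda>x. x / ?p ^ k) ` int_ring" by (intro image_eqI[of _ _ "x * ?p ^ k"]) auto
  qed
  moreover have "closed {x :: 'f. aval x \<le> B}" by (intro closed_Collect_le continuous_intros)
  ultimately show ?thesis using compact_Int_closed[OF c] by (metis inf.absorb_iff2)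
qed

instance nonarch_local_field < heine_borel
proof
  fix f :: "nat \<Rightarrow> 'a" assume "bounded (range f)"
  then obtain B where "\<And>k. dist 0 (f k) \<le> B" unfolding bounded_any_center[of _ 0] by auto
  then have "\<forall>k. f k \<in> {x. aval x \<le> B}" by (simp add: dist_commute)
  then show "\<exists>l r. strict_mono r \<and> (f \<circ> r) \<longlonglongrightarrow> l"
    using compact_aval_le[of B] unfolding compact_eq_seq_compact_metric seq_compact_def by blast
qed

text \<open>
  The residue field is finite because the compact ring of integers is covered by finitely many
  translates of its open ideal.
\<close>

lemma residue_representatives:
  "\<exists>T :: 'f::nonarch_local_field set. finite T \<and> T \<subseteq> int_ring \<and> (\<forall>x\<in>int_ring. \<exists>!t\<in>T. aval (x - t) < 1)"
proof -
  have "\<forall>e>0. \<exists>k::'f set. finite k \<and> k \<subseteq> int_ring \<and> int_ring \<subseteq> (\<Union>x\<in>k. ball x e)"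
    using seq_compact_imp_totally_bounded[OF compact_imp_seq_compact, OF compact_unit_ball] unfolding int_ring_def .
  then obtain k :: "'f set" where k: "finite k" "k \<subseteq> int_ring" "int_ring \<subseteq> (\<Union>x\<in>k. ball x 1)"
    by (meson zero_less_one)
  define r where "r x = (SOME t. t \<in> k \<and> aval (x - t) < 1)" for x
  have ex: "\<exists>t. t \<in> k \<and> aval (x - t) < 1" if "x \<in> int_ring" for x
  proof -
    have "x \<in> (\<Union>x\<in>k. ball x 1)" using k(3) that by (rule subsetD)
    then obtain t where "t \<in> k" "dist t x < 1" by auto
    then show ?thesis using dist_eq_aval[of x t] by (auto simp: dist_commute)
  qed
  have r: "r x \<in> k" "aval (x - r x) < 1" if "x \<in> int_ring" for x
    using someI_ex[OF ex[OF that]] unfolding r_def by blast+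
  have rr: "r x = r y" if "aval (x - y) < 1" for x y
  proof -
    have "aval (x - t) < 1 \<longleftrightarrow> aval (y - t) < 1" for t
      using that aval_diff_less[of "x - t" 1 "x - y"] aval_add_less[of "x - y" 1 "y - t"] by auto
    then show ?thesis unfolding r_def by simp
  qed
  show ?thesis
  proof (intro exI[of _ "r ` int_ring"] conjI ballI)
    show "finite (r ` int_ring)" using k(1) r(1) by (meson finite_subset image_subsetI)
    show sub: "r ` int_ring \<subseteq> int_ring" using k(2) r(1) by blast
    fix x :: 'f assume x: "x \<in> int_ring"
    show "\<exists>!t. t \<in> r ` int_ring \<and> aval (x - t) < 1"
    proof (rule ex1I[of _ "r x"])
      show "r x \<in> r ` int_ring \<and> aval (x - r x) < 1" using x r by auto
      fix t assume t: "t \<in> r ` int_ring \<and> aval (x - t) < 1"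
      then obtain y where y: "y \<in> int_ring" "t = r y" by auto
      have "r (r y) = r y" using rr[of y "r y"] r(2)[OF y(1)] by simp
      then show "t = r x" using rr[of x t] t y by simp
    qed
  qed
qed

text \<open>
  Every ball is compact, hence totally bounded. Density of a countable set is used for the countability
  of the set of lattices, which replaces second countability of the groups in question.
\<close>

lemma countable_dense_subset:
  "\<exists>D :: 'f::nonarch_local_field set. countable D \<and> (\<forall>x e. 0 < e \<longrightarrow> (\<exists>d\<in>D. dist x d < e))"
proof -
  have "\<exists>k::'f set. finite k \<and> {x. aval x \<le> real N} \<subseteq> (\<Union>x\<in>k. ball x (inverse (real (Suc N))))" for N
    using seq_compact_imp_totally_bounded[OF compact_imp_seq_compact, OF compact_aval_le[of "real N"]]
    by (metis inverse_positive_iff_positive of_nat_0_less_iff zero_less_Suc)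
  then obtain k :: "nat \<Rightarrow> 'f set" where
    k: "\<And>N. finite (k N)" "\<And>N. {x. aval x \<le> real N} \<subseteq> (\<Union>x\<in>k N. ball x (inverse (real (Suc N))))"
    by metis
  show ?thesis
  proof (intro exI[of _ "\<Union>N. k N"] conjI allI impI)
    show "countable (\<Union>N. k N)" using k(1) by (auto intro: countable_finite)
    fix x :: 'f and e :: real assume e: "0 < e"
    obtain M where M: "inverse (real (Suc M)) < e" using reals_Archimedean[OF e] by auto
    obtain M' where M': "aval x \<le> real M'" using real_arch_simple by blast
    define N where "N = max M M'"
    have "aval x \<le> real N" using M' by (simp add: N_def)
    then obtain d where d: "d \<in> k N" "dist d x < inverse (real (Suc N))" using k(2)[of N] by auto
    have "inverse (real (Suc N)) \<le> inverse (real (Suc M))" by (simp add: N_def)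
    then have "dist x d < e" using d(2) M by (simp only: dist_commute)
    moreover have "d \<in> (\<Union>N. k N)" using d(1) by blast
    ultimately show "\<exists>d\<in>\<Union>N. k N. dist x d < e" by blast
  qed
qed

section \<open>Integral matrices and lattices\<close>

lemma matrix_inv_right: "invertible A \<Longrightarrow> A ** matrix_inv A = mat 1"
  and matrix_inv_left: "invertible A \<Longrightarrow> matrix_inv A ** A = mat 1" for A :: "'a::semiring_1^'n^'n"
  unfolding invertible_def matrix_inv_def by (auto intro: someI2)

lemma invertible_matrix_inv: "invertible A \<Longrightarrow> invertible (matrix_inv A)" for A :: "'a::semiring_1^'n^'n"
  using matrix_inv_left matrix_inv_right unfolding invertible_def by blast

lemma matrix_inv_unique: "A ** B = mat 1 \<Longrightarrow> B ** A = mat 1 \<Longrightarrow> matrix_inv A = B"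
  for A :: "'a::semiring_1^'n^'n"
  by (metis invertible_def matrix_inv_left matrix_mul_assoc matrix_mul_lid matrix_mul_rid)

lemma invertible_left: "B ** A = mat 1 \<Longrightarrow> invertible A" for A :: "'a::field^'n^'n"
  using invertible_left_inverse by blast

lemma matrix_inv_mv [simp]:
  "invertible A \<Longrightarrow> matrix_inv A *v (A *v x) = x" "invertible A \<Longrightarrow> A *v (matrix_inv A *v x) = x"
  for A :: "'a::field^'n^'n"
  by (simp_all add: matrix_vector_mul_assoc matrix_inv_left matrix_inv_right)

lemma invertible_mat_1: "invertible (mat 1 :: 'a::semiring_1^'n^'n)"
  unfolding invertible_def by (intro exI[of _ "mat 1"]) simp

lemma matrix_inv_mult:
  "invertible A \<Longrightarrow> invertible B \<Longrightarrow> matrix_inv (A ** B) = matrix_inv B ** matrix_inv A"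
  for A B :: "'a::field^'n^'n"
  by (intro matrix_inv_unique) (metis matrix_inv_left matrix_inv_right matrix_mul_assoc matrix_mul_rid)+

lemma matrix_inv_inv: "invertible A \<Longrightarrow> matrix_inv (matrix_inv A) = A" for A :: "'a::field^'n^'n"
  by (intro matrix_inv_unique matrix_inv_left matrix_inv_right)

lemma matrix_cancel_left: "invertible A \<Longrightarrow> A ** B = A ** C \<longleftrightarrow> B = C" for A :: "'a::field^'n^'n"
  by (metis matrix_inv_left matrix_mul_assoc matrix_mul_lid)

lemma matrix_inv_commute: "invertible A \<Longrightarrow> A ** B = B ** A \<Longrightarrow> matrix_inv A ** B = B ** matrix_inv A"
  for A B :: "'a::field^'n^'n"
  by (metis matrix_inv_left matrix_inv_right matrix_mul_assoc matrix_mul_lid matrix_mul_rid)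

lemma mat_mv [simp]: "mat c *v x = c *s x" for x :: "'a::comm_ring_1^'n"
  by (simp add: vec_eq_iff matrix_vector_mult_def mat_def if_distrib[of "\<lambda>u. u * _"] cong: if_cong)

lemma mv_scale [simp]: "A *v (c *s x) = c *s (A *v x)" for A :: "'a::comm_ring_1^'n^'m"
  by (simp add: vec_eq_iff matrix_vector_mult_def sum_distrib_left algebra_simps)

lemma mv_minus: "A *v (- x) = - (A *v x)" for A :: "'a::comm_ring_1^'n^'m"
  using matrix_vector_mult_diff_distrib[of A 0 x] by simp

lemma mat_entry: "(mat c ** A) $ i $ j = c * A $ i $ j" for A :: "'a::comm_ring_1^'n^'n"
  by (simp add: matrix_matrix_mult_def mat_def if_distrib[of "\<lambda>u. u * _"] cong: if_cong)

lemma mat_central: "A ** mat c = mat c ** A" for A :: "'a::comm_ring_1^'n^'n"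
  by (simp add: matrix_eq flip: matrix_vector_mul_assoc)

lemma mv_sum: "A *v (\<Sum>i\<in>S. f i) = (\<Sum>i\<in>S. A *v f i)" for A :: "'a::comm_ring_1^'n^'m"
  by (induction S rule: infinite_finite_induct) (auto simp: matrix_vector_right_distrib)

lemma sum_mv: "(\<Sum>i\<in>S. f i) *v x = (\<Sum>i\<in>S. f i *v x)" for f :: "'b \<Rightarrow> 'a::comm_ring_1^'n^'m"
  by (induction S rule: infinite_finite_induct) (auto simp: matrix_vector_mult_add_rdistrib)

lemma matrix_eqI: "(\<And>x. A *v x = B *v x) \<Longrightarrow> A = B" for A B :: "'a::comm_ring_1^'n^'n"
  by (simp add: matrix_eq)

lemma mult_mv: "(A ** B) *v x = A *v (B *v x)" for A :: "'a::comm_ring_1^'n^'n"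
  by (simp add: matrix_vector_mul_assoc)

lemmas mv_simps = mult_mv matrix_vector_mult_add_rdistrib matrix_vector_mult_diff_rdistrib
  matrix_vector_right_distrib matrix_vector_mult_diff_distrib mv_minus

lemma mat_add: "mat (c + d) = (mat c + mat d :: 'a::comm_ring_1^'n^'n)"
  and mat_mult: "mat (c * d) = (mat c ** mat d :: 'a::comm_ring_1^'n^'n)"
  and mat_diff: "mat (c - d) = (mat c - mat d :: 'a::comm_ring_1^'n^'n)"
  and mat_0 [simp]: "mat 0 = (0 :: 'a::comm_ring_1^'n^'n)"
  by (auto simp: matrix_eq mv_simps vec_eq_iff algebra_simps)

lemma continuous_on_matrix_mult [continuous_intros]:
  fixes f g :: "'x::topological_space \<Rightarrow> 'f::nonarch_local_field^'n^'n"
  assumes "continuous_on S f" "continuous_on S g"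
  shows "continuous_on S (\<lambda>x. f x ** g x)"
  unfolding matrix_matrix_mult_def
  by (intro continuous_intros assms)

lemma continuous_on_det [continuous_intros]:
  fixes f :: "'x::topological_space \<Rightarrow> 'f::nonarch_local_field^'n^'n"
  assumes "continuous_on S f"
  shows "continuous_on S (\<lambda>x. det (f x))"
  unfolding det_def
  by (intro continuous_intros assms)

lemma bounded_matrix_iff:
  fixes S :: "('f::nonarch_local_field^'n^'n) set"
  shows "bounded S \<longleftrightarrow> (\<exists>B. \<forall>M\<in>S. \<forall>i j. aval (M $ i $ j) \<le> B)"
proof
  assume "bounded S"
  then obtain B where B: "\<And>M. M \<in> S \<Longrightarrow> dist M 0 \<le> B" unfolding bounded_any_center[of _ 0] by (auto simp: dist_commute)
  have "aval (M $ i $ j) \<le> B" if "M \<in> S" for M :: "'f^'n^'n" and i j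
  proof -
    have "dist (M $ i $ j) ((0 :: 'f^'n^'n) $ i $ j) \<le> dist M 0"
      by (rule order_trans[OF dist_vec_nth_le dist_vec_nth_le])
    then show ?thesis using B[OF that] by simp
  qed
  then show "\<exists>B. \<forall>M\<in>S. \<forall>i j. aval (M $ i $ j) \<le> B" by blast
next
  assume "\<exists>B. \<forall>M\<in>S. \<forall>i j. aval (M $ i $ j) \<le> B"
  then obtain B where B: "\<And>M i j. M \<in> S \<Longrightarrow> aval (M $ i $ j) \<le> B" by blast
  have row: "dist (v::'f^'n) 0 \<le> (\<Sum>j\<in>(UNIV::'n set). B)" if "\<And>j. aval (v $ j) \<le> B" for v
    unfolding dist_vec_def using that by (intro order_trans[OF L2_set_le_sum] sum_mono) auto
  have "dist M 0 \<le> (\<Sum>i\<in>(UNIV::'n set). \<Sum>j\<in>(UNIV::'n set). B)" if "M \<in> S" for M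
    unfolding dist_vec_def[of M] using row B[OF that]
    by (intro order_trans[OF L2_set_le_sum] sum_mono) auto
  then show "bounded S" unfolding bounded_any_center[of _ 0] by (metis dist_commute)
qed

lemma compact_mat_over_int: "compact (mat_over int_ring :: ('f::nonarch_local_field^'n^'n) set)"
  unfolding compact_eq_bounded_closed
proof
  show "bounded (mat_over int_ring :: ('f^'n^'n) set)"
    unfolding bounded_matrix_iff by (intro exI[of _ 1]) (auto simp: mat_over_def int_ring_def)
  have "mat_over int_ring = (\<Inter>i. \<Inter>j. {M :: 'f^'n^'n. aval (M $ i $ j) \<le> 1})"
    by (auto simp: mat_over_def int_ring_def)
  moreover have "closed (\<Inter>i. \<Inter>j. {M :: 'f^'n^'n. aval (M $ i $ j) \<le> 1})"
    by (intro closed_INT ballI closed_Collect_le continuous_intros)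
  ultimately show "closed (mat_over int_ring :: ('f^'n^'n) set)" by simp
qed

lemma open_aval_le_1: "open {x :: 'f::nonarch_local_field. aval x \<le> 1}"
  unfolding open_dist
proof (intro ballI)
  fix x :: 'f assume x: "x \<in> {x. aval x \<le> 1}"
  have "aval y \<le> 1" if "dist y x < 1" for y
    using that x aval_add_le[of "y - x" 1 x] by (auto simp: dist_eq_aval[of y x])
  then show "\<exists>e>0. \<forall>y. dist y x < e \<longrightarrow> y \<in> {x. aval x \<le> 1}" by (intro exI[of _ 1]) auto
qed

lemma open_aval_eq_1: "open {x :: 'f::nonarch_local_field. aval x = 1}"
  unfolding open_dist
proof (intro ballI)
  fix x :: 'f assume x: "x \<in> {x. aval x = 1}"
  have "aval y = 1" if "dist y x < 1" for y
    using that x aval_diff_lt_1_eq[of x y] by (auto simp: dist_eq_aval[of x y] dist_commute)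
  then show "\<exists>e>0. \<forall>y. dist y x < e \<longrightarrow> y \<in> {x. aval x = 1}" by (intro exI[of _ 1]) auto
qed

lemma det_int: "M \<in> mat_over int_ring \<Longrightarrow> det M \<in> int_ring" for M :: "'f::nonarch_local_field^'n^'n"
proof -
  assume M: "M \<in> mat_over int_ring"
  have "of_int (sign p) \<in> (int_ring :: 'f set)" for p :: "'n \<Rightarrow> 'n"
    by (cases p rule: sign_cases) (auto intro: int_ring_intros)
  then show ?thesis unfolding det_def using M
    by (intro int_ring_sum int_ring_mult int_ring_prod) (auto simp: mat_over_def)
qed

lemma mat_over_int_mult: "A \<in> mat_over int_ring \<Longrightarrow> B \<in> mat_over int_ring \<Longrightarrow> A ** B \<in> mat_over int_ring"
  and mat_over_int_add: "A \<in> mat_over int_ring \<Longrightarrow> B \<in> mat_over int_ring \<Longrightarrow> A + B \<in> mat_over int_ring"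
  and mat_over_int_mat: "c \<in> int_ring \<Longrightarrow> mat c \<in> mat_over int_ring"
  for A B :: "'f::nonarch_local_field^'n^'n"
  by (auto simp: mat_over_def matrix_matrix_mult_def mat_def intro!: int_ring_sum intro: int_ring_intros)

text \<open>Cramer's rule identifies the unit group of the integral matrices.\<close>

lemma GL_int_iff:
  "M \<in> GL_int \<longleftrightarrow> M \<in> mat_over int_ring \<and> aval (det M) = 1" for M :: "'f::nonarch_local_field^'n^'n"
proof
  assume "M \<in> GL_int"
  then obtain N where N: "M \<in> mat_over int_ring" "N \<in> mat_over int_ring" "M ** N = mat 1"
    by (auto simp: GL_int_def mat_units_def)
  then have "aval (det M) \<le> 1" "aval (det N) \<le> 1" using det_int by (auto simp: int_ring_def)
  moreover have "aval (det M) * aval (det N) = 1"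
    using N(3) det_mul[of M N] by (simp add: aval_mult[symmetric])
  ultimately have "aval (det M) = 1"
    using mult_left_mono[of "aval (det N)" 1 "aval (det M)"] by auto
  then show "M \<in> mat_over int_ring \<and> aval (det M) = 1" using N by simp
next
  assume M: "M \<in> mat_over int_ring \<and> aval (det M) = 1"
  then have d: "det M \<noteq> 0" by auto
  then have inv: "invertible M" by (simp add: invertible_det_nz)
  have "matrix_inv M $ k $ l \<in> int_ring" for k l
  proof -
    have "M *v (matrix_inv M *v axis l 1) = axis l 1" using inv by simp
    then have sol: "matrix_inv M *v axis l 1 = (\<chi> k. det (\<chi> i j. if j = k then axis l 1 $ i else M $ i $ j) / det M)"
      by (rule iffD1[OF cramer[OF d]])
    moreover have "(matrix_inv M *v axis l 1) $ k = matrix_inv M $ k $ l"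
      by (simp add: matrix_vector_mult_def axis_def if_distrib cong: if_cong)
    ultimately have "matrix_inv M $ k $ l = det (\<chi> i j. if j = k then axis l 1 $ i else M $ i $ j) / det M"
      unfolding sol by simp
    moreover have "det (\<chi> i j. if j = k then axis l 1 $ i else M $ i $ j) \<in> int_ring"
      using M by (intro det_int) (auto simp: mat_over_def axis_def)
    ultimately show ?thesis using M by (simp add: int_ring_def aval_divide)
  qed
  then have "matrix_inv M \<in> mat_over int_ring" by (simp add: mat_over_def)
  moreover have "M ** matrix_inv M = mat 1 \<and> matrix_inv M ** M = mat 1"
    using matrix_inv_left[OF inv] matrix_inv_right[OF inv] by simp
  ultimately show "M \<in> GL_int" unfolding GL_int_def mat_units_def
    using M by (intro CollectI conjI bexI[of _ "matrix_inv M"]) auto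
qed

lemma GL_int_invertible: "M \<in> GL_int \<Longrightarrow> invertible M"
  unfolding GL_int_def mat_units_def invertible_def by blast

lemma open_GL_int: "open (GL_int :: ('f::nonarch_local_field^'n^'n) set)"
proof -
  have "GL_int = (\<Inter>i. \<Inter>j. (\<lambda>M :: 'f^'n^'n. M $ i $ j) -` {x. aval x \<le> 1}) \<inter> det -` {x. aval x = 1}"
    by (auto simp: GL_int_iff mat_over_def int_ring_def)
  moreover have "open \<dots>"
    by (intro open_Int open_INT ballI open_vimage open_aval_le_1 open_aval_eq_1 continuous_intros) auto
  ultimately show ?thesis by simp
qed

lemma mat_over_int_iff:
  "M \<in> mat_over int_ring \<longleftrightarrow> (\<forall>v\<in>std_lattice. M *v v \<in> std_lattice)" for M :: "'f::nonarch_local_field^'n^'n"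
proof
  assume "M \<in> mat_over int_ring"
  then show "\<forall>v\<in>std_lattice. M *v v \<in> std_lattice"
    by (auto simp: std_lattice_def mat_over_def matrix_vector_mult_def intro!: int_ring_sum int_ring_mult)
next
  assume *: "\<forall>v\<in>std_lattice. M *v v \<in> std_lattice"
  have "M $ k $ l \<in> int_ring" for k l
  proof -
    have "axis l 1 \<in> (std_lattice :: ('f^'n) set)" by (simp add: std_lattice_def axis_def)
    then have "(M *v axis l 1) $ k \<in> int_ring" using * by (auto simp: std_lattice_def)
    then show ?thesis by (simp add: matrix_vector_mult_def axis_def if_distrib cong: if_cong)
  qed
  then show "M \<in> mat_over int_ring" by (simp add: mat_over_def)
qed

definition lattice_of :: "'f::nonarch_local_field^'n^'n \<Rightarrow> ('f^'n) set" where
  "lattice_of g = (*v) g ` std_lattice"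

definition lattices :: "('f::nonarch_local_field^'n) set set" where
  "lattices = {lattice_of g | g. invertible g}"

definition stabilizers :: "('f::nonarch_local_field^'n) set \<Rightarrow> ('f^'n^'n) set" where
  "stabilizers \<Lambda> = {M. \<forall>v\<in>\<Lambda>. M *v v \<in> \<Lambda>}"

lemma image_lattice_of: "(*v) M ` lattice_of g = lattice_of (M ** g)"
  by (simp add: lattice_of_def image_image mult_mv)

lemma lattice_image: "invertible M \<Longrightarrow> \<Lambda> \<in> lattices \<Longrightarrow> (*v) M ` \<Lambda> \<in> lattices"
  for M :: "'f::nonarch_local_field^'n^'n"
proof -
  assume M: "invertible M" and "\<Lambda> \<in> lattices"
  then obtain g where g: "invertible g" "\<Lambda> = lattice_of g" by (auto simp: lattices_def)
  then have "(*v) M ` \<Lambda> = lattice_of (M ** g)" by (simp add: image_lattice_of)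
  then show ?thesis using invertible_mult[OF M g(1)] by (auto simp: lattices_def)
qed

text \<open>
  All closure properties are transported from the standard lattice.
\<close>

lemma lattice_add: "\<Lambda> \<in> lattices \<Longrightarrow> x \<in> \<Lambda> \<Longrightarrow> y \<in> \<Lambda> \<Longrightarrow> x + y \<in> \<Lambda>"
  and lattice_diff: "\<Lambda> \<in> lattices \<Longrightarrow> x \<in> \<Lambda> \<Longrightarrow> y \<in> \<Lambda> \<Longrightarrow> x - y \<in> \<Lambda>"
  and lattice_scale: "\<Lambda> \<in> lattices \<Longrightarrow> x \<in> \<Lambda> \<Longrightarrow> c \<in> int_ring \<Longrightarrow> c *s x \<in> \<Lambda>"
  and lattice_0: "\<Lambda> \<in> lattices \<Longrightarrow> 0 \<in> \<Lambda>"
  for \<Lambda> :: "('f::nonarch_local_field^'n) set"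
proof -
  assume "\<Lambda> \<in> lattices"
  then obtain g :: "'f^'n^'n" where g: "\<Lambda> = (*v) g ` std_lattice" unfolding lattices_def lattice_of_def by blast
  show "x + y \<in> \<Lambda>" if xy: "x \<in> \<Lambda>" "y \<in> \<Lambda>"
  proof -
    obtain u v where "u \<in> std_lattice" "v \<in> std_lattice" "x = g *v u" "y = g *v v" using g xy by auto
    then show ?thesis unfolding g
      by (intro image_eqI[of _ _ "u + v"]) (auto simp: mv_simps std_lattice_def intro: int_ring_intros)
  qed
  show "x - y \<in> \<Lambda>" if xy: "x \<in> \<Lambda>" "y \<in> \<Lambda>"
  proof -
    obtain u v where "u \<in> std_lattice" "v \<in> std_lattice" "x = g *v u" "y = g *v v" using g xy by auto
    then show ?thesis unfolding g
      by (intro image_eqI[of _ _ "u - v"]) (auto simp: mv_simps std_lattice_def intro: int_ring_intros)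
  qed
  show "c *s x \<in> \<Lambda>" if xy: "x \<in> \<Lambda>" "c \<in> int_ring"
  proof -
    obtain u where "u \<in> std_lattice" "x = g *v u" using g xy by auto
    then show ?thesis unfolding g using xy
      by (intro image_eqI[of _ _ "c *s u"]) (auto simp: std_lattice_def intro: int_ring_intros)
  qed
  show "0 \<in> \<Lambda>" unfolding g by (intro image_eqI[of _ _ 0]) (auto simp: std_lattice_def)
qed

lemma lattice_minus: "\<Lambda> \<in> lattices \<Longrightarrow> x \<in> \<Lambda> \<Longrightarrow> - x \<in> \<Lambda>"
  using lattice_diff[of \<Lambda> 0 x] lattice_0[of \<Lambda>] by simp

lemma stabilizers_iff: "M \<in> stabilizers \<Lambda> \<longleftrightarrow> (\<forall>v\<in>\<Lambda>. M *v v \<in> \<Lambda>)"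
  by (simp add: stabilizers_def)

lemma stabilizers_add: "\<Lambda> \<in> lattices \<Longrightarrow> A \<in> stabilizers \<Lambda> \<Longrightarrow> B \<in> stabilizers \<Lambda> \<Longrightarrow> A + B \<in> stabilizers \<Lambda>"
  and stabilizers_diff: "\<Lambda> \<in> lattices \<Longrightarrow> A \<in> stabilizers \<Lambda> \<Longrightarrow> B \<in> stabilizers \<Lambda> \<Longrightarrow> A - B \<in> stabilizers \<Lambda>"
  and stabilizers_mult: "A \<in> stabilizers \<Lambda> \<Longrightarrow> B \<in> stabilizers \<Lambda> \<Longrightarrow> A ** B \<in> stabilizers \<Lambda>"
  and stabilizers_mat: "\<Lambda> \<in> lattices \<Longrightarrow> c \<in> int_ring \<Longrightarrow> mat c \<in> stabilizers \<Lambda>"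
  and stabilizers_mat_1: "mat 1 \<in> stabilizers \<Lambda>"
  by (auto simp: stabilizers_def mv_simps lattice_add lattice_diff lattice_scale)

lemmas stabilizers_intros = stabilizers_add stabilizers_diff stabilizers_mult stabilizers_mat stabilizers_mat_1

lemma stabilizers_lattice_of:
  fixes g :: "'f::nonarch_local_field^'n^'n"
  assumes "invertible g"
  shows "M \<in> stabilizers (lattice_of g) \<longleftrightarrow> matrix_inv g ** M ** g \<in> mat_over int_ring"
proof -
  have mem: "x \<in> lattice_of g \<longleftrightarrow> matrix_inv g *v x \<in> std_lattice" for x
  proof
    assume "x \<in> lattice_of g"
    then show "matrix_inv g *v x \<in> std_lattice" using assms by (auto simp: lattice_of_def)
  next
    assume "matrix_inv g *v x \<in> std_lattice"
    then show "x \<in> lattice_of g"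
      unfolding lattice_of_def using assms by (intro image_eqI[of _ _ "matrix_inv g *v x"]) auto
  qed
  have "(M *v (g *v v) \<in> lattice_of g) = (matrix_inv g *v (M *v (g *v v)) \<in> std_lattice)" for v
    by (rule mem)
  then show ?thesis
    unfolding mat_over_int_iff stabilizers_def by (auto simp: lattice_of_def mult_mv)
qed

lemma det_conj: "invertible g \<Longrightarrow> det (matrix_inv g ** M ** g) = det M" for M g :: "'a::field^'n^'n"
proof -
  assume g: "invertible g"
  have "det (matrix_inv g) * det g = 1" using matrix_inv_left[OF g] by (metis det_I det_mul)
  then show ?thesis by (simp add: det_mul algebra_simps)
qed

text \<open>
  Conjugation by \<open>g\<close> reduces this to the standard lattice, which a matrix maps onto itself exactly
  when the columns of the matrix and of its inverse are integral.
\<close>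

lemma image_lattice_eq_iff:
  assumes g: "invertible (g :: 'a::nonarch_local_field^'b^'b)"
  shows "(*v) M ` lattice_of g = lattice_of g \<longleftrightarrow> matrix_inv g ** M ** g \<in> GL_int"

proof -
  have eq: "(*v) M ` lattice_of g = lattice_of g \<longleftrightarrow> (*v) (matrix_inv g ** M ** g) ` std_lattice = std_lattice"
  proof -
    have "(*v) (matrix_inv g ** M ** g) ` std_lattice = (*v) (matrix_inv g) ` (*v) M ` lattice_of g"
      by (simp add: lattice_of_def image_image mult_mv)
    moreover have "std_lattice = (*v) (matrix_inv g) ` lattice_of g"
      using g by (simp add: lattice_of_def image_image)
    moreover have "inj ((*v) (matrix_inv g))"
      using g by (intro inj_matrix_vector_mult invertible_matrix_inv)
    ultimately show ?thesis by (metis inj_image_eq_iff)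
  qed
  define N where "N = matrix_inv g ** M ** g"
  have "(*v) N ` std_lattice = std_lattice \<longleftrightarrow> N \<in> GL_int"
  proof
    assume *: "(*v) N ` std_lattice = std_lattice"
    then have N: "N \<in> mat_over int_ring" unfolding mat_over_int_iff by blast
    have "\<exists>v\<in>std_lattice. N *v v = axis l 1" for l
    proof -
      have "axis l 1 \<in> (*v) N ` std_lattice" unfolding * by (simp add: std_lattice_def axis_def)
      then show ?thesis by auto
    qed
    then obtain c where c: "\<And>l. c l \<in> std_lattice" "\<And>l. N *v c l = axis l 1" by metis
    define Y :: "'a^'b^'b" where "Y = (\<chi> k l. c l $ k)"
    have "(N ** Y) $ i $ l = (N *v c l) $ i" for i l
      by (simp add: Y_def matrix_matrix_mult_def matrix_vector_mult_def)
    then have NY: "N ** Y = mat 1" by (simp add: c vec_eq_iff mat_def axis_def eq_commute)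
    have Y: "Y \<in> mat_over int_ring" using c(1) by (auto simp: Y_def mat_over_def std_lattice_def)
    have "Y ** N = mat 1" using NY matrix_left_right_inverse by blast
    then show "N \<in> GL_int" unfolding GL_int_def mat_units_def using N Y NY by blast
  next
    assume "N \<in> GL_int"
    then obtain Y where Y: "N \<in> mat_over int_ring" "Y \<in> mat_over int_ring" "N ** Y = mat 1"
      by (auto simp: GL_int_def mat_units_def)
    show "(*v) N ` std_lattice = std_lattice"
    proof
      show "(*v) N ` std_lattice \<subseteq> std_lattice" using Y(1) mat_over_int_iff by blast
      show "std_lattice \<subseteq> (*v) N ` std_lattice"
      proof
        fix v :: "'a^'b" assume "v \<in> std_lattice"
        then have "Y *v v \<in> std_lattice" using Y(2) mat_over_int_iff by blast
        moreover have "v = N *v (Y *v v)" using Y(3) by (simp add: matrix_vector_mul_assoc)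
        ultimately show "v \<in> (*v) N ` std_lattice" by blast
      qed
    qed
  qed
  then show ?thesis unfolding eq N_def .
qed

text \<open>
  Integrality together with a determinant of absolute value 1 implies invertibility over the ring of
  integers, so the inclusion of the image in the lattice is an equality.
\<close>

lemma image_lattice_eq:
  assumes "\<Lambda> \<in> lattices" "M \<in> stabilizers \<Lambda>" "aval (det M) = 1"
  shows "(*v) M ` \<Lambda> = \<Lambda>"
proof -
  obtain g where g: "invertible g" "\<Lambda> = lattice_of g" using assms(1) by (auto simp: lattices_def)
  have "matrix_inv g ** M ** g \<in> GL_int"
    using assms g by (simp add: GL_int_iff det_conj stabilizers_lattice_of)
  then show ?thesis using image_lattice_eq_iff[OF g(1)] g(2) by simp
qed

lemma lattice_of_eq_iff:
  fixes g h :: "'f::nonarch_local_field^'n^'n"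
  assumes "invertible g" "invertible h"
  shows "lattice_of g = lattice_of h \<longleftrightarrow> matrix_inv g ** h \<in> GL_int"
proof -
  have "lattice_of h = (*v) (h ** matrix_inv g) ` lattice_of g"
    using assms by (simp add: image_lattice_of matrix_inv_left flip: matrix_mul_assoc)
  then have "lattice_of g = lattice_of h \<longleftrightarrow> matrix_inv g ** (h ** matrix_inv g) ** g \<in> GL_int"
    using image_lattice_eq_iff[OF assms(1)] by metis
  also have "matrix_inv g ** (h ** matrix_inv g) ** g = matrix_inv g ** h"
    by (metis assms(1) matrix_inv_left matrix_mul_assoc matrix_mul_rid)
  finally show ?thesis .
qed

lemma open_lattice_of_eq: "invertible g \<Longrightarrow> open {h. invertible h \<and> lattice_of h = lattice_of g}"
  for g :: "'f::nonarch_local_field^'n^'n"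
proof -
  assume g: "invertible g"
  have "invertible h \<and> lattice_of h = lattice_of g \<longleftrightarrow> matrix_inv g ** h \<in> GL_int" for h
  proof -
    have "invertible h" if "matrix_inv g ** h \<in> GL_int"
    proof -
      have "invertible (g ** (matrix_inv g ** h))" by (rule invertible_mult[OF g GL_int_invertible[OF that]])
      then show "invertible h" by (simp add: matrix_mul_assoc matrix_inv_right g)
    qed
    then show ?thesis using lattice_of_eq_iff[OF g, of h] by auto
  qed
  then have "{h. invertible h \<and> lattice_of h = lattice_of g} = (\<lambda>h. matrix_inv g ** h) -` GL_int"
    by (simp add: vimage_def)
  also have "open \<dots>" by (intro open_vimage open_GL_int continuous_intros)
  finally show ?thesis .
qed

text \<open>
  A lattice has an open set of bases, and a countable set of matrices is dense.
\<close>

lemma countable_lattices: "countable (lattices :: ('f::nonarch_local_field^'n) set set)"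
proof -
  obtain D :: "'f set" where D: "countable D" "\<And>x e. 0 < e \<Longrightarrow> \<exists>d\<in>D. dist x d < e"
    using countable_dense_subset by metis
  define DM where "DM = {M :: 'f^'n^'n. \<forall>i j. M $ i $ j \<in> D}"
  have "countable DM"
  proof -
    have c: "countable {v :: 'z^'n. \<forall>i. v $ i \<in> E}" if "countable E" for E :: "'z set"
    proof -
      have "countable (Pi\<^sub>E (UNIV::'n set) (\<lambda>_. E))" using that by (intro countable_PiE) auto
      moreover have "{v :: 'z^'n. \<forall>i. v $ i \<in> E} \<subseteq> vec_lambda ` (Pi\<^sub>E UNIV (\<lambda>_. E))"
        by (auto intro!: image_eqI[of _ _ "vec_nth _"] simp: PiE_def Pi_def extensional_def)
      ultimately show ?thesis by (meson countable_image countable_subset)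
    qed
    show ?thesis using c[OF c[OF D(1)]] unfolding DM_def by simp
  qed
  moreover have "lattices \<subseteq> lattice_of ` DM"
  proof
    fix \<Lambda> :: "('f^'n) set" assume "\<Lambda> \<in> lattices"
    then obtain g where g: "invertible g" "\<Lambda> = lattice_of g" by (auto simp: lattices_def)
    obtain e where e: "0 < e" "\<And>h. dist h g < e \<Longrightarrow> lattice_of h = lattice_of g"
      using open_lattice_of_eq[OF g(1)] g(1) unfolding open_dist by blast
    define c where "c = e / (2 * real CARD('n) * real CARD('n))"
    have c: "0 < c" using e(1) by (simp add: c_def)
    have "\<forall>i j. \<exists>d\<in>D. dist (g $ i $ j) d < c" using D(2)[OF c] by blast
    then obtain d where d: "\<And>i j. d i j \<in> D" "\<And>i j. dist (g $ i $ j) (d i j) < c" by metis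
    define h where "h = (\<chi> i j. d i j)"
    have row: "dist (h $ i) (g $ i) \<le> (\<Sum>j\<in>(UNIV::'n set). c)" for i
      unfolding dist_vec_def[of "h $ i"] using d(2)[of i]
      by (intro order_trans[OF L2_set_le_sum] sum_mono) (auto simp: h_def dist_commute less_imp_le)
    have "dist h g \<le> (\<Sum>i\<in>(UNIV::'n set). \<Sum>j\<in>(UNIV::'n set). c)"
      unfolding dist_vec_def[of h] using row by (intro order_trans[OF L2_set_le_sum] sum_mono) auto
    also have "\<dots> < e" using e(1) by (simp add: c_def)
    finally have "lattice_of h = \<Lambda>" using e(2) g(2) by simp
    moreover have "h \<in> DM" using d(1) by (simp add: DM_def h_def)
    ultimately show "\<Lambda> \<in> lattice_of ` DM" by blast
  qed
  ultimately show ?thesis by (meson countable_image countable_subset)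
qed

section \<open>Matrix polynomials and integrality\<close>

lemma matrix_sub_ldistrib: "A ** (B - C) = A ** B - A ** C" for A B C :: "'a::comm_ring_1^'n^'n"
  by (intro matrix_eqI) (simp add: mv_simps)

lemma matrix_add_rdist: "(A + B) ** C = A ** C + B ** C" for A B C :: "'a::comm_ring_1^'n^'n"
  by (intro matrix_eqI) (simp add: mv_simps)

lemma matrix_sub_rdistrib: "(A - B) ** C = A ** C - B ** C" for A B C :: "'a::comm_ring_1^'n^'n"
  by (intro matrix_eqI) (simp add: mv_simps)

lemma matrix_sum_ldistrib: "A ** (\<Sum>i\<in>S. f i) = (\<Sum>i\<in>S. A ** f i)" for A :: "'a::comm_ring_1^'n^'n" and f :: "'b \<Rightarrow> 'a^'n^'n"
  by (intro matrix_eqI) (simp add: mv_simps sum_mv mv_sum)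

lemma matrix_mul_0 [simp]: "A ** 0 = 0" "0 ** A = 0" for A :: "'a::comm_ring_1^'n^'n"
  by (auto intro!: matrix_eqI simp: mv_simps)

lemma matrix_mul_minus: "A ** (- B) = - (A ** B)" "(- A) ** B = - (A ** B)" for A B :: "'a::comm_ring_1^'n^'n"
  using matrix_sub_ldistrib[of A 0 B] matrix_sub_rdistrib[of 0 A B] by simp_all

definition matpow :: "'a::comm_ring_1^'n^'n \<Rightarrow> nat \<Rightarrow> 'a^'n^'n" where
  "matpow M k = ((\<lambda>N. M ** N) ^^ k) (mat 1)"

lemma matpow_0 [simp]: "matpow M 0 = mat 1"
  and matpow_Suc: "matpow M (Suc k) = M ** matpow M k"
  by (simp_all add: matpow_def)

lemma matpow_commute: "A ** B = B ** A \<Longrightarrow> A ** matpow B k = matpow B k ** A"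
  by (induction k) (auto simp: matpow_Suc, metis matrix_mul_assoc)

lemma matpow_mult: "A ** B = B ** A \<Longrightarrow> matpow (A ** B) k = matpow A k ** matpow B k"
proof (induction k)
  case (Suc k)
  then show ?case using matpow_commute[of B A k]
    by (simp add: matpow_Suc) (metis matrix_mul_assoc)
qed simp

lemma mat_poly_eq_sum: "Polynomial.degree p \<le> N \<Longrightarrow> mat_poly p M = (\<Sum>k\<le>N. mat (Polynomial.coeff p k) ** matpow M k)"
  unfolding mat_poly_def matpow_def[symmetric]
  by (intro sum.mono_neutral_left) (auto simp: Polynomial.coeff_eq_0)

lemma mat_poly_pCons [simp]: "mat_poly (pCons c p) M = mat c + M ** mat_poly p M"
proof -
  have "mat_poly (pCons c p) M = (\<Sum>k\<le>Suc (Polynomial.degree p). mat (Polynomial.coeff (pCons c p) k) ** matpow M k)"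
    by (intro mat_poly_eq_sum) (simp add: degree_pCons_le)
  also have "\<dots> = mat c + (\<Sum>k\<le>Polynomial.degree p. M ** (mat (Polynomial.coeff p k) ** matpow M k))"
    by (subst sum.atMost_Suc_shift) (simp add: matpow_Suc, simp add: matrix_mul_assoc mat_central[of M])
  also have "\<dots> = mat c + M ** mat_poly p M"
    by (simp add: matrix_sum_ldistrib mat_poly_eq_sum[of p "Polynomial.degree p"])
  finally show ?thesis .
qed

lemma mat_poly_0 [simp]: "mat_poly 0 M = 0"
  by (simp add: mat_poly_def)

lemma mat_poly_1 [simp]: "mat_poly 1 M = mat 1"
  unfolding one_pCons using mat_poly_pCons[of 1 0 M] by (simp del: mat_poly_pCons)

lemma mat_poly_add: "mat_poly (p + q) M = mat_poly p M + mat_poly q M"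
  by (induction p q rule: poly_induct2) (simp_all add: mat_add matrix_add_ldistrib)

lemma mat_poly_smult: "mat_poly (Polynomial.smult c p) M = mat c ** mat_poly p M"
  by (induction p) (simp_all add: mat_mult matrix_add_ldistrib matrix_mul_assoc mat_central[of M])

lemma mat_poly_minus: "mat_poly (p - q) M = mat_poly p M - mat_poly q M"
  using mat_poly_add[of "p - q" q M] by (simp add: algebra_simps)

lemma mat_poly_mult: "mat_poly (p * q) M = mat_poly p M ** mat_poly q M"
  by (induction p) (simp_all add: mult_pCons_left mat_poly_add mat_poly_smult matrix_add_rdist matrix_mul_assoc)

lemma mat_poly_commute: "A ** M = M ** A \<Longrightarrow> A ** mat_poly p M = mat_poly p M ** A"
proof (induction p)
  case (pCons c p)
  then show ?case
    by (simp add: matrix_add_ldistrib matrix_add_rdist mat_central[of A]) (metis matrix_mul_assoc)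
qed simp

lemma mat_poly_intertwine: "T ** M = N ** T \<Longrightarrow> T ** mat_poly p M = mat_poly p N ** T"
  for T M N :: "'a::comm_ring_1^'n^'n"
proof (induction p)
  case (pCons c p)
  then show ?case
    by (simp add: matrix_add_ldistrib matrix_add_rdist mat_central[of T]) (metis matrix_mul_assoc)
qed simp

lemma mat_poly_monom: "mat_poly (Polynomial.monom 1 k) M = matpow M k"
  by (induction k) (simp_all add: monom_Suc matpow_Suc monom_0)

abbreviation int_coeffs :: "'f::nonarch_local_field poly \<Rightarrow> bool" where
  "int_coeffs p \<equiv> \<forall>k. Polynomial.coeff p k \<in> int_ring"

text \<open>
  Nonzero absolute values accumulate only at 0, so a maximal one exists.
\<close>

lemma bounded_value_attained:
  fixes S :: "'f::nonarch_local_field set"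
  assumes "\<And>x. x \<in> S \<Longrightarrow> aval x \<le> B" "y \<in> S" "y \<noteq> 0"
  shows "\<exists>s\<in>S. s \<noteq> 0 \<and> (\<forall>x\<in>S. aval x \<le> aval s)"
proof -
  have "closure S \<subseteq> {x. aval x \<le> B}"
    by (intro closure_minimal closed_Collect_le continuous_intros) (use assms(1) in auto)
  then have "compact (closure S)"
    using compact_Int_closed[OF compact_aval_le[of B] closed_closure[of S]] by (simp add: inf.absorb2)
  moreover have "closure S \<noteq> {}" using assms(2) closure_subset by blast
  moreover have "continuous_on (closure S) aval" by (intro continuous_intros)
  ultimately obtain z where z: "z \<in> closure S" "\<And>x. x \<in> closure S \<Longrightarrow> aval x \<le> aval z"
    using continuous_attains_sup by metis
  have "aval y \<le> aval z" using z(2) assms(2) closure_subset by blast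
  then have "0 < aval z" using assms(3) by (metis less_le_trans zero_less_dist_iff)
  then obtain s where s: "s \<in> S" "dist s z < aval z" using z(1) closure_approachable by metis
  then have "aval (z + (s - z)) = aval z" by (intro aval_add_eq) (simp add: dist_eq_aval[of s])
  then have "aval s = aval z" by simp
  then have "s \<noteq> 0" "\<forall>x\<in>S. aval x \<le> aval s" using z(2) closure_subset \<open>0 < aval z\<close> by auto
  then show ?thesis using s(1) by blast
qed

inductive_set int_span :: "('f::nonarch_local_field^'n^'n) set \<Rightarrow> ('f^'n^'n) set" for S where
  int_span_0: "0 \<in> int_span S"
| int_span_step: "c \<in> int_ring \<Longrightarrow> x \<in> S \<Longrightarrow> y \<in> int_span S \<Longrightarrow> mat c ** x + y \<in> int_span S"

lemma int_span_base: "x \<in> S \<Longrightarrow> x \<in> int_span S"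
  using int_span_step[of 1 x S 0] int_span_0[of S] by simp

lemma int_span_add: "x \<in> int_span S \<Longrightarrow> y \<in> int_span S \<Longrightarrow> x + y \<in> int_span S"
  by (induction rule: int_span.induct) (auto simp: add.assoc intro: int_span_step)

lemma int_span_scale: "x \<in> int_span S \<Longrightarrow> c \<in> int_ring \<Longrightarrow> mat c ** x \<in> int_span S"
proof (induction rule: int_span.induct)
  case (int_span_step d x y)
  then show ?case
    using int_span.int_span_step[of "c * d" x S "mat c ** y"]
    by (auto simp: matrix_add_ldistrib matrix_mul_assoc mat_mult intro: int_ring_mult)
qed (simp add: int_span_0)

text \<open>
  A bounded sequence of vectors over a discrete valuation ring generates a Noetherian module, so
  one of its terms is an integral combination of earlier ones. Gaussian elimination on the
  coordinates shows this: a term whose leading coordinate is of maximal size clears that coordinate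
  in all later terms.
\<close>

lemma bounded_sequence_int_span:
  fixes v :: "nat \<Rightarrow> 'f::nonarch_local_field^'n^'n"
  assumes "finite I" "\<And>k i j. aval (v k $ i $ j) \<le> B" "\<And>k i j. (i, j) \<notin> I \<Longrightarrow> v k $ i $ j = 0"
  shows "\<exists>k. v k \<in> int_span (v ` {..<k})"
  using assms
proof (induction I arbitrary: v rule: finite_induct)
  case empty
  then have "v 0 = 0" by (simp add: vec_eq_iff)
  then show ?case by (metis int_span_0)
next
  case (insert x I)
  obtain a b where x: "x = (a, b)" by fastforce
  show ?case
  proof (cases "\<forall>k. v k $ a $ b = 0")
    case True
    then have "v k $ i $ j = 0" if "(i, j) \<notin> I" for k i j
      using insert.prems(2) that x by (metis insertE prod.inject)
    then show ?thesis using insert.IH insert.prems(1) by blast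
  next
    case False
    then obtain y where y: "y \<in> range (\<lambda>k. v k $ a $ b)" "y \<noteq> 0" by blast
    have ub: "aval x \<le> B" if "x \<in> range (\<lambda>k. v k $ a $ b)" for x using that insert.prems(1) by auto
    obtain s where s: "s \<in> range (\<lambda>k. v k $ a $ b)" "s \<noteq> 0" "\<And>x. x \<in> range (\<lambda>k. v k $ a $ b) \<Longrightarrow> aval x \<le> aval s"
      using bounded_value_attained[OF ub y] by blast
    then obtain m where m: "v m $ a $ b = s" by auto
    define r where "r k = v (Suc (m + k)) $ a $ b / s" for k
    \<comment> \<open>Subtracting multiples of \<open>v m\<close> clears the entry \<open>x\<close> in all later terms.\<close>
    define u where "u k = v (Suc (m + k)) - mat (r k) ** v m" for k
    have r: "r k \<in> int_ring" for k
      using s(3)[of "v (Suc (m + k)) $ a $ b"] s(2) by (simp add: r_def int_ring_def aval_divide)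
    have u_bound: "aval (u k $ i $ j) \<le> B" for k i j
    proof -
      have "aval (r k * v m $ i $ j) \<le> 1 * B"
        unfolding aval_mult using r insert.prems(1) by (intro mult_mono) (auto simp: int_ring_def)
      then show ?thesis unfolding u_def vector_minus_component mat_entry
        using insert.prems(1) by (intro aval_diff_le) auto
    qed
    have u_zero: "u k $ i $ j = 0" if "(i, j) \<notin> I" for k i j
    proof (cases "(i, j) = x")
      case True
      then show ?thesis using s(2) m x by (simp add: u_def mat_entry r_def)
    next
      case False
      then show ?thesis using that insert.prems(2) by (simp add: u_def mat_entry)
    qed
    have "\<exists>k. u k \<in> int_span (u ` {..<k})" by (rule insert.IH) (rule u_bound, rule u_zero)
    then obtain k where k: "u k \<in> int_span (u ` {..<k})" by blast
    let ?X = "v ` {..<Suc (m + k)}"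
    have step: "y \<in> int_span ?X" if "y \<in> int_span (u ` {..<k})" for y
      using that
    proof (induction rule: int_span.induct)
      case (int_span_step c x y)
      then obtain l where l: "l < k" "x = u l" by auto
      have "mat (- r l) ** v m \<in> int_span ?X"
        using l r by (intro int_span_scale int_span_base int_ring_uminus) auto
      moreover have "v (Suc (m + l)) \<in> int_span ?X" using l by (intro int_span_base) auto
      moreover have "u l = v (Suc (m + l)) + mat (- r l) ** v m"
        by (simp add: u_def vec_eq_iff mat_entry)
      ultimately have "x \<in> int_span ?X" unfolding l by (metis int_span_add)
      then show ?case using int_span_step by (intro int_span_add int_span_scale) auto
    qed (rule int_span_0)
    have "mat (r k) ** v m \<in> int_span ?X"
      using r by (intro int_span_scale int_span_base) auto
    then have "u k + mat (r k) ** v m \<in> int_span ?X" using step[OF k] by (intro int_span_add)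
    then have "v (Suc (m + k)) \<in> int_span ?X" by (simp add: u_def)
    then show ?thesis by blast
  qed
qed

definition integral_matrix :: "'f::nonarch_local_field^'n^'n \<Rightarrow> bool" where
  "integral_matrix x \<longleftrightarrow> (\<exists>p. Polynomial.lead_coeff p = 1 \<and> int_coeffs p \<and> mat_poly p x = 0)"

text \<open>
  Boundedness of the powers is the form of integrality that is visibly inherited by products of
  commuting matrices and that holds for every matrix preserving a lattice.
\<close>

definition power_bounded :: "'f::nonarch_local_field^'n^'n \<Rightarrow> bool" where
  "power_bounded x \<longleftrightarrow> (\<exists>B. \<forall>k i j. aval (matpow x k $ i $ j) \<le> B)"

text \<open>
  Some power is an integral combination of lower ones, by the lemma on bounded sequences.
\<close>

lemma power_bounded_imp_integral:
  fixes x :: "'f::nonarch_local_field^'n^'n"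
  assumes "power_bounded x" shows "integral_matrix x"
proof -
  obtain B where B: "\<And>k i j. aval (matpow x k $ i $ j) \<le> B" using assms by (auto simp: power_bounded_def)
  obtain k where k: "matpow x k \<in> int_span (matpow x ` {..<k})"
    using bounded_sequence_int_span[of UNIV "matpow x" B] B by auto
  have "\<exists>q. int_coeffs q \<and> (\<forall>i\<ge>k. Polynomial.coeff q i = 0) \<and> y = mat_poly q x"
    if "y \<in> int_span (matpow x ` {..<k})" for y
    using that
  proof (induction rule: int_span.induct)
    case int_span_0
    show ?case by (intro exI[of _ 0]) simp
  next
    case (int_span_step c z y)
    then obtain q l where q: "int_coeffs q" "\<forall>i\<ge>k. Polynomial.coeff q i = 0" "y = mat_poly q x" "l < k" "z = matpow x l"
      by auto
    show ?case
      by (intro exI[of _ "Polynomial.smult c (Polynomial.monom 1 l) + q"])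
         (use q int_span_step(1) in \<open>auto simp: mat_poly_add mat_poly_smult mat_poly_monom intro: int_ring_intros\<close>)
  qed
  then obtain q where q: "int_coeffs q" "\<forall>i\<ge>k. Polynomial.coeff q i = 0" "matpow x k = mat_poly q x"
    using k by blast
  let ?p = "Polynomial.monom 1 k - q"
  have c: "Polynomial.coeff ?p k = 1" using q(2) by simp
  moreover have "Polynomial.degree ?p \<le> k" using q(2) by (intro degree_le) simp
  ultimately have "Polynomial.degree ?p = k" by (metis le_antisym le_degree zero_neq_one)
  then have "Polynomial.lead_coeff ?p = 1" using c by simp
  moreover have "int_coeffs ?p" using q(1) by (auto intro: int_ring_intros)
  moreover have "mat_poly ?p x = 0" using q(3) by (simp add: mat_poly_minus mat_poly_monom)
  ultimately show ?thesis unfolding integral_matrix_def by blast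
qed

text \<open>
  Division by the integral equation expresses every power as an integral combination of finitely many
  fixed powers.
\<close>

lemma integral_imp_power_bounded:
  fixes x :: "'f::nonarch_local_field^'n^'n"
  assumes "integral_matrix x" shows "power_bounded x"
proof -
  obtain p where p: "Polynomial.lead_coeff p = 1" "int_coeffs p" "mat_poly p x = 0"
    using assms by (auto simp: integral_matrix_def)
  define d where "d = Polynomial.degree p"
  have d0: "0 < d"
  proof (rule ccontr)
    assume "\<not> 0 < d"
    then have "p = [:1:]" using p(1) by (metis d_def degree_0_id gr0I degree_eq_zeroE lead_coeff_pCons(2) pCons_0_0 coeff_pCons_0)
    then have "mat 1 = (0 :: 'f^'n^'n)" using p(3) by simp
    then have "(mat 1 :: 'f^'n^'n) $ undefined $ undefined = 0" by simp
    then show False by (simp add: mat_def)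
  qed
  have red: "\<exists>q. int_coeffs q \<and> (\<forall>i\<ge>d. Polynomial.coeff q i = 0) \<and> matpow x k = mat_poly q x" for k
  proof (induction k)
    case 0
    show ?case by (intro exI[of _ 1]) (use d0 in \<open>auto simp: coeff_eq_0\<close>)
  next
    case (Suc k)
    then obtain q where q: "int_coeffs q" "\<And>i. i \<ge> d \<Longrightarrow> Polynomial.coeff q i = 0" "matpow x k = mat_poly q x" by blast
    define c where "c = Polynomial.coeff q (d - 1)"
    let ?r = "pCons 0 q - Polynomial.smult c p"
    have "Polynomial.coeff ?r i = 0" if "i \<ge> d" for i
    proof (cases "i = d")
      case True
      then show ?thesis using p(1) d0 by (simp add: c_def d_def coeff_pCons split: nat.split)
    next
      case False
      then have "d < i" using that by simp
      then show ?thesis using q(2)[of "i - 1"] by (auto simp: d_def coeff_pCons coeff_eq_0 split: nat.split)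
    qed
    moreover have "int_coeffs ?r"
      using q(1) p(2) by (auto simp: c_def coeff_pCons split: nat.split intro!: int_ring_intros)
    moreover have "matpow x (Suc k) = mat_poly ?r x"
      using q(3) p(3) by (simp add: mat_poly_minus mat_poly_smult matpow_Suc)
    ultimately show ?case by blast
  qed
  define S where "S = (\<Sum>l\<le>d. \<Sum>i\<in>UNIV. \<Sum>j\<in>UNIV. aval (matpow x l $ i $ j))"
  have S: "aval (matpow x l $ i $ j) \<le> S" if "l \<le> d" for l i j
  proof -
    have "aval (matpow x l $ i $ j) \<le> (\<Sum>j\<in>UNIV. aval (matpow x l $ i $ j))"
      by (rule member_le_sum) auto
    also have "\<dots> \<le> (\<Sum>i\<in>UNIV. \<Sum>j\<in>UNIV. aval (matpow x l $ i $ j))"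
      by (rule member_le_sum) (auto intro: sum_nonneg)
    also have "\<dots> \<le> S" unfolding S_def
      using that by (intro member_le_sum[of l "{..d}" "\<lambda>l. \<Sum>i\<in>UNIV. \<Sum>j\<in>UNIV. aval (matpow x l $ i $ j)"]) (auto intro!: sum_nonneg)
    finally show ?thesis .
  qed
  have S0: "0 \<le> S" using S[of 0 undefined undefined] by (meson order_trans zero_le_dist le0)
  have "aval (matpow x k $ i $ j) \<le> S" for k i j
  proof -
    obtain q where q: "int_coeffs q" "\<forall>i\<ge>d. Polynomial.coeff q i = 0" "matpow x k = mat_poly q x" using red by blast
    have "Polynomial.degree q \<le> d" using q(2) by (intro degree_le) simp
    then have "matpow x k $ i $ j = (\<Sum>l\<le>d. Polynomial.coeff q l * matpow x l $ i $ j)"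
      using q(3) by (simp add: mat_poly_eq_sum[of q d] mat_entry)
    moreover have "aval (Polynomial.coeff q l * matpow x l $ i $ j) \<le> S" if "l \<le> d" for l
      using S[OF that, of i j] q(1) mult_mono[of "aval (Polynomial.coeff q l)" 1 "aval (matpow x l $ i $ j)" S]
      by (auto simp: aval_mult int_ring_def)
    ultimately show ?thesis using S0 by (auto intro: aval_sum_le)
  qed
  then show ?thesis unfolding power_bounded_def by blast
qed

lemma power_bounded_mult:
  fixes x y :: "'a::nonarch_local_field^'b^'b"
  assumes "power_bounded x" "power_bounded y" "x ** y = y ** x"
  shows "power_bounded (x ** y)"
proof -
  obtain B C where B: "\<And>k i j. aval (matpow x k $ i $ j) \<le> B" and C: "\<And>k i j. aval (matpow y k $ i $ j) \<le> C"
    using assms(1,2) by (auto simp: power_bounded_def)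
  have nonneg: "0 \<le> B" "0 \<le> C" using B[of 0 undefined undefined] C[of 0 undefined undefined] by (meson order_trans zero_le_dist)+
  have entry: "(M ** N) $ i $ j = (\<Sum>k\<in>UNIV. M $ i $ k * N $ k $ j)" for M N :: "'a^'b^'b" and i j
    by (simp add: matrix_matrix_mult_def)
  have "aval (matpow (x ** y) k $ i $ j) \<le> B * C" for k i j
    unfolding matpow_mult[OF assms(3)] entry
    using nonneg B C by (intro aval_sum_le) (auto simp: aval_mult intro!: mult_mono)
  then show ?thesis unfolding power_bounded_def by blast
qed

lemma compact_stabilizers: "\<Lambda> \<in> lattices \<Longrightarrow> compact (stabilizers \<Lambda>)"
proof -
  assume "\<Lambda> \<in> lattices"
  then obtain g where g: "invertible g" "\<Lambda> = lattice_of g" by (auto simp: lattices_def)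
  have "stabilizers \<Lambda> = (\<lambda>M. g ** M ** matrix_inv g) ` mat_over int_ring"
  proof (intro Set.set_eqI iffI)
    fix M assume "M \<in> stabilizers \<Lambda>"
    then have "matrix_inv g ** M ** g \<in> mat_over int_ring" using stabilizers_lattice_of g by blast
    moreover have "M = g ** (matrix_inv g ** M ** g) ** matrix_inv g"
      by (metis g(1) matrix_inv_right matrix_mul_assoc matrix_mul_lid matrix_mul_rid)
    ultimately show "M \<in> (\<lambda>M. g ** M ** matrix_inv g) ` mat_over int_ring" by blast
  next
    fix M assume "M \<in> (\<lambda>M. g ** M ** matrix_inv g) ` mat_over int_ring"
    then obtain N where N: "N \<in> mat_over int_ring" "M = g ** N ** matrix_inv g" by blast
    moreover have "matrix_inv g ** (g ** N ** matrix_inv g) ** g = N"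
      by (metis g(1) matrix_inv_left matrix_mul_assoc matrix_mul_lid matrix_mul_rid)
    ultimately show "M \<in> stabilizers \<Lambda>" using stabilizers_lattice_of[OF g(1)] g(2) by simp
  qed
  also have "compact \<dots>" by (intro compact_continuous_image compact_mat_over_int continuous_intros)
  finally show ?thesis .
qed

lemma stabilizer_power_bounded: "\<Lambda> \<in> lattices \<Longrightarrow> x \<in> stabilizers \<Lambda> \<Longrightarrow> power_bounded x"
proof -
  assume *: "\<Lambda> \<in> lattices" "x \<in> stabilizers \<Lambda>"
  have "matpow x k \<in> stabilizers \<Lambda>" for k
    by (induction k) (auto simp: matpow_Suc * intro: stabilizers_intros)
  then show ?thesis
    using compact_imp_bounded[OF compact_stabilizers[OF *(1)]] unfolding bounded_matrix_iff power_bounded_def by blast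
qed

lemma adjoin_mult: "x \<in> adjoin w \<Longrightarrow> y \<in> adjoin w \<Longrightarrow> x ** y \<in> adjoin w"
  by (auto simp: adjoin_def mat_poly_mult[symmetric])

lemma adjoin_mat_1: "mat 1 \<in> adjoin w"
  unfolding adjoin_def by (metis mat_poly_1 rangeI)

lemma adjoin_commute: "A ** w = w ** A \<Longrightarrow> x \<in> adjoin w \<Longrightarrow> A ** x = x ** A"
  unfolding adjoin_def using mat_poly_commute by blast

lemma adjoin_commute_adjoin: "x \<in> adjoin w \<Longrightarrow> y \<in> adjoin w \<Longrightarrow> x ** y = y ** x"
proof -
  assume *: "x \<in> adjoin w" "y \<in> adjoin w"
  have "w ** x = x ** w" using adjoin_commute[of w w x] *(1) by simp
  then show ?thesis using adjoin_commute[of x w y] *(2) by simp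
qed

lemma adjoin_max_order_iff:
  "x \<in> adjoin_max_order w \<longleftrightarrow> x \<in> adjoin w \<and> power_bounded x"
  unfolding adjoin_max_order_def using integral_imp_power_bounded power_bounded_imp_integral
  by (auto simp: integral_matrix_def)

lemma power_bounded_mat_1: "power_bounded (mat 1)"
proof -
  have "matpow (mat 1 :: 'a^'b^'b) k = mat 1" for k by (induction k) (auto simp: matpow_Suc)
  then show ?thesis unfolding power_bounded_def by (intro exI[of _ 1]) (auto simp: mat_def)
qed

section \<open>A quadratic case of Hensel's lemma\<close>

text \<open>
  Iterating the right-hand side gives solutions modulo every power of the uniformizer; a limit point
  in the compact ring \<open>C\<close> is a solution.
\<close>

lemma hensel_quadratic:
  fixes C :: "('f::nonarch_local_field^'n^'n) set"
  assumes C: "compact C" "\<And>x y. x \<in> C \<Longrightarrow> y \<in> C \<Longrightarrow> x + y \<in> C" "\<And>x y. x \<in> C \<Longrightarrow> y \<in> C \<Longrightarrow> x ** y \<in> C"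
    "\<And>x y. x \<in> C \<Longrightarrow> y \<in> C \<Longrightarrow> x ** y = y ** x" "mat uniformizer \<in> C"
    and AB: "A \<in> C" "B \<in> C"
  shows "\<exists>y\<in>C. y = A + mat uniformizer ** (B ** (y ** y))"
proof -
  let ?p = "uniformizer :: 'f"
  define F where "F y = A + mat ?p ** (B ** (y ** y))" for y
  define y where "y = rec_nat A (\<lambda>_. F)"
  have y0: "y 0 = A" and ySuc: "y (Suc k) = F (y k)" for k by (simp_all add: y_def)
  have yC: "y k \<in> C" for k
    by (induction k) (auto simp: y0 ySuc F_def intro!: C AB)
  have "\<exists>d\<in>C. F (y k) - y k = mat (?p ^ k) ** (mat ?p ** d)" for k
  proof (induction k)
    case 0
    show ?case by (intro bexI[of _ "B ** (A ** A)"]) (auto simp: y0 F_def intro!: C AB)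
  next
    case (Suc k)
    then obtain d where d: "d \<in> C" "F (y k) - y k = mat (?p ^ k) ** (mat ?p ** d)" by blast
    let ?u = "y k" and ?v = "F (y k)"
    have comm: "?u ** ?v = ?v ** ?u" using C(4) yC ySuc by metis
    have "F ?v - ?v = mat ?p ** (B ** ((?v - ?u) ** (?v + ?u)))"
    proof -
      have "F a - F b = mat ?p ** (B ** (a ** a)) - mat ?p ** (B ** (b ** b))" for a b
        by (simp add: F_def)
      then have "F ?v - ?v = mat ?p ** (B ** (?v ** ?v)) - mat ?p ** (B ** (?u ** ?u))" .
      also have "\<dots> = mat ?p ** (B ** (?v ** ?v - ?u ** ?u))" by (simp add: matrix_sub_ldistrib)
      also have "?v ** ?v - ?u ** ?u = (?v - ?u) ** (?v + ?u)"
        using comm by (simp add: matrix_sub_rdistrib matrix_add_ldistrib)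
      finally show ?thesis .
    qed
    also have "\<dots> = mat (?p ^ Suc k) ** (mat ?p ** (B ** (d ** (?v + ?u))))"
      unfolding d(2) power_Suc mat_mult by (simp add: matrix_eq mult_mv)
    finally have "F (y (Suc k)) - y (Suc k) = mat (?p ^ Suc k) ** (mat ?p ** (B ** (d ** (?v + ?u))))"
      by (simp only: ySuc)
    moreover have "B ** (d ** (?v + ?u)) \<in> C" using d(1) yC[of k] yC[of "Suc k"] unfolding ySuc by (intro C AB)
    ultimately show ?case by blast
  qed
  then obtain d where d: "\<And>k. d k \<in> C" "\<And>k. F (y k) - y k = mat (?p ^ k) ** (mat ?p ** d k)" by metis
  obtain B where B: "\<And>M i j. M \<in> C \<Longrightarrow> aval (M $ i $ j) \<le> B"
    using compact_imp_bounded[OF C(1)] unfolding bounded_matrix_iff by blast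
  obtain l r where l: "l \<in> C" "strict_mono r" "(y \<circ> r) \<longlonglongrightarrow> l"
    using C(1) yC unfolding compact_eq_seq_compact_metric seq_compact_def by metis
  have "continuous_on UNIV (\<lambda>y. (F y - y) $ i $ j)" for i j
    unfolding F_def vector_add_component vector_minus_component mat_entry by (intro continuous_intros)
  then have lim: "(\<lambda>k. (F (y (r k)) - y (r k)) $ i $ j) \<longlonglongrightarrow> (F l - l) $ i $ j" for i j
    using continuous_on_tendsto_compose[of UNIV "\<lambda>y. (F y - y) $ i $ j" "y \<circ> r" l] l(3)
    by (simp add: o_def del: vector_minus_component)
  have "(\<lambda>k. (F (y (r k)) - y (r k)) $ i $ j) \<longlonglongrightarrow> 0" for i j
  proof (rule tendstoI)
    fix e :: real assume e: "0 < e"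
    have "(\<lambda>k. aval ?p ^ k * (\<bar>B\<bar> + 1)) \<longlonglongrightarrow> 0 * (\<bar>B\<bar> + 1)"
      using aval_uniformizer_less[where ?'f='f] by (intro tendsto_intros LIMSEQ_realpow_zero) auto
    then have "\<forall>\<^sub>F k in sequentially. aval ?p ^ k * (\<bar>B\<bar> + 1) < e"
      using e by (simp add: order_tendsto_iff)
    then have "\<forall>\<^sub>F k in sequentially. aval ?p ^ (r k) * (\<bar>B\<bar> + 1) < e"
      by (rule eventually_subseq[OF l(2)])
    then show "\<forall>\<^sub>F k in sequentially. dist ((F (y (r k)) - y (r k)) $ i $ j) 0 < e"
    proof (rule eventually_mono)
      fix k assume k: "aval ?p ^ (r k) * (\<bar>B\<bar> + 1) < e"
      have "aval ?p * aval (d (r k) $ i $ j) \<le> 1 * (\<bar>B\<bar> + 1)"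
        using B[OF d(1), of "r k" i j] aval_uniformizer_less[where ?'f='f] by (intro mult_mono) auto
      then have "aval ?p ^ (r k) * (aval ?p * aval (d (r k) $ i $ j)) \<le> aval ?p ^ (r k) * (\<bar>B\<bar> + 1)"
        by (intro mult_left_mono) auto
      also note k
      finally show "dist ((F (y (r k)) - y (r k)) $ i $ j) 0 < e"
        by (simp only: d(2) mat_entry aval_mult aval_power)
    qed
  qed
  then have "(F l - l) $ i $ j = 0" for i j using LIMSEQ_unique lim by blast
  then have "F l = l" by (simp add: vec_eq_iff)
  then show ?thesis using l(1) unfolding F_def by metis
qed

section \<open>Lattices over valuation rings\<close>

lemma mat_minus: "mat (- c) = - (mat c :: 'a::comm_ring_1^'n^'n)"
  by (simp add: vec_eq_iff mat_def)

definition module_closed :: "('f::nonarch_local_field^'n^'n) set \<Rightarrow> ('f^'n) set \<Rightarrow> bool" where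
  "module_closed R M \<longleftrightarrow> 0 \<in> M \<and> (\<forall>u\<in>M. \<forall>v\<in>M. u + v \<in> M) \<and> (\<forall>A\<in>R. \<forall>v\<in>M. A *v v \<in> M)"

definition generates :: "('f::nonarch_local_field^'n^'n) set \<Rightarrow> ('f^'n) set \<Rightarrow> ('f^'n) set \<Rightarrow> bool" where
  "generates R S M \<longleftrightarrow> finite S \<and> M = {\<Sum>s\<in>S. A s *v s | A. \<forall>s\<in>S. A s \<in> R}"

definition spanning :: "('f::nonarch_local_field^'n) set \<Rightarrow> bool" where
  "spanning M \<longleftrightarrow> (\<forall>v. \<exists>c. c \<noteq> 0 \<and> c *s v \<in> M)"

text \<open>
  \<open>K\<close> is a field of matrices, of finite degree over the scalars with basis \<open>Bs\<close>, and \<open>R\<close> is a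
  valuation ring of \<open>K\<close>.
\<close>

locale valuation_order =
  fixes K R :: "('f::nonarch_local_field^'n^'n) set" and Bs :: "('f^'n^'n) set"
  assumes R_sub: "R \<subseteq> K"
    and R_mat: "c \<in> int_ring \<Longrightarrow> mat c \<in> R"
    and R_add: "x \<in> R \<Longrightarrow> y \<in> R \<Longrightarrow> x + y \<in> R"
    and R_mult: "x \<in> R \<Longrightarrow> y \<in> R \<Longrightarrow> x ** y \<in> R"
    and K_mat: "mat c \<in> K"
    and K_add: "x \<in> K \<Longrightarrow> y \<in> K \<Longrightarrow> x + y \<in> K"
    and K_mult: "x \<in> K \<Longrightarrow> y \<in> K \<Longrightarrow> x ** y \<in> K"
    and K_commute: "x \<in> K \<Longrightarrow> y \<in> K \<Longrightarrow> x ** y = y ** x"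
    and K_inverse: "x \<in> K \<Longrightarrow> x \<noteq> 0 \<Longrightarrow> invertible x \<and> matrix_inv x \<in> K"
    and valuation: "x \<in> K \<Longrightarrow> x \<noteq> 0 \<Longrightarrow> x \<in> R \<or> matrix_inv x \<in> R"
    and Bs: "finite Bs" "Bs \<subseteq> K"
    and Bs_span: "x \<in> K \<Longrightarrow> \<exists>e. x = (\<Sum>\<beta>\<in>Bs. mat (e \<beta>) ** \<beta>)"
    and Bs_indep: "(\<Sum>\<beta>\<in>Bs. mat (e \<beta>) ** \<beta>) = 0 \<Longrightarrow> \<beta> \<in> Bs \<Longrightarrow> e \<beta> = 0"
begin

lemma R_uminus: "x \<in> R \<Longrightarrow> - x \<in> R"
  using R_mult[OF R_mat[of "- 1"], of x] int_ring_uminus[OF int_ring_1]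
  by (auto simp: matrix_mul_minus mat_minus)

lemma K_uminus: "x \<in> K \<Longrightarrow> - x \<in> K"
  using K_mult[OF K_mat[of "- 1"], of x] by (simp add: matrix_mul_minus mat_minus)

lemma R_0: "0 \<in> R" and K_0: "0 \<in> K" and R_1: "mat 1 \<in> R"
  using R_mat[of 0] K_mat[of 0] R_mat[of 1] by simp_all

lemma R_diff: "x \<in> R \<Longrightarrow> y \<in> R \<Longrightarrow> x - y \<in> R" and K_diff: "x \<in> K \<Longrightarrow> y \<in> K \<Longrightarrow> x - y \<in> K"
  using R_add[of x "- y"] R_uminus[of y] K_add[of x "- y"] K_uminus[of y] by simp_all

lemma R_sum: "(\<And>i. i \<in> S \<Longrightarrow> f i \<in> R) \<Longrightarrow> sum f S \<in> R"
  by (induction S rule: infinite_finite_induct) (auto intro: R_0 R_add)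

lemma K_sum: "(\<And>i. i \<in> S \<Longrightarrow> f i \<in> K) \<Longrightarrow> sum f S \<in> K"
  by (induction S rule: infinite_finite_induct) (auto intro: K_0 K_add)

definition independent_over :: "('f^'n) set \<Rightarrow> bool" where
  "independent_over S \<longleftrightarrow> (\<forall>A. (\<forall>s\<in>S. A s \<in> K) \<and> (\<Sum>s\<in>S. A s *v s) = 0 \<longrightarrow> (\<forall>s\<in>S. A s = 0))"

lemma independent_overD:
  assumes "independent_over S" "\<And>s. s \<in> S \<Longrightarrow> A s \<in> K" "(\<Sum>s\<in>S. A s *v s) = 0" "s \<in> S"
  shows "A s = 0"
  using assms unfolding independent_over_def by blast

lemma generatesI:
  assumes "finite I" "module_closed R M" "f ` I \<subseteq> M"
    "\<And>v. v \<in> M \<Longrightarrow> \<exists>A. (\<forall>i\<in>I. A i \<in> R) \<and> v = (\<Sum>i\<in>I. A i *v f i)"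
  shows "generates R (f ` I) M"
proof -
  have "\<exists>A. (\<forall>s\<in>f ` I. A s \<in> R) \<and> v = (\<Sum>s\<in>f ` I. A s *v s)" if "v \<in> M" for v
  proof -
    from assms(4)[OF \<open>v \<in> M\<close>] obtain A where A: "\<And>i. i \<in> I \<Longrightarrow> A i \<in> R" "v = (\<Sum>i\<in>I. A i *v f i)"
      by blast
    have "v = (\<Sum>s\<in>f ` I. \<Sum>i\<in>{i \<in> I. f i = s}. A i *v f i)"
      unfolding A(2) by (rule sum.image_gen[OF assms(1)])
    also have "\<dots> = (\<Sum>s\<in>f ` I. (\<Sum>i\<in>{i \<in> I. f i = s}. A i) *v s)"
      by (intro sum.cong refl) (simp add: sum_mv)
    finally show ?thesis
      using A(1) by (intro exI[of _ "\<lambda>s. \<Sum>i\<in>{i \<in> I. f i = s}. A i"]) (auto intro: R_sum)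
  qed
  moreover have "(\<Sum>s\<in>f ` I. A s *v s) \<in> M" if "\<forall>s\<in>f ` I. A s \<in> R" for A
  proof -
    have "(\<Sum>s\<in>T. A s *v s) \<in> M" if "T \<subseteq> f ` I" for T
      using that finite_subset[OF that finite_imageI[OF assms(1)]]
      by (induction T rule: infinite_finite_induct)
         (use assms(2,3) \<open>\<forall>s\<in>f ` I. A s \<in> R\<close> in \<open>auto simp: module_closed_def\<close>)
    then show ?thesis by blast
  qed
  ultimately show ?thesis unfolding generates_def using assms(1) by blast
qed

text \<open>
  Divisibility by elements of \<open>R\<close> is a total preorder on the nonzero elements of \<open>K\<close>, by the valuation
  property; a minimal member of a finite set divides the others.
\<close>

lemma dividing_member:
  assumes "finite T" "T \<noteq> {}" "T \<subseteq> K - {0}"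
  shows "\<exists>x\<in>T. \<forall>y\<in>T. matrix_inv x ** y \<in> R"
  using assms
proof (induction T rule: finite_ne_induct)
  case (singleton x)
  then show ?case using K_inverse[of x] by (auto simp: matrix_inv_left R_1)
next
  case (insert a T)
  then obtain x where x: "x \<in> T" "\<And>y. y \<in> T \<Longrightarrow> matrix_inv x ** y \<in> R" by blast
  have inv: "invertible a" "invertible x" "matrix_inv x \<in> K" "a \<in> K" "x \<in> K"
    using insert.prems x(1) K_inverse by auto
  show ?case
  proof (cases "matrix_inv x ** a \<in> R")
    case True
    then show ?thesis using x by blast
  next
    case False
    have i: "invertible (matrix_inv x ** a)" using inv by (intro invertible_mult invertible_matrix_inv)
    then have "matrix_inv x ** a \<noteq> 0" by (metis invertible_det_nz det_0 mat_0)
    then have "matrix_inv (matrix_inv x ** a) \<in> R" using valuation[of "matrix_inv x ** a"] False inv K_mult by blast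
    then have ax: "matrix_inv a ** x \<in> R" using inv by (simp add: matrix_inv_mult invertible_matrix_inv matrix_inv_inv)
    have "matrix_inv a ** y \<in> R" if "y \<in> insert a T" for y
    proof (cases "y = a")
      case True
      then show ?thesis using inv by (simp add: matrix_inv_left R_1)
    next
      case False
      then have "(matrix_inv a ** x) ** (matrix_inv x ** y) \<in> R" using that x(2) ax R_mult by blast
      moreover have "(matrix_inv a ** x) ** (matrix_inv x ** y) = matrix_inv a ** y"
        by (metis inv(2) matrix_inv_right matrix_mul_assoc matrix_mul_rid)
      ultimately show ?thesis by simp
    qed
    then show ?thesis by blast
  qed
qed

text \<open>
  A generating set of minimal size is independent: in a relation one coefficient divides all
  others, so the corresponding generator is redundant.
\<close>

lemma independent_generators:
  assumes "generates R S0 M"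
  obtains S where "generates R S M" "independent_over S"
proof -
  define S where "S = arg_min card (\<lambda>S. generates R S M)"
  have S: "generates R S M" "\<And>S'. generates R S' M \<Longrightarrow> card S \<le> card S'"
    unfolding S_def using assms arg_min_natI arg_min_nat_le by metis+
  have fin: "finite S" using S(1) by (simp add: generates_def)
  have "independent_over S"
  proof (rule ccontr)
    assume "\<not> independent_over S"
    then obtain A s1 where A: "\<And>s. s \<in> S \<Longrightarrow> A s \<in> K" "(\<Sum>s\<in>S. A s *v s) = 0" "s1 \<in> S" "A s1 \<noteq> 0"
      unfolding independent_over_def by blast
    have "\<exists>x\<in>A ` S - {0}. \<forall>y\<in>A ` S - {0}. matrix_inv x ** y \<in> R"
      using A fin by (intro dividing_member) auto
    then obtain x where x: "x \<in> A ` S - {0}" "\<And>y. y \<in> A ` S - {0} \<Longrightarrow> matrix_inv x ** y \<in> R" by blast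
    then obtain s0 where s0: "s0 \<in> S" "A s0 = x" by auto
    have xi: "invertible x" using x(1) A K_inverse by auto
    define C where "C s = matrix_inv x ** A s" for s
    have C: "C s \<in> R" if "s \<in> S" for s
      using x(2)[of "A s"] that by (cases "A s = 0") (auto simp: C_def R_0)
    have C0: "C s0 = mat 1" by (simp add: C_def s0 matrix_inv_left xi)
    have "(\<Sum>s\<in>S. C s *v s) = matrix_inv x *v (\<Sum>s\<in>S. A s *v s)" by (simp add: C_def mv_sum mult_mv)
    then have "(\<Sum>s\<in>S. C s *v s) = 0" by (simp add: A)
    then have rel: "s0 = - (\<Sum>s\<in>S - {s0}. C s *v s)"
      using fin s0(1) C0 by (simp add: sum.remove[of S s0] eq_neg_iff_add_eq_0)
    have "generates R (S - {s0}) M"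
      unfolding generates_def
    proof (intro conjI Set.set_eqI iffI)
      fix v assume "v \<in> M"
      then obtain B where B: "\<forall>s\<in>S. B s \<in> R" "v = (\<Sum>s\<in>S. B s *v s)" using S(1) by (auto simp: generates_def)
      have "v = B s0 *v s0 + (\<Sum>s\<in>S - {s0}. B s *v s)" using B(2) fin s0(1) by (simp add: sum.remove)
      also have "B s0 *v s0 = - (\<Sum>s\<in>S - {s0}. (B s0 ** C s) *v s)"
        by (subst (2) rel) (simp add: mv_minus mv_sum mult_mv)
      finally have "v = (\<Sum>s\<in>S - {s0}. (B s - B s0 ** C s) *v s)"
        by (simp add: sum_subtractf matrix_vector_mult_diff_rdistrib)
      moreover have "\<forall>s\<in>S - {s0}. B s - B s0 ** C s \<in> R" using B(1) C s0 by (auto intro!: R_diff R_mult)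
      ultimately show "v \<in> {\<Sum>s\<in>S - {s0}. A s *v s |A. \<forall>s\<in>S - {s0}. A s \<in> R}"
        by (intro CollectI exI[of _ "\<lambda>s. B s - B s0 ** C s"]) simp
    next
      fix v assume "v \<in> {\<Sum>s\<in>S - {s0}. A s *v s |A. \<forall>s\<in>S - {s0}. A s \<in> R}"
      then obtain B where B: "\<forall>s\<in>S - {s0}. B s \<in> R" "v = (\<Sum>s\<in>S - {s0}. B s *v s)" by blast
      define B' where "B' s = (if s = s0 then 0 else B s)" for s
      have "v = (\<Sum>s\<in>S. B' s *v s)"
        unfolding B(2) using fin by (intro sum.mono_neutral_cong_left) (auto simp: B'_def)
      moreover have "\<forall>s\<in>S. B' s \<in> R" using B(1) by (auto simp: B'_def R_0)
      ultimately show "v \<in> M" using S(1) unfolding generates_def by blast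
    qed (use fin in simp)
    then have "card S \<le> card (S - {s0})" by (rule S(2))
    then show False using fin s0(1) by (metis card_Diff1_less not_le)
  qed
  then show ?thesis using that S(1) by blast
qed

text \<open>
  This determines the number of elements of a basis over \<open>K\<close> from the dimension over the scalars, so that any
  two such bases are equinumerous. The products of basis elements form a scalar basis.
\<close>

lemma basis_dim:
  assumes "finite S" "independent_over S"
  shows "vec.dim {\<Sum>s\<in>S. A s *v s | A. \<forall>s\<in>S. A s \<in> K} = card Bs * card S"
proof -
  let ?W = "{\<Sum>s\<in>S. A s *v s | A. \<forall>s\<in>S. A s \<in> K}"
  define e :: "('f^'n^'n) \<times> ('f^'n) \<Rightarrow> ('f^'n)" where "e = (\<lambda>(\<beta>, s). \<beta> *v s)"
  have zero: "A s = 0" if "\<And>s. s \<in> S \<Longrightarrow> A s \<in> K" "(\<Sum>s\<in>S. A s *v s) = 0" "s \<in> S" for A s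
    using assms(2) that unfolding independent_over_def by blast
  have Bs0: "\<beta> \<noteq> 0" if "\<beta> \<in> Bs" for \<beta>
  proof
    assume "\<beta> = 0"
    then have "(\<Sum>\<beta>'\<in>Bs. mat (if \<beta>' = \<beta> then 1 else 0) ** \<beta>') = 0"
      by (intro sum.neutral) auto
    from Bs_indep[OF this that] show False by simp
  qed
  have comb: "(\<Sum>\<beta>\<in>Bs. mat (c \<beta>) ** \<beta>) \<in> K" for c
    using Bs(2) by (intro K_sum K_mult K_mat) auto
  have indep: "\<forall>\<beta>\<in>Bs. \<forall>s\<in>S. u \<beta> s = 0" if "(\<Sum>s\<in>S. \<Sum>\<beta>\<in>Bs. u \<beta> s *s (\<beta> *v s)) = 0" for u
  proof -
    have "(\<Sum>s\<in>S. (\<Sum>\<beta>\<in>Bs. mat (u \<beta> s) ** \<beta>) *v s) = 0"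
      using that by (simp add: sum_mv mult_mv)
    then have "(\<Sum>\<beta>\<in>Bs. mat (u \<beta> s) ** \<beta>) = 0" if "s \<in> S" for s
      using zero[of "\<lambda>s. \<Sum>\<beta>\<in>Bs. mat (u \<beta> s) ** \<beta>" s, OF comb _ that] by simp
    then show ?thesis by (intro ballI) (rule Bs_indep)
  qed
  have inj: "inj_on e (Bs \<times> S)"
  proof (rule inj_onI)
    fix x y assume "x \<in> Bs \<times> S" "y \<in> Bs \<times> S" "e x = e y"
    moreover obtain \<beta> s \<beta>' s' where xy: "x = (\<beta>, s)" "y = (\<beta>', s')" by fastforce
    ultimately have *: "\<beta> \<in> Bs" "s \<in> S" "\<beta>' \<in> Bs" "s' \<in> S" "\<beta> *v s = \<beta>' *v s'" by (auto simp: e_def)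
    define u where "u b r = (if (b, r) = (\<beta>, s) then 1 else 0) - (if (b, r) = (\<beta>', s') then 1 else (0::'f))" for b r
    have single: "(\<Sum>r\<in>S. \<Sum>b\<in>Bs. (if (b, r) = (b0, r0) then 1 else (0::'f)) *s (b *v r)) = b0 *v r0"
      if "b0 \<in> Bs" "r0 \<in> S" for b0 r0
    proof -
      have "(\<Sum>r\<in>S. \<Sum>b\<in>Bs. (if (b, r) = (b0, r0) then 1 else (0::'f)) *s (b *v r)) =
        (\<Sum>r\<in>S. if r = r0 then (\<Sum>b\<in>Bs. if b = b0 then b *v r else 0) else 0)"
        by (intro sum.cong refl) (auto intro!: sum.cong)
      then show ?thesis using that assms(1) Bs(1) by simp
    qed
    have "(\<Sum>r\<in>S. \<Sum>b\<in>Bs. u b r *s (b *v r)) = \<beta> *v s - \<beta>' *v s'"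
      unfolding u_def vec.scale_left_diff_distrib sum_subtractf using single * by simp
    then have "u \<beta> s = 0" using indep[of u] * by auto
    then show "x = y" by (auto simp: u_def xy split: if_splits)
  qed
  have fin: "finite (e ` (Bs \<times> S))" using assms(1) Bs(1) by simp
  have ind: "vec.independent (e ` (Bs \<times> S))"
    unfolding vec.dependent_finite[OF fin]
  proof safe
    fix u :: "'f^'n \<Rightarrow> 'f" and \<beta> s
    assume *: "(\<Sum>v\<in>e ` (Bs \<times> S). u v *s v) = 0" "\<beta> \<in> Bs" "s \<in> S" "u (e (\<beta>, s)) \<noteq> 0"
    have "(\<Sum>v\<in>e ` (Bs \<times> S). u v *s v) = (\<Sum>x\<in>Bs \<times> S. u (e x) *s e x)"
      by (simp add: sum.reindex[OF inj])
    also have "\<dots> = (\<Sum>\<beta>\<in>Bs. \<Sum>s\<in>S. u (\<beta> *v s) *s (\<beta> *v s))"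
      by (simp add: e_def sum.cartesian_product split_def)
    also have "\<dots> = (\<Sum>s\<in>S. \<Sum>\<beta>\<in>Bs. u (\<beta> *v s) *s (\<beta> *v s))" by (rule sum.swap)
    finally show False using indep[of "\<lambda>\<beta> s. u (\<beta> *v s)"] * by (auto simp: e_def)
  qed
  have "e ` (Bs \<times> S) \<subseteq> ?W"
  proof safe
    fix \<beta> s assume "\<beta> \<in> Bs" "s \<in> S"
    then have "e (\<beta>, s) = (\<Sum>r\<in>S. (if r = s then \<beta> else 0) *v r)"
      using assms(1) by (simp add: e_def if_distrib[of "\<lambda>A. A *v _"] cong: if_cong)
    then show "\<exists>A. e (\<beta>, s) = (\<Sum>s\<in>S. A s *v s) \<and> (\<forall>s\<in>S. A s \<in> K)"
      using Bs(2) \<open>\<beta> \<in> Bs\<close> K_0 by (intro exI[of _ "\<lambda>r. if r = s then \<beta> else 0"]) auto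
  qed
  moreover have "?W \<subseteq> vec.span (e ` (Bs \<times> S))"
  proof safe
    fix A assume A: "\<forall>s\<in>S. A s \<in> K"
    then have "\<forall>s\<in>S. \<exists>c. A s = (\<Sum>\<beta>\<in>Bs. mat (c \<beta>) ** \<beta>)" using Bs_span by blast
    from bchoice[OF this] obtain c where c: "\<forall>s\<in>S. A s = (\<Sum>\<beta>\<in>Bs. mat (c s \<beta>) ** \<beta>)" by blast
    have "(\<Sum>s\<in>S. A s *v s) = (\<Sum>s\<in>S. \<Sum>\<beta>\<in>Bs. c s \<beta> *s e (\<beta>, s))"
      by (intro sum.cong refl) (simp add: c sum_mv mult_mv e_def)
    also have "\<dots> \<in> vec.span (e ` (Bs \<times> S))"
      by (intro vec.span_sum vec.span_scale vec.span_base) auto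
    finally show "(\<Sum>s\<in>S. A s *v s) \<in> vec.span (e ` (Bs \<times> S))" .
  qed
  ultimately have "vec.dim ?W = card (e ` (Bs \<times> S))"
    using vec.dim_unique[OF _ _ ind refl] by blast
  then show ?thesis by (simp add: card_image[OF inj] card_cartesian_product)
qed

lemma Bs_card_pos: "0 < card Bs"
proof -
  have "Bs \<noteq> {}"
  proof
    assume "Bs = {}"
    then have "mat 1 = (0 :: 'f^'n^'n)" using Bs_span[OF K_mat[of 1]] by simp
    then have "(mat 1 :: 'f^'n^'n) $ undefined $ undefined = 0" by simp
    then show False by (simp add: mat_def)
  qed
  then show ?thesis using Bs(1) by (simp add: card_gt_0_iff)
qed

text \<open>
  Linear extension over \<open>K\<close>. Commutation with \<open>K\<close> is linearity over \<open>K\<close>.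
\<close>

lemma basis_map:
  assumes S: "finite S" "independent_over S" "\<And>v. \<exists>A. (\<forall>s\<in>S. A s \<in> K) \<and> v = (\<Sum>s\<in>S. A s *v s)"
    and S': "independent_over S'" and \<phi>: "bij_betw \<phi> S S'"
  shows "\<exists>h. invertible h \<and> (\<forall>A. (\<forall>s\<in>S. A s \<in> K) \<longrightarrow> h *v (\<Sum>s\<in>S. A s *v s) = (\<Sum>s\<in>S. A s *v \<phi> s)) \<and>
    (\<forall>x\<in>K. h ** x = x ** h)"
proof -
  obtain cf where cf: "\<And>v s. s \<in> S \<Longrightarrow> cf v s \<in> K" "\<And>v. v = (\<Sum>s\<in>S. cf v s *v s)"
    using S(3) by metis
  have uniq: "A s = B s" if "\<forall>s\<in>S. A s \<in> K" "\<forall>s\<in>S. B s \<in> K" "(\<Sum>s\<in>S. A s *v s) = (\<Sum>s\<in>S. B s *v s)" "s \<in> S" for A B s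
  proof -
    have "(\<Sum>s\<in>S. (A s - B s) *v s) = 0" using that(3) by (simp add: sum_subtractf matrix_vector_mult_diff_rdistrib)
    moreover have "\<forall>s\<in>S. A s - B s \<in> K" using that K_diff by blast
    ultimately have "A s - B s = 0" using independent_overD[OF S(2), of "\<lambda>s. A s - B s" s] that(4) by blast
    then show ?thesis by simp
  qed
  define H where "H v = (\<Sum>s\<in>S. cf v s *v \<phi> s)" for v
  have H: "H (\<Sum>s\<in>S. A s *v s) = (\<Sum>s\<in>S. A s *v \<phi> s)" if "\<forall>s\<in>S. A s \<in> K" for A
  proof -
    let ?w = "\<Sum>s\<in>S. A s *v s"
    have "cf ?w r = A r" if "r \<in> S" for r
      by (rule uniq[OF _ \<open>\<forall>s\<in>S. A s \<in> K\<close> cf(2)[symmetric] that]) (use cf(1) in blast)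
    then show ?thesis unfolding H_def by (intro sum.cong refl) simp
  qed
  have Hadd: "H (u + v) = H u + H v" for u v
  proof -
    have "H (\<Sum>s\<in>S. (cf u s + cf v s) *v s) = (\<Sum>s\<in>S. (cf u s + cf v s) *v \<phi> s)"
      using cf(1) by (intro H) (auto intro: K_add)
    moreover have "(\<Sum>s\<in>S. (cf u s + cf v s) *v s) = u + v"
      using cf(2)[of u] cf(2)[of v] by (simp add: matrix_vector_mult_add_rdistrib sum.distrib)
    ultimately show ?thesis by (simp add: H_def matrix_vector_mult_add_rdistrib sum.distrib)
  qed
  have Hmult: "H (x *v v) = x *v H v" if "x \<in> K" for x v
  proof -
    have "H (\<Sum>s\<in>S. (x ** cf v s) *v s) = (\<Sum>s\<in>S. (x ** cf v s) *v \<phi> s)"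
      using cf(1) that by (intro H) (auto intro: K_mult)
    moreover have "(\<Sum>s\<in>S. (x ** cf v s) *v s) = x *v (\<Sum>s\<in>S. cf v s *v s)" by (simp add: mv_sum mult_mv)
    ultimately show ?thesis using cf(2)[of v] by (simp add: H_def mv_sum mult_mv)
  qed
  have "Vector_Spaces.linear (*s) (*s) H"
    unfolding Vector_Spaces.linear_iff using Hadd Hmult[OF K_mat] vec.vector_space_axioms by auto
  then have mH: "matrix H *v v = H v" for v using matrix_works by blast
  have "inj ((*v) (matrix H))"
  proof (rule injI)
    fix u v assume "matrix H *v u = matrix H *v v"
    then have "H u = H v" by (simp add: mH)
    then have z: "(\<Sum>s\<in>S. (cf u s - cf v s) *v \<phi> s) = 0"
      by (simp add: H_def matrix_vector_mult_diff_rdistrib sum_subtractf)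
    have "(\<Sum>s\<in>S. (cf u s - cf v s) *v \<phi> s) = (\<Sum>r\<in>S'. (cf u (the_inv_into S \<phi> r) - cf v (the_inv_into S \<phi> r)) *v r)"
      using \<phi> by (intro sum.reindex_bij_witness[of _ "the_inv_into S \<phi>" \<phi>])
        (auto simp: bij_betw_def the_inv_into_f_f f_the_inv_into_f the_inv_into_into)
    moreover have "\<forall>r\<in>S'. cf u (the_inv_into S \<phi> r) - cf v (the_inv_into S \<phi> r) \<in> K"
      using \<phi> cf(1) by (auto intro!: K_diff simp: bij_betw_def the_inv_into_into)
    ultimately have all: "cf u (the_inv_into S \<phi> r) - cf v (the_inv_into S \<phi> r) = 0" if "r \<in> S'" for r
      using independent_overD[OF S', of "\<lambda>r. cf u (the_inv_into S \<phi> r) - cf v (the_inv_into S \<phi> r)" r] z that by simp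
    have "cf u s = cf v s" if "s \<in> S" for s
    proof -
      have "the_inv_into S \<phi> (\<phi> s) = s" "\<phi> s \<in> S'" using \<phi> that by (auto simp: bij_betw_def the_inv_into_f_f)
      then show ?thesis using all by (metis eq_iff_diff_eq_0)
    qed
    then show "u = v" using cf(2)[of u] cf(2)[of v] by (metis (no_types, lifting) sum.cong)
  qed
  then have inv: "invertible (matrix H)"
    using matrix_left_invertible_injective invertible_left_inverse by blast
  show ?thesis
  proof (intro exI[of _ "matrix H"] conjI allI ballI impI)
    show "invertible (matrix H)" by (rule inv)
    show "matrix H *v (\<Sum>s\<in>S. A s *v s) = (\<Sum>s\<in>S. A s *v \<phi> s)" if "\<forall>s\<in>S. A s \<in> K" for A
      using H[OF that] by (simp add: mH)
    show "matrix H ** x = x ** matrix H" if "x \<in> K" for x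
      using Hmult[OF that] by (intro matrix_eqI) (simp add: mult_mv mH)
  qed
qed

lemma basis_map_image:
  assumes "\<And>A. (\<forall>s\<in>S. A s \<in> K) \<Longrightarrow> h *v (\<Sum>s\<in>S. A s *v s) = (\<Sum>s\<in>S. A s *v \<phi> s)"
    and "generates R S M" "generates R S' M'" and \<phi>: "bij_betw \<phi> S S'"
  shows "(*v) h ` M = M'"
proof -
  have M: "M = {\<Sum>s\<in>S. A s *v s | A. \<forall>s\<in>S. A s \<in> R}" and M': "M' = {\<Sum>s\<in>S'. A s *v s | A. \<forall>s\<in>S'. A s \<in> R}"
    using assms(2,3) by (simp_all add: generates_def)
  have re: "(\<Sum>s\<in>S. A s *v \<phi> s) = (\<Sum>r\<in>S'. A (the_inv_into S \<phi> r) *v r)" for A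
    using \<phi> by (intro sum.reindex_bij_witness[of _ "the_inv_into S \<phi>" \<phi>])
      (auto simp: bij_betw_def the_inv_into_f_f f_the_inv_into_f the_inv_into_into)
  have re': "(\<Sum>r\<in>S'. B r *v r) = (\<Sum>s\<in>S. B (\<phi> s) *v \<phi> s)" for B
    using sum.reindex_bij_betw[OF \<phi>, of "\<lambda>r. B r *v r"] by simp
  show ?thesis
  proof (intro Set.set_eqI iffI)
    fix v assume "v \<in> (*v) h ` M"
    then obtain A where A: "\<forall>s\<in>S. A s \<in> R" "v = h *v (\<Sum>s\<in>S. A s *v s)" unfolding M by blast
    have "v = (\<Sum>s\<in>S. A s *v \<phi> s)" unfolding A(2) using A(1) R_sub by (intro assms(1)) auto
    moreover have "\<forall>r\<in>S'. A (the_inv_into S \<phi> r) \<in> R"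
      using A(1) \<phi> by (auto simp: bij_betw_def the_inv_into_into)
    ultimately show "v \<in> M'" unfolding M' re
      by (intro CollectI exI[of _ "\<lambda>r. A (the_inv_into S \<phi> r)"]) simp
  next
    fix v assume "v \<in> M'"
    then obtain B where B: "\<forall>s\<in>S'. B s \<in> R" "v = (\<Sum>s\<in>S'. B s *v s)" unfolding M' by blast
    have in_R: "\<forall>s\<in>S. B (\<phi> s) \<in> R" using B(1) \<phi> by (auto simp: bij_betw_def)
    have "v = h *v (\<Sum>s\<in>S. B (\<phi> s) *v s)"
      unfolding B(2) re' using in_R R_sub by (intro assms(1)[symmetric]) auto
    moreover have "(\<Sum>s\<in>S. B (\<phi> s) *v s) \<in> M" unfolding M using in_R by (intro CollectI exI[of _ "\<lambda>s. B (\<phi> s)"]) simp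
    ultimately show "v \<in> (*v) h ` M" by blast
  qed
qed

lemma spanning_generators:
  assumes "generates R S M" "spanning M"
  shows "\<exists>A. (\<forall>s\<in>S. A s \<in> K) \<and> v = (\<Sum>s\<in>S. A s *v s)"
proof -
  obtain c where c: "c \<noteq> 0" "c *s v \<in> M" using assms(2) by (auto simp: spanning_def)
  then obtain A where A: "\<forall>s\<in>S. A s \<in> R" "c *s v = (\<Sum>s\<in>S. A s *v s)" using assms(1) by (auto simp: generates_def)
  have "v = mat (inverse c) *v (c *s v)" using c(1) by simp
  also have "\<dots> = (\<Sum>s\<in>S. (mat (inverse c) ** A s) *v s)" unfolding A(2) by (simp only: mv_sum mult_mv)
  finally show ?thesis using A(1) R_sub K_mult K_mat by (intro exI[of _ "\<lambda>s. mat (inverse c) ** A s"]) auto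
qed

text \<open>
  Both modules are free over \<open>R\<close> and span the space, so that their bases have the same number of
  elements; matching the bases gives an automorphism that is linear over \<open>K\<close>.
\<close>

lemma transitive_on_full_modules:
  assumes "generates R S0 M" "spanning M" "generates R S0' M'" "spanning M'"
  shows "\<exists>h. invertible h \<and> (*v) h ` M = M' \<and> (\<forall>x\<in>K. h ** x = x ** h)"
proof -
  obtain S where S: "generates R S M" "independent_over S" using independent_generators[OF assms(1)] .
  obtain S' where S': "generates R S' M'" "independent_over S'" using independent_generators[OF assms(3)] .
  have fin: "finite S" "finite S'" using S S' by (auto simp: generates_def)
  have full: "{\<Sum>s\<in>S. A s *v s | A. \<forall>s\<in>S. A s \<in> K} = UNIV" "{\<Sum>s\<in>S'. A s *v s | A. \<forall>s\<in>S'. A s \<in> K} = UNIV"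
    using spanning_generators[OF S(1) assms(2)] spanning_generators[OF S'(1) assms(4)] by blast+
  have "card Bs * card S = card Bs * card S'"
    using basis_dim[OF fin(1) S(2)] basis_dim[OF fin(2) S'(2)] unfolding full by metis
  then have "card S = card S'" using Bs_card_pos by simp
  then obtain \<phi> where \<phi>: "bij_betw \<phi> S S'" using fin finite_same_card_bij by blast
  obtain h where h: "invertible h" "\<And>A. (\<forall>s\<in>S. A s \<in> K) \<Longrightarrow> h *v (\<Sum>s\<in>S. A s *v s) = (\<Sum>s\<in>S. A s *v \<phi> s)"
      "\<forall>x\<in>K. h ** x = x ** h"
    using basis_map[OF fin(1) S(2) spanning_generators[OF S(1) assms(2)] S'(2) \<phi>] by blast
  show ?thesis using h(1,3) basis_map_image[OF h(2) S(1) S'(1) \<phi>] by blast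
qed

lemma lattice_module_closed:
  assumes "\<Lambda> \<in> lattices" "R \<subseteq> stabilizers \<Lambda>"
  shows "module_closed R \<Lambda>"
  using assms by (auto simp: module_closed_def lattice_0 lattice_add stabilizers_def)

text \<open>
  A lattice is generated by finitely many elements over the scalars, hence also over the larger ring.
\<close>

lemma lattice_generates:
  assumes "\<Lambda> \<in> lattices" "R \<subseteq> stabilizers \<Lambda>"
  shows "\<exists>S. generates R S \<Lambda>"
proof -
  obtain g where g: "\<Lambda> = lattice_of g" using assms(1) by (auto simp: lattices_def)
  have "generates R ((\<lambda>i. g *v axis i 1) ` UNIV) \<Lambda>"
  proof (rule generatesI)
    show "module_closed R \<Lambda>" by (rule lattice_module_closed[OF assms])
    show "range (\<lambda>i. g *v axis i 1) \<subseteq> \<Lambda>"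
      unfolding g lattice_of_def by (auto simp: std_lattice_def axis_def)
    fix v assume "v \<in> \<Lambda>"
    then obtain u where u: "u \<in> std_lattice" "v = g *v u" by (auto simp: g lattice_of_def)
    have "v = g *v (\<Sum>i\<in>UNIV. (u $ i) *s axis i 1)" by (simp add: u basis_expansion)
    then have "v = (\<Sum>i\<in>UNIV. mat (u $ i) *v (g *v axis i 1))" by (simp add: mv_sum)
    then show "\<exists>A. (\<forall>i\<in>UNIV. A i \<in> R) \<and> v = (\<Sum>i\<in>UNIV. A i *v (g *v axis i 1))"
      using u(1) R_mat by (intro exI[of _ "\<lambda>i. mat (u $ i)"]) (auto simp: std_lattice_def)
  qed simp
  then show ?thesis by blast
qed

end

lemma lattice_spanning: "\<Lambda> \<in> lattices \<Longrightarrow> spanning \<Lambda>"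
  for \<Lambda> :: "('f::nonarch_local_field^'n) set"
  unfolding spanning_def
proof
  fix v :: "'f^'n"
  assume "\<Lambda> \<in> lattices"
  then obtain g where g: "invertible g" "\<Lambda> = lattice_of g" by (auto simp: lattices_def)
  let ?u = "matrix_inv g *v v" and ?p = "uniformizer :: 'f"
  define B where "B = (\<Sum>i\<in>UNIV. aval (?u $ i)) + 1"
  have B: "0 < B" unfolding B_def by (intro add_nonneg_pos sum_nonneg) auto
  obtain k where k: "aval (?p ^ k) < inverse B" using uniformizer_power_below[of "inverse B"] B by auto
  have "aval (?p ^ k * ?u $ i) \<le> 1" for i
  proof -
    have "aval (?u $ i) \<le> (\<Sum>i\<in>UNIV. aval (?u $ i))" by (rule member_le_sum) auto
    then have "aval (?p ^ k) * aval (?u $ i) \<le> inverse B * B"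
      using k B by (intro mult_mono) (auto simp: B_def)
    then show ?thesis using B by (simp add: aval_mult)
  qed
  then have "?p ^ k *s ?u \<in> std_lattice" by (simp add: std_lattice_def int_ring_def)
  then have "g *v (?p ^ k *s ?u) \<in> \<Lambda>" unfolding g lattice_of_def by blast
  then show "\<exists>c. c \<noteq> 0 \<and> c *s v \<in> \<Lambda>" using g(1) by (intro exI[of _ "?p ^ k"]) simp
qed

lemma mat_eq_iff [simp]: "(mat c :: 'a::comm_ring_1^'n^'n) = mat d \<longleftrightarrow> c = d"
  by (auto simp: vec_eq_iff mat_def)

lemma matrix_inv_mat: "c \<noteq> 0 \<Longrightarrow> matrix_inv (mat c) = (mat (inverse c) :: 'a::field^'n^'n)"
  by (intro matrix_inv_unique) (simp_all flip: mat_mult)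

text \<open>
  The case \<open>K = F\<close> serves for lattices with an idempotent and for constructing lattices.
\<close>

lemma scalar_valuation_order:
  "valuation_order (range mat) (mat ` int_ring) {mat 1 :: 'f::nonarch_local_field^'n^'n}"
proof
  fix x :: "'f^'n^'n" assume x: "x \<in> range mat" "x \<noteq> 0"
  then obtain c where c: "x = mat c" "c \<noteq> 0" by (metis mat_0 rangeE)
  have "invertible x" unfolding invertible_def c(1)
    using c(2) by (intro exI[of _ "mat (inverse c)"]) (simp flip: mat_mult)
  then show "invertible x \<and> matrix_inv x \<in> range mat" using c by (simp add: matrix_inv_mat)
  have "c \<in> int_ring \<or> inverse c \<in> int_ring"
    by (auto simp: int_ring_def aval_inverse inverse_le_1_iff)
  then show "x \<in> mat ` int_ring \<or> matrix_inv x \<in> mat ` int_ring"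
    using c by (auto simp: matrix_inv_mat)
next
  fix c :: "'f^'n^'n \<Rightarrow> 'f" and \<beta> :: "'f^'n^'n" assume "(\<Sum>\<beta>\<in>{mat 1}. mat (c \<beta>) ** \<beta>) = 0" "\<beta> \<in> {mat 1}"
  then have "mat (c (mat 1)) = (mat 0 :: 'f^'n^'n)" by simp
  then show "c \<beta> = 0" using \<open>\<beta> \<in> {mat 1}\<close> unfolding mat_eq_iff by simp
qed (auto simp flip: mat_mult mat_add simp: mult.commute intro: int_ring_intros)

text \<open>
  The polynomial \<open>X\<^sup>2 - t X + n\<close> is integral and \<open>O[X] / (X\<^sup>2 - t X + n)\<close> contains every element of
  integral norm, where \<open>O\<close> is the ring of integers of \<open>F\<close>.
  This forces the quotient of \<open>F[X]\<close> to be a field with that ring as its valuation ring.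
\<close>

definition maximal_quadratic :: "'f::nonarch_local_field \<Rightarrow> 'f \<Rightarrow> bool" where
  "maximal_quadratic t n \<longleftrightarrow> t \<in> int_ring \<and> n \<in> int_ring \<and>
     (\<forall>x y. aval (x ^ 2 + x * y * t + y ^ 2 * n) \<le> 1 \<longrightarrow> x \<in> int_ring \<and> y \<in> int_ring)"

text \<open>
  A nontrivial zero could be divided by arbitrary powers of the uniformizer, against the integrality of
  its coordinates.
\<close>

lemma maximal_quadratic_anisotropic:
  fixes t n :: "'f::nonarch_local_field"
  assumes "maximal_quadratic t n" "x ^ 2 + x * y * t + y ^ 2 * n = 0"
  shows "x = 0 \<and> y = 0"
proof -
  let ?p = "uniformizer :: 'f"
  have int: "x / ?p ^ k \<in> int_ring \<and> y / ?p ^ k \<in> int_ring" for k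
  proof -
    have "(x / ?p ^ k) ^ 2 + (x / ?p ^ k) * (y / ?p ^ k) * t + (y / ?p ^ k) ^ 2 * n = (x ^ 2 + x * y * t + y ^ 2 * n) / (?p ^ k) ^ 2"
      by (simp add: power2_eq_square add_divide_distrib)
    also have "\<dots> = 0" using assms(2) by simp
    finally show ?thesis using assms(1) unfolding maximal_quadratic_def
      by (metis dist_self zero_le_one)
  qed
  have "z = 0" if "\<And>k. z / ?p ^ k \<in> int_ring" for z
  proof (rule ccontr)
    assume "z \<noteq> 0"
    then have "0 < aval z" by simp
    then obtain k where "aval (?p ^ k) < aval z" by (rule uniformizer_power_below)
    moreover have "aval z \<le> aval (?p ^ k)" using that[of k] by (simp add: int_ring_def aval_divide)
    ultimately show False by simp
  qed
  then show ?thesis using int by blast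
qed

lemma quadratic_product:
  fixes b :: "'a::comm_ring_1^'n^'n"
  assumes "b ** b = mat t ** b - mat n"
  shows "(mat x + mat y ** b) ** (mat x' + mat y' ** b) =
    mat (x * x' - y * y' * n) + mat (x * y' + x' * y + y * y' * t) ** b"
proof (intro matrix_eqI)
  fix v
  have bb: "b *v (b *v u) = t *s (b *v u) - n *s u" for u
    using arg_cong[OF assms, of "\<lambda>M. M *v u"] by (simp add: mv_simps)
  show "((mat x + mat y ** b) ** (mat x' + mat y' ** b)) *v v =
    (mat (x * x' - y * y' * n) + mat (x * y' + x' * y + y * y' * t) ** b) *v v"
    by (simp add: mv_simps bb vec_eq_iff algebra_simps)
qed

text \<open>
  The form \<open>x\<^sup>2 + x y t + y\<^sup>2 n\<close> is the norm of \<open>x + y b\<close>. An element or its inverse has norm of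
  absolute value at most 1, which is the valuation property.
\<close>

lemma quadratic_valuation_order:
  fixes b :: "'f::nonarch_local_field^'n^'n"
  assumes mq: "maximal_quadratic t n" and b: "b ** b = mat t ** b - mat n"
  shows "valuation_order {mat x + mat y ** b | x y. True} {mat x + mat y ** b | x y. x \<in> int_ring \<and> y \<in> int_ring} {mat 1, b}"
proof -
  let ?K = "{mat x + mat y ** b | x y. True}" and ?R = "{mat x + mat y ** b | x y. x \<in> int_ring \<and> y \<in> int_ring}"
  note prod = quadratic_product[OF b]
  have tn: "t \<in> int_ring" "n \<in> int_ring" using mq by (auto simp: maximal_quadratic_def)
  have nz: "x ^ 2 + x * y * t + y ^ 2 * n \<noteq> 0" if "x \<noteq> 0 \<or> y \<noteq> 0" for x y
    using maximal_quadratic_anisotropic[OF mq] that by blast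
  have b_ns: "b \<noteq> mat r" for r
  proof
    assume "b = mat r"
    then have "mat (r * r) = (mat (t * r - n) :: 'f^'n^'n)" using b by (simp add: mat_mult mat_diff)
    then have "r * r = t * r - n" by (simp only: mat_eq_iff)
    then have "(- r) ^ 2 + (- r) * 1 * t + 1 ^ 2 * n = 0" by (simp add: power2_eq_square algebra_simps)
    then show False using nz[of "- r" 1] by simp
  qed
  have indep: "x = 0 \<and> y = 0" if "mat x + mat y ** b = 0" for x y
  proof -
    have "y = 0"
    proof (rule ccontr)
      assume y: "y \<noteq> 0"
      have "mat (inverse y) ** (mat x + mat y ** b) = mat (inverse y * x) + b"
        using y by (simp add: matrix_add_ldistrib matrix_mul_assoc flip: mat_mult)
      then have "b = mat (- (inverse y * x))"
        using that by (simp add: eq_neg_iff_add_eq_0 add.commute mat_minus)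
      then show False using b_ns by blast
    qed
    moreover have "x = 0" using that \<open>y = 0\<close> mat_eq_iff[of x 0] by (metis add.right_neutral mat_0 matrix_mul_0(2))
    ultimately show ?thesis by simp
  qed
  have inv: "matrix_inv (mat x + mat y ** b) = mat ((x + y * t) / (x ^ 2 + x * y * t + y ^ 2 * n)) + mat (- y / (x ^ 2 + x * y * t + y ^ 2 * n)) ** b"
    "invertible (mat x + mat y ** b)" if "x \<noteq> 0 \<or> y \<noteq> 0" for x y
  proof -
    let ?N = "x ^ 2 + x * y * t + y ^ 2 * n"
    have N: "?N \<noteq> 0" using nz[OF that] .
    have 1: "(mat x + mat y ** b) ** (mat ((x + y * t) / ?N) + mat (- y / ?N) ** b) = mat 1"
    proof -
      have "x * ((x + y * t) / ?N) - y * (- y / ?N) * n = (x * (x + y * t) + y * y * n) / ?N"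
        unfolding add_divide_distrib[of "x * (x + y * t)"] by (simp only: times_divide_eq_right) simp
      also have "x * (x + y * t) + y * y * n = ?N" by (simp add: power2_eq_square algebra_simps)
      finally have "x * ((x + y * t) / ?N) - y * (- y / ?N) * n = ?N / ?N" .
      moreover have "x * (- y / ?N) + (x + y * t) / ?N * y + y * (- y / ?N) * t = 0"
        by (simp add: add_divide_distrib algebra_simps)
      ultimately show ?thesis unfolding prod using N by simp
    qed
    then have 2: "(mat ((x + y * t) / ?N) + mat (- y / ?N) ** b) ** (mat x + mat y ** b) = mat 1"
      using matrix_left_right_inverse by blast
    show "invertible (mat x + mat y ** b)" using 2 invertible_left by blast
    show "matrix_inv (mat x + mat y ** b) = mat ((x + y * t) / ?N) + mat (- y / ?N) ** b"
      using 1 2 by (rule matrix_inv_unique)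
  qed
  have b1: "b \<noteq> mat 1" using b_ns .
  show ?thesis
  proof
    fix c :: 'f assume "c \<in> int_ring"
    then show "mat c \<in> ?R"
      by (intro CollectI exI[of _ c] exI[of _ 0]) simp
  next
    fix c :: 'f
    show "mat c \<in> ?K" by (intro CollectI exI[of _ c] exI[of _ 0]) simp
  next
    fix u v assume "u \<in> ?R" "v \<in> ?R"
    then obtain x y x' y' where uv: "u = mat x + mat y ** b" "v = mat x' + mat y' ** b" and i: "x \<in> int_ring" "y \<in> int_ring" "x' \<in> int_ring" "y' \<in> int_ring"
      by blast
    show "u + v \<in> ?R"
      using i by (intro CollectI exI[of _ "x + x'"] exI[of _ "y + y'"]) (simp add: uv mat_add matrix_add_rdist int_ring_intros)
    show "u ** v \<in> ?R"
      unfolding uv prod using i tn by (blast intro: int_ring_intros)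
  next
    fix u v assume "u \<in> ?K" "v \<in> ?K"
    then obtain x y x' y' where uv: "u = mat x + mat y ** b" "v = mat x' + mat y' ** b" by blast
    show "u + v \<in> ?K"
      by (intro CollectI exI[of _ "x + x'"] exI[of _ "y + y'"]) (simp add: uv mat_add matrix_add_rdist)
    show "u ** v \<in> ?K" unfolding uv prod by blast
    show "u ** v = v ** u" unfolding uv prod by (simp add: algebra_simps)
  next
    fix u assume u: "u \<in> ?K" "u \<noteq> 0"
    then obtain x y where xy: "u = mat x + mat y ** b" "x \<noteq> 0 \<or> y \<noteq> 0" by fastforce
    let ?N = "x ^ 2 + x * y * t + y ^ 2 * n"
    show "invertible u \<and> matrix_inv u \<in> ?K"
      unfolding xy(1) using inv[OF xy(2)] by auto
    show "u \<in> ?R \<or> matrix_inv u \<in> ?R"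
    proof (cases "aval ?N \<le> 1")
      case True
      then show ?thesis using mq xy(1) unfolding maximal_quadratic_def by blast
    next
      case False
      have N: "?N \<noteq> 0" using nz[OF xy(2)] .
      have scaled: "(u / m) ^ 2 + (u / m) * (v / m) * t + (v / m) ^ 2 * n = (u ^ 2 + u * v * t + v ^ 2 * n) / m ^ 2" for u v m
        by (simp add: power2_eq_square add_divide_distrib)
      have "((x + y * t) / ?N) ^ 2 + ((x + y * t) / ?N) * (- y / ?N) * t + (- y / ?N) ^ 2 * n
          = ((x + y * t) ^ 2 + (x + y * t) * (- y) * t + (- y) ^ 2 * n) / ?N ^ 2"
        by (rule scaled)
      also have "(x + y * t) ^ 2 + (x + y * t) * (- y) * t + (- y) ^ 2 * n = ?N"
        by (simp add: power2_eq_square algebra_simps)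
      also have "?N / ?N ^ 2 = inverse ?N" using N by (simp add: power2_eq_square divide_inverse)
      finally have "aval (((x + y * t) / ?N) ^ 2 + ((x + y * t) / ?N) * (- y / ?N) * t + (- y / ?N) ^ 2 * n) \<le> 1"
        using False by (simp add: aval_inverse inverse_le_1_iff)
      then have "(x + y * t) / ?N \<in> int_ring \<and> - y / ?N \<in> int_ring"
        using mq unfolding maximal_quadratic_def by blast
      then show ?thesis unfolding xy(1) inv(1)[OF xy(2)] by blast
    qed
  next
    show "{mat 1, b} \<subseteq> ?K"
    proof -
      have "mat 1 = mat 1 + mat 0 ** b" "b = mat 0 + mat 1 ** b" by simp_all
      then show ?thesis by blast
    qed
  next
    fix u assume "u \<in> ?K"
    then obtain x y where "u = mat x + mat y ** b" by blast
    then show "\<exists>c. u = (\<Sum>\<beta>\<in>{mat 1, b}. mat (c \<beta>) ** \<beta>)"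
      using b1 by (intro exI[of _ "\<lambda>\<beta>. if \<beta> = b then y else x"]) (auto simp: eq_commute[of "mat 1" b])
  next
    fix c :: "'f^'n^'n \<Rightarrow> 'f" and \<beta> :: "'f^'n^'n"
    assume "(\<Sum>\<beta>\<in>{mat 1, b}. mat (c \<beta>) ** \<beta>) = 0" and "\<beta> \<in> {mat 1, b}"
    moreover have "(\<Sum>\<beta>\<in>{mat 1, b}. mat (c \<beta>) ** \<beta>) = mat (c (mat 1)) + mat (c b) ** b"
      using b1 by (auto simp: eq_commute[of "mat 1" b])
    ultimately show "c \<beta> = 0" using indep by auto
  qed auto
qed

lemma transitive_quadratic:
  fixes b :: "'f::nonarch_local_field^'n^'n"
  assumes "maximal_quadratic t n" "b ** b = mat t ** b - mat n"
    and "\<Lambda> \<in> lattices" "b \<in> stabilizers \<Lambda>" "\<Lambda>' \<in> lattices" "b \<in> stabilizers \<Lambda>'"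
  obtains h where "invertible h" "h ** b = b ** h" "(*v) h ` \<Lambda> = \<Lambda>'"
proof -
  interpret valuation_order "{mat x + mat y ** b | x y. True}"
    "{mat x + mat y ** b | x y. x \<in> int_ring \<and> y \<in> int_ring}" "{mat 1, b}"
    by (rule quadratic_valuation_order[OF assms(1,2)])
  have sub: "{mat x + mat y ** b | x y. x \<in> int_ring \<and> y \<in> int_ring} \<subseteq> stabilizers \<Lambda>"
    if "\<Lambda> \<in> lattices" "b \<in> stabilizers \<Lambda>" for \<Lambda>
    using that by (auto intro!: stabilizers_intros)
  obtain S where S: "generates {mat x + mat y ** b | x y. x \<in> int_ring \<and> y \<in> int_ring} S \<Lambda>"
    using lattice_generates[OF assms(3) sub[OF assms(3,4)]] by blast
  obtain S' where S': "generates {mat x + mat y ** b | x y. x \<in> int_ring \<and> y \<in> int_ring} S' \<Lambda>'"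
    using lattice_generates[OF assms(5) sub[OF assms(5,6)]] by blast
  obtain h where h: "invertible h" "(*v) h ` \<Lambda> = \<Lambda>'" "\<And>x. x \<in> {mat x + mat y ** b | x y. True} \<Longrightarrow> h ** x = x ** h"
    using transitive_on_full_modules[OF S lattice_spanning[OF assms(3)] S' lattice_spanning[OF assms(5)]] by blast
  have "b \<in> {mat x + mat y ** b | x y. True}" by (intro CollectI exI[of _ 0] exI[of _ 1]) simp
  then show ?thesis using that h by blast
qed

interpretation scalar: valuation_order "range mat" "mat ` int_ring" "{mat 1 :: 'f::nonarch_local_field^'n^'n}"
  by (rule scalar_valuation_order)

text \<open>
  A finitely generated spanning module is free of full rank, like the standard lattice, and therefore the
  image of the latter under an invertible matrix.
\<close>

lemma generated_spanning_lattice: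
  fixes M :: "('f::nonarch_local_field^'n) set"
  assumes "generates (mat ` int_ring) S M" "spanning M"
  shows "M \<in> lattices"
proof -
  have std: "lattice_of (mat 1) \<in> (lattices :: ('f^'n) set set)"
    unfolding lattices_def using invertible_mat_1 by blast
  have "mat ` int_ring \<subseteq> stabilizers (lattice_of (mat 1 :: 'f^'n^'n))"
    using stabilizers_mat[OF std] by auto
  then obtain S' where S': "generates (mat ` int_ring) S' (lattice_of (mat 1 :: 'f^'n^'n))"
    using scalar.lattice_generates[OF std] by blast
  obtain h :: "'f^'n^'n" where h: "invertible h" "(*v) h ` lattice_of (mat 1) = M"
    using scalar.transitive_on_full_modules[OF S' lattice_spanning[OF std] assms] by blast
  then show ?thesis using lattice_image[OF h(1) std] by simp
qed

text \<open>
  A lattice stable under an idempotent is the sum of its two components, which are free; the ranks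
  are the dimensions of the image and the kernel of the idempotent.
\<close>

lemma idempotent_component_generates:
  fixes p :: "'f::nonarch_local_field^'n^'n"
  assumes "\<Lambda> \<in> lattices" "p \<in> stabilizers \<Lambda>" "p ** p = p"
  obtains S where "generates (mat ` int_ring) S ((*v) p ` \<Lambda>)" "scalar.independent_over S"
    "card S = vec.dim (range ((*v) p))"
    "\<And>s. s \<in> S \<Longrightarrow> p *v s = s"
proof -
  have sub: "mat ` int_ring \<subseteq> stabilizers \<Lambda>" using stabilizers_mat[OF assms(1)] by auto
  obtain S0 where S0: "generates (mat ` int_ring) S0 \<Lambda>" using scalar.lattice_generates[OF assms(1) sub] by blast
  then have fin0: "finite S0" and L: "\<Lambda> = {\<Sum>s\<in>S0. A s *v s | A. \<forall>s\<in>S0. A s \<in> mat ` int_ring}"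
    by (simp_all add: generates_def)
  have comm: "p *v (A *v v) = A *v (p *v v)" if "A \<in> range mat" for A v using that by auto
  have S0L: "S0 \<subseteq> \<Lambda>"
  proof
    fix s assume s: "s \<in> S0"
    have "s = (\<Sum>r\<in>S0. (if r = s then mat 1 else mat 0) *v r)"
      using s fin0 by (simp add: if_distrib[of "\<lambda>A. A *v _"] cong: if_cong del: mat_mv)
    moreover have "\<forall>r\<in>S0. (if r = s then mat 1 else mat 0 :: 'f^'n^'n) \<in> mat ` int_ring"
      by (simp add: scalar.R_0 scalar.R_1)
    ultimately show "s \<in> \<Lambda>" unfolding L by (intro CollectI exI[of _ "\<lambda>r. if r = s then mat 1 else mat 0"] conjI)
  qed
  have "generates (mat ` int_ring) ((*v) p ` S0) ((*v) p ` \<Lambda>)"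
  proof (rule scalar.generatesI[OF fin0])
    have "module_closed (mat ` int_ring) \<Lambda>" using scalar.lattice_module_closed[OF assms(1) sub] .
    then show "module_closed (mat ` int_ring) ((*v) p ` \<Lambda>)"
      unfolding module_closed_def
      by (auto simp: image_iff comm[symmetric] intro: bexI[of _ 0])
         (metis matrix_vector_right_distrib, metis mat_mv mv_scale)
    show "(*v) p ` S0 \<subseteq> (*v) p ` \<Lambda>" using S0L by blast
    fix v assume "v \<in> (*v) p ` \<Lambda>"
    then obtain A where A: "\<forall>s\<in>S0. A s \<in> mat ` int_ring" "v = p *v (\<Sum>s\<in>S0. A s *v s)" unfolding L by blast
    have "v = (\<Sum>s\<in>S0. A s *v (p *v s))"
      unfolding A(2) mv_sum using A(1) by (intro sum.cong refl comm) auto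
    then show "\<exists>A. (\<forall>i\<in>S0. A i \<in> mat ` int_ring) \<and> v = (\<Sum>i\<in>S0. A i *v (p *v i))" using A(1) by blast
  qed
  then obtain S where S: "generates (mat ` int_ring) S ((*v) p ` \<Lambda>)" "scalar.independent_over S"
    by (rule scalar.independent_generators)
  have fin: "finite S" and pL: "(*v) p ` \<Lambda> = {\<Sum>s\<in>S. A s *v s | A. \<forall>s\<in>S. A s \<in> mat ` int_ring}"
    using S(1) by (simp_all add: generates_def)
  have Sfix: "p *v s = s" if s: "s \<in> S" for s
  proof -
    have "s = (\<Sum>r\<in>S. (if r = s then mat 1 else mat 0) *v r)"
      using s fin by (simp add: if_distrib[of "\<lambda>A. A *v _"] cong: if_cong del: mat_mv)
    moreover have "\<forall>r\<in>S. (if r = s then mat 1 else mat 0 :: 'f^'n^'n) \<in> mat ` int_ring"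
      by (simp add: scalar.R_0 scalar.R_1)
    ultimately have "s \<in> (*v) p ` \<Lambda>" unfolding pL
      by (intro CollectI exI[of _ "\<lambda>r. if r = s then mat 1 else mat 0"] conjI)
    then show ?thesis using assms(3) by (auto simp: matrix_vector_mul_assoc)
  qed
  have "{\<Sum>s\<in>S. A s *v s | A. \<forall>s\<in>S. A s \<in> range mat} = range ((*v) p)"
  proof (intro Set.set_eqI iffI)
    fix v assume "v \<in> {\<Sum>s\<in>S. A s *v s | A. \<forall>s\<in>S. A s \<in> range mat}"
    then obtain A where A: "\<forall>s\<in>S. A s \<in> range mat" "v = (\<Sum>s\<in>S. A s *v s)" by blast
    have "p *v v = v" unfolding A(2) mv_sum using A(1) Sfix comm by (intro sum.cong refl) metis
    then show "v \<in> range ((*v) p)" by (metis rangeI)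
  next
    fix v assume "v \<in> range ((*v) p)"
    then obtain u where u: "v = p *v u" by blast
    obtain c where c: "c \<noteq> 0" "c *s u \<in> \<Lambda>" using lattice_spanning[OF assms(1)] by (auto simp: spanning_def)
    then have "c *s v \<in> (*v) p ` \<Lambda>" unfolding u by (metis image_eqI mv_scale)
    then obtain A where A: "\<forall>s\<in>S. A s \<in> mat ` int_ring" "c *s v = (\<Sum>s\<in>S. A s *v s)" unfolding pL by blast
    have "v = mat (inverse c) *v (c *s v)" using c(1) by simp
    also have "\<dots> = (\<Sum>s\<in>S. (mat (inverse c) ** A s) *v s)" unfolding A(2) by (simp only: mv_sum mult_mv)
    finally show "v \<in> {\<Sum>s\<in>S. A s *v s | A. \<forall>s\<in>S. A s \<in> range mat}"
      using A(1) by (intro CollectI exI[of _ "\<lambda>s. mat (inverse c) ** A s"]) (auto simp flip: mat_mult)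
  qed
  then have "card S = vec.dim (range ((*v) p))" using scalar.basis_dim[OF fin S(2)] by simp
  then show ?thesis using that S Sfix by blast
qed

text \<open>
  Bases adapted to the decomposition by \<open>p\<close> are matched component by component, so that the resulting
  automorphism commutes with \<open>p\<close>.
\<close>

lemma transitive_idempotent:
  fixes p :: "'f::nonarch_local_field^'n^'n"
  assumes p: "p ** p = p"
    and L: "\<Lambda> \<in> lattices" "p \<in> stabilizers \<Lambda>" "\<Lambda>' \<in> lattices" "p \<in> stabilizers \<Lambda>'"
  obtains h where "invertible h" "h ** p = p ** h" "(*v) h ` \<Lambda> = \<Lambda>'"
proof -
  define q where "q = mat 1 - p"
  have q: "q ** q = q" "p ** q = 0" "q ** p = 0"
    using p by (simp_all add: q_def matrix_sub_ldistrib matrix_sub_rdistrib)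
  have decomp: "v = p *v v + q *v v" for v by (simp add: q_def mv_simps)
  have qst: "q \<in> stabilizers \<Lambda>" "q \<in> stabilizers \<Lambda>'"
    unfolding q_def using L by (auto intro: stabilizers_intros)
  have basis: "\<exists>Sp Sq. finite Sp \<and> finite Sq \<and> Sp \<inter> Sq = {} \<and> generates (mat ` int_ring) (Sp \<union> Sq) \<Lambda> \<and>
      scalar.independent_over (Sp \<union> Sq) \<and> card Sp = vec.dim (range ((*v) p)) \<and> card Sq = vec.dim (range ((*v) q)) \<and>
      (\<forall>s\<in>Sp. p *v s = s) \<and> (\<forall>s\<in>Sq. p *v s = 0)"
    if L: "\<Lambda> \<in> lattices" "p \<in> stabilizers \<Lambda>" "q \<in> stabilizers \<Lambda>" for \<Lambda>
  proof -
    obtain Sp where Sp: "generates (mat ` int_ring) Sp ((*v) p ` \<Lambda>)" "scalar.independent_over Sp"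
        "card Sp = vec.dim (range ((*v) p))" "\<And>s. s \<in> Sp \<Longrightarrow> p *v s = s"
      using idempotent_component_generates[OF L(1,2) p] by blast
    obtain Sq where Sq: "generates (mat ` int_ring) Sq ((*v) q ` \<Lambda>)" "scalar.independent_over Sq"
        "card Sq = vec.dim (range ((*v) q))" "\<And>s. s \<in> Sq \<Longrightarrow> q *v s = s"
      using idempotent_component_generates[OF L(1,3) q(1)] by blast
    have fin: "finite Sp" "finite Sq" using Sp Sq by (auto simp: generates_def)
    have kill: "p *v s = 0" if "s \<in> Sq" for s
      using Sq(4)[OF that] q(2) by (metis matrix_vector_mul_assoc matrix_vector_mult_0)
    have disj: "Sp \<inter> Sq = {}"
    proof (rule ccontr)
      assume "Sp \<inter> Sq \<noteq> {}"
      then obtain s where s: "s \<in> Sp" "s \<in> Sq" by blast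
      then have s0: "s = 0" using Sp(4) kill by metis
      have "(\<Sum>r\<in>Sp. (if r = s then mat 1 else mat 0) *v r) = 0"
        by (intro sum.neutral) (auto simp: s0)
      moreover have "(if r = s then mat 1 else mat 0 :: 'f^'n^'n) \<in> range mat" for r :: "'f^'n" by (simp add: scalar.K_0)
      ultimately have "(if s = s then mat 1 else mat 0) = (0 :: 'f^'n^'n)"
        using scalar.independent_overD[OF Sp(2), of "\<lambda>r. if r = s then mat 1 else mat 0" s] s(1) by blast
      then have "mat 1 = (mat 0 :: 'f^'n^'n)" by simp
      then show False by (simp only: mat_eq_iff) simp
    qed
    have ind: "scalar.independent_over (Sp \<union> Sq)"
      unfolding scalar.independent_over_def
    proof safe
      fix A s assume A: "\<forall>s\<in>Sp \<union> Sq. A s \<in> range mat" "(\<Sum>s\<in>Sp \<union> Sq. A s *v s) = 0"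
      have split: "(\<Sum>s\<in>Sp. A s *v s) + (\<Sum>s\<in>Sq. A s *v s) = 0"
        using A(2) fin disj by (simp add: sum.union_disjoint)
      have c: "p *v (A s *v s) = A s *v (p *v s)" if "s \<in> Sp \<union> Sq" for s
        using A(1) that by (metis mat_mv mv_scale rangeE)
      have "p *v (\<Sum>s\<in>Sp. A s *v s) = (\<Sum>s\<in>Sp. A s *v s)"
        unfolding mv_sum using c Sp(4) by (intro sum.cong refl) auto
      moreover have "p *v (\<Sum>s\<in>Sq. A s *v s) = 0"
        unfolding mv_sum using c kill by (intro sum.neutral) auto
      ultimately have z: "(\<Sum>s\<in>Sp. A s *v s) = 0"
        using arg_cong[OF split, of "\<lambda>v. p *v v"] by (simp add: matrix_vector_right_distrib)
      then have z': "(\<Sum>s\<in>Sq. A s *v s) = 0" using split by simp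
      show "A s = 0" if "s \<in> Sp" using z A(1) that by (intro scalar.independent_overD[OF Sp(2)]) auto
      show "A s = 0" if "s \<in> Sq" using z' A(1) that by (intro scalar.independent_overD[OF Sq(2)]) auto
    qed
    have gen: "generates (mat ` int_ring) (Sp \<union> Sq) \<Lambda>"
      unfolding generates_def
    proof (intro conjI Set.set_eqI iffI)
      fix v assume v: "v \<in> \<Lambda>"
      then obtain A where A: "\<forall>s\<in>Sp. A s \<in> mat ` int_ring" "p *v v = (\<Sum>s\<in>Sp. A s *v s)"
        using Sp(1) unfolding generates_def by blast
      obtain B where B: "\<forall>s\<in>Sq. B s \<in> mat ` int_ring" "q *v v = (\<Sum>s\<in>Sq. B s *v s)"
        using v Sq(1) unfolding generates_def by blast
      define C where "C s = (if s \<in> Sp then A s else B s)" for s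
      have "(\<Sum>s\<in>Sp \<union> Sq. C s *v s) = (\<Sum>s\<in>Sp. C s *v s) + (\<Sum>s\<in>Sq. C s *v s)"
        using fin disj by (simp add: sum.union_disjoint)
      also have "(\<Sum>s\<in>Sp. C s *v s) = p *v v" unfolding A(2) by (intro sum.cong refl) (simp add: C_def)
      also have "(\<Sum>s\<in>Sq. C s *v s) = q *v v" unfolding B(2) using disj by (intro sum.cong refl) (auto simp: C_def)
      finally have "v = (\<Sum>s\<in>Sp \<union> Sq. C s *v s)" using decomp[of v] by simp
      moreover have "\<forall>s\<in>Sp \<union> Sq. C s \<in> mat ` int_ring" using A(1) B(1) by (auto simp: C_def)
      ultimately show "v \<in> {\<Sum>s\<in>Sp \<union> Sq. A s *v s |A. \<forall>s\<in>Sp \<union> Sq. A s \<in> mat ` int_ring}" by blast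
    next
      fix v assume "v \<in> {\<Sum>s\<in>Sp \<union> Sq. A s *v s |A. \<forall>s\<in>Sp \<union> Sq. A s \<in> mat ` int_ring}"
      then obtain A where A: "\<forall>s\<in>Sp \<union> Sq. A s \<in> mat ` int_ring" "v = (\<Sum>s\<in>Sp. A s *v s) + (\<Sum>s\<in>Sq. A s *v s)"
        using fin disj by (auto simp: sum.union_disjoint)
      have "(\<Sum>s\<in>Sp. A s *v s) \<in> (*v) p ` \<Lambda>" "(\<Sum>s\<in>Sq. A s *v s) \<in> (*v) q ` \<Lambda>"
        using A(1) Sp(1) Sq(1) unfolding generates_def by auto
      then have "(\<Sum>s\<in>Sp. A s *v s) \<in> \<Lambda>" "(\<Sum>s\<in>Sq. A s *v s) \<in> \<Lambda>" using L(2,3) by (auto simp: stabilizers_def)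
      then show "v \<in> \<Lambda>" unfolding A(2) by (rule lattice_add[OF L(1)])
    qed (use fin in simp)
    show ?thesis using fin disj gen ind Sp(3,4) Sq(3) kill by blast
  qed
  obtain Sp Sq where S: "finite Sp" "finite Sq" "Sp \<inter> Sq = {}" "generates (mat ` int_ring) (Sp \<union> Sq) \<Lambda>"
      "scalar.independent_over (Sp \<union> Sq)" "card Sp = vec.dim (range ((*v) p))" "card Sq = vec.dim (range ((*v) q))"
      "\<forall>s\<in>Sp. p *v s = s" "\<forall>s\<in>Sq. p *v s = 0"
    using basis[OF L(1,2) qst(1)] by blast
  obtain Sp' Sq' where S': "finite Sp'" "finite Sq'" "Sp' \<inter> Sq' = {}" "generates (mat ` int_ring) (Sp' \<union> Sq') \<Lambda>'"
      "scalar.independent_over (Sp' \<union> Sq')" "card Sp' = vec.dim (range ((*v) p))" "card Sq' = vec.dim (range ((*v) q))"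
      "\<forall>s\<in>Sp'. p *v s = s" "\<forall>s\<in>Sq'. p *v s = 0"
    using basis[OF L(3,4) qst(2)] by blast
  obtain f where f: "bij_betw f Sp Sp'" using finite_same_card_bij[of Sp Sp'] S S' by metis
  obtain g where g: "bij_betw g Sq Sq'" using finite_same_card_bij[of Sq Sq'] S S' by metis
  define \<phi> where "\<phi> s = (if s \<in> Sp then f s else g s)" for s
  have "bij_betw \<phi> Sp Sp'" using f by (simp add: \<phi>_def cong: bij_betw_cong)
  moreover have "bij_betw \<phi> Sq Sq'"
  proof -
    have "\<phi> s = g s" if "s \<in> Sq" for s using that S(3) by (auto simp: \<phi>_def)
    then show ?thesis using g by (simp cong: bij_betw_cong)
  qed
  ultimately have \<phi>: "bij_betw \<phi> (Sp \<union> Sq) (Sp' \<union> Sq')" using S'(3) by (intro bij_betw_combine)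
  have fin: "finite (Sp \<union> Sq)" using S by simp
  have span: "\<exists>A. (\<forall>s\<in>Sp \<union> Sq. A s \<in> range mat) \<and> v = (\<Sum>s\<in>Sp \<union> Sq. A s *v s)" for v
    using scalar.spanning_generators[OF S(4) lattice_spanning[OF L(1)]] .
  obtain h where h: "invertible h" "\<And>A. (\<forall>s\<in>Sp \<union> Sq. A s \<in> range mat) \<Longrightarrow> h *v (\<Sum>s\<in>Sp \<union> Sq. A s *v s) = (\<Sum>s\<in>Sp \<union> Sq. A s *v \<phi> s)"
    using scalar.basis_map[OF fin S(5) span S'(5) \<phi>] by blast
  have comm: "p *v (A *v v) = A *v (p *v v)" if "A \<in> range mat" for A v using that by auto
  have "h ** p = p ** h"
  proof (intro matrix_eqI)
    fix v
    obtain A where A: "\<forall>s\<in>Sp \<union> Sq. A s \<in> range mat" "v = (\<Sum>s\<in>Sp \<union> Sq. A s *v s)" using span by blast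
    define B where "B s = (if s \<in> Sp then A s else mat 0)" for s
    have "p *v v = (\<Sum>s\<in>Sp \<union> Sq. B s *v s)"
      unfolding A(2) mv_sum
    proof (intro sum.cong refl)
      fix s assume s: "s \<in> Sp \<union> Sq"
      then have "p *v (A s *v s) = A s *v (p *v s)" using A(1) by (intro comm) blast
      also have "\<dots> = B s *v s" using s S(3,8,9) by (auto simp: B_def)
      finally show "p *v (A s *v s) = B s *v s" .
    qed
    moreover have "\<forall>s\<in>Sp \<union> Sq. B s \<in> range mat" using A(1) by (simp add: B_def scalar.K_0)
    ultimately have "h *v (p *v v) = (\<Sum>s\<in>Sp \<union> Sq. B s *v \<phi> s)" using h(2)[of B] by simp
    also have "\<dots> = (\<Sum>s\<in>Sp \<union> Sq. p *v (A s *v \<phi> s))"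
    proof (intro sum.cong refl)
      fix s assume s: "s \<in> Sp \<union> Sq"
      have "p *v \<phi> s = (if s \<in> Sp then \<phi> s else 0)"
        using s S(3) S'(8,9) f g unfolding \<phi>_def bij_betw_def by auto
      moreover have "p *v (A s *v \<phi> s) = A s *v (p *v \<phi> s)" using A(1) s by (intro comm) blast
      ultimately show "B s *v \<phi> s = p *v (A s *v \<phi> s)" by (auto simp: B_def)
    qed
    also have "\<dots> = p *v (\<Sum>s\<in>Sp \<union> Sq. A s *v \<phi> s)" by (simp only: mv_sum)
    also have "\<dots> = p *v (h *v v)" unfolding A(2) using h(2)[OF A(1)] by simp
    finally show "(h ** p) *v v = (p ** h) *v v" by (simp add: mult_mv)
  qed
  then show ?thesis using that[OF h(1) _ scalar.basis_map_image[OF h(2) S(4) S'(4) \<phi>]] by blast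
qed

section \<open>Quadratic polynomials over a local field\<close>

text \<open>
  The case of matrices of size 1.
\<close>

lemma hensel_scalar:
  fixes A B :: "'f::nonarch_local_field"
  assumes "A \<in> int_ring" "B \<in> int_ring"
  shows "\<exists>y\<in>int_ring. y = A + uniformizer * (B * y ^ 2)"
proof -
  let ?C = "mat_over int_ring :: ('f^1^1) set"
  have comm: "x ** y = y ** x" for x y :: "'f^1^1"
    by (simp add: vec_eq_iff matrix_matrix_mult_def mult.commute)
  have "\<exists>y\<in>?C. y = mat A + mat uniformizer ** (mat B ** (y ** y))"
    by (rule hensel_quadratic)
       (use assms comm in \<open>auto intro: compact_mat_over_int mat_over_int_add mat_over_int_mult mat_over_int_mat\<close>)
  then obtain y where y: "y \<in> ?C" "y = mat A + mat uniformizer ** (mat B ** (y ** y))" by blast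
  have "y $ 1 $ 1 = A + uniformizer * (B * (y $ 1 $ 1) ^ 2)"
    by (subst y(2)) (simp add: mat_entry mat_def matrix_matrix_mult_def power2_eq_square)
  then show ?thesis using y(1) by (intro bexI[of _ "y $ 1 $ 1"]) (auto simp: mat_over_def)
qed

text \<open>
  A root \<open>r + \<pi> y\<close> of the polynomial, with \<open>\<pi>\<close> the uniformizer, is a solution \<open>y\<close> of an equation of the form
  treated above.
\<close>

lemma hensel_root:
  fixes r t n :: "'f::nonarch_local_field"
  assumes "r \<in> int_ring" "aval (r ^ 2 - t * r + n) < 1" "aval (2 * r - t) = 1"
  shows "\<exists>s. s ^ 2 - t * s + n = 0"
proof -
  obtain e where e: "e \<in> int_ring" "r ^ 2 - t * r + n = uniformizer * e" using divide_uniformizer[OF assms(2)] .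
  let ?u = "2 * r - t"
  have u: "?u \<noteq> 0" "inverse ?u \<in> int_ring" using assms(3) by (auto simp: int_ring_def aval_inverse)
  obtain y where y: "y = - (inverse ?u * e) + uniformizer * (- inverse ?u * y ^ 2)"
    using hensel_scalar[of "- (inverse ?u * e)" "- inverse ?u"] u e by (auto intro: int_ring_intros)
  have "?u * y = ?u * (- (inverse ?u * e) + uniformizer * (- inverse ?u * y ^ 2))" using y by simp
  also have "\<dots> = - e - uniformizer * y ^ 2"
  proof -
    have "w * (- (v * e) + uniformizer * (- v * y ^ 2)) = - (w * v) * e - uniformizer * (w * v) * y ^ 2" for w v :: 'f
      by (simp add: algebra_simps)
    then show ?thesis using u(1) by simp
  qed
  finally have uy: "?u * y = - e - uniformizer * y ^ 2" .
  have "(r + uniformizer * y) ^ 2 - t * (r + uniformizer * y) + n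
      = (r ^ 2 - t * r + n) + uniformizer * (?u * y) + uniformizer ^ 2 * y ^ 2"
    by (simp add: power2_eq_square algebra_simps)
  also have "\<dots> = 0" unfolding e(2) uy by (simp add: power2_eq_square algebra_simps)
  finally show ?thesis by blast
qed

definition no_root :: "'f::field \<Rightarrow> 'f \<Rightarrow> bool" where
  "no_root t n \<longleftrightarrow> (\<forall>r. r ^ 2 - t * r + n \<noteq> 0)"

text \<open>
  An irreducible polynomial with integral constant term is integral: otherwise, after rescaling
  the variable, it has the simple root 1 modulo the uniformizer.
\<close>

lemma trace_bound:
  fixes t n :: "'f::nonarch_local_field"
  assumes "no_root t n" "aval (x ^ 2 + x * y * t + y ^ 2 * n) \<le> 1"
  shows "aval (2 * x + y * t) \<le> 1"
proof (rule ccontr)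
  let ?T = "2 * x + y * t" and ?N = "x ^ 2 + x * y * t + y ^ 2 * n"
  assume "\<not> aval ?T \<le> 1"
  then have T: "1 < aval ?T" by simp
  then have T0: "?T \<noteq> 0" by auto
  have y: "y \<noteq> 0"
  proof
    assume y0: "y = 0"
    then have "aval x ^ 2 \<le> 1" using assms(2) by (simp add: aval_power)
    then have "aval x \<le> 1" by (simp add: power_le_one_iff)
    then have "aval (2 * x) \<le> 1" using int_ring_mult[OF int_ring_numeral] by (auto simp: int_ring_def)
    then show False using T y0 by simp
  qed
  have "aval (?N / ?T ^ 2) < 1"
  proof -
    have "1 < aval ?T ^ 2" using T by (simp add: one_less_power)
    then have "aval ?N < aval ?T ^ 2" using assms(2) by linarith
    moreover have "0 < aval ?T ^ 2" using T by (intro zero_less_power) linarith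
    ultimately show ?thesis by (simp add: aval_divide aval_power)
  qed
  \<comment> \<open>The polynomial of \<open>(x + y g) / T\<close>, where \<open>g\<close> is a root; it has trace 1 and small norm, so 1 is a simple root modulo the uniformizer.\<close>
  then have "\<exists>s. s ^ 2 - 1 * s + ?N / ?T ^ 2 = 0" by (intro hensel_root[of 1]) simp_all
  then obtain s where s: "s ^ 2 - s + ?N / ?T ^ 2 = 0" by auto
  have "T ^ 2 * (s ^ 2 - s + N / T ^ 2) = (s * T) ^ 2 - T * (s * T) + N" if "T \<noteq> 0" for T N :: 'f
    using that by (simp add: distrib_left) (simp add: power2_eq_square algebra_simps)
  then have "?T ^ 2 * (s ^ 2 - s + ?N / ?T ^ 2) = (s * ?T) ^ 2 - ?T * (s * ?T) + ?N"
    using T0 by blast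
  then have r: "(s * ?T) ^ 2 - ?T * (s * ?T) + ?N = 0" using s by simp
  let ?r = "(s * ?T - x) / y"
  have "y ^ 2 * (?r ^ 2 - t * ?r + n) = (y * ?r) ^ 2 - t * y * (y * ?r) + y ^ 2 * n"
    by (simp add: power2_eq_square algebra_simps)
  also have "y * ?r = s * ?T - x" using y by simp
  also have "(s * ?T - x) ^ 2 - t * y * (s * ?T - x) + y ^ 2 * n = (s * ?T) ^ 2 - ?T * (s * ?T) + ?N"
    by (simp only: power2_eq_square) (simp add: algebra_simps)
  finally have "y ^ 2 * (?r ^ 2 - t * ?r + n) = 0" using r by simp
  then have "?r ^ 2 - t * ?r + n = 0" using y by (simp only: mult_eq_0_iff power_eq_0_iff) simp
  then show False using assms(1) unfolding no_root_def by blast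
qed

text \<open>
  For an element \<open>z = x + y g\<close> of integral norm, with \<open>g\<close> a root, the traces of \<open>z\<close> and \<open>z g\<close> are
  integral by the preceding lemma. They determine \<open>x\<close> and \<open>y\<close> through linear equations whose determinant is
  the discriminant.
\<close>

lemma maximal_quadratic_unit_disc:
  fixes t n :: "'f::nonarch_local_field"
  assumes nr: "no_root t n" and int: "t \<in> int_ring" "n \<in> int_ring" and d: "aval (t ^ 2 - 4 * n) = 1"
  shows "maximal_quadratic t n"
  unfolding maximal_quadratic_def
proof (intro conjI allI impI int)
  fix x y assume N: "aval (x ^ 2 + x * y * t + y ^ 2 * n) \<le> 1"
  let ?A = "2 * x + y * t" and ?B = "2 * (- (y * n)) + (x + y * t) * t" and ?d = "t ^ 2 - 4 * n"
  have A: "?A \<in> int_ring" using trace_bound[OF nr N] by (simp add: int_ring_def)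
  have "(- (y * n)) ^ 2 + (- (y * n)) * (x + y * t) * t + (x + y * t) ^ 2 * n = (x ^ 2 + x * y * t + y ^ 2 * n) * n"
    by (simp add: power2_eq_square algebra_simps)
  then have "aval ((- (y * n)) ^ 2 + (- (y * n)) * (x + y * t) * t + (x + y * t) ^ 2 * n) \<le> 1"
    using N int(2) by (simp add: aval_mult int_ring_def mult_le_one)
  then have B: "?B \<in> int_ring" unfolding int_ring_iff by (rule trace_bound[OF nr])
  have "- (?A * t - 2 * ?B) = y * ?d" "?A * (t ^ 2 - 2 * n) - t * ?B = x * ?d"
    by (simp_all add: power2_eq_square algebra_simps)
  moreover have "- (u * t - 2 * v) \<in> int_ring" "u * (t ^ 2 - 2 * n) - t * v \<in> int_ring"
    if "u \<in> int_ring" "v \<in> int_ring" for u v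
    using that int by (auto intro!: int_ring_intros)
  then have "- (?A * t - 2 * ?B) \<in> int_ring" "?A * (t ^ 2 - 2 * n) - t * ?B \<in> int_ring"
    using A B by blast+
  ultimately have "aval (y * ?d) \<le> 1" "aval (x * ?d) \<le> 1" unfolding int_ring_def by simp_all
  then show "x \<in> int_ring" "y \<in> int_ring" using d by (simp_all add: aval_mult int_ring_def)
qed

lemma square_le_1: "aval (x ^ 2) \<le> 1 \<Longrightarrow> aval x \<le> 1" for x :: "'f::nonarch_local_field"
  by (simp add: aval_power power_le_one_iff)

lemma square_less_1: "aval (x ^ 2) < 1 \<Longrightarrow> aval x < 1" for x :: "'f::nonarch_local_field"
  using power_less_one_iff[of "aval x" 2] by (simp add: aval_power)

lemma square_eq_1: "aval (x ^ 2) = 1 \<Longrightarrow> aval x = 1" for x :: "'f::nonarch_local_field"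
  using power_eq_1_iff[of "aval x" 2] by (simp add: aval_power)

text \<open>
  If \<open>y\<close> were a unit, then \<open>- x / y\<close> would be a root modulo the uniformizer. It would be simple
  because the discriminant is a unit, and hence lift to a root.
\<close>

lemma unit_disc_anisotropic_mod:
  fixes t n :: "'f::nonarch_local_field"
  assumes nr: "no_root t n" and int: "t \<in> int_ring" "n \<in> int_ring" and d: "aval (t ^ 2 - 4 * n) = 1"
    and xy: "aval (x ^ 2 + x * y * t + y ^ 2 * n) < 1"
  shows "aval x < 1 \<and> aval y < 1"
proof -
  have xyi: "aval x \<le> 1" "aval y \<le> 1"
    using maximal_quadratic_unit_disc[OF nr int d] less_imp_le[OF xy] unfolding maximal_quadratic_def int_ring_iff by blast+
  have y: "aval y < 1"
  proof (rule ccontr)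
    assume "\<not> aval y < 1"
    then have y1: "aval y = 1" using xyi by simp
    then have y0: "y \<noteq> 0" by auto
    let ?r = "- x / y"
    have eq: "?r ^ 2 - t * ?r + n = (x ^ 2 + x * y * t + y ^ 2 * n) / y ^ 2"
      using y0 by (simp add: add_divide_distrib) (simp add: power2_eq_square)
    then have small: "aval (?r ^ 2 - t * ?r + n) < 1" using xy y1 by (simp add: aval_divide aval_power)
    have "(2 * ?r - t) ^ 2 = (t ^ 2 - 4 * n) + 4 * (?r ^ 2 - t * ?r + n)"
      by (simp add: power2_eq_square algebra_simps)
    moreover have "aval (4 * (?r ^ 2 - t * ?r + n)) < 1"
      using small int_ring_numeral[of "num.Bit0 (num.Bit0 num.One)", where ?'f='f]
      by (simp only: aval_mult int_ring_iff) (meson le_less_trans mult_left_le_one_le zero_le_dist)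
    moreover have "aval (a + b) = 1" if "aval a = 1" "aval b < 1" for a b :: 'f
      using aval_add_eq[of b a] that by simp
    ultimately have "aval ((2 * ?r - t) ^ 2) = 1" using d by metis
    then have "aval (2 * ?r - t) = 1" by (rule square_eq_1)
    moreover have "?r \<in> int_ring" using xyi y1 by (simp add: int_ring_def aval_divide)
    ultimately show False using hensel_root[OF _ small] nr unfolding no_root_def by blast
  qed
  have "aval (x * y * t + y ^ 2 * n) < 1"
  proof (rule aval_add_less)
    show "aval (x * y * t) < 1"
      using xyi y int(1) by (simp add: aval_mult int_ring_def) (meson le_less_trans mult_left_le mult_left_le_one_le mult_nonneg_nonneg zero_le_dist)
    have "aval y ^ 2 < 1" using y by (simp add: power_less_one_iff)
    then show "aval (y ^ 2 * n) < 1"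
      using int(2) by (simp add: aval_mult aval_power int_ring_def) (meson le_less_trans mult_left_le zero_le_dist zero_le_power)
  qed
  then have "aval ((x ^ 2 + x * y * t + y ^ 2 * n) - (x * y * t + y ^ 2 * n)) < 1" using xy by (intro aval_diff_less)
  then have "aval (x ^ 2) < 1" by (simp add: algebra_simps)
  then show ?thesis using y square_less_1 by blast
qed

text \<open>
  Translation of the variable by an integer \<open>r\<close> does not change the ring generated by a root.
\<close>

lemma maximal_quadratic_shift:
  fixes t n :: "'f::nonarch_local_field"
  assumes "maximal_quadratic t n" "r \<in> int_ring"
  shows "maximal_quadratic (t + 2 * r) (n + t * r + r ^ 2)"
  unfolding maximal_quadratic_def
proof (intro conjI allI impI)
  have int: "t \<in> int_ring" "n \<in> int_ring" using assms(1) by (auto simp: maximal_quadratic_def)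
  then show "t + 2 * r \<in> int_ring" "n + t * r + r ^ 2 \<in> int_ring" using assms(2) by (auto intro!: int_ring_intros)
  fix x y assume "aval (x ^ 2 + x * y * (t + 2 * r) + y ^ 2 * (n + t * r + r ^ 2)) \<le> 1"
  also have "x ^ 2 + x * y * (t + 2 * r) + y ^ 2 * (n + t * r + r ^ 2) = (x + y * r) ^ 2 + (x + y * r) * y * t + y ^ 2 * n"
    by (simp add: power2_eq_square algebra_simps)
  finally have *: "x + y * r \<in> int_ring" "y \<in> int_ring" using assms(1) unfolding maximal_quadratic_def by blast+
  then show "y \<in> int_ring" by simp
  have "(x + y * r) - y * r \<in> int_ring" using * assms(2) by (intro int_ring_diff int_ring_mult)
  moreover have "(x + y * r) - y * r = x" by simp
  ultimately show "x \<in> int_ring" by (simp only:)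
qed

lemma aval_less_uniformizer: "aval x < aval (uniformizer :: 'f) \<Longrightarrow> aval x \<le> aval (uniformizer :: 'f) ^ 2"
  for x :: "'f::nonarch_local_field"
proof -
  assume "aval x < aval (uniformizer :: 'f)"
  then have "aval (x / uniformizer) < 1" by (simp add: aval_divide)
  then have "aval (x / uniformizer) \<le> aval (uniformizer :: 'f)" by (rule aval_le_uniformizer)
  then show ?thesis by (simp add: aval_divide pos_divide_le_eq power2_eq_square)
qed

text \<open>For an Eisenstein polynomial the two squares in the norm form have valuations of different parity.\<close>

lemma eisenstein_maximal:
  fixes t n :: "'f::nonarch_local_field"
  assumes t: "aval t < 1" and n: "aval n = aval (uniformizer :: 'f)"
  shows "maximal_quadratic t n"
  unfolding maximal_quadratic_def
proof (intro conjI allI impI)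
  let ?p = "aval (uniformizer :: 'f)"
  have p: "0 < ?p" "?p < 1" by (simp, rule aval_uniformizer_less)
  show "t \<in> int_ring" "n \<in> int_ring" using t n p by (auto simp: int_ring_def)
  have tp: "aval t \<le> ?p" using t by (rule aval_le_uniformizer)
  fix x y assume N: "aval (x ^ 2 + x * y * t + y ^ 2 * n) \<le> 1"
  have "aval x \<le> 1 \<and> aval y \<le> 1"
  proof (cases "aval y \<le> aval x")
    case True
    show ?thesis
    proof (cases "x = 0")
      case False
      then have x0: "0 < aval x" by simp
      have "aval (x * y * t + y ^ 2 * n) < aval (x ^ 2)"
      proof (rule aval_add_less)
        have "aval x * aval y * aval t \<le> aval x * aval x * ?p"
          using True tp by (intro mult_mono) auto
        also have "\<dots> < aval x * aval x" using x0 p by simp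
        finally show "aval (x * y * t) < aval (x ^ 2)" by (simp add: aval_mult power2_eq_square)
        have "aval y * aval y * aval n \<le> aval x * aval x * ?p"
          using True n by (intro mult_mono) auto
        also have "\<dots> < aval x * aval x" using x0 p by simp
        finally show "aval (y ^ 2 * n) < aval (x ^ 2)" by (simp add: aval_mult power2_eq_square)
      qed
      then have "aval (x ^ 2) \<le> 1" using N aval_add_eq[of "x * y * t + y ^ 2 * n" "x ^ 2"] by (simp add: add.assoc)
      then show ?thesis using True square_le_1 by force
    qed (use True in auto)
  next
    case False
    then have y0: "0 < aval y" by (meson le_less_trans not_le zero_le_dist)
    then have y: "y \<noteq> 0" by auto
    have "aval (x / y) < 1" using False y0 by (simp add: aval_divide)
    then have "aval (x / y) \<le> ?p" by (rule aval_le_uniformizer)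
    then have xp: "aval x \<le> ?p * aval y" using y0 by (simp add: aval_divide pos_divide_le_eq)
    have bound: "?p * (?p * (aval y * aval y)) < ?p * (aval y * aval y)" using y0 p by simp
    have "aval (x * y * t + x ^ 2) < aval (y ^ 2 * n)"
    proof (rule aval_add_less)
      have "aval x * aval y * aval t \<le> (?p * aval y) * aval y * ?p"
        using xp tp p by (intro mult_mono) auto
      also have "\<dots> = ?p * (?p * (aval y * aval y))" by (simp add: algebra_simps)
      also note bound
      finally show "aval (x * y * t) < aval (y ^ 2 * n)" by (simp add: aval_mult power2_eq_square n mult.commute)
      have "aval x * aval x \<le> (?p * aval y) * (?p * aval y)" using xp p by (intro mult_mono) auto
      also have "\<dots> = ?p * (?p * (aval y * aval y))" by (simp add: algebra_simps)
      also note bound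
      finally show "aval (x ^ 2) < aval (y ^ 2 * n)" by (simp add: aval_mult power2_eq_square n mult.commute)
    qed
    then have "aval (y ^ 2 * n) \<le> 1"
      using N aval_add_eq[of "x * y * t + x ^ 2" "y ^ 2 * n"] by (simp add: algebra_simps)
    then have yn: "aval y ^ 2 * ?p \<le> 1" by (simp add: aval_mult aval_power n)
    have "aval y \<le> 1"
    proof (rule ccontr)
      assume "\<not> aval y \<le> 1"
      then have "1 < aval y" by simp
      then have "1 \<le> ?p * aval y" by (rule aval_greater_1_imp)
      moreover have "aval y < aval y * (?p * aval y) \<or> ?p * aval y = 1" using \<open>1 \<le> ?p * aval y\<close> y0 by auto
      moreover have "aval y * (?p * aval y) = aval y ^ 2 * ?p" by (simp add: power2_eq_square algebra_simps)
      ultimately show False using yn \<open>1 < aval y\<close> by auto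
    qed
    then show ?thesis using False by auto
  qed
  then show "x \<in> int_ring" "y \<in> int_ring" by (auto simp: int_ring_def)
qed

text \<open>
  \<open>X\<^sup>2 - t\<^sub>1 t\<^sub>2 X + n\<^sub>1 t\<^sub>2\<^sup>2 + t\<^sub>1\<^sup>2 n\<^sub>2 - 4 n\<^sub>1 n\<^sub>2\<close> is the polynomial of
  \<open>a b + a' b'\<close>, where \<open>a, a'\<close> and \<open>b, b'\<close> are the roots of the two given polynomials. If the second one
  is a square modulo the uniformizer, then a translation makes it Eisenstein, and the translate of the
  third one is Eisenstein as well.
\<close>

lemma maximal_quadratic_third:
  fixes t1 n1 t2 n2 :: "'f::nonarch_local_field"
  assumes int: "t1 \<in> int_ring" "n1 \<in> int_ring" and d: "aval (t1 ^ 2 - 4 * n1) = 1"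
    and mq: "maximal_quadratic t2 n2"
    and r: "r \<in> int_ring" "aval (t2 - 2 * r) < 1" "aval (n2 - r ^ 2) < 1"
  shows "maximal_quadratic (t1 * t2) (n1 * t2 ^ 2 + t1 ^ 2 * n2 - 4 * n1 * n2)"
proof -
  let ?p = "aval (uniformizer :: 'f)"
  have p: "0 < ?p" "?p < 1" by (simp, rule aval_uniformizer_less)
  \<comment> \<open>Trace and norm of the translated root \<open>b - r\<close>; the polynomial with these coefficients is Eisenstein.\<close>
  define u m where "u = t2 + 2 * (- r)" and "m = n2 + t2 * (- r) + (- r) ^ 2"
  have mqs: "maximal_quadratic u m" unfolding u_def m_def using r(1) by (intro maximal_quadratic_shift mq int_ring_intros)
  have u1: "aval u < 1" using r(2) by (simp add: u_def)
  have "m = (n2 - r ^ 2) - r * u" by (simp add: m_def u_def power2_eq_square algebra_simps)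
  moreover have "aval (r * u) < 1" using r(1) u1
    by (simp add: aval_mult int_ring_def) (meson le_less_trans mult_left_le_one_le zero_le_dist)
  ultimately have m1: "aval m < 1" using r(3) by (simp add: aval_diff_less)
  have m: "aval m = ?p"
  proof (rule ccontr)
    assume "aval m \<noteq> ?p"
    then have "aval m < ?p" using aval_le_uniformizer[OF m1] by simp
    then have "aval m \<le> ?p ^ 2" by (rule aval_less_uniformizer)
    \<comment> \<open>The norm form at \<open>(0, \<pi>\<^sup>-\<^sup>1)\<close> would be integral, against maximality.\<close>
    then have "aval (0 ^ 2 + 0 * inverse uniformizer * u + inverse uniformizer ^ 2 * m) \<le> 1"
      using p by (simp add: aval_mult aval_power aval_inverse inverse_eq_divide power_divide aval_divide)
    then have "(inverse uniformizer :: 'f) \<in> int_ring" using mqs unfolding maximal_quadratic_def by blast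
    then show False using p by (simp add: int_ring_def aval_inverse inverse_le_1_iff)
  qed
  \<comment> \<open>The third polynomial, translated by \<open>t\<^sub>1 r\<close>, has trace \<open>t\<^sub>1 u\<close> and norm \<open>m (t\<^sub>1\<^sup>2 - 4 n\<^sub>1) + n\<^sub>1 u\<^sup>2\<close>.\<close>
  have "aval (n1 * u ^ 2) < ?p"
  proof -
    have "aval u ^ 2 \<le> ?p ^ 2" using aval_le_uniformizer[OF u1] by (intro power_mono) auto
    moreover have "?p ^ 2 < ?p" using p by (simp add: power2_eq_square)
    moreover have "aval n1 * aval u ^ 2 \<le> 1 * aval u ^ 2" using int(2) by (intro mult_right_mono) (auto simp: int_ring_def)
    ultimately have "aval n1 * aval u ^ 2 < ?p" by linarith
    then show ?thesis by (simp add: aval_mult aval_power)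
  qed
  then have "aval (m * (t1 ^ 2 - 4 * n1) + n1 * u ^ 2) = ?p"
    using m d by (subst aval_add_eq) (simp_all add: aval_mult)
  moreover have "aval (t1 * u) < 1" using int(1) u1
    by (simp add: aval_mult int_ring_def) (meson le_less_trans mult_left_le_one_le zero_le_dist)
  ultimately have "maximal_quadratic (t1 * u) (m * (t1 ^ 2 - 4 * n1) + n1 * u ^ 2)" by (intro eisenstein_maximal)
  then have "maximal_quadratic (t1 * u + 2 * (t1 * r)) (m * (t1 ^ 2 - 4 * n1) + n1 * u ^ 2 + (t1 * u) * (t1 * r) + (t1 * r) ^ 2)"
    using int(1) r(1) by (intro maximal_quadratic_shift int_ring_intros)
  moreover have "t1 * u + 2 * (t1 * r) = t1 * t2" by (simp add: u_def algebra_simps)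
  moreover have "m * (t1 ^ 2 - 4 * n1) + n1 * u ^ 2 + (t1 * u) * (t1 * r) + (t1 * r) ^ 2 = n1 * t2 ^ 2 + t1 ^ 2 * n2 - 4 * n1 * n2"
    by (simp add: u_def m_def power2_eq_square algebra_simps)
  ultimately show ?thesis by simp
qed

section \<open>Quadratic Galois extensions\<close>

lemma vector_space_alg_scale:
  fixes \<iota> :: "'f::field \<Rightarrow> 'a::comm_ring_1"
  assumes "unital_hom \<iota>" shows "vector_space (alg_scale \<iota>)"
  using assms by unfold_locales (auto simp: alg_scale_def unital_hom_def algebra_simps)

locale quadratic_ext =
  fixes \<iota> :: "'f::nonarch_local_field \<Rightarrow> 'k::field" and \<sigma> :: "'k \<Rightarrow> 'k"
  assumes qg: "quadratic_galois \<iota> \<sigma>"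
begin

lemma iota_hom: "\<iota> 1 = 1" "\<iota> (x + y) = \<iota> x + \<iota> y" "\<iota> (x * y) = \<iota> x * \<iota> y"
  using qg by (auto simp: quadratic_galois_def unital_hom_def)

lemma iota_0 [simp]: "\<iota> 0 = 0"
proof -
  have "\<iota> 0 + \<iota> 0 = \<iota> 0 + 0" using iota_hom(2)[of 0 0] by simp
  then show ?thesis by (rule add_left_imp_eq)
qed

lemma iota_minus: "\<iota> (- x) = - \<iota> x"
  using iota_hom(2)[of x "- x"] by (simp add: eq_neg_iff_add_eq_0 add.commute)

lemma iota_diff: "\<iota> (x - y) = \<iota> x - \<iota> y" using iota_hom(2)[of x "- y"] by (simp add: iota_minus)

lemma iota_power: "\<iota> (x ^ k) = \<iota> x ^ k" by (induction k) (simp_all add: iota_hom)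

lemma iota_numeral: "\<iota> (numeral k) = numeral k"
proof -
  have "\<iota> (of_nat m) = of_nat m" for m by (induction m) (simp_all add: iota_hom)
  then show ?thesis by (metis of_nat_numeral)
qed

lemmas iota_simps = iota_hom iota_minus iota_diff iota_power iota_numeral

lemma iota_eq_0 [simp]: "\<iota> x = 0 \<longleftrightarrow> x = 0"
proof
  assume *: "\<iota> x = 0"
  show "x = 0"
  proof (rule ccontr)
    assume "x \<noteq> 0"
    then have "\<iota> x * \<iota> (inverse x) = 1" by (simp add: iota_hom flip: iota_hom(3))
    then show False using * by simp
  qed
qed simp

lemma iota_eq [simp]: "\<iota> x = \<iota> y \<longleftrightarrow> x = y"
  using iota_eq_0[of "x - y"] by (simp add: iota_diff del: iota_eq_0)

lemma sigma_hom: "\<sigma> 1 = 1" "\<sigma> (x + y) = \<sigma> x + \<sigma> y" "\<sigma> (x * y) = \<sigma> x * \<sigma> y"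
  using qg by (auto simp: quadratic_galois_def unital_hom_def)

lemma sigma_iota [simp]: "\<sigma> (\<iota> x) = \<iota> x" and fixed: "\<sigma> z = z \<Longrightarrow> z \<in> range \<iota>"
  using qg by (auto simp: quadratic_galois_def)

lemma sigma_minus: "\<sigma> (- z) = - \<sigma> z"
  using sigma_hom(2)[of z "- z"] sigma_iota[of 0] by (simp add: eq_neg_iff_add_eq_0 add.commute)

lemma sigma_diff: "\<sigma> (y - z) = \<sigma> y - \<sigma> z" using sigma_hom(2)[of y "- z"] by (simp add: sigma_minus)

lemma generator_exists: "\<exists>g. g \<notin> range \<iota>"
proof -
  obtain g where "\<sigma> g \<noteq> g" using qg by (auto simp: quadratic_galois_def fun_eq_iff)
  then show ?thesis using sigma_iota by (metis rangeE)
qed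

sublocale vs: vector_space "alg_scale \<iota>"
  using qg by (intro vector_space_alg_scale) (simp add: quadratic_galois_def)

lemma span_generator: "vs.span {1, g} = {\<iota> x + \<iota> y * g | x y. True}"
  by (auto simp: vs.span_insert vs.span_singleton alg_scale_def) (metis diff_add_cancel add.commute diff_eq_eq)+

lemma independent_generator:
  assumes "g \<notin> range \<iota>" shows "vs.independent {1, g}" "1 \<noteq> g"
proof -
  show g1: "1 \<noteq> g" using assms iota_hom(1) by (metis rangeI)
  have "1 \<notin> vs.span {g}"
  proof
    assume "1 \<in> vs.span {g}"
    then obtain x where x: "1 = \<iota> x * g" by (auto simp: vs.span_singleton alg_scale_def)
    then have "x \<noteq> 0" by auto
    have "\<iota> (inverse x) * (\<iota> x * g) = g" using \<open>x \<noteq> 0\<close> by (simp add: iota_hom flip: mult.assoc iota_hom(3))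
    then show False using x assms by (metis mult.right_neutral rangeI)
  qed
  moreover have "g \<noteq> 0" using assms iota_0 by (metis rangeI)
  then have "vs.independent {g}" by (simp add: vs.dependent_single)
  ultimately show "vs.independent {1, g}" using g1 by (simp add: vs.independent_insert)
qed

text \<open>
  The extension has dimension 2 and \<open>1, g\<close> are independent.
\<close>

lemma generator_spans:
  assumes "g \<notin> range \<iota>" shows "\<exists>x y. z = \<iota> x + \<iota> y * g"
proof -
  have dim: "vs.dim UNIV = 2" using qg by (simp add: quadratic_galois_def)
  obtain B where B: "vs.independent B" "UNIV \<subseteq> vs.span B" "card B = vs.dim UNIV"
    by (rule vs.basis_exists[of UNIV])
  have finB: "finite B" using B(3) dim by (metis card.infinite zero_neq_numeral)
  have "z \<in> vs.span {1, g}"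
  proof (rule ccontr)
    assume z: "z \<notin> vs.span {1, g}"
    then have "vs.independent (insert z {1, g})" using independent_generator(1)[OF assms] by (simp only: vs.independent_insert) auto
    moreover have "insert z {1, g} \<subseteq> vs.span B" using B(2) by (meson subset_UNIV subset_trans)
    ultimately have "finite (insert z {1, g}) \<and> card (insert z {1, g}) \<le> card B"
      by (rule vs.independent_span_bound[OF finB])
    moreover have "z \<notin> {1, g}" using z vs.span_base[of z "{1, g}"] by metis
    ultimately show False using B(3) dim independent_generator(2)[OF assms] by simp
  qed
  then show ?thesis unfolding span_generator by simp
qed

lemma generator_basis: "g \<notin> range \<iota> \<Longrightarrow> alg_basis \<iota> {1, g}"
  using independent_generator(1) generator_spans span_generator unfolding alg_basis_def by blast

lemma generator_unique:
  assumes "g \<notin> range \<iota>" "\<iota> x + \<iota> y * g = \<iota> x' + \<iota> y' * g"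
  shows "x = x' \<and> y = y'"
proof -
  have *: "\<iota> (x - x') = \<iota> (y' - y) * g" using assms(2) by (simp add: iota_diff algebra_simps)
  have "y' = y"
  proof (rule ccontr)
    assume "y' \<noteq> y"
    then have "\<iota> (inverse (y' - y) * (x - x')) = g"
      unfolding iota_hom(3) * by (simp add: iota_hom flip: mult.assoc iota_hom(3))
    then show False using assms(1) by (metis rangeI)
  qed
  then show ?thesis using * by simp
qed

text \<open>Trace and norm of a generator; the conjugate is the second root of its quadratic equation.\<close>

lemma generator_trace_norm:
  assumes "g \<notin> range \<iota>"
  obtains t n where "\<sigma> g = \<iota> t - g" "g * \<sigma> g = \<iota> n" "no_root t n"
proof -
  obtain x y where xy: "g * g = \<iota> x + \<iota> y * g" using generator_spans[OF assms] by blast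
  then have s: "\<sigma> g * \<sigma> g = \<iota> x + \<iota> y * \<sigma> g" by (metis sigma_hom(2,3) sigma_iota)
  have "(\<sigma> g - g) * (\<sigma> g + g - \<iota> y) = (\<sigma> g * \<sigma> g - \<iota> y * \<sigma> g) - (g * g - \<iota> y * g)"
    by (simp add: algebra_simps)
  also have "\<dots> = 0" unfolding xy s by simp
  finally have "\<sigma> g + g - \<iota> y = 0" using assms fixed by auto
  then have sg: "\<sigma> g = \<iota> y - g" by (simp add: algebra_simps eq_diff_eq)
  have n: "g * \<sigma> g = \<iota> (- x)" unfolding sg using xy by (simp add: algebra_simps iota_minus)
  have "no_root y (- x)"
    unfolding no_root_def
  proof (intro allI notI)
    fix r assume root: "r ^ 2 - y * r + - x = 0"
    have "\<iota> r * \<iota> r - \<iota> y * \<iota> r - \<iota> x = \<iota> (r ^ 2 - y * r + - x)"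
      by (simp only: iota_hom iota_diff iota_minus power2_eq_square) simp
    then have "\<iota> r * \<iota> r - \<iota> y * \<iota> r - \<iota> x = 0" unfolding root by simp
    moreover have "(\<iota> r - g) * (\<iota> r - \<sigma> g) = \<iota> r * \<iota> r - \<iota> y * \<iota> r - \<iota> x"
      unfolding sg using xy by (simp add: algebra_simps)
    ultimately have "\<iota> r = g \<or> \<iota> r = \<sigma> g" by auto
    moreover have "\<iota> r \<noteq> \<sigma> g"
    proof
      assume "\<iota> r = \<sigma> g"
      then have "g = \<iota> (y - r)" unfolding sg by (simp add: iota_diff)
      then show False using assms by blast
    qed
    ultimately show False using assms by blast
  qed
  then show ?thesis using that sg n by blast
qed

lemma sigma_sigma: "\<sigma> (\<sigma> z) = z"
proof -
  obtain g where g: "g \<notin> range \<iota>" using generator_exists by blast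
  obtain t n where t: "\<sigma> g = \<iota> t - g" using generator_trace_norm[OF g] by metis
  obtain x y where z: "z = \<iota> x + \<iota> y * g" using generator_spans[OF g] by blast
  show ?thesis unfolding z by (simp add: sigma_hom sigma_diff t)
qed

definition Nm :: "'k \<Rightarrow> 'f" where "Nm z = inv_into UNIV \<iota> (z * \<sigma> z)"
definition Tr :: "'k \<Rightarrow> 'f" where "Tr z = inv_into UNIV \<iota> (z + \<sigma> z)"

lemma Nm: "\<iota> (Nm z) = z * \<sigma> z"
  unfolding Nm_def by (rule f_inv_into_f, rule fixed) (simp add: sigma_hom sigma_sigma mult.commute)

lemma Tr: "\<iota> (Tr z) = z + \<sigma> z"
  unfolding Tr_def by (rule f_inv_into_f, rule fixed) (simp add: sigma_hom sigma_sigma add.commute)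

lemma Nm_mult: "Nm (y * z) = Nm y * Nm z"
proof -
  have "\<iota> (Nm (y * z)) = \<iota> (Nm y * Nm z)" by (simp add: Nm iota_hom sigma_hom del: iota_eq)
  then show ?thesis by simp
qed

lemma Nm_add: "Nm (y + z) = Nm y + Nm z + Tr (y * \<sigma> z)"
proof -
  have "\<iota> (Nm (y + z)) = \<iota> (Nm y + Nm z + Tr (y * \<sigma> z))"
    by (simp add: Nm Tr iota_hom sigma_hom sigma_sigma algebra_simps del: iota_eq)
  then show ?thesis by simp
qed

lemma Nm_iota [simp]: "Nm (\<iota> x) = x ^ 2"
proof -
  have "\<iota> (Nm (\<iota> x)) = \<iota> (x ^ 2)" by (simp add: Nm iota_hom power2_eq_square del: iota_eq)
  then show ?thesis by simp
qed

lemma Nm_sigma: "Nm (\<sigma> z) = Nm z"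
proof -
  have "\<iota> (Nm (\<sigma> z)) = \<iota> (Nm z)" by (simp add: Nm sigma_sigma mult.commute del: iota_eq)
  then show ?thesis by simp
qed

lemma Nm_1 [simp]: "Nm 1 = 1" using Nm_iota[of 1] by (simp add: iota_hom)

lemma Nm_minus [simp]: "Nm (- z) = Nm z"
proof -
  have "\<iota> (Nm (- z)) = \<iota> (Nm z)" by (simp add: Nm sigma_minus del: iota_eq)
  then show ?thesis by simp
qed

lemma char_poly: "z * z = \<iota> (Tr z) * z - \<iota> (Nm z)"
  by (simp add: Tr Nm algebra_simps)

lemma coord_Nm_Tr:
  assumes "\<sigma> g = \<iota> t - g" "g * \<sigma> g = \<iota> n"
  shows "Nm (\<iota> x + \<iota> y * g) = x ^ 2 + x * y * t + y ^ 2 * n" "Tr (\<iota> x + \<iota> y * g) = 2 * x + y * t"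
proof -
  have "\<iota> (Nm (\<iota> x + \<iota> y * g)) = (\<iota> x) ^ 2 + \<iota> x * \<iota> y * (g + \<sigma> g) + (\<iota> y) ^ 2 * (g * \<sigma> g)"
    by (simp add: Nm sigma_hom power2_eq_square algebra_simps)
  also have "\<dots> = \<iota> (x ^ 2 + x * y * t + y ^ 2 * n)" unfolding assms(2) by (simp add: assms(1) iota_simps del: iota_eq)
  finally show "Nm (\<iota> x + \<iota> y * g) = x ^ 2 + x * y * t + y ^ 2 * n" by simp
  have "\<iota> (Tr (\<iota> x + \<iota> y * g)) = \<iota> (2 * x + y * t)"
    by (simp add: Tr sigma_hom assms(1) iota_simps algebra_simps del: iota_eq)
  then show "Tr (\<iota> x + \<iota> y * g) = 2 * x + y * t" by simp
qed

lemma Tr_bound: "aval (Nm z) \<le> 1 \<Longrightarrow> aval (Tr z) \<le> 1"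
proof -
  assume N: "aval (Nm z) \<le> 1"
  obtain g where g: "g \<notin> range \<iota>" using generator_exists by blast
  obtain t n where t: "\<sigma> g = \<iota> t - g" "g * \<sigma> g = \<iota> n" "no_root t n" using generator_trace_norm[OF g] by metis
  obtain x y where z: "z = \<iota> x + \<iota> y * g" using generator_spans[OF g] by blast
  show ?thesis using trace_bound[OF t(3)] N unfolding z coord_Nm_Tr[OF t(1,2)] by blast
qed

text \<open>
  The ring of integers of the extension, in the form in which membership can be computed.
\<close>

definition norm_ring :: "'k set" where "norm_ring = {z. aval (Nm z) \<le> 1}"

lemma norm_ring_mult: "y \<in> norm_ring \<Longrightarrow> z \<in> norm_ring \<Longrightarrow> y * z \<in> norm_ring"
  by (simp add: norm_ring_def Nm_mult aval_mult mult_le_one)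

lemma norm_ring_add: "y \<in> norm_ring \<Longrightarrow> z \<in> norm_ring \<Longrightarrow> y + z \<in> norm_ring"
proof -
  assume *: "y \<in> norm_ring" "z \<in> norm_ring"
  then have "aval (Tr (y * \<sigma> z)) \<le> 1"
    by (intro Tr_bound) (simp add: norm_ring_def Nm_mult Nm_sigma aval_mult mult_le_one)
  then show ?thesis using * by (simp add: norm_ring_def Nm_add aval_add_le)
qed

lemma norm_ring_minus: "z \<in> norm_ring \<Longrightarrow> - z \<in> norm_ring"
  by (simp add: norm_ring_def)

lemma norm_ring_diff: "y \<in> norm_ring \<Longrightarrow> z \<in> norm_ring \<Longrightarrow> y - z \<in> norm_ring"
  using norm_ring_add[of y "- z"] norm_ring_minus by simp

lemma norm_ring_iota: "\<iota> x \<in> norm_ring \<longleftrightarrow> x \<in> int_ring"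
  using square_le_1[of x] by (auto simp: norm_ring_def int_ring_def aval_power power_le_one)

lemma norm_ring_sum: "(\<And>i. i \<in> S \<Longrightarrow> f i \<in> norm_ring) \<Longrightarrow> sum f S \<in> norm_ring"
  using norm_ring_iota[of 0] by (induction S rule: infinite_finite_induct) (auto intro: norm_ring_add)

lemma norm_ring_power: "z \<in> norm_ring \<Longrightarrow> z ^ k \<in> norm_ring"
  using norm_ring_iota[of 1] by (induction k) (auto intro: norm_ring_mult simp: iota_hom)

lemma poly_map_poly_iota: "poly (map_poly \<iota> p) z = (\<Sum>i\<le>Polynomial.degree p. \<iota> (Polynomial.coeff p i) * z ^ i)"
proof -
  have "Polynomial.degree (map_poly \<iota> p) = Polynomial.degree p" by (intro degree_map_poly) simp
  then show ?thesis by (simp add: poly_altdef coeff_map_poly)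
qed

text \<open>
  An element of norm larger than 1 is not integral: dividing an integral equation by its leading
  term would express 1 through positive powers of the inverse, whose norm is smaller than 1.
\<close>

lemma max_order_eq_norm_ring: "max_order UNIV \<iota> = norm_ring"
proof (intro Set.set_eqI iffI)
  fix z assume "z \<in> max_order UNIV \<iota>"
  then obtain p where p: "Polynomial.lead_coeff p = 1" "int_coeffs p" "poly (map_poly \<iota> p) z = 0"
    by (auto simp: max_order_def integral_over_def)
  define d where "d = Polynomial.degree p"
  show "z \<in> norm_ring"
  proof (rule ccontr)
    assume "z \<notin> norm_ring"
    then have N: "1 < aval (Nm z)" by (simp add: norm_ring_def)
    then have z0: "z \<noteq> 0" using Nm_iota[of 0] by auto
    let ?w = "inverse z"
    have "Nm z * Nm ?w = 1" using z0 Nm_mult[of z ?w] by simp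
    then have "aval (Nm z) * aval (Nm ?w) = 1" by (metis aval_mult aval_one)
    then have w: "aval (Nm ?w) < 1" using N by (metis less_le_not_le linorder_not_less mult_le_cancel_left1 not_less_iff_gr_or_eq zero_le_dist mult.right_neutral mult_less_cancel_left_disj order.strict_trans zero_less_one)
    then have wO: "?w \<in> norm_ring" by (simp add: norm_ring_def)
    \<comment> \<open>The integral equation divided by \<open>z\<^sup>d\<close> reads \<open>1 + w q = 0\<close> with \<open>w = z\<^sup>-\<^sup>1\<close>.\<close>
    define q where "q = (\<Sum>i<d. \<iota> (Polynomial.coeff p i) * ?w ^ (d - 1 - i))"
    have q: "q \<in> norm_ring" unfolding q_def
      using p(2) wO by (intro norm_ring_sum norm_ring_mult norm_ring_power) (auto simp: norm_ring_iota)
    have "0 = (\<Sum>i\<le>d. \<iota> (Polynomial.coeff p i) * z ^ i) * ?w ^ d" using p(3) by (simp add: poly_map_poly_iota d_def)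
    also have "\<dots> = (\<Sum>i<d. \<iota> (Polynomial.coeff p i) * z ^ i) * ?w ^ d + \<iota> (Polynomial.coeff p d) * (z ^ d * ?w ^ d)"
      by (simp add: lessThan_Suc_atMost[symmetric] distrib_right mult.assoc)
    also have "z ^ d * ?w ^ d = 1" using z0 by (simp add: power_inverse)
    also have "\<iota> (Polynomial.coeff p d) = 1" using p(1) by (simp add: d_def iota_hom)
    also have "(\<Sum>i<d. \<iota> (Polynomial.coeff p i) * z ^ i) * ?w ^ d = ?w * q"
      unfolding q_def sum_distrib_left sum_distrib_right
    proof (intro sum.cong refl)
      fix i assume "i \<in> {..<d}"
      then have "d = i + Suc (d - 1 - i)" by simp
      then have "?w ^ d = ?w ^ i * ?w ^ Suc (d - 1 - i)" by (metis power_add)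
      moreover have "z ^ i * ?w ^ i = 1" using z0 by (simp add: power_inverse)
      ultimately show "\<iota> (Polynomial.coeff p i) * z ^ i * ?w ^ d = ?w * (\<iota> (Polynomial.coeff p i) * ?w ^ (d - 1 - i))"
        by (simp add: algebra_simps)
    qed
    finally have "1 = - (?w * q)" by (simp add: eq_neg_iff_add_eq_0 add.commute)
    then have "Nm 1 = Nm (- (?w * q))" by (rule arg_cong)
    then have "aval (Nm ?w) * aval (Nm q) = 1" by (simp add: Nm_mult flip: aval_mult)
    moreover have "aval (Nm ?w) * aval (Nm q) \<le> aval (Nm ?w)" using q by (intro mult_left_le) (auto simp: norm_ring_def)
    ultimately show False using w by simp
  qed
next
  fix z assume z: "z \<in> norm_ring"
  then have int: "Nm z \<in> int_ring" "Tr z \<in> int_ring" using Tr_bound by (auto simp: norm_ring_def int_ring_def)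
  let ?p = "[:Nm z, - Tr z, 1:]"
  have "Polynomial.lead_coeff ?p = 1" by simp
  moreover have "int_coeffs ?p" using int by (auto simp: coeff_pCons split: nat.split intro: int_ring_intros)
  moreover have "poly (map_poly \<iota> ?p) z = 0"
    using char_poly[of z] by (simp add: map_poly_pCons iota_hom iota_minus algebra_simps)
  ultimately show "z \<in> max_order UNIV \<iota>" unfolding max_order_def integral_over_def by blast
qed

text \<open>
  A quadratic extension is determined by the polynomial of a generator; the isomorphism preserves
  coordinates.
\<close>

lemma alg_isomorphic_same_polynomial:
  fixes \<iota>' :: "'f \<Rightarrow> 'k'::field"
  assumes q': "quadratic_galois \<iota>' \<sigma>'"
    and g: "g \<notin> range \<iota>" "g * g = \<iota> t * g - \<iota> n"
    and g': "g' \<notin> range \<iota>'" "g' * g' = \<iota>' t * g' - \<iota>' n"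
  shows "alg_isomorphic \<iota> \<iota>'"
proof -
  interpret q': quadratic_ext \<iota>' \<sigma>' by unfold_locales (rule q')
  obtain cx cy where c: "\<And>z. z = \<iota> (cx z) + \<iota> (cy z) * g" using generator_spans[OF g(1)] by metis
  define \<phi> where "\<phi> z = \<iota>' (cx z) + \<iota>' (cy z) * g'" for z
  have \<phi>: "\<phi> (\<iota> x + \<iota> y * g) = \<iota>' x + \<iota>' y * g'" for x y
    using generator_unique[OF g(1) c[of "\<iota> x + \<iota> y * g", symmetric]] by (simp add: \<phi>_def)
  have hom1: "\<phi> 1 = 1" using \<phi>[of 1 0] by (simp add: iota_hom q'.iota_hom)
  have hom2: "\<phi> (y + z) = \<phi> y + \<phi> z" for y z
  proof -
    obtain a b c d where yz: "y = \<iota> a + \<iota> b * g" "z = \<iota> c + \<iota> d * g" using generator_spans[OF g(1)] by metis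
    have "y + z = \<iota> (a + c) + \<iota> (b + d) * g" unfolding yz by (simp add: iota_hom algebra_simps)
    then show ?thesis using \<phi> yz by (simp add: q'.iota_hom algebra_simps)
  qed
  have hom3: "\<phi> (y * z) = \<phi> y * \<phi> z" for y z
  proof -
    obtain a b c d where yz: "y = \<iota> a + \<iota> b * g" "z = \<iota> c + \<iota> d * g" using generator_spans[OF g(1)] by metis
    have "y * z = \<iota> a * \<iota> c + (\<iota> a * \<iota> d + \<iota> b * \<iota> c) * g + \<iota> b * \<iota> d * (g * g)"
      unfolding yz by (simp add: algebra_simps)
    also have "\<dots> = \<iota> (a * c - b * d * n) + \<iota> (a * d + b * c + b * d * t) * g"
      unfolding g(2) by (simp add: iota_simps algebra_simps)
    finally have "\<phi> (y * z) = \<iota>' (a * c - b * d * n) + \<iota>' (a * d + b * c + b * d * t) * g'" using \<phi> by simp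
    also have "\<dots> = \<iota>' a * \<iota>' c + (\<iota>' a * \<iota>' d + \<iota>' b * \<iota>' c) * g' + \<iota>' b * \<iota>' d * (g' * g')"
      unfolding g'(2) by (simp add: q'.iota_simps algebra_simps)
    also have "\<dots> = \<phi> y * \<phi> z" unfolding yz \<phi> by (simp add: algebra_simps)
    finally show ?thesis .
  qed
  have "bij \<phi>"
  proof (intro bijI injI surjI)
    fix y z assume "\<phi> y = \<phi> z"
    then have "cx y = cx z \<and> cy y = cy z" unfolding \<phi>_def by (rule q'.generator_unique[OF g'(1)])
    then show "y = z" using c by metis
  next
    show "\<phi> ((\<lambda>w. SOME z. \<phi> z = w) w) = w" for w
    proof -
      obtain x y where "w = \<iota>' x + \<iota>' y * g'" using q'.generator_spans[OF g'(1)] by blast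
      then have "\<exists>z. \<phi> z = w" using \<phi> by metis
      then show ?thesis by (rule someI_ex)
    qed
  qed
  moreover have "\<phi> \<circ> \<iota> = \<iota>'" using \<phi>[of _ 0] by (auto simp: fun_eq_iff)
  ultimately show ?thesis unfolding alg_isomorphic_def unital_hom_def using hom1 hom2 hom3 by blast
qed

end

lemma continuous_on_mat [continuous_intros]:
  fixes f :: "'x::topological_space \<Rightarrow> 'f::nonarch_local_field"
  assumes "continuous_on S f"
  shows "continuous_on S (\<lambda>x. mat (f x) :: 'f^'n^'n)"
proof -
  have "continuous_on S (\<lambda>x. if i = j then f x else 0)" for i j :: 'n
    using assms by (cases "i = j") auto
  then show ?thesis unfolding mat_def by (intro continuous_on_vec_lambda)
qed

lemma card_le_two_fibres:
  assumes "finite S" "\<And>x. x \<in> S \<Longrightarrow> {y \<in> S. f y = f x} \<subseteq> {x, p x}"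
  shows "card S \<le> 2 * card (f ` S)"
proof -
  have "card S = (\<Sum>y\<in>f ` S. \<Sum>x\<in>{x \<in> S. f x = y}. 1::nat)"
    using sum.image_gen[OF assms(1), of "\<lambda>_. 1::nat" f] by simp
  also have "\<dots> \<le> (\<Sum>y\<in>f ` S. 2)"
  proof (rule sum_mono)
    fix y assume "y \<in> f ` S"
    then obtain x where x: "x \<in> S" "y = f x" by blast
    have "card {z \<in> S. f z = f x} \<le> card {x, p x}" by (intro card_mono assms(2) x(1)) simp
    also have "\<dots> \<le> 2" by (simp add: card_insert_if)
    finally show "(\<Sum>x\<in>{x \<in> S. f x = y}. 1::nat) \<le> 2" using x(2) by simp
  qed
  finally show ?thesis by simp
qed

text \<open>
  In residue characteristic 2 squaring is injective on the finite residue field, hence surjective.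
\<close>

lemma residue_square_root:
  fixes n :: "'f::nonarch_local_field"
  assumes two: "aval (2::'f) < 1" and n: "n \<in> int_ring"
  shows "\<exists>r\<in>int_ring. aval (n - r ^ 2) < 1"
proof -
  obtain T :: "'f set" where T: "finite T" "T \<subseteq> int_ring" "\<And>x. x \<in> int_ring \<Longrightarrow> \<exists>!t. t \<in> T \<and> aval (x - t) < 1"
    using residue_representatives by metis
  define rep where "rep x = (THE t. t \<in> T \<and> aval (x - t) < 1)" for x
  have rep: "rep x \<in> T" "aval (x - rep x) < 1" if "x \<in> int_ring" for x
    using theI'[OF T(3)[OF that]] unfolding rep_def by blast+
  have inj: "inj_on (\<lambda>x. rep (x ^ 2)) T"
  proof (rule inj_onI)
    fix x y assume xy: "x \<in> T" "y \<in> T" "rep (x ^ 2) = rep (y ^ 2)"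
    then have i: "x \<in> int_ring" "y \<in> int_ring" using T(2) by auto
    have "aval ((x ^ 2 - rep (x ^ 2)) - (y ^ 2 - rep (y ^ 2))) < 1"
      by (rule aval_diff_less; intro rep(2) int_ring_power i)
    then have sq: "aval ((x - y) * (x + y)) < 1" using xy(3) by (simp add: power2_eq_square algebra_simps)
    have "aval (x - y) < 1"
    proof (rule ccontr)
      assume "\<not> aval (x - y) < 1"
      then have "aval (x - y) = 1" using int_ring_diff[OF i] by (simp add: int_ring_def)
      then have "aval (x + y) < 1" using sq by (simp add: aval_mult)
      moreover have "aval (2 * y) < 1" using two i by (intro aval_mult_less_1) simp_all
      ultimately have "aval ((x + y) - 2 * y) < 1" by (rule aval_diff_less)
      then show False using \<open>aval (x - y) = 1\<close> by (simp add: algebra_simps)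
    qed
    then show "x = y" using T(3)[OF i(1)] xy(1,2) by (auto simp: dist_self)
  qed
  moreover have "(\<lambda>x. rep (x ^ 2)) ` T \<subseteq> T" using rep(1) T(2) by (auto intro: int_ring_power)
  ultimately have "(\<lambda>x. rep (x ^ 2)) ` T = T" using T(1) by (simp add: endo_inj_surj)
  then obtain r where r: "r \<in> T" "rep n = rep (r ^ 2)" using rep(1)[OF n] by blast
  then have ri: "r \<in> int_ring" using T(2) by blast
  have "aval ((n - rep n) - (r ^ 2 - rep (r ^ 2))) < 1"
    by (rule aval_diff_less; intro rep(2) int_ring_power ri n)
  then show ?thesis using ri r(2) by auto
qed

context quadratic_ext
begin

lemma norm_ring_coords:
  assumes "g \<notin> range \<iota>" "\<sigma> g = \<iota> t - g" "g * \<sigma> g = \<iota> n" "maximal_quadratic t n"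
  shows "\<iota> x + \<iota> y * g \<in> norm_ring \<longleftrightarrow> x \<in> int_ring \<and> y \<in> int_ring"
proof
  assume "\<iota> x + \<iota> y * g \<in> norm_ring"
  then show "x \<in> int_ring \<and> y \<in> int_ring"
    using assms(4) unfolding norm_ring_def mem_Collect_eq coord_Nm_Tr[OF assms(2,3)] maximal_quadratic_def by blast
next
  assume "x \<in> int_ring \<and> y \<in> int_ring"
  moreover have "n \<in> int_ring" using assms(4) by (simp add: maximal_quadratic_def)
  then have "g \<in> norm_ring" using coord_Nm_Tr(1)[OF assms(2,3), of 0 1] by (simp add: norm_ring_def int_ring_def iota_hom)
  ultimately show "\<iota> x + \<iota> y * g \<in> norm_ring" by (intro norm_ring_add norm_ring_mult) (simp_all add: norm_ring_iota)
qed

text \<open>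
  The ring of integers is compact in any matrix representation, so Hensel's lemma applies to it. The
  embedding \<open>\<gamma>\<close> supplies such a representation.
\<close>

lemma hensel_norm_ring:
  fixes \<gamma> :: "'k \<Rightarrow> 'f^'m^'m"
  assumes g: "g \<notin> range \<iota>" "\<sigma> g = \<iota> t - g" "g * \<sigma> g = \<iota> n" "maximal_quadratic t n"
    and \<gamma>: "alg_embedding UNIV \<iota> \<gamma>" and AB: "A \<in> norm_ring" "B \<in> norm_ring"
  shows "\<exists>y\<in>norm_ring. y = A + \<iota> uniformizer * (B * y ^ 2)"
proof -
  have hom: "\<gamma> (\<iota> c) = mat c" "\<gamma> (x + y) = \<gamma> x + \<gamma> y" "\<gamma> (x * y) = \<gamma> x ** \<gamma> y" for c x y
    using \<gamma> by (auto simp: alg_embedding_def)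
  have inj: "x = y" if "\<gamma> x = \<gamma> y" for x y
  proof (rule ccontr)
    assume "x \<noteq> y"
    have "\<gamma> 0 = 0" using hom(1)[of 0] by simp
    have "\<gamma> (x - y) + \<gamma> y = \<gamma> x" using hom(2)[of "x - y" y] by simp
    then have "\<gamma> (x - y) = 0" using that by simp
    then have "\<gamma> ((x - y) * inverse (x - y)) = 0" by (simp add: hom)
    then have "mat 1 = (mat 0 :: 'f^'m^'m)" using \<open>x \<noteq> y\<close> hom(1)[of 1] by (simp add: iota_hom)
    then show False by (simp only: mat_eq_iff) simp
  qed
  let ?C = "\<gamma> ` norm_ring"
  have C: "?C = (\<lambda>xy. mat (fst xy) + mat (snd xy) ** \<gamma> g) ` (int_ring \<times> int_ring)"
  proof (intro Set.set_eqI iffI)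
    fix M assume "M \<in> ?C"
    then obtain z where z: "z \<in> norm_ring" "M = \<gamma> z" by blast
    obtain x y where xy: "z = \<iota> x + \<iota> y * g" using generator_spans[OF g(1)] by blast
    then have "x \<in> int_ring" "y \<in> int_ring" using z(1) norm_ring_coords[OF g] by auto
    moreover have "M = mat x + mat y ** \<gamma> g" unfolding z(2) xy by (simp add: hom)
    ultimately show "M \<in> (\<lambda>xy. mat (fst xy) + mat (snd xy) ** \<gamma> g) ` (int_ring \<times> int_ring)"
      by (intro image_eqI[of _ _ "(x, y)"]) auto
  next
    fix M assume "M \<in> (\<lambda>xy. mat (fst xy) + mat (snd xy) ** \<gamma> g) ` (int_ring \<times> int_ring)"
    then obtain x y where xy: "x \<in> int_ring" "y \<in> int_ring" "M = mat x + mat y ** \<gamma> g" by auto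
    then have "M = \<gamma> (\<iota> x + \<iota> y * g)" by (simp add: hom)
    then show "M \<in> ?C" using xy norm_ring_coords[OF g] by blast
  qed
  have cont: "continuous_on S (\<lambda>x. a x + b x)" if "continuous_on S a" "continuous_on S b"
    for S and a b :: "'f \<times> 'f \<Rightarrow> 'f^'m^'m"
  proof -
    have eq: "(\<lambda>x. a x + b x) = (\<lambda>x. \<chi> i j. a x $ i $ j + b x $ i $ j)" by (simp add: fun_eq_iff vec_eq_iff)
    show ?thesis unfolding eq by (intro continuous_intros that)
  qed
  have int: "compact (int_ring :: 'f set)" using compact_unit_ball unfolding int_ring_def .
  have "compact ?C" unfolding C
    by (intro compact_continuous_image compact_Times int cont continuous_intros)
  moreover have "x + y \<in> ?C" "x ** y \<in> ?C" "x ** y = y ** x" if xy: "x \<in> ?C" "y \<in> ?C" for x y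
  proof -
    obtain u v where uv: "u \<in> norm_ring" "x = \<gamma> u" "v \<in> norm_ring" "y = \<gamma> v" using xy by auto
    then show "x + y \<in> ?C" "x ** y \<in> ?C" "x ** y = y ** x"
      using norm_ring_add[of u v] norm_ring_mult[of u v] hom(3)[of u v] hom(3)[of v u]
      by (auto simp: mult.commute simp flip: hom)
  qed
  moreover have "mat uniformizer \<in> ?C"
    using norm_ring_iota[of uniformizer] hom(1) by (metis image_eqI uniformizer_int)
  ultimately have "\<exists>y\<in>?C. y = \<gamma> A + mat uniformizer ** (\<gamma> B ** (y ** y))"
    using AB by (intro hensel_quadratic) auto
  then obtain y where y: "y \<in> norm_ring" "\<gamma> y = \<gamma> A + mat uniformizer ** (\<gamma> B ** (\<gamma> y ** \<gamma> y))" by blast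
  then have "\<gamma> y = \<gamma> (A + \<iota> uniformizer * (B * y ^ 2))" by (simp add: hom power2_eq_square)
  then show ?thesis using inj y(1) by blast
qed

text \<open>
  The derivative \<open>2 x - t'\<close> at an approximate root has a square that is congruent to the unit
  discriminant, so it is a unit and the Hensel equation can be normalized.
\<close>

lemma residual_root_lifts:
  fixes \<gamma> :: "'k \<Rightarrow> 'f^'m^'m"
  assumes g: "g \<notin> range \<iota>" "\<sigma> g = \<iota> t - g" "g * \<sigma> g = \<iota> n" "maximal_quadratic t n"
    and \<gamma>: "alg_embedding UNIV \<iota> \<gamma>"
    and tn: "t' \<in> int_ring" "n' \<in> int_ring" "aval (t' ^ 2 - 4 * n') = 1"
    and x: "x \<in> norm_ring" "e \<in> norm_ring" "x ^ 2 - \<iota> t' * x + \<iota> n' = \<iota> uniformizer * e"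
  shows "\<exists>z. z * z = \<iota> t' * z - \<iota> n'"
proof -
  let ?D = "2 * x - \<iota> t'" and ?d = "t' ^ 2 - 4 * n'" and ?p = "uniformizer :: 'f"
  have two: "2 \<in> norm_ring" "4 \<in> norm_ring" using norm_ring_iota[of 2] norm_ring_iota[of 4] by (simp_all add: iota_numeral)
  have "?D ^ 2 = \<iota> ?d + \<iota> ?p * (4 * e)"
  proof -
    have "?D ^ 2 = 4 * (x ^ 2 - \<iota> t' * x + \<iota> n') + (\<iota> t' ^ 2 - 4 * \<iota> n')"
      by (simp add: power2_eq_square algebra_simps)
    then show ?thesis unfolding x(3) by (simp add: iota_simps algebra_simps)
  qed
  moreover have "aval (Nm (\<iota> ?d + \<iota> ?p * (4 * e))) = 1"
  proof -
    have e4: "\<iota> ?d * \<sigma> (4 * e) \<in> norm_ring"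
      using norm_ring_mult[of 4 e] two x(2) tn
      by (intro norm_ring_mult) (auto simp: norm_ring_iota norm_ring_def Nm_sigma int_ring_def aval_power)
    have "Nm (\<iota> ?d + \<iota> ?p * (4 * e)) = ?d ^ 2 + (?p ^ 2 * Nm (4 * e) + Tr (\<iota> ?p * (\<iota> ?d * \<sigma> (4 * e))))"
      by (simp only: Nm_add Nm_mult Nm_iota sigma_hom sigma_iota) (simp add: algebra_simps)
    also have "Tr (\<iota> ?p * (\<iota> ?d * \<sigma> (4 * e))) = ?p * Tr (\<iota> ?d * \<sigma> (4 * e))"
    proof -
      have "\<iota> (Tr (\<iota> ?p * y)) = \<iota> (?p * Tr y)" for y by (simp add: Tr iota_hom sigma_hom algebra_simps del: iota_eq)
      then show ?thesis by simp
    qed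
    finally have N: "Nm (\<iota> ?d + \<iota> ?p * (4 * e)) = ?d ^ 2 + ?p * (?p * Nm (4 * e) + Tr (\<iota> ?d * \<sigma> (4 * e)))"
      by (simp add: power2_eq_square algebra_simps)
    have "aval (?p * Nm (4 * e) + Tr (\<iota> ?d * \<sigma> (4 * e))) \<le> 1"
      using Tr_bound e4 norm_ring_mult[OF two(2) x(2)] aval_uniformizer_less[where ?'f='f]
      by (intro aval_add_le) (auto simp: norm_ring_def aval_mult intro: mult_le_one)
    then have "aval (?p * (?p * Nm (4 * e) + Tr (\<iota> ?d * \<sigma> (4 * e)))) < 1"
      using aval_uniformizer_less[where ?'f='f] by (simp add: aval_mult) (meson le_less_trans mult_left_le zero_le_dist)
    then show ?thesis unfolding N using tn(3) by (subst aval_add_eq) (simp_all add: aval_power)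
  qed
  ultimately have "aval (Nm ?D ^ 2) = 1" by (metis Nm_mult power2_eq_square)
  then have ND: "aval (Nm ?D) = 1" by (rule square_eq_1)
  then have D0: "?D \<noteq> 0" using Nm_iota[of 0] by auto
  have "Nm ?D * Nm (inverse ?D) = 1" using D0 Nm_mult[of ?D "inverse ?D"] by simp
  then have "aval (Nm (inverse ?D)) = 1" using ND by (metis aval_mult aval_one mult.left_neutral)
  then have Di: "inverse ?D \<in> norm_ring" by (simp add: norm_ring_def)
  have "\<exists>y\<in>norm_ring. y = - (inverse ?D * e) + \<iota> ?p * (- inverse ?D * y ^ 2)"
    using Di x(2) by (intro hensel_norm_ring[OF g \<gamma>] norm_ring_minus norm_ring_mult)
  then obtain y where y: "y = - (inverse ?D * e) + \<iota> ?p * (- inverse ?D * y ^ 2)" by blast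
  have "?D * y = ?D * (- (inverse ?D * e) + \<iota> ?p * (- inverse ?D * y ^ 2))" using y by simp
  also have "\<dots> = - e - \<iota> ?p * y ^ 2"
  proof -
    have "w * (- (v * e) + \<iota> ?p * (- v * y ^ 2)) = - (w * v) * e - \<iota> ?p * (w * v) * y ^ 2" for w v
      by (simp add: algebra_simps)
    then show ?thesis using D0 by simp
  qed
  finally have Dy: "?D * y = - e - \<iota> ?p * y ^ 2" .
  let ?z = "x + \<iota> ?p * y"
  have "?z * ?z - \<iota> t' * ?z + \<iota> n' = (x ^ 2 - \<iota> t' * x + \<iota> n') + \<iota> ?p * (?D * y) + \<iota> ?p * \<iota> ?p * y ^ 2"
    by (simp add: power2_eq_square algebra_simps)
  also have "\<dots> = 0" unfolding x(3) Dy by (simp add: power2_eq_square algebra_simps)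
  finally have "?z * ?z = \<iota> t' * ?z - \<iota> n'" by (simp add: algebra_simps eq_neg_iff_add_eq_0)
  then show ?thesis by blast
qed

text \<open>
  Every monic quadratic polynomial over the residue field \<open>k\<close> has a root in the quadratic extension
  \<open>k\<^sub>2\<close>. The map from \<open>k \<times> k\<close>, by sum and product, and from \<open>k\<^sub>2\<close>, by trace and norm, to polynomials
  has fibres with at most two points, since a polynomial has at most two roots; the source has twice
  as many points as the target.
\<close>

lemma residual_root_exists:
  assumes g: "g \<notin> range \<iota>" "\<sigma> g = \<iota> t - g" "g * \<sigma> g = \<iota> n"
    and nr: "no_root t n" "t \<in> int_ring" "n \<in> int_ring" "aval (t ^ 2 - 4 * n) = 1"
    and tn: "t' \<in> int_ring" "n' \<in> int_ring"
  shows "\<exists>x\<in>norm_ring. \<exists>e\<in>norm_ring. x ^ 2 - \<iota> t' * x + \<iota> n' = \<iota> uniformizer * e"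
proof -
  let ?p = "uniformizer :: 'f"
  note mq = maximal_quadratic_unit_disc[OF nr]
  note coords = norm_ring_coords[OF g mq]
  define m where "m = {z. aval (Nm z) < 1}"
  have m_coords: "\<iota> x + \<iota> y * g \<in> m \<Longrightarrow> aval x < 1 \<and> aval y < 1" for x y
    using unit_disc_anisotropic_mod[OF nr] unfolding m_def mem_Collect_eq coord_Nm_Tr[OF g(2,3)] by blast
  have m_iff: "z \<in> m \<longleftrightarrow> (\<exists>e\<in>norm_ring. z = \<iota> ?p * e)" for z
  proof
    assume z: "z \<in> m"
    obtain x y where xy: "z = \<iota> x + \<iota> y * g" using generator_spans[OF g(1)] by blast
    then have small: "aval x < 1" "aval y < 1" using m_coords z by auto
    obtain x' where x': "x' \<in> int_ring" "x = ?p * x'" using divide_uniformizer[OF small(1)] .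
    obtain y' where y': "y' \<in> int_ring" "y = ?p * y'" using divide_uniformizer[OF small(2)] .
    have "z = \<iota> ?p * (\<iota> x' + \<iota> y' * g)" unfolding xy x'(2) y'(2) by (simp add: iota_hom algebra_simps)
    then show "\<exists>e\<in>norm_ring. z = \<iota> ?p * e" using coords x' y' by blast
  next
    assume "\<exists>e\<in>norm_ring. z = \<iota> ?p * e"
    then obtain e where e: "e \<in> norm_ring" "z = \<iota> ?p * e" by blast
    have "aval ?p ^ 2 * aval (Nm e) \<le> aval ?p ^ 2" using e(1) by (intro mult_left_le) (auto simp: norm_ring_def)
    also have "\<dots> < 1" using aval_uniformizer_less[where ?'f='f] by (simp add: power_less_one_iff)
    finally show "z \<in> m" by (simp add: m_def e(2) Nm_mult aval_mult aval_power)
  qed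
  have m_add: "y + z \<in> m" if "y \<in> m" "z \<in> m" for y z
    using that unfolding m_iff by (metis distrib_left norm_ring_add)
  have m_mult: "y * z \<in> m" if "y \<in> m" "z \<in> norm_ring" for y z
    using that unfolding m_iff by (metis mult.assoc norm_ring_mult)
  have m_minus: "- z \<in> m" if "z \<in> m" for z using that by (simp add: m_def)
  have m_diff: "y - z \<in> m" if "y \<in> m" "z \<in> m" for y z using m_add[OF that(1) m_minus[OF that(2)]] by simp
  have m_prime: "y \<in> m \<or> z \<in> m" if "y * z \<in> m" "y \<in> norm_ring" "z \<in> norm_ring" for y z
  proof (rule ccontr)
    assume "\<not> (y \<in> m \<or> z \<in> m)"
    then have "aval (Nm y) = 1" "aval (Nm z) = 1" using that by (auto simp: m_def norm_ring_def)
    then show False using that(1) by (simp add: m_def Nm_mult aval_mult)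
  qed
  have m_iota: "\<iota> x \<in> m \<longleftrightarrow> aval x < 1" for x
    using square_less_1[of x] by (auto simp: m_def aval_power power_less_one_iff)
  obtain T :: "'f set" where T: "finite T" "T \<subseteq> int_ring" "\<And>x. x \<in> int_ring \<Longrightarrow> \<exists>!t. t \<in> T \<and> aval (x - t) < 1"
    using residue_representatives by metis
  define rep where "rep x = (THE t. t \<in> T \<and> aval (x - t) < 1)" for x
  have rep: "rep x \<in> T" "aval (x - rep x) < 1" if "x \<in> int_ring" for x
    using theI'[OF T(3)[OF that]] unfolding rep_def by blast+
  have T_eq: "x = y" if "x \<in> T" "y \<in> T" "aval (x - y) < 1" for x y
    using T(3)[of x] that T(2) by (metis dist_self diff_self subsetD zero_less_one)
  have rep_eq: "x = rep y" if "x \<in> T" "y \<in> int_ring" "aval (x - y) < 1" for x y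
    using T_eq[OF that(1) rep(1)[OF that(2)]] aval_add_less[of "x - y" 1 "y - rep y"] rep(2)[OF that(2)] that by simp
  let ?o = "rep 0"
  have o: "aval ?o < 1" "?o \<in> T" using rep[of 0] by simp_all
  define el where "el a b = \<iota> a + \<iota> b * g" for a b
  have el_O: "el a b \<in> norm_ring" if "a \<in> T" "b \<in> T" for a b using coords T(2) that unfolding el_def by blast
  have iota_O: "\<iota> a \<in> norm_ring" if "a \<in> T" for a using T(2) that norm_ring_iota by blast
  have sg: "\<sigma> (el a b) = el (a + b * t) (- b)" for a b
    by (simp add: el_def sigma_hom g(2) iota_simps algebra_simps)
  have el_diff: "el a b - el a' b' = \<iota> (a - a') + \<iota> (b - b') * g" for a b a' b'
    by (simp add: el_def iota_simps algebra_simps)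
  have el_m: "aval (a - a') < 1 \<and> aval (b - b') < 1" if "el a b - el a' b' \<in> m" for a b a' b'
    using that m_coords unfolding el_diff by blast
  have el_iota: "\<iota> a = el a 0" for a by (simp add: el_def)
  \<comment> \<open>The left summand stands for split polynomials, given by two roots in the residue field, and the right one for conjugate roots in its extension; \<open>sm\<close> and \<open>pr\<close> are the sum and the product of the roots.\<close>
  define rt :: "'f \<times> 'f + 'f \<times> 'f \<Rightarrow> 'k \<times> 'k" where
    "rt e = (case e of Inl (a, b) \<Rightarrow> (\<iota> a, \<iota> b) | Inr (a, b) \<Rightarrow> (el a b, \<sigma> (el a b)))" for e
  define sm :: "'f \<times> 'f + 'f \<times> 'f \<Rightarrow> 'f" where
    "sm e = (case e of Inl (a, b) \<Rightarrow> a + b | Inr (a, b) \<Rightarrow> Tr (el a b))" for e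
  define pr :: "'f \<times> 'f + 'f \<times> 'f \<Rightarrow> 'f" where
    "pr e = (case e of Inl (a, b) \<Rightarrow> a * b | Inr (a, b) \<Rightarrow> Nm (el a b))" for e
  \<comment> \<open>The other point with the same polynomial: the roots are interchanged, except that a double root occurs once in each summand.\<close>
  define partner :: "'f \<times> 'f + 'f \<times> 'f \<Rightarrow> 'f \<times> 'f + 'f \<times> 'f" where
    "partner e = (case e of Inl (a, b) \<Rightarrow> if a \<noteq> b then Inl (b, a) else Inr (a, ?o)
      | Inr (a, b) \<Rightarrow> if b = ?o then Inl (a, a) else Inr (rep (a + b * t), rep (- b)))" for e
  let ?S = "(T \<times> T) <+> (T \<times> T)"
  have sig_O: "\<sigma> z \<in> norm_ring" if "z \<in> norm_ring" for z using that by (simp add: norm_ring_def Nm_sigma)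
  have rt_O: "fst (rt e) \<in> norm_ring" "snd (rt e) \<in> norm_ring" if "e \<in> ?S" for e
    using that el_O iota_O sig_O by (auto simp: rt_def)
  have rt_sum: "fst (rt e) + snd (rt e) = \<iota> (sm e)" and rt_prod: "fst (rt e) * snd (rt e) = \<iota> (pr e)" for e
    by (auto simp: rt_def sm_def pr_def iota_hom Tr Nm split: sum.split)
  have sp_int: "sm e \<in> int_ring" "pr e \<in> int_ring" if "e \<in> ?S" for e
    using norm_ring_add[OF rt_O[OF that]] norm_ring_mult[OF rt_O[OF that]] unfolding rt_sum rt_prod norm_ring_iota by auto
  define f where "f e = (rep (sm e), rep (pr e))" for e
  have root_mod: "fst (rt e) ^ 2 - \<iota> s * fst (rt e) + \<iota> q \<in> m"
    if "e \<in> ?S" "aval (s - sm e) < 1" "aval (q - pr e) < 1" for e s q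
  proof -
    let ?u = "fst (rt e)" and ?v = "snd (rt e)"
    have "?u ^ 2 - \<iota> s * ?u + \<iota> q = \<iota> (q - pr e) - \<iota> (s - sm e) * ?u + (?u ^ 2 - (?u + ?v) * ?u + ?u * ?v)"
      by (simp add: rt_sum rt_prod iota_diff algebra_simps)
    also have "?u ^ 2 - (?u + ?v) * ?u + ?u * ?v = 0" by (simp add: power2_eq_square algebra_simps)
    finally show ?thesis
      using m_diff[OF _ m_mult[OF _ rt_O(1)[OF that(1)]]] that(2,3) m_iota by (simp del: iota_eq)
  qed
  have fibre: "(fst (rt e') - fst (rt e) \<in> m \<and> snd (rt e') - snd (rt e) \<in> m) \<or>
      (fst (rt e') - snd (rt e) \<in> m \<and> snd (rt e') - fst (rt e) \<in> m)"
    if e: "e \<in> ?S" "e' \<in> ?S" "f e' = f e" for e e'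
  proof -
    let ?u = "fst (rt e)" and ?v = "snd (rt e)" and ?u' = "fst (rt e')" and ?v' = "snd (rt e')"
    have "aval ((sm e - rep (sm e)) - (sm e' - rep (sm e'))) < 1" "aval ((pr e - rep (pr e)) - (pr e' - rep (pr e'))) < 1"
      by (rule aval_diff_less; intro rep(2) sp_int e)+
    then have close: "aval (sm e - sm e') < 1" "aval (pr e - pr e') < 1" using e(3) by (simp_all add: f_def)
    have "(?u' - ?u) * (?u' - ?v) = ?u' ^ 2 - \<iota> (sm e) * ?u' + \<iota> (pr e)"
      by (simp add: power2_eq_square algebra_simps flip: rt_sum rt_prod)
    then have "(?u' - ?u) * (?u' - ?v) \<in> m" using root_mod[OF e(2) close] by simp
    then have d: "?u' - ?u \<in> m \<or> ?u' - ?v \<in> m"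
      by (rule m_prime) (intro norm_ring_diff rt_O e)+
    have "aval (sm e' - sm e) < 1" using close(1) aval_minus[of "sm e - sm e'"] by simp
    then have "\<iota> (sm e' - sm e) \<in> m" by (simp only: m_iota)
    then have s: "(?u' + ?v') - (?u + ?v) \<in> m" by (simp add: rt_sum iota_diff)
    show ?thesis using d
    proof
      assume d: "?u' - ?u \<in> m"
      have "((?u' + ?v') - (?u + ?v)) - (?u' - ?u) = ?v' - ?v" by (simp add: algebra_simps)
      then show ?thesis using d m_diff[OF s d] by simp
    next
      assume d: "?u' - ?v \<in> m"
      have "((?u' + ?v') - (?u + ?v)) - (?u' - ?v) = ?v' - ?u" by (simp add: algebra_simps)
      then show ?thesis using d m_diff[OF s d] by simp
    qed
  qed
  have fib2: "{e' \<in> ?S. f e' = f e} \<subseteq> {e, partner e}" if e: "e \<in> ?S" for e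
  proof (intro subsetI, rule ccontr)
    fix e' assume "e' \<in> {e' \<in> ?S. f e' = f e}" and ne: "e' \<notin> {e, partner e}"
    then have e': "e' \<in> ?S" "f e' = f e" "e' \<noteq> partner e" by auto
    note fb = fibre[OF e e'(1,2)]
    have small_o: "b = ?o" if "b \<in> T" "aval (b - 0) < 1 \<or> aval (0 - b) < 1" for b
      using rep_eq[OF that(1), of 0] that(2) by auto
    have "e' = e"
    proof (cases e)
      case (Inl ab)
      obtain a b where ab: "ab = (a, b)" "a \<in> T" "b \<in> T" using Inl e by (cases ab) auto
      have rte: "rt e = (\<iota> a, \<iota> b)" by (simp add: rt_def Inl ab)
      show ?thesis
      proof (cases e')
        case (Inl ab')
        obtain a' b' where ab': "ab' = (a', b')" "a' \<in> T" "b' \<in> T" using Inl e'(1) by (cases ab') auto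
        have rte': "rt e' = (\<iota> a', \<iota> b')" by (simp add: rt_def Inl ab')
        have "(a' = a \<and> b' = b) \<or> (a' = b \<and> b' = a)"
          using fb T_eq ab ab' unfolding rte rte' by (auto simp: m_iota simp flip: iota_diff)
        then show ?thesis using e'(3) \<open>e = Inl ab\<close> Inl ab ab' by (auto simp: partner_def split: if_splits)
      next
        case (Inr ab')
        obtain a' b' where ab': "ab' = (a', b')" "a' \<in> T" "b' \<in> T" using Inr e'(1) by (cases ab') auto
        have rte': "rt e' = (el a' b', el (a' + b' * t) (- b'))" by (simp add: rt_def Inr ab' sg)
        have "(a' = a \<or> a' = b) \<and> b' = ?o \<and> a = b"
          using fb
        proof
          assume *: "fst (rt e') - fst (rt e) \<in> m \<and> snd (rt e') - snd (rt e) \<in> m"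
          then have 1: "aval (a' - a) < 1" "aval (b' - 0) < 1" "aval (a' + b' * t - b) < 1"
            unfolding rte rte' using el_m[of a' b' a 0] el_m[of "a' + b' * t" "- b'" b 0] by (auto simp: el_iota)
          have bt: "aval (b' * t) < 1" using 1(2) nr(2) by (intro aval_mult_less_1) simp_all
          have "aval ((a' + b' * t - b) - b' * t - (a' - a)) < 1" by (rule aval_diff_less[OF aval_diff_less[OF 1(3) bt] 1(1)])
          then have "a = b" using T_eq ab by (simp add: algebra_simps)
          then show ?thesis using 1 T_eq[of a' a] small_o[of b'] ab ab' by auto
        next
          assume *: "fst (rt e') - snd (rt e) \<in> m \<and> snd (rt e') - fst (rt e) \<in> m"
          then have 1: "aval (a' - b) < 1" "aval (b' - 0) < 1" "aval (a' + b' * t - a) < 1"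
            unfolding rte rte' using el_m[of a' b' b 0] el_m[of "a' + b' * t" "- b'" a 0] by (auto simp: el_iota)
          have bt: "aval (b' * t) < 1" using 1(2) nr(2) by (intro aval_mult_less_1) simp_all
          have "aval ((a' + b' * t - a) - b' * t - (a' - b)) < 1" by (rule aval_diff_less[OF aval_diff_less[OF 1(3) bt] 1(1)])
          then have "b = a" using T_eq ab by (simp add: algebra_simps)
          then show ?thesis using 1 T_eq[of a' b] small_o[of b'] ab ab' by auto
        qed
        then show ?thesis using e'(3) \<open>e = Inl ab\<close> Inr ab ab' by (auto simp: partner_def)
      qed
    next
      case (Inr ab)
      obtain a b where ab: "ab = (a, b)" "a \<in> T" "b \<in> T" using Inr e by (cases ab) auto
      have rte: "rt e = (el a b, el (a + b * t) (- b))" by (simp add: rt_def Inr ab sg)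
      have ints: "a + b * t \<in> int_ring" "- b \<in> int_ring" using ab T(2) nr(2) by (auto intro!: int_ring_intros)
      show ?thesis
      proof (cases e')
        case (Inl ab')
        obtain a' b' where ab': "ab' = (a', b')" "a' \<in> T" "b' \<in> T" using Inl e'(1) by (cases ab') auto
        have rte': "rt e' = (\<iota> a', \<iota> b')" by (simp add: rt_def Inl ab')
        have "b = ?o \<and> a' = a \<and> b' = a"
          using fb
        proof
          assume *: "fst (rt e') - fst (rt e) \<in> m \<and> snd (rt e') - snd (rt e) \<in> m"
          then have 1: "aval (a' - a) < 1" "aval (0 - b) < 1" "aval (b' - (a + b * t)) < 1"
            unfolding rte rte' using el_m[of a' 0 a b] el_m[of b' 0 "a + b * t" "- b"] by (auto simp: el_iota)
          have bt: "aval (b * t) < 1" using 1(2) nr(2) by (intro aval_mult_less_1) simp_all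
          have "aval ((b' - (a + b * t)) + b * t) < 1" by (rule aval_add_less[OF 1(3) bt])
          then have "b' = a" using T_eq ab ab' by (simp add: algebra_simps)
          then show ?thesis using 1 T_eq[of a' a] small_o[of b] ab ab' by auto
        next
          assume *: "fst (rt e') - snd (rt e) \<in> m \<and> snd (rt e') - fst (rt e) \<in> m"
          then have 1: "aval (b' - a) < 1" "aval (0 - b) < 1" "aval (a' - (a + b * t)) < 1"
            unfolding rte rte' using el_m[of b' 0 a b] el_m[of a' 0 "a + b * t" "- b"] by (auto simp: el_iota)
          have bt: "aval (b * t) < 1" using 1(2) nr(2) by (intro aval_mult_less_1) simp_all
          have "aval ((a' - (a + b * t)) + b * t) < 1" by (rule aval_add_less[OF 1(3) bt])
          then have "a' = a" using T_eq ab ab' by (simp add: algebra_simps)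
          then show ?thesis using 1 T_eq[of b' a] small_o[of b] ab ab' by auto
        qed
        then show ?thesis using e'(3) \<open>e = Inr ab\<close> Inl ab ab' by (auto simp: partner_def)
      next
        case (Inr ab')
        obtain a' b' where ab': "ab' = (a', b')" "a' \<in> T" "b' \<in> T" using Inr e'(1) by (cases ab') auto
        have rte': "rt e' = (el a' b', el (a' + b' * t) (- b'))" by (simp add: rt_def Inr ab' sg)
        have "(a' = a \<and> b' = b) \<or> (b \<noteq> ?o \<and> a' = rep (a + b * t) \<and> b' = rep (- b))"
          using fb
        proof
          assume "fst (rt e') - fst (rt e) \<in> m \<and> snd (rt e') - snd (rt e) \<in> m"
          then have "aval (a' - a) < 1" "aval (b' - b) < 1" unfolding rte rte' using el_m[of a' b' a b] by auto
          then show ?thesis using T_eq ab ab' by blast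
        next
          assume *: "fst (rt e') - snd (rt e) \<in> m \<and> snd (rt e') - fst (rt e) \<in> m"
          then have 1: "aval (a' - (a + b * t)) < 1" "aval (b' - - b) < 1"
            unfolding rte rte' using el_m[of a' b' "a + b * t" "- b"] by auto
          show ?thesis
          proof (cases "b = ?o")
            case True
            then have b: "aval b < 1" using o by simp
            have bt: "aval (b * t) < 1" using b nr(2) by (intro aval_mult_less_1) simp_all
            have "aval ((a' - (a + b * t)) + b * t) < 1" "aval ((b' - - b) - b - b) < 1"
              by (rule aval_add_less[OF 1(1) bt], rule aval_diff_less[OF aval_diff_less[OF 1(2) b] b])
            then have "a' = a" "b' = b" using T_eq ab ab' by (simp_all add: algebra_simps)
            then show ?thesis by simp
          next
            case False
            then show ?thesis using rep_eq[OF ab'(2) ints(1) 1(1)] rep_eq[OF ab'(3) ints(2) 1(2)] by simp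
          qed
        qed
        then show ?thesis using e'(3) \<open>e = Inr ab\<close> Inr ab ab' by (auto simp: partner_def)
      qed
    qed
    then show False using ne by simp
  qed
  have finS: "finite ?S" using T(1) by simp
  have "card ?S \<le> 2 * card (f ` ?S)" by (rule card_le_two_fibres[OF finS fib2])
  then have "card (T \<times> T) \<le> card (f ` ?S)" using T(1) by (simp add: card_Plus)
  moreover have "f ` ?S \<subseteq> T \<times> T" using sp_int rep(1) unfolding f_def by blast
  ultimately have "f ` ?S = T \<times> T" using T(1) by (intro card_seteq) auto
  then have "(rep t', rep n') \<in> f ` ?S" using rep(1) tn by auto
  then obtain e where e: "e \<in> ?S" "rep t' = rep (sm e)" "rep n' = rep (pr e)" by (auto simp: f_def)
  have "aval ((t' - rep t') - (sm e - rep (sm e))) < 1" "aval ((n' - rep n') - (pr e - rep (pr e))) < 1"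
    by (rule aval_diff_less; intro rep(2) sp_int[OF e(1)] tn)+
  then have "aval (t' - sm e) < 1" "aval (n' - pr e) < 1" using e by simp_all
  then show ?thesis using root_mod[OF e(1)] rt_O(1)[OF e(1)] m_iff by blast
qed

text \<open>
  An extension that is not isomorphic to the unramified one is ramified. If the discriminant of its
  generating polynomial were a unit, the polynomial would have a root in the unramified extension, first
  modulo the uniformizer and then exactly, and the extensions would be isomorphic. A polynomial with
  discriminant divisible by the uniformizer is a square modulo it; the case of residue characteristic 2
  needs a square root of the constant term.
\<close>

lemma residually_square:
  fixes \<gamma> :: "'k \<Rightarrow> 'f^'m^'m" and \<iota>' :: "'f \<Rightarrow> 'k'::field"
  assumes g: "g \<notin> range \<iota>" "\<sigma> g = \<iota> t - g" "g * \<sigma> g = \<iota> n"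
    and nr: "no_root t n" "t \<in> int_ring" "n \<in> int_ring" "aval (t ^ 2 - 4 * n) = 1"
    and \<gamma>: "alg_embedding UNIV \<iota> \<gamma>"
    and q': "quadratic_galois \<iota>' \<sigma>'" "\<not> alg_isomorphic \<iota> \<iota>'"
    and g': "g' \<notin> range \<iota>'" "\<sigma>' g' = \<iota>' t' - g'" "g' * \<sigma>' g' = \<iota>' n'" "no_root t' n'"
    and tn: "t' \<in> int_ring" "n' \<in> int_ring"
  shows "\<exists>r\<in>int_ring. aval (t' - 2 * r) < 1 \<and> aval (n' - r ^ 2) < 1"
proof -
  let ?d = "t' ^ 2 - 4 * n'"
  have d_int: "?d \<in> int_ring" using tn by (auto intro!: int_ring_intros)
  have d: "aval ?d < 1"
  proof (rule ccontr)
    assume "\<not> aval ?d < 1"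
    then have d1: "aval ?d = 1" using d_int by (simp add: int_ring_def)
    obtain x e where xe: "x \<in> norm_ring" "e \<in> norm_ring" "x ^ 2 - \<iota> t' * x + \<iota> n' = \<iota> uniformizer * e"
      using residual_root_exists[OF g nr tn] by blast
    obtain z where z: "z * z = \<iota> t' * z - \<iota> n'"
      using residual_root_lifts[OF g maximal_quadratic_unit_disc[OF nr] \<gamma> tn d1 xe] by blast
    have "z \<notin> range \<iota>"
    proof
      assume "z \<in> range \<iota>"
      then obtain r where "z = \<iota> r" by blast
      then have "\<iota> (r ^ 2 - t' * r + n') = 0" using z by (simp add: iota_simps power2_eq_square del: iota_eq_0)
      then show False using g'(4) by (simp add: no_root_def)
    qed
    moreover have "g' * (\<iota>' t' - g') = \<iota>' n'" using g'(3) unfolding g'(2) .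
    then have "g' * g' = \<iota>' t' * g' - \<iota>' n'" by (simp add: algebra_simps)
    ultimately show False using alg_isomorphic_same_polynomial[OF q'(1) _ z g'(1)] q'(2) by blast
  qed
  show ?thesis
  proof (cases "aval (2 :: 'f) < 1")
    case True
    have "aval (4 * n') < 1"
    proof -
      have "aval (4 * n') = aval (2::'f) * (aval (2::'f) * aval n')" by (simp flip: aval_mult)
      also have "\<dots> \<le> aval (2::'f)" using True tn by (intro mult_left_le mult_le_one) (auto simp: int_ring_def)
      finally show ?thesis using True by simp
    qed
    then have "aval (?d + 4 * n') < 1" using aval_add_less[OF d] by blast
    then have t': "aval t' < 1" using square_less_1 by simp
    obtain r where r: "r \<in> int_ring" "aval (n' - r ^ 2) < 1" using residue_square_root[OF True tn(2)] by blast
    have "aval (2 * r) < 1" using True r by (intro aval_mult_less_1) simp_all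
    then show ?thesis using r t' aval_diff_less by blast
  next
    case False
    then have two: "aval (2 :: 'f) = 1" using int_ring_numeral[of "num.Bit0 num.One", where ?'f='f] by (simp add: int_ring_def)
    then have two0: "(2 :: 'f) \<noteq> 0" by auto
    let ?r = "t' / 2"
    have four: "aval (4 :: 'f) = 1" using two aval_mult[of "2::'f" 2] by simp
    have "(4 :: 'f) \<noteq> 0" using four by auto
    then have "n' - ?r ^ 2 = - ?d / 4" using two0 by (simp add: power2_eq_square diff_divide_distrib)
    then have "aval (n' - ?r ^ 2) = aval (- ?d / 4)" by (rule arg_cong)
    also have "\<dots> < 1" using d four by (simp only: aval_divide aval_minus div_by_1)
    finally have "aval (n' - ?r ^ 2) < 1" .
    moreover have "t' - 2 * ?r = 0" using two0 by simp
    moreover have "?r \<in> int_ring" using tn two by (simp add: int_ring_def aval_divide)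
    ultimately show ?thesis by (metis dist_self zero_less_one)
  qed
qed

end

section \<open>Tensor products of quadratic extensions\<close>

locale tensor_pair =
  L: quadratic_ext \<iota> \<sigma> + R: quadratic_ext \<iota>' \<sigma>'
  for \<iota> :: "'f::nonarch_local_field \<Rightarrow> 'k::field" and \<sigma> and \<iota>' :: "'f \<Rightarrow> 'l::field" and \<sigma>' +
  fixes i :: "'k \<Rightarrow> 't::comm_ring_1" and j :: "'l \<Rightarrow> 't" and g :: 'l and t n :: 'f
  assumes tensor: "is_tensor_product \<iota> \<iota>' i j"
    and g: "g \<notin> range \<iota>'" "\<sigma>' g = \<iota>' t - g" "g * \<sigma>' g = \<iota>' n"
begin

lemma i_hom: "i 1 = 1" "i (x + y) = i x + i y" "i (x * y) = i x * i y"
  and j_hom: "j 1 = 1" "j (u + v) = j u + j v" "j (u * v) = j u * j v"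
  and ij: "j (\<iota>' c) = i (\<iota> c)"
  using tensor by (auto simp: is_tensor_product_def unital_hom_def o_def fun_eq_iff)

lemma i_0 [simp]: "i 0 = 0"
proof -
  have "i 0 + i 0 = i 0 + 0" using i_hom(2)[of 0 0] by simp
  then show ?thesis by (rule add_left_imp_eq)
qed

lemma i_minus: "i (- x) = - i x"
  using i_hom(2)[of x "- x"] by (simp add: eq_neg_iff_add_eq_0 add.commute)

lemma i_diff: "i (x - y) = i x - i y" using i_hom(2)[of x "- y"] by (simp add: i_minus)

lemma j_0 [simp]: "j 0 = 0"
proof -
  have "j 0 + j 0 = j 0 + 0" using j_hom(2)[of 0 0] by simp
  then show ?thesis by (rule add_left_imp_eq)
qed

lemma j_minus: "j (- x) = - j x"
  using j_hom(2)[of x "- x"] by (simp add: eq_neg_iff_add_eq_0 add.commute)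

lemma j_diff: "j (x - y) = j x - j y" using j_hom(2)[of x "- y"] by (simp add: j_minus)

lemma g_square: "g * g = \<iota>' t * g - \<iota>' n"
proof -
  have "g * (\<iota>' t - g) = \<iota>' n" using g(3) unfolding g(2) .
  then show ?thesis by (simp add: algebra_simps)
qed

lemma j_conj: "j (\<sigma>' g) = i (\<iota> t) - j g"
  by (simp add: g(2) j_diff ij)

lemma g_not_1: "g \<noteq> 1"
  using g(1) R.iota_hom(1) by (metis rangeI)

text \<open>
  Every element of the tensor product is handled through its coordinates with respect to the basis
  \<open>1, g\<close> of the second factor.
\<close>

lemma decomposition: "\<exists>x y. s = i x + i y * j g"
  and decomposition_unique: "i x + i y * j g = i x' + i y' * j g \<Longrightarrow> x = x' \<and> y = y'"
proof -
  have *: "\<exists>!c. (\<forall>b. b \<notin> {1, g} \<longrightarrow> c b = 0) \<and> s = (\<Sum>b\<in>{1, g}. i (c b) * j b)" for s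
    using tensor R.generator_basis[OF g(1)] unfolding is_tensor_product_def by blast
  have sum: "(\<Sum>b\<in>{1, g}. i (c b) * j b) = i (c 1) + i (c g) * j g" for c
    using g_not_1 by (auto simp: j_hom)
  show "\<exists>x y. s = i x + i y * j g" using *[of s] unfolding sum by blast
  assume eq: "i x + i y * j g = i x' + i y' * j g"
  define c c' where "c b = (if b = 1 then x else if b = g then y else 0)"
    and "c' b = (if b = 1 then x' else if b = g then y' else 0)" for b
  have "(\<forall>b. b \<notin> {1, g} \<longrightarrow> c b = 0) \<and> i x + i y * j g = (\<Sum>b\<in>{1, g}. i (c b) * j b)"
    "(\<forall>b. b \<notin> {1, g} \<longrightarrow> c' b = 0) \<and> i x + i y * j g = (\<Sum>b\<in>{1, g}. i (c' b) * j b)"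
    unfolding sum using g_not_1 eq by (auto simp: c_def c'_def)
  then have "c = c'" using *[of "i x + i y * j g"] by blast
  then have "c 1 = c' 1 \<and> c g = c' g" by simp
  then show "x = x' \<and> y = y'" using g_not_1 by (simp add: c_def c'_def)
qed

text \<open>
  A balanced biadditive map takes the same value on all representations of a tensor, since it can be evaluated on the coordinates.
\<close>

lemma tensor_lift_eq:
  fixes \<phi> :: "'k \<Rightarrow> 'l \<Rightarrow> 's::ab_group_add"
  assumes add1: "\<And>x x' y. \<phi> (x + x') y = \<phi> x y + \<phi> x' y" and add2: "\<And>x y y'. \<phi> x (y + y') = \<phi> x y + \<phi> x y'"
    and bal: "\<And>x c y. \<phi> x (\<iota>' c * y) = \<phi> (x * \<iota> c) y"
  shows "tensor_lift i j \<phi> (i x + i y * j g) = \<phi> x 1 + \<phi> y g"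
  unfolding tensor_lift_def
proof (rule the_equality)
  show "\<exists>xys. i x + i y * j g = (\<Sum>(x, y)\<leftarrow>xys. i x * j y) \<and> \<phi> x 1 + \<phi> y g = (\<Sum>(x, y)\<leftarrow>xys. \<phi> x y)"
    by (intro exI[of _ "[(x, 1), (y, g)]"]) (simp add: j_hom)
next
  fix s assume "\<exists>xys. i x + i y * j g = (\<Sum>(x, y)\<leftarrow>xys. i x * j y) \<and> s = (\<Sum>(x, y)\<leftarrow>xys. \<phi> x y)"
  then obtain xys where xys: "i x + i y * j g = (\<Sum>(x, y)\<leftarrow>xys. i x * j y)" "s = (\<Sum>(x, y)\<leftarrow>xys. \<phi> x y)" by blast
  have zero: "\<phi> 0 v = 0" for v
  proof -
    have "\<phi> 0 v + \<phi> 0 v = \<phi> 0 v + 0" using add1[of 0 0 v] by simp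
    then show ?thesis by (rule add_left_imp_eq)
  qed
  have "\<exists>a b. (\<Sum>(x, y)\<leftarrow>xys. i x * j y) = i a + i b * j g \<and> (\<Sum>(x, y)\<leftarrow>xys. \<phi> x y) = \<phi> a 1 + \<phi> b g" for xys
  proof (induction xys)
    case Nil
    show ?case by (intro exI[of _ 0]) (simp add: zero)
  next
    case (Cons p xys)
    obtain u v where p: "p = (u, v)" by fastforce
    obtain a b where ab: "(\<Sum>(x, y)\<leftarrow>xys. i x * j y) = i a + i b * j g" "(\<Sum>(x, y)\<leftarrow>xys. \<phi> x y) = \<phi> a 1 + \<phi> b g"
      using Cons by blast
    obtain c d where v: "v = \<iota>' c + \<iota>' d * g" using R.generator_spans[OF g(1)] by blast
    have "\<phi> u v = \<phi> (u * \<iota> c) 1 + \<phi> (u * \<iota> d) g"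
      unfolding v add2 bal using bal[of u c 1] by simp
    moreover have "i u * j v = i (u * \<iota> c) + i (u * \<iota> d) * j g"
      by (simp add: v j_hom ij i_hom algebra_simps)
    ultimately show ?case
      by (intro exI[of _ "u * \<iota> c + a"] exI[of _ "u * \<iota> d + b"]) (simp add: p ab add1 i_hom algebra_simps)
  qed
  from this[of xys] obtain a b where "(\<Sum>(x, y)\<leftarrow>xys. i x * j y) = i a + i b * j g" "(\<Sum>(x, y)\<leftarrow>xys. \<phi> x y) = \<phi> a 1 + \<phi> b g"
    by blast
  then show "s = \<phi> x 1 + \<phi> y g" using xys decomposition_unique by metis
qed

lemma mem_tensor_fixed_iff:
  "i x + i y * j g \<in> tensor_fixed i j \<sigma> \<sigma>' \<longleftrightarrow> y = - \<sigma> y \<and> x = \<sigma> x + \<sigma> y * \<iota> t"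
proof -
  have "tensor_lift i j (\<lambda>x y. i (\<sigma> x) * j (\<sigma>' y)) (i x + i y * j g) = i (\<sigma> x) * j (\<sigma>' 1) + i (\<sigma> y) * j (\<sigma>' g)"
    by (rule tensor_lift_eq) (simp_all add: L.sigma_hom R.sigma_hom i_hom j_hom ij algebra_simps)
  also have "\<dots> = i (\<sigma> x + \<sigma> y * \<iota> t) + i (- \<sigma> y) * j g"
    by (simp add: R.sigma_hom j_hom j_conj i_hom i_minus algebra_simps)
  finally show ?thesis
    unfolding tensor_fixed_def using decomposition_unique[of "\<sigma> x + \<sigma> y * \<iota> t" "- \<sigma> y" x y] by auto
qed

lemma base_change_eq:
  fixes \<gamma> :: "'l \<Rightarrow> 'f^'m^'m"
  assumes \<gamma>: "alg_embedding UNIV \<iota>' \<gamma>"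
  shows "base_change \<iota> i j \<gamma> (i x + i y * j g) = mat x + mat y ** map_matrix \<iota> (\<gamma> g)"
proof -
  have hom: "\<gamma> (\<iota>' c) = mat c" "\<gamma> (u + v) = \<gamma> u + \<gamma> v" "\<gamma> (u * v) = \<gamma> u ** \<gamma> v" for c u v
    using \<gamma> by (auto simp: alg_embedding_def)
  have g1: "\<gamma> 1 = mat 1" using hom(1)[of 1] by (simp add: R.iota_hom)
  have "base_change \<iota> i j \<gamma> (i x + i y * j g) = mat x ** map_matrix \<iota> (\<gamma> 1) + mat y ** map_matrix \<iota> (\<gamma> g)"
    unfolding base_change_def
  proof (rule tensor_lift_eq)
    show "mat (x + x') ** map_matrix \<iota> (\<gamma> y) = mat x ** map_matrix \<iota> (\<gamma> y) + mat x' ** map_matrix \<iota> (\<gamma> y)" for x x' y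
      by (simp add: mat_add matrix_add_rdist)
    show "mat x ** map_matrix \<iota> (\<gamma> (y + y')) = mat x ** map_matrix \<iota> (\<gamma> y) + mat x ** map_matrix \<iota> (\<gamma> y')" for x y y'
      by (simp add: hom vec_eq_iff mat_entry map_matrix_def L.iota_hom algebra_simps)
    show "mat x ** map_matrix \<iota> (\<gamma> (\<iota>' c * y)) = mat (x * \<iota> c) ** map_matrix \<iota> (\<gamma> y)" for x c y
      by (simp add: hom vec_eq_iff mat_entry map_matrix_def L.iota_hom mult.assoc)
  qed
  also have "map_matrix \<iota> (\<gamma> 1) = mat 1"
    by (simp add: g1 vec_eq_iff map_matrix_def mat_def L.iota_hom)
  finally show ?thesis by simp
qed

text \<open>
  The element \<open>\<theta> = \<zeta> \<otimes> g + \<zeta>' \<otimes> g'\<close>, where primes denote conjugates, has second coordinate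
  \<open>\<zeta> - \<zeta>'\<close>. A fixed element has a second coordinate that is mapped to its negative by the involution, hence
  is an \<open>F\<close>-multiple of \<open>\<zeta> - \<zeta>'\<close>; subtracting the multiple of \<open>\<theta>\<close> leaves a scalar.
\<close>

lemma fixed_ring:
  fixes \<zeta> t1 n1
  assumes \<zeta>: "\<zeta> \<notin> range \<iota>" "\<sigma> \<zeta> = \<iota> t1 - \<zeta>" "\<zeta> * \<sigma> \<zeta> = \<iota> n1"
  defines "\<theta> \<equiv> i \<zeta> * j g + i (\<sigma> \<zeta>) * j (\<sigma>' g)"
  shows fixed_generator_eq: "\<theta> = i (\<sigma> \<zeta> * \<iota> t) + i (\<zeta> - \<sigma> \<zeta>) * j g"
    and fixed_generator_mem: "\<theta> \<in> tensor_fixed i j \<sigma> \<sigma>'"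
    and fixed_generator_spans: "s \<in> tensor_fixed i j \<sigma> \<sigma>' \<Longrightarrow> \<exists>c d. s = i (\<iota> c) + i (\<iota> d) * \<theta>"
    and fixed_generator_square: "\<theta> * \<theta> = i (\<iota> (t1 * t)) * \<theta> - i (\<iota> (n1 * t ^ 2 + t1 ^ 2 * n - 4 * n1 * n))"
    and fixed_generator_conj: "i (\<sigma> \<zeta>) * j g + i \<zeta> * j (\<sigma>' g) = i (\<iota> (t1 * t)) - \<theta>"
proof -
  have \<delta>: "\<zeta> - \<sigma> \<zeta> \<noteq> 0" using \<zeta>(1) L.fixed by auto
  show eq: "\<theta> = i (\<sigma> \<zeta> * \<iota> t) + i (\<zeta> - \<sigma> \<zeta>) * j g"
    by (simp add: \<theta>_def j_conj i_hom i_diff algebra_simps)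
  show "\<theta> \<in> tensor_fixed i j \<sigma> \<sigma>'"
    unfolding eq mem_tensor_fixed_iff
    by (simp add: L.sigma_hom L.sigma_diff L.sigma_sigma algebra_simps)
  show "\<exists>c d. s = i (\<iota> c) + i (\<iota> d) * \<theta>" if s: "s \<in> tensor_fixed i j \<sigma> \<sigma>'"
  proof -
    obtain x y where xy: "s = i x + i y * j g" using decomposition by blast
    have y': "y = - \<sigma> y" and x: "x = \<sigma> x + \<sigma> y * \<iota> t" using s unfolding xy mem_tensor_fixed_iff by blast+
    have y: "\<sigma> y = - y" using y' by (metis minus_minus)
    let ?d = "y / (\<zeta> - \<sigma> \<zeta>)"
    have "\<sigma> ?d * \<sigma> (\<zeta> - \<sigma> \<zeta>) = \<sigma> y" using \<delta> by (simp flip: L.sigma_hom)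
    then have "\<sigma> ?d * (\<zeta> - \<sigma> \<zeta>) = y" by (simp add: y L.sigma_diff L.sigma_sigma algebra_simps)
    then have "\<sigma> ?d = ?d" using \<delta> by (simp add: eq_divide_eq)
    then obtain d where d: "?d = \<iota> d" using L.fixed by blast
    then have yd: "y = \<iota> d * (\<zeta> - \<sigma> \<zeta>)" using \<delta> by (simp add: divide_eq_eq)
    have sx: "\<sigma> x = x + y * \<iota> t" using x y by (simp add: algebra_simps)
    have "\<sigma> (x - \<iota> d * \<sigma> \<zeta> * \<iota> t) = x - \<iota> d * \<sigma> \<zeta> * \<iota> t"
      by (simp add: L.sigma_diff L.sigma_hom L.sigma_sigma sx yd algebra_simps)
    then obtain c where c: "x - \<iota> d * \<sigma> \<zeta> * \<iota> t = \<iota> c" using L.fixed by blast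
    have xc: "x = \<iota> c + \<iota> d * \<sigma> \<zeta> * \<iota> t" using c by (simp add: algebra_simps)
    have "s = i (\<iota> c) + i (\<iota> d) * \<theta>"
      unfolding xy eq by (simp add: xc yd i_hom i_diff algebra_simps)
    then show ?thesis by blast
  qed
  have tr: "i \<zeta> + i (\<sigma> \<zeta>) = i (\<iota> t1)" "i \<zeta> * i (\<sigma> \<zeta>) = i (\<iota> n1)"
    by (simp_all add: \<zeta>(2) i_diff) (simp add: \<zeta>(2)[symmetric] \<zeta>(3) flip: i_hom i_diff)
  have tr': "j g + j (\<sigma>' g) = i (\<iota> t)" "j g * j (\<sigma>' g) = i (\<iota> n)"
    by (simp_all add: j_conj) (simp add: j_conj[symmetric] g(3) ij flip: j_hom)
  show conj: "i (\<sigma> \<zeta>) * j g + i \<zeta> * j (\<sigma>' g) = i (\<iota> (t1 * t)) - \<theta>"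
  proof -
    have "(i \<zeta> + i (\<sigma> \<zeta>)) * (j g + j (\<sigma>' g)) = \<theta> + (i (\<sigma> \<zeta>) * j g + i \<zeta> * j (\<sigma>' g))"
      by (simp add: \<theta>_def algebra_simps)
    then show ?thesis unfolding tr tr' by (simp add: L.iota_hom i_hom algebra_simps)
  qed
  have "\<theta> * (i (\<sigma> \<zeta>) * j g + i \<zeta> * j (\<sigma>' g)) =
      (i \<zeta> * i (\<sigma> \<zeta>)) * (j g + j (\<sigma>' g)) ^ 2 + (i \<zeta> + i (\<sigma> \<zeta>)) ^ 2 * (j g * j (\<sigma>' g))
       - 4 * (i \<zeta> * i (\<sigma> \<zeta>)) * (j g * j (\<sigma>' g))"
    by (simp add: \<theta>_def power2_eq_square algebra_simps)
  also have "\<dots> = i (\<iota> (n1 * t ^ 2 + t1 ^ 2 * n - 4 * n1 * n))"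
  proof -
    have "i (\<iota> 4) = 4"
    proof -
      have "(4 :: 'f) = 1 + 1 + 1 + 1" by simp
      then have "i (\<iota> 4) = i (\<iota> (1 + 1 + 1 + 1))" by (rule arg_cong)
      also have "\<dots> = 4" by (simp only: L.iota_hom i_hom) simp
      finally show ?thesis .
    qed
    then show ?thesis unfolding tr tr' by (simp add: L.iota_hom L.iota_diff i_hom i_diff power2_eq_square)
  qed
  finally show "\<theta> * \<theta> = i (\<iota> (t1 * t)) * \<theta> - i (\<iota> (n1 * t ^ 2 + t1 ^ 2 * n - 4 * n1 * n))"
    unfolding conj by (simp add: algebra_simps)
qed

end

text \<open>
  For two equal factors the fixed ring is \<open>F \<times> F\<close>, spanned by 1 and the idempotent
  \<open>\<zeta>\<^sub>0 = (1, 0)\<close>, which is \<open>\<delta>\<^sup>-\<^sup>1 (1 \<otimes> \<zeta> - \<zeta>' \<otimes> 1)\<close> with \<open>\<delta> = \<zeta> - \<zeta>'\<close>.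
\<close>

locale tensor_square = tensor_pair \<iota> \<sigma> \<iota> \<sigma> i j g t n
  for \<iota> :: "'f::nonarch_local_field \<Rightarrow> 'k::field" and \<sigma> and i j :: "'k \<Rightarrow> 't::comm_ring_1" and g t n
begin

lemma delta_nonzero: "g - \<sigma> g \<noteq> 0"
  using g(1) L.fixed by auto

definition idem :: 't where
  "idem = i (- (\<sigma> g / (g - \<sigma> g))) + i (1 / (g - \<sigma> g)) * j g"

lemma K0_coords_eq: "K0_coords i j \<sigma> (i x + i y * j g) = (x + y * g, x + y * \<sigma> g)"
proof -
  have "K0_coords i j \<sigma> (i x + i y * j g) = (x * 1, x * \<sigma> 1) + (y * g, y * \<sigma> g)"
    unfolding K0_coords_def by (rule tensor_lift_eq) (simp_all add: L.sigma_hom algebra_simps)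
  then show ?thesis by (simp add: L.sigma_hom)
qed

lemma K0_coords_inj: "K0_coords i j \<sigma> s = K0_coords i j \<sigma> s' \<Longrightarrow> s = s'"
proof -
  assume eq: "K0_coords i j \<sigma> s = K0_coords i j \<sigma> s'"
  obtain x y x' y' where s: "s = i x + i y * j g" "s' = i x' + i y' * j g" using decomposition by metis
  have 1: "x + y * g = x' + y' * g" and 2: "x + y * \<sigma> g = x' + y' * \<sigma> g" using eq unfolding s K0_coords_eq by auto
  have "(y - y') * (g - \<sigma> g) = (x + y * g) - (x + y * \<sigma> g) - ((x' + y' * g) - (x' + y' * \<sigma> g))"
    by (simp add: algebra_simps)
  also have "\<dots> = 0" unfolding 1 2 by simp
  finally have "y = y'" using delta_nonzero by simp
  then show ?thesis using 1 s by simp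
qed

lemma idem_coords: "K0_coords i j \<sigma> idem = (1, 0)"
proof -
  have "- (u / d) + 1 / d * v = (v - u) / d" for u v d :: 'k by (simp add: diff_divide_distrib)
  then show ?thesis using delta_nonzero unfolding idem_def K0_coords_eq by simp
qed

lemma idem_fixed: "idem \<in> tensor_fixed i j \<sigma> \<sigma>"
proof -
  let ?\<delta> = "g - \<sigma> g"
  have s\<delta>: "\<sigma> ?\<delta> = - ?\<delta>" by (simp add: L.sigma_diff L.sigma_sigma)
  have sdiv: "\<sigma> (x / ?\<delta>) = - (\<sigma> x / ?\<delta>)" for x
  proof -
    have "x / ?\<delta> * ?\<delta> = x" using delta_nonzero by simp
    then have "\<sigma> (x / ?\<delta>) * \<sigma> ?\<delta> = \<sigma> x" by (metis L.sigma_hom(3))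
    then have "\<sigma> (x / ?\<delta>) * - ?\<delta> = \<sigma> x" unfolding s\<delta> .
    then have "- \<sigma> (x / ?\<delta>) * ?\<delta> = \<sigma> x" by (simp only: mult_minus_left mult_minus_right)
    then have "- \<sigma> (x / ?\<delta>) = \<sigma> x / ?\<delta>" by (simp only: nonzero_eq_divide_eq[OF delta_nonzero])
    then show ?thesis by (metis minus_minus)
  qed
  have "- (\<sigma> g / ?\<delta>) = g / ?\<delta> - \<iota> t / ?\<delta>" unfolding g(2) by (simp add: diff_divide_distrib)
  then show ?thesis
    unfolding idem_def mem_tensor_fixed_iff L.sigma_minus sdiv by (simp add: L.sigma_hom L.sigma_sigma)
qed

lemma fixed_coords: "s \<in> tensor_fixed i j \<sigma> \<sigma> \<Longrightarrow> \<exists>a b. K0_coords i j \<sigma> s = (\<iota> a, \<iota> b)"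
proof -
  assume s: "s \<in> tensor_fixed i j \<sigma> \<sigma>"
  obtain x y where xy: "s = i x + i y * j g" using decomposition by blast
  have y': "y = - \<sigma> y" and x: "x = \<sigma> x + \<sigma> y * \<iota> t" using s unfolding xy mem_tensor_fixed_iff by blast+
  have y: "\<sigma> y = - y" using y' by (metis minus_minus)
  have sx: "\<sigma> x = x + y * \<iota> t" using x y by (simp add: algebra_simps)
  have "\<sigma> (x + y * g) = x + y * g" "\<sigma> (x + y * \<sigma> g) = x + y * \<sigma> g"
    by (simp_all add: L.sigma_hom L.sigma_sigma y sx g(2) L.sigma_diff algebra_simps)
  then show ?thesis unfolding xy K0_coords_eq using L.fixed by (metis imageE)
qed

lemma scalar_coords: "K0_coords i j \<sigma> (i (\<iota> c) + i (\<iota> d) * idem) = (\<iota> (c + d), \<iota> c)"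
proof -
  let ?\<delta> = "g - \<sigma> g"
  have "i (\<iota> c) + i (\<iota> d) * idem = i (\<iota> c - \<iota> d * (\<sigma> g / ?\<delta>)) + i (\<iota> d * (1 / ?\<delta>)) * j g"
  proof -
    have "i c' + i d' * (i (- u) + i v * j g) = i (c' - d' * u) + i (d' * v) * j g" for c' d' u v
      by (simp add: i_hom i_diff i_minus algebra_simps)
    then show ?thesis unfolding idem_def .
  qed
  then have "K0_coords i j \<sigma> (i (\<iota> c) + i (\<iota> d) * idem) =
      (\<iota> c - \<iota> d * (\<sigma> g / ?\<delta>) + \<iota> d * (1 / ?\<delta>) * g, \<iota> c - \<iota> d * (\<sigma> g / ?\<delta>) + \<iota> d * (1 / ?\<delta>) * \<sigma> g)"
    by (simp only: K0_coords_eq)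
  moreover have "x - y * (u / d) + y * (1 / d) * v = x + y * ((v - u) / d)" for x y u v d :: 'k
    by (simp add: diff_divide_distrib algebra_simps)
  ultimately show ?thesis using delta_nonzero by (simp only: L.iota_hom) simp
qed

lemma fixed_spans: "s \<in> tensor_fixed i j \<sigma> \<sigma> \<Longrightarrow> \<exists>c d. s = i (\<iota> c) + i (\<iota> d) * idem"
proof -
  assume "s \<in> tensor_fixed i j \<sigma> \<sigma>"
  then obtain a b where "K0_coords i j \<sigma> s = (\<iota> a, \<iota> b)" using fixed_coords by blast
  then have "K0_coords i j \<sigma> s = K0_coords i j \<sigma> (i (\<iota> b) + i (\<iota> (a - b)) * idem)"
    by (simp add: scalar_coords)
  then show ?thesis using K0_coords_inj by blast
qed

lemma K0_elem_10: "K0_elem i j \<sigma> (1, 0) = idem"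
  unfolding K0_elem_def using idem_fixed idem_coords K0_coords_inj by (intro the_equality) auto

lemma one_minus_idem_fixed: "1 - idem \<in> tensor_fixed i j \<sigma> \<sigma>"
proof -
  obtain x y where xy: "idem = i x + i y * j g" using decomposition by blast
  then have f: "y = - \<sigma> y \<and> x = \<sigma> x + \<sigma> y * \<iota> t" using idem_fixed mem_tensor_fixed_iff by simp
  have 1: "1 - idem = i (1 - x) + i (- y) * j g" by (simp add: xy i_hom i_diff i_minus algebra_simps)
  have "- y = - \<sigma> (- y)" using f by (simp add: L.sigma_minus)
  moreover have "1 - x = \<sigma> (1 - x) + \<sigma> (- y) * \<iota> t"
  proof -
    have "\<sigma> (1 - x) + \<sigma> (- y) * \<iota> t = 1 - (\<sigma> x + \<sigma> y * \<iota> t)"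
      by (simp add: L.sigma_minus L.sigma_diff L.sigma_hom)
    then show ?thesis using f by metis
  qed
  ultimately show ?thesis unfolding 1 mem_tensor_fixed_iff by blast
qed

lemma K0_elem_01: "K0_elem i j \<sigma> (0, 1) = 1 - idem"
proof -
  have "1 - idem = i (\<iota> 1) + i (\<iota> (- 1)) * idem" by (simp add: L.iota_hom L.iota_minus i_hom i_minus)
  then have "K0_coords i j \<sigma> (1 - idem) = (0, 1)" by (simp only: scalar_coords) (simp add: L.iota_hom)
  then show ?thesis
    unfolding K0_elem_def using one_minus_idem_fixed K0_coords_inj by (intro the_equality) auto
qed

lemma idem_idem: "idem * idem = idem"
proof -
  let ?\<delta> = "g - \<sigma> g"
  have gg: "j g * j g = i (g + \<sigma> g) * j g - i (g * \<sigma> g)"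
  proof -
    have "j g * j g = i (\<iota> t) * j g - i (\<iota> n)" using j_hom(3)[of g g] by (simp add: g_square j_diff j_hom ij)
    moreover have "g + \<sigma> g = \<iota> t" by (simp add: g(2))
    ultimately show ?thesis by (simp add: g(3))
  qed
  have idem: "idem = i (1 / ?\<delta>) * (j g - i (\<sigma> g))"
    unfolding idem_def by (simp add: i_minus algebra_simps flip: i_hom)
  have "(j g - i (\<sigma> g)) * (j g - i (\<sigma> g)) = j g * j g - 2 * i (\<sigma> g) * j g + i (\<sigma> g) * i (\<sigma> g)"
    by (simp add: algebra_simps)
  also have "\<dots> = i ?\<delta> * (j g - i (\<sigma> g))"
    unfolding gg by (simp add: i_hom i_diff algebra_simps)
  finally have sq: "(j g - i (\<sigma> g)) * (j g - i (\<sigma> g)) = i ?\<delta> * (j g - i (\<sigma> g))" .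
  have "idem * idem = i (1 / ?\<delta>) * i (1 / ?\<delta>) * ((j g - i (\<sigma> g)) * (j g - i (\<sigma> g)))"
    unfolding idem by (simp add: algebra_simps)
  also have "\<dots> = i (1 / ?\<delta>) * (i (1 / ?\<delta>) * i ?\<delta>) * (j g - i (\<sigma> g))"
    unfolding sq by (simp add: algebra_simps)
  also have "i (1 / ?\<delta>) * i ?\<delta> = 1" using delta_nonzero by (simp add: i_hom(1) flip: i_hom(3))
  finally show ?thesis by (simp add: idem)
qed

end

section \<open>The quaternion relations of a pair of quadratic matrices\<close>

text \<open>
  The relations between \<open>w\<close> and \<open>z\<close> hold for all pairs of quadratic matrices, so that they can be used
  for \<open>K\<^sub>1, K\<^sub>2\<close> as well as for \<open>K\<^sub>0, K\<^sub>3\<close>, where the first matrix is idempotent.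
\<close>

locale quaternion_pair =
  fixes a b :: "'a::field^'n^'n" and t1 n1 t2 n2 :: 'a
  assumes aa: "a ** a = mat t1 ** a - mat n1" and bb: "b ** b = mat t2 ** b - mat n2"
begin

definition w where "w = a ** b + (mat t2 - b) ** (mat t1 - a)"
definition z where "z = b ** a - a ** b"

lemma aav: "a *v (a *v x) = t1 *s (a *v x) - n1 *s x"
  using arg_cong[OF aa, of "\<lambda>M. M *v x"] by (simp add: mv_simps)

lemma bbv: "b *v (b *v x) = t2 *s (b *v x) - n2 *s x"
  using arg_cong[OF bb, of "\<lambda>M. M *v x"] by (simp add: mv_simps)

lemma w_a: "w ** a = a ** w" and w_b: "w ** b = b ** w"
  and z_a: "z ** a = (mat t1 - a) ** z" and z_b: "z ** b = (mat t2 - b) ** z"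
  by (intro matrix_eqI, simp add: w_def z_def mv_simps aav bbv vec_eq_iff algebra_simps)+

lemma z_square: "z ** z = w ** w - mat (t1 * t2) ** w + mat (n1 * t2 ^ 2 + n2 * t1 ^ 2 - 4 * n1 * n2)"
  by (intro matrix_eqI, simp add: w_def z_def mv_simps aav bbv vec_eq_iff power2_eq_square algebra_simps)

lemma w_z: "w ** z = z ** w"
  by (intro matrix_eqI, simp add: w_def z_def mv_simps aav bbv vec_eq_iff algebra_simps)

lemma b_recovered: "b ** (mat 2 ** a - mat t1) = w + z - mat t2 ** (mat t1 - a)"
  by (intro matrix_eqI, simp add: w_def z_def mv_simps vec_eq_iff algebra_simps)

lemma disc_square: "(mat 2 ** a - mat t1) ** (mat 2 ** a - mat t1) = mat (t1 ^ 2 - 4 * n1)"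
  by (intro matrix_eqI, simp add: mv_simps aav vec_eq_iff power2_eq_square algebra_simps)

lemma b_eq:
  assumes "t1 ^ 2 - 4 * n1 \<noteq> 0"
  shows "b = (w + z - mat t2 ** (mat t1 - a)) ** ((mat 2 ** a - mat t1) ** mat (inverse (t1 ^ 2 - 4 * n1)))"
proof -
  have "(w + z - mat t2 ** (mat t1 - a)) ** ((mat 2 ** a - mat t1) ** mat (inverse (t1 ^ 2 - 4 * n1)))
      = b ** (((mat 2 ** a - mat t1) ** (mat 2 ** a - mat t1)) ** mat (inverse (t1 ^ 2 - 4 * n1)))"
    by (simp only: b_recovered[symmetric] matrix_mul_assoc)
  also have "\<dots> = b" unfolding disc_square using assms by (simp flip: mat_mult)
  finally show ?thesis by simp
qed

end

locale local_quaternion_pair = quaternion_pair a b t1 n1 t2 n2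
  for a b :: "'f::nonarch_local_field^'n^'n" and t1 n1 t2 n2 +
  assumes int: "t1 \<in> int_ring" "n1 \<in> int_ring" "t2 \<in> int_ring" "n2 \<in> int_ring"
    and disc: "aval (t1 ^ 2 - 4 * n1) = 1"
begin

lemma disc_nonzero: "t1 ^ 2 - 4 * n1 \<noteq> 0" using disc by auto

text \<open>
  The element \<open>b\<close> is an expression in \<open>a\<close>, \<open>w\<close> and \<open>z\<close> whose only denominator is the discriminant of \<open>a\<close>,
  a unit.
\<close>

lemma stable_iff:
  assumes L: "\<Lambda> \<in> lattices" and a: "a \<in> stabilizers \<Lambda>"
  shows "b \<in> stabilizers \<Lambda> \<longleftrightarrow> w \<in> stabilizers \<Lambda> \<and> z \<in> stabilizers \<Lambda>"
proof
  assume "b \<in> stabilizers \<Lambda>"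
  then show "w \<in> stabilizers \<Lambda> \<and> z \<in> stabilizers \<Lambda>"
    unfolding w_def z_def using L a int by (auto intro!: stabilizers_intros)
next
  assume *: "w \<in> stabilizers \<Lambda> \<and> z \<in> stabilizers \<Lambda>"
  have "inverse (t1 ^ 2 - 4 * n1) \<in> int_ring" using disc by (simp add: int_ring_def aval_inverse)
  then show "b \<in> stabilizers \<Lambda>"
    by (subst b_eq[OF disc_nonzero]) (use * L a int in \<open>auto intro!: stabilizers_intros\<close>)
qed

end

section \<open>Determinants modulo the uniformizer\<close>

lemma aval_sum_less:
  fixes f :: "'b \<Rightarrow> 'f::nonarch_local_field"
  assumes "0 < B" "\<And>i. i \<in> A \<Longrightarrow> aval (f i) < B"
  shows "aval (sum f A) < B"
  using assms by (induction A rule: infinite_finite_induct) (auto intro: aval_add_less)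

lemma prod_congruent:
  fixes f g :: "'b \<Rightarrow> 'f::nonarch_local_field"
  assumes "\<And>i. i \<in> A \<Longrightarrow> f i \<in> int_ring \<and> g i \<in> int_ring \<and> aval (f i - g i) < 1"
  shows "aval (prod f A - prod g A) < 1"
  using assms
proof (induction A rule: infinite_finite_induct)
  case (insert x A)
  have "aval ((f x - g x) * prod f A + (prod f A - prod g A) * g x) < 1"
    using insert by (intro aval_add_less aval_mult_less_1 int_ring_prod) auto
  then show ?case using insert.hyps by (simp add: algebra_simps)
qed auto

lemma det_congruent:
  fixes M N :: "'f::nonarch_local_field^'n^'n"
  assumes "M \<in> mat_over int_ring" "N \<in> mat_over int_ring" "\<And>i j. aval (M $ i $ j - N $ i $ j) < 1"
  shows "aval (det M - det N) < 1"
proof -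
  have s: "of_int (sign p) \<in> (int_ring :: 'f set)" for p :: "'n \<Rightarrow> 'n"
    by (cases p rule: sign_cases) (auto intro: int_ring_intros)
  have "det M - det N = (\<Sum>p | p permutes UNIV. ((\<Prod>i\<in>UNIV. M $ i $ p i) - (\<Prod>i\<in>UNIV. N $ i $ p i)) * of_int (sign p))"
    unfolding det_def by (simp add: sum_subtractf[symmetric] algebra_simps)
  also have "aval \<dots> < 1"
    using assms s by (intro aval_sum_less aval_mult_less_1 prod_congruent) (auto simp: mat_over_def)
  finally show ?thesis .
qed

text \<open>
  In a basis of the lattice both matrices are integral and congruent modulo the uniformizer, hence so
  are their determinants.
\<close>

lemma det_unit_perturb:
  fixes A E :: "'f::nonarch_local_field^'n^'n"
  assumes L: "\<Lambda> \<in> lattices" and "A \<in> stabilizers \<Lambda>" "E \<in> stabilizers \<Lambda>" "aval (det A) = 1"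
  shows "aval (det (A - mat uniformizer ** E)) = 1"
proof -
  obtain g where g: "invertible g" "\<Lambda> = lattice_of g" using L by (auto simp: lattices_def)
  let ?c = "\<lambda>M. matrix_inv g ** M ** g"
  have c: "?c A \<in> mat_over int_ring" "?c E \<in> mat_over int_ring" using assms g stabilizers_lattice_of by blast+
  have eq: "?c (A - mat uniformizer ** E) = ?c A - mat uniformizer ** ?c E"
    by (intro matrix_eqI) (simp add: mv_simps)
  have "aval (det (?c A) - det (?c (A - mat uniformizer ** E))) < 1"
  proof (rule det_congruent)
    show "?c A \<in> mat_over int_ring" by (rule c)
    show "?c (A - mat uniformizer ** E) \<in> mat_over int_ring"
      unfolding eq mat_over_def using c by (auto simp: mat_over_def mat_entry intro!: int_ring_intros)
    have "aval (uniformizer * ?c E $ i $ j) < 1" for i j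
      using c(2) aval_uniformizer_less by (intro aval_mult_less_1) (auto simp: mat_over_def)
    then show "aval (?c A $ i $ j - ?c (A - mat uniformizer ** E) $ i $ j) < 1" for i j
      unfolding eq by (simp add: mat_entry)
  qed
  then have "aval (det A - det (A - mat uniformizer ** E)) < 1" by (simp add: det_conj[OF g(1)])
  then show ?thesis using assms(4) by (rule aval_diff_lt_1_eq)
qed

section \<open>Descent to an involution\<close>

text \<open>
  The ring of operators that behave like integral polynomials in \<open>w\<close>, in a form that is evidently
  closed: they commute with everything that commutes with \<open>w\<close>, and they preserve every lattice that
  \<open>w\<close> preserves.
\<close>

definition closed_order :: "'f::nonarch_local_field^'n^'n \<Rightarrow> ('f^'n^'n) set" where
  "closed_order w = {x. (\<forall>y. y ** w = w ** y \<longrightarrow> y ** x = x ** y) \<and>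
     (\<forall>\<Lambda>\<in>lattices. w \<in> stabilizers \<Lambda> \<longrightarrow> x \<in> stabilizers \<Lambda>)}"

lemma closed_order_commute: "x \<in> closed_order w \<Longrightarrow> y ** w = w ** y \<Longrightarrow> y ** x = x ** y"
  and closed_order_stable: "x \<in> closed_order w \<Longrightarrow> \<Lambda> \<in> lattices \<Longrightarrow> w \<in> stabilizers \<Lambda> \<Longrightarrow> x \<in> stabilizers \<Lambda>"
  by (auto simp: closed_order_def)

lemma closed_order_comm: "x \<in> closed_order w \<Longrightarrow> y \<in> closed_order w \<Longrightarrow> x ** y = y ** x"
  using closed_order_commute[of x w w] closed_order_commute[of y w x] by metis

lemma closed_order_w: "w \<in> closed_order w" and closed_order_mat: "c \<in> int_ring \<Longrightarrow> mat c \<in> closed_order w"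
  by (auto simp: closed_order_def mat_central intro: stabilizers_intros)

lemma closed_order_add: "x \<in> closed_order w \<Longrightarrow> y \<in> closed_order w \<Longrightarrow> x + y \<in> closed_order w"
  and closed_order_diff: "x \<in> closed_order w \<Longrightarrow> y \<in> closed_order w \<Longrightarrow> x - y \<in> closed_order w"
  by (auto simp: closed_order_def matrix_add_ldistrib matrix_add_rdist matrix_sub_ldistrib matrix_sub_rdistrib
    intro: stabilizers_intros)

lemma closed_order_mult:
  fixes x y w :: "'f::nonarch_local_field^'n^'n"
  assumes "x \<in> closed_order w" "y \<in> closed_order w" shows "x ** y \<in> closed_order w"
  unfolding closed_order_def
proof (intro CollectI conjI allI impI ballI)
  fix u assume u: "u ** w = w ** u"
  have "u ** x = x ** u" "u ** y = y ** u" using assms closed_order_commute u by blast+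
  then show "u ** (x ** y) = x ** y ** u" by (metis matrix_mul_assoc)
next
  fix \<Lambda> :: "('f^'n) set" assume "\<Lambda> \<in> lattices" "w \<in> stabilizers \<Lambda>"
  then show "x ** y \<in> stabilizers \<Lambda>" using assms closed_order_stable by (intro stabilizers_mult)
qed

lemmas closed_order_intros = closed_order_add closed_order_diff closed_order_mult closed_order_mat closed_order_w

lemma closed_order_inverse:
  fixes x w :: "'f::nonarch_local_field^'n^'n"
  assumes x: "x \<in> closed_order w" and d: "aval (det x) = 1"
  shows "matrix_inv x \<in> closed_order w" "invertible x"
proof -
  have "det x \<noteq> 0" using d by auto
  then show inv: "invertible x" by (simp add: invertible_det_nz)
  show "matrix_inv x \<in> closed_order w"
    unfolding closed_order_def
  proof (intro CollectI conjI allI impI ballI)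
    fix u assume "u ** w = w ** u"
    then have "x ** u = u ** x" using closed_order_commute[OF x] by metis
    then show "u ** matrix_inv x = matrix_inv x ** u" using matrix_inv_commute[OF inv] by metis
  next
    fix \<Lambda> :: "('f^'n) set" assume L: "\<Lambda> \<in> lattices" "w \<in> stabilizers \<Lambda>"
    have "(*v) x ` \<Lambda> = \<Lambda>" using image_lattice_eq[OF L(1) closed_order_stable[OF x L] d] .
    then show "matrix_inv x \<in> stabilizers \<Lambda>" using inv by (auto simp: stabilizers_def image_iff) (metis imageE matrix_inv_mv(1))
  qed
qed

text \<open>
  The ring is closed and contained in the compact ring that preserves a single lattice.
\<close>

lemma compact_closed_order:
  fixes w :: "'f::nonarch_local_field^'n^'n"
  assumes L: "\<Lambda>0 \<in> lattices" "w \<in> stabilizers \<Lambda>0"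
  shows "compact (closed_order w)"
proof -
  have "closed {x. y ** x = x ** y}" for y :: "'f^'n^'n"
    by (intro closed_Collect_eq continuous_intros)
  then have 1: "closed (\<Inter>y\<in>{y. y ** w = w ** y}. {x. y ** x = x ** y})" by blast
  have 2: "closed (\<Inter>\<Lambda>\<in>{\<Lambda> \<in> lattices. w \<in> stabilizers \<Lambda>}. stabilizers \<Lambda>)"
    using compact_stabilizers compact_imp_closed by blast
  have "closed_order w = stabilizers \<Lambda>0 \<inter> ((\<Inter>y\<in>{y. y ** w = w ** y}. {x. y ** x = x ** y}) \<inter>
      (\<Inter>\<Lambda>\<in>{\<Lambda> \<in> lattices. w \<in> stabilizers \<Lambda>}. stabilizers \<Lambda>))"
    using L by (auto simp: closed_order_def)
  also have "compact \<dots>" by (intro compact_Int_closed compact_stabilizers L closed_Int 1 2)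
  finally show ?thesis .
qed

text \<open>
  The sum of the standard lattice and its image under \<open>w\<close> is stable: the quadratic equation expresses
  \<open>w\<^sup>2\<close> by operators with integral coefficients.
\<close>

lemma stable_lattice_exists:
  fixes w c :: "'f::nonarch_local_field^'n^'n"
  assumes w: "w ** w = c + mat t ** w - mat k" and c: "c \<in> mat_over int_ring" and tk: "t \<in> int_ring" "k \<in> int_ring"
    and cw: "c ** w = w ** c"
  shows "\<exists>\<Lambda>\<in>lattices. w \<in> stabilizers \<Lambda>"
proof -
  define M where "M = {x + w *v y | x y. x \<in> std_lattice \<and> y \<in> std_lattice}"
  have std: "(std_lattice :: ('f^'n) set) \<in> lattices"
    unfolding lattices_def lattice_of_def using invertible_mat_1 by (intro CollectI exI[of _ "mat 1"]) (simp add: image_iff)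
  have subM: "std_lattice \<subseteq> M"
    unfolding M_def using lattice_0[OF std] by (intro subsetI CollectI) (metis add.right_neutral matrix_vector_mult_0_right)
  have closed: "module_closed (mat ` int_ring) M"
    unfolding module_closed_def
  proof (intro conjI ballI)
    show "0 \<in> M" using subM lattice_0[OF std] by blast
    fix u v assume "u \<in> M" "v \<in> M"
    then obtain x y x' y' where uv: "u = x + w *v y" "v = x' + w *v y'" "x \<in> std_lattice" "y \<in> std_lattice" "x' \<in> std_lattice" "y' \<in> std_lattice"
      unfolding M_def by blast
    then show "u + v \<in> M" unfolding M_def using lattice_add[OF std]
      by (intro CollectI exI[of _ "x + x'"] exI[of _ "y + y'"]) (auto simp: mv_simps)
  next
    fix A :: "'f^'n^'n" and v assume "A \<in> mat ` int_ring" "v \<in> M"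
    then obtain d x y where "A = mat d" "d \<in> int_ring" "v = x + w *v y" "x \<in> std_lattice" "y \<in> std_lattice"
      unfolding M_def by blast
    then show "A *v v \<in> M" unfolding M_def using lattice_scale[OF std]
      by (intro CollectI exI[of _ "d *s x"] exI[of _ "d *s y"]) (auto simp: mv_simps)
  qed
  define f where "f e = (case e of Inl l \<Rightarrow> axis l (1::'f) | Inr l \<Rightarrow> w *v axis l 1)" for e :: "'n + 'n"
  have ax: "axis l (1::'f) \<in> std_lattice" for l :: 'n by (simp add: std_lattice_def axis_def)
  have "generates (mat ` int_ring) (f ` UNIV) M"
  proof (rule scalar.generatesI[OF _ closed])
    show "range f \<subseteq> M"
    proof
      fix v assume "v \<in> range f"
      then obtain e where e: "v = f e" by blast
      show "v \<in> M"
      proof (cases e)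
        case (Inl l)
        then show ?thesis using ax subM e by (auto simp: f_def)
      next
        case (Inr l)
        then have "v = 0 + w *v axis l 1" using e by (simp add: f_def)
        then show ?thesis unfolding M_def using ax lattice_0[OF std] by blast
      qed
    qed
    fix v assume "v \<in> M"
    then obtain x y where v: "v = x + w *v y" "x \<in> std_lattice" "y \<in> std_lattice" unfolding M_def by blast
    define A :: "'n + 'n \<Rightarrow> 'f^'n^'n" where "A e = (case e of Inl l \<Rightarrow> mat (x $ l) | Inr l \<Rightarrow> mat (y $ l))" for e
    have "(\<Sum>e\<in>UNIV. A e *v f e) = (\<Sum>l\<in>UNIV. x $ l *s axis l 1) + (\<Sum>l\<in>UNIV. y $ l *s (w *v axis l 1))"
      by (simp add: UNIV_Plus_UNIV[symmetric] sum.Plus A_def f_def del: UNIV_Plus_UNIV)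
    also have "(\<Sum>l\<in>UNIV. y $ l *s (w *v axis l 1)) = w *v (\<Sum>l\<in>UNIV. y $ l *s axis l 1)" by (simp add: mv_sum)
    finally have "v = (\<Sum>e\<in>UNIV. A e *v f e)" by (simp add: v(1) basis_expansion)
    moreover have "\<forall>e\<in>UNIV. A e \<in> mat ` int_ring"
      using v(2,3) by (auto simp: A_def std_lattice_def split: sum.split)
    ultimately show "\<exists>A. (\<forall>e\<in>UNIV. A e \<in> mat ` int_ring) \<and> v = (\<Sum>e\<in>UNIV. A e *v f e)" by blast
  qed simp
  moreover have "spanning M" using lattice_spanning[OF std] subM unfolding spanning_def by blast
  ultimately have "M \<in> lattices" by (rule generated_spanning_lattice)
  moreover have "w \<in> stabilizers M"
    unfolding stabilizers_def
  proof (intro CollectI ballI)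
    fix v assume "v \<in> M"
    then obtain x y where v: "v = x + w *v y" "x \<in> std_lattice" "y \<in> std_lattice" unfolding M_def by blast
    have "w *v (w *v y) = c *v y + t *s (w *v y) - k *s y"
      using arg_cong[OF w, of "\<lambda>M. M *v y"] by (simp add: mv_simps)
    then have "w *v v = (c *v y - k *s y) + w *v (x + t *s y)"
      by (simp add: v(1) mv_simps)
    moreover have "c *v y - k *s y \<in> std_lattice"
      using c v(3) tk(2) mat_over_int_iff lattice_diff[OF std] lattice_scale[OF std] by blast
    moreover have "x + t *s y \<in> std_lattice" using v tk(1) lattice_add[OF std] lattice_scale[OF std] by blast
    ultimately show "w *v v \<in> M" unfolding M_def by blast
  qed
  ultimately show ?thesis by blast
qed

text \<open>
  If \<open>X\<^sup>2 - t\<^sub>2 X + n\<^sub>2\<close> is a square modulo the uniformizer, then so is \<open>z\<^sup>2\<close> as a polynomial in \<open>w\<close>.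
  A square is a norm from the unramified extension generated by \<open>a\<close>, and Hensel's lemma turns this
  into an exact equation \<open>z\<^sup>2 = U U'\<close>. Hence \<open>u z\<close> with \<open>u = U\<^sup>-\<^sup>1\<close> is an involution that is semilinear for
  \<open>a\<close>. The last conclusion is the form in which it is used
  that \<open>u\<close> is a unit of the ring generated by \<open>w\<close> and \<open>a\<close>.
\<close>

lemma (in local_quaternion_pair) semilinear_involution:
  assumes t1: "aval t1 = 1" and z: "z \<in> GL_int"
    and r: "r \<in> int_ring" "aval (t2 - 2 * r) < 1" "aval (n2 - r ^ 2) < 1"
  obtains u v where "u ** v = mat 1" "v ** u = mat 1" "(u ** z) ** (u ** z) = mat 1"
    "(u ** z) ** a = (mat t1 - a) ** (u ** z)" "(u ** z) ** w = w ** (u ** z)"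
    "\<And>\<Lambda>. \<Lambda> \<in> lattices \<Longrightarrow> a \<in> stabilizers \<Lambda> \<Longrightarrow> w \<in> stabilizers \<Lambda> \<Longrightarrow> u \<in> stabilizers \<Lambda> \<and> v \<in> stabilizers \<Lambda>"
proof -
  let ?p = "uniformizer :: 'f"
  let ?k = "n1 * t2 ^ 2 + n2 * t1 ^ 2 - 4 * n1 * n2"
  let ?C = "closed_order w"
  define c where "c = z ** z"
  have k: "?k \<in> int_ring" and t12: "t1 * t2 \<in> int_ring" using int by (auto intro!: int_ring_intros)
  have c_eq: "c = w ** w - mat (t1 * t2) ** w + mat ?k" unfolding c_def by (rule z_square)
  have "\<exists>\<Lambda>\<in>lattices. w \<in> stabilizers \<Lambda>"
  proof (rule stable_lattice_exists[OF _ _ t12 k])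
    show "w ** w = c + mat (t1 * t2) ** w - mat ?k" unfolding c_eq by simp
    show "c \<in> mat_over int_ring" unfolding c_def using z by (intro mat_over_int_mult) (auto simp: GL_int_iff)
    show "c ** w = w ** c" unfolding c_def using w_z by (metis matrix_mul_assoc)
  qed
  then obtain \<Lambda>0 where L0: "\<Lambda>0 \<in> lattices" "w \<in> stabilizers \<Lambda>0" by blast
  have dc: "aval (det c) = 1" using z by (simp add: c_def det_mul aval_mult GL_int_iff)
  have cC: "c \<in> ?C" unfolding c_eq using t12 k by (intro closed_order_intros)
  obtain s m where s: "s \<in> int_ring" "t2 - 2 * r = ?p * s" and m: "m \<in> int_ring" "n2 - r ^ 2 = ?p * m"
    using divide_uniformizer r(2,3) by metis
  define E where "E = mat (4 * n1 * r * s + ?p * s ^ 2 * n1 + m * t1 ^ 2 - 4 * m * n1) - mat (s * t1) ** w"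
  have EC: "E \<in> ?C" unfolding E_def using int r(1) s(1) m(1) by (intro closed_order_intros int_ring_intros) auto
  \<comment> \<open>With \<open>t\<^sub>2 = 2 r\<close> and \<open>n\<^sub>2 = r\<^sup>2\<close> the equation of \<open>z\<^sup>2\<close> reads \<open>z\<^sup>2 = (w - t\<^sub>1 r)\<^sup>2\<close>; \<open>E\<close> is the error divided by the uniformizer.\<close>
  define u0 where "u0 = w - mat (t1 * r)"
  have u0C: "u0 \<in> ?C" unfolding u0_def using int r by (intro closed_order_intros int_ring_intros)
  have u0c: "u0 ** u0 = c - mat ?p ** E"
  proof (intro matrix_eqI)
    fix x
    have t2: "t2 = 2 * r + ?p * s" and n2: "n2 = r ^ 2 + ?p * m" using s(2) m(2) by (simp_all add: algebra_simps)
    show "(u0 ** u0) *v x = (c - mat ?p ** E) *v x"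
      unfolding u0_def c_eq E_def t2 n2
      by (simp add: mv_simps vec_eq_iff power2_eq_square algebra_simps)
  qed
  have "aval (det u0 ^ 2) = 1"
    using det_unit_perturb[OF L0(1) closed_order_stable[OF cC L0] closed_order_stable[OF EC L0] dc]
    by (simp add: power2_eq_square det_mul flip: u0c)
  then have du0: "aval (det u0) = 1" by (rule square_eq_1)
  let ?v0 = "mat (inverse t1) ** matrix_inv u0"
  have it1: "inverse t1 \<in> int_ring" "t1 \<noteq> 0" using t1 by (auto simp: int_ring_def aval_inverse)
  have v0C: "?v0 \<in> ?C" using closed_order_inverse[OF u0C du0] it1 by (intro closed_order_intros)
  \<comment> \<open>The ansatz \<open>U = u\<^sub>0 + \<pi> y a\<close> with conjugate \<open>U' = u\<^sub>0 + \<pi> y a'\<close> gives \<open>U U' = u\<^sub>0\<^sup>2 + \<pi> t\<^sub>1 u\<^sub>0 y + \<pi>\<^sup>2 n\<^sub>1 y\<^sup>2\<close>.\<close>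
  have "\<exists>y\<in>?C. y = ?v0 ** E + mat ?p ** (mat (- n1) ** ?v0 ** (y ** y))"
  proof (rule hensel_quadratic)
    show "compact ?C" by (rule compact_closed_order[OF L0])
  qed (use int v0C EC in \<open>auto intro: closed_order_intros closed_order_comm int_ring_uminus\<close>)
  then obtain y where y: "y \<in> ?C" "y = ?v0 ** E + mat ?p ** (mat (- n1) ** ?v0 ** (y ** y))" by blast
  have u0i: "invertible u0" by (rule closed_order_inverse[OF u0C du0])
  have "mat t1 ** (u0 ** y) = mat t1 ** (u0 ** (?v0 ** E + mat ?p ** (mat (- n1) ** ?v0 ** (y ** y))))"
    using y(2) by simp
  also have "\<dots> = E - mat (?p * n1) ** (y ** y)"
    using u0i it1(2) by (intro matrix_eqI) (simp add: mv_simps vec_eq_iff)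
  finally have norm_eq: "mat t1 ** (u0 ** y) = E - mat (?p * n1) ** (y ** y)" .
  define U U' where "U = u0 + mat ?p ** (y ** a)" and "U' = u0 + mat ?p ** (y ** (mat t1 - a))"
  have ay: "a ** y = y ** a" using closed_order_commute[OF y(1)] w_a by metis
  have au: "a ** u0 = u0 ** a" using closed_order_commute[OF u0C] w_a by metis
  have zy: "z ** y = y ** z" using closed_order_commute[OF y(1)] w_z by metis
  have zu: "z ** u0 = u0 ** z" using closed_order_commute[OF u0C] w_z by metis
  have wy: "w ** y = y ** w" using closed_order_commute[OF y(1)] by metis
  have wu: "w ** u0 = u0 ** w" using closed_order_commute[OF u0C] by metis
  have uy: "u0 ** y = y ** u0" using closed_order_comm[OF u0C y(1)] .
  note vec = arg_cong[of _ _ "\<lambda>M. M *v x" for x]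
  have v: "a *v (y *v x) = y *v (a *v x)" "a *v (u0 *v x) = u0 *v (a *v x)" "z *v (y *v x) = y *v (z *v x)"
    "z *v (u0 *v x) = u0 *v (z *v x)" "w *v (y *v x) = y *v (w *v x)" "w *v (u0 *v x) = u0 *v (w *v x)"
    "u0 *v (y *v x) = y *v (u0 *v x)" "w *v (a *v x) = a *v (w *v x)"
    "z *v (a *v x) = t1 *s (z *v x) - a *v (z *v x)" for x
  proof -
    have comm: "A *v (B *v x) = A' *v (B' *v x)" if "A ** B = A' ** B'" for A B A' B' :: "'f^'n^'n"
      using that by (simp add: matrix_vector_mul_assoc)
    show "a *v (y *v x) = y *v (a *v x)" "a *v (u0 *v x) = u0 *v (a *v x)" "z *v (y *v x) = y *v (z *v x)"
      "z *v (u0 *v x) = u0 *v (z *v x)" "w *v (y *v x) = y *v (w *v x)" "w *v (u0 *v x) = u0 *v (w *v x)"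
      "u0 *v (y *v x) = y *v (u0 *v x)" "w *v (a *v x) = a *v (w *v x)"
      by (rule comm, rule ay au zy zu wy wu uy w_a)+
    show "z *v (a *v x) = t1 *s (z *v x) - a *v (z *v x)" using comm[OF z_a] by (simp add: mv_simps)
  qed
  have vn: "t1 *s (y *v (u0 *v x)) = E *v x - (?p * n1) *s (y *v (y *v x))"
    and vc: "u0 *v (u0 *v x) = c *v x - ?p *s (E *v x)" for x
    using vec[OF norm_eq, of x] vec[OF u0c, of x] by (simp_all add: mv_simps v)
  have norm: "U ** U' = c" "U' ** U = c"
  proof -
    have "(U ** U') *v x = c *v x \<and> (U' ** U) *v x = c *v x" for x
    proof -
      have E: "E *v x = t1 *s (y *v (u0 *v x)) + (?p * n1) *s (y *v (y *v x))" using vn[of x] by simp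
      have "c *v x = u0 *v (u0 *v x) + ?p *s (E *v x)" using vc[of x] by simp
      then show ?thesis unfolding E U_def U'_def
        by (simp add: mv_simps v aav vec_eq_iff algebra_simps)
    qed
    then show "U ** U' = c" "U' ** U = c" by (auto intro: matrix_eqI)
  qed
  have zU: "z ** U = U' ** z" unfolding U_def U'_def by (intro matrix_eqI) (simp add: mv_simps v)
  have aU: "a ** U = U ** a" "a ** U' = U' ** a"
    unfolding U_def U'_def by (intro matrix_eqI; simp add: mv_simps v)+
  have wU: "w ** U = U ** w" "w ** U' = U' ** w"
    unfolding U_def U'_def by (intro matrix_eqI; simp add: mv_simps v)+
  have ciC: "matrix_inv c \<in> ?C" and ci: "invertible c" using closed_order_inverse[OF cC dc] by auto
  let ?u = "U' ** matrix_inv c"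
  have cU: "U ** c = c ** U" "U' ** c = c ** U'" by (metis norm matrix_mul_assoc)+
  have ciU: "matrix_inv c ** U = U ** matrix_inv c" "matrix_inv c ** U' = U' ** matrix_inv c"
    using matrix_inv_commute[OF ci] cU by metis+
  have "?u ** U = (U' ** U) ** matrix_inv c" by (simp only: matrix_mul_assoc[symmetric] ciU(1))
  moreover have "U ** ?u = (U ** U') ** matrix_inv c" by (simp only: matrix_mul_assoc)
  ultimately have uU: "?u ** U = mat 1" "U ** ?u = mat 1" by (simp_all only: norm matrix_inv_right[OF ci])
  have Ui: "invertible U" using uU unfolding invertible_def by blast
  have ui: "invertible ?u" using uU unfolding invertible_def by blast
  have zu': "U' ** (z ** ?u) = z"
    by (metis matrix_mul_assoc uU(2) matrix_mul_rid zU)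
  have inv2: "(?u ** z) ** (?u ** z) = mat 1"
  proof -
    have "c ** ((?u ** z) ** (?u ** z)) = U' ** (U ** ?u) ** (z ** ?u) ** z"
      by (simp only: norm(2)[symmetric] matrix_mul_assoc)
    also have "\<dots> = U' ** (z ** ?u) ** z" by (simp add: uU)
    also have "\<dots> = c ** mat 1" unfolding zu' by (simp add: c_def)
    finally show ?thesis using matrix_cancel_left[OF ci] by blast
  qed
  have ua: "?u ** a = a ** ?u"
    using matrix_inv_commute[OF Ui aU(1)[symmetric]] matrix_inv_unique[OF uU(2) uU(1)] by simp
  have uw: "?u ** w = w ** ?u"
    using matrix_inv_commute[OF Ui wU(1)[symmetric]] matrix_inv_unique[OF uU(2) uU(1)] by simp
  show ?thesis
  proof (rule that[OF uU inv2])
    show "?u ** z ** a = (mat t1 - a) ** (?u ** z)"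
    proof -
      have "?u ** z ** a = ?u ** (mat t1 - a) ** z" by (metis matrix_mul_assoc z_a)
      also have "?u ** (mat t1 - a) = (mat t1 - a) ** ?u"
        using ua by (simp add: matrix_sub_ldistrib matrix_sub_rdistrib mat_central)
      finally show ?thesis by (simp add: matrix_mul_assoc)
    qed
    show "?u ** z ** w = w ** (?u ** z)" using uw w_z by (metis matrix_mul_assoc)
    fix \<Lambda> :: "('f^'n) set" assume L: "\<Lambda> \<in> lattices" "a \<in> stabilizers \<Lambda>" "w \<in> stabilizers \<Lambda>"
    have "u0 \<in> stabilizers \<Lambda>" "y \<in> stabilizers \<Lambda>" "matrix_inv c \<in> stabilizers \<Lambda>"
      using closed_order_stable[OF _ L(1,3)] u0C y(1) ciC by blast+
    then show "?u \<in> stabilizers \<Lambda> \<and> U \<in> stabilizers \<Lambda>"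
      unfolding U_def U'_def using L int by (auto intro!: stabilizers_intros)
  qed
qed

section \<open>Intertwining the two pairs\<close>

text \<open>
  The automorphism \<open>J\<close> is conjugation by the matrix with columns \<open>J(E\<^sub>k\<^sub>c) v\<close>, where \<open>E\<^sub>k\<^sub>c\<close> are the
  matrix units in a fixed column \<open>c\<close> and \<open>J(E\<^sub>c\<^sub>c) v \<noteq> 0\<close>.
\<close>

lemma automorphism_inner:
  fixes J :: "'k::field^'m^'m \<Rightarrow> 'k^'m^'m"
  assumes J: "mat_automorphism J"
  shows "\<exists>P. invertible P \<and> (\<forall>M. J M ** P = P ** M)"
proof -
  have hom: "J (M + N) = J M + J N" "J (M ** N) = J M ** J N" "J (mat c ** M) = mat c ** J M" for M N c
    using J by (auto simp: mat_automorphism_def)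
  have inj: "inj J" using J by (auto simp: mat_automorphism_def bij_def)
  have J0: "J 0 = 0"
  proof -
    have "J 0 + J 0 = J 0 + 0" using hom(1)[of 0 0] by simp
    then show ?thesis by (rule add_left_imp_eq)
  qed
  fix c0 :: 'm
  \<comment> \<open>The matrices supported in one column form a copy of the standard module, which \<open>J\<close> twists.\<close>
  define C :: "'k^'m \<Rightarrow> 'k^'m^'m" where "C x = (\<chi> r c. if c = c0 then x $ r else 0)" for x
  have C_add: "C (x + y) = C x + C y" and C_scale: "C (a *s x) = mat a ** C x" for x y a
    by (simp_all add: C_def vec_eq_iff mat_entry)
  have C_mult: "M ** C x = C (M *v x)" for M x
    by (simp add: C_def vec_eq_iff matrix_matrix_mult_def matrix_vector_mult_def)
  have C_inj: "C x = 0 \<Longrightarrow> x = 0" for x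
    by (simp add: C_def vec_eq_iff) (metis)
  have "C (axis c0 1) \<noteq> 0" using C_inj by (metis axis_eq_0_iff zero_neq_one)
  then have "J (C (axis c0 1)) \<noteq> 0" using inj J0 by (metis injD)
  then obtain v where v: "J (C (axis c0 1)) *v v \<noteq> 0" using matrix_eqI[of _ 0] by (metis matrix_vector_mult_0)
  define f where "f x = J (C x) *v v" for x
  have "Vector_Spaces.linear (*s) (*s) f"
    unfolding Vector_Spaces.linear_iff f_def C_add C_scale hom(1,3)
    by (simp add: mv_simps vec.vector_space_axioms)
  then have P: "matrix f *v x = f x" for x using matrix_works by blast
  have equiv: "f (M *v x) = J M *v f x" for M x
    by (simp add: f_def mult_mv hom(2) flip: C_mult)
  have "inj ((*v) (matrix f))"
  proof (rule injI)
    fix x y assume "matrix f *v x = matrix f *v y"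
    then have fd: "f (x - y) = 0" by (simp add: mv_simps flip: P)
    show "x = y"
    proof (rule ccontr)
      assume "x \<noteq> y"
      then obtain k where k: "(x - y) $ k \<noteq> 0" by (auto simp: vec_eq_iff)
      define M :: "'k^'m^'m" where "M = (\<chi> r c. if r = c0 \<and> c = k then inverse ((x - y) $ k) else 0)"
      have "M *v (x - y) = axis c0 1"
        using k by (simp add: vec_eq_iff M_def matrix_vector_mult_def axis_def if_distrib[of "\<lambda>u. u * _"] cong: if_cong)
      then have "f (axis c0 1) = J M *v f (x - y)" using equiv[of M "x - y"] by simp
      then show False using v fd by (simp add: f_def)
    qed
  qed
  then have "invertible (matrix f)"
    using matrix_left_invertible_injective invertible_left_inverse by blast
  moreover have "J M ** matrix f = matrix f ** M" for M
    by (intro matrix_eqI) (simp add: mult_mv P equiv)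
  ultimately show ?thesis by blast
qed

text \<open>
  Over the extension the two pairs are intertwined by \<open>P\<close>, which maps the image of \<open>p\<close> to the
  eigenspace of \<open>A\<close> for \<open>\<zeta>\<close>. The involution \<open>Z\<close> exchanges the two eigenspaces, so \<open>(1 + Z) P\<close> maps
  the image of \<open>p\<close> isomorphically to the fixed space of \<open>Z\<close>; \<open>D\<close> is this map, composed with \<open>p\<close>.
\<close>

lemma intertwiner_exists:
  fixes A W Z P p Wb Zb Zi :: "'k::field^'n^'n"
  assumes ne: "\<zeta> \<noteq> s" and AA: "A ** A = mat (\<zeta> + s) ** A - mat (\<zeta> * s)"
    and Z: "Z ** Z = mat 1" "Z ** A = (mat (\<zeta> + s) - A) ** Z" "Z ** W = W ** Z" and WA: "W ** A = A ** W"
    and P: "invertible P" "W ** P = P ** Wb" "A ** P = P ** (mat s + mat (\<zeta> - s) ** p)"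
    and p: "p ** p = p" "Zb ** p = (mat 1 - p) ** Zb" "Wb ** p = p ** Wb" "Wb ** Zb = Zb ** Wb"
    and Zi: "Zi ** Zb = mat 1" "Zb ** Zi = mat 1"
  shows "\<exists>T. invertible T \<and> W ** T = T ** Wb \<and> Z ** (T ** p) = T ** p \<and> T ** (Zb ** p) = A ** (T ** p)"
proof -
  have comm: "B *v (C *v x) = B' *v (C' *v x)" if "B ** C = B' ** C'" for B C B' C' :: "'k^'n^'n" and x
    using that by (simp add: matrix_vector_mul_assoc)
  have ZiWb: "Zi ** Wb = Wb ** Zi"
  proof -
    have "Zi ** Wb = Zi ** (Wb ** Zb) ** Zi" using Zi(2) by (metis matrix_mul_assoc matrix_mul_rid)
    also have "\<dots> = Wb ** Zi" unfolding p(4) using Zi(1) by (metis matrix_mul_assoc matrix_mul_lid)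
    finally show ?thesis .
  qed
  have Zip: "p ** Zi = Zi ** (mat 1 - p)"
  proof -
    have "p ** Zi = Zi ** (Zb ** p) ** Zi" using Zi(1) by (metis matrix_mul_assoc matrix_mul_lid)
    also have "\<dots> = Zi ** (mat 1 - p)" unfolding p(2) using Zi(2) by (metis matrix_mul_assoc matrix_mul_rid)
    finally show ?thesis .
  qed
  have v: "A *v (A *v x) = (\<zeta> + s) *s (A *v x) - (\<zeta> * s) *s x" "Z *v (Z *v x) = x"
    "Z *v (A *v x) = (\<zeta> + s) *s (Z *v x) - A *v (Z *v x)" "Z *v (W *v x) = W *v (Z *v x)" "W *v (A *v x) = A *v (W *v x)"
    "W *v (P *v x) = P *v (Wb *v x)" "A *v (P *v x) = s *s (P *v x) + (\<zeta> - s) *s (P *v (p *v x))"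
    "p *v (p *v x) = p *v x" "Zb *v (p *v x) = Zb *v x - p *v (Zb *v x)" "Wb *v (p *v x) = p *v (Wb *v x)"
    "Wb *v (Zi *v x) = Zi *v (Wb *v x)" "Zi *v (Zb *v x) = x" "Zb *v (Zi *v x) = x"
    "p *v (Zi *v x) = Zi *v x - Zi *v (p *v x)" for x
    using arg_cong[OF AA, of "\<lambda>M. M *v x"] comm[OF Z(2), of x] comm[OF Z(3), of x] comm[OF WA, of x]
      comm[OF P(2), of x] comm[OF P(3), of x] comm[OF p(2), of x] comm[OF p(3), of x] comm[OF ZiWb, of x] comm[OF Zip, of x]
      arg_cong[OF Z(1), of "\<lambda>M. M *v x"] arg_cong[OF p(1), of "\<lambda>M. M *v x"] arg_cong[OF Zi(1), of "\<lambda>M. M *v x"] arg_cong[OF Zi(2), of "\<lambda>M. M *v x"]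
    by (simp_all add: mv_simps)
  \<comment> \<open>The operator \<open>1 + Z\<close> maps the eigenspace to the space fixed by \<open>Z\<close>, injectively since \<open>Z\<close> exchanges the two eigenspaces.\<close>
  define D where "D = (mat 1 + Z) ** P ** p"
  have D: "D *v x = P *v (p *v x) + Z *v (P *v (p *v x))" for x by (simp add: D_def mv_simps)
  have Dp: "D *v (p *v x) = D *v x" and ZD: "Z *v (D *v x) = D *v x" for x
    by (simp_all add: D mv_simps v algebra_simps)
  have WD: "W *v (D *v x) = D *v (Wb *v x)" for x
    using v(4)[of "P *v (p *v x)"] by (simp add: D mv_simps v)
  have D_q: "D *v (x - p *v x) = 0" for x by (simp add: D mv_simps v)
  have D_Zip: "D *v (Zi *v (p *v x)) = 0" for x
    using v(14)[of "p *v x"] by (simp add: D v)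
  have D_ker: "p *v x = 0" if "D *v x = 0" for x
  proof -
    let ?y = "P *v (p *v x)"
    have Zy: "Z *v ?y = - ?y" using that by (simp add: D eq_neg_iff_add_eq_0 add.commute)
    have Ay: "A *v ?y = \<zeta> *s ?y" by (simp add: v vec_eq_iff algebra_simps)
    have "Z *v (A *v ?y) = (\<zeta> + s) *s (Z *v ?y) - A *v (Z *v ?y)" by (rule v(3))
    then have "- (\<zeta> *s ?y) = - ((\<zeta> + s) *s ?y) + \<zeta> *s ?y"
      unfolding Ay by (simp add: Zy Ay mv_minus vec.scale_minus_right)
    then have "(\<zeta> - s) *s ?y = 0" by (simp add: vec_eq_iff algebra_simps)
    then have "?y = 0" using ne by simp
    then have "matrix_inv P *v ?y = 0" by simp
    then show ?thesis using P(1) by simp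
  qed
  \<comment> \<open>On the image of \<open>p\<close> this is \<open>D\<close>, and on the kernel of \<open>p\<close>, which is \<open>Zb\<close> applied to the image, it is \<open>A D Zb\<^sup>-\<^sup>1\<close>.\<close>
  define T where "T = D + A ** D ** Zi"
  have T: "T *v x = D *v x + A *v (D *v (Zi *v x))" for x by (simp add: T_def mv_simps)
  have "inj ((*v) T)"
  proof (rule injI)
    fix x' x'' assume "T *v x' = T *v x''"
    define x where "x = x' - x''"
    have T0: "T *v x = 0" unfolding x_def using \<open>T *v x' = T *v x''\<close> by (simp add: mv_simps)
    let ?y1 = "D *v x" and ?y2 = "D *v (Zi *v x)"
    have e1: "?y1 + A *v ?y2 = 0" using T0 by (simp add: T)
    then have "Z *v (?y1 + A *v ?y2) = 0" by simp
    then have e2: "?y1 + ((\<zeta> + s) *s ?y2 - A *v ?y2) = 0" by (simp only: matrix_vector_right_distrib v(3) ZD)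
    have e3: "A *v ?y2 + A *v ?y2 = (\<zeta> + s) *s ?y2"
    proof -
      have "A *v ?y2 + A *v ?y2 - (\<zeta> + s) *s ?y2 = (?y1 + A *v ?y2) - (?y1 + ((\<zeta> + s) *s ?y2 - A *v ?y2))"
        by (simp add: algebra_simps)
      then show ?thesis unfolding e1 e2 by simp
    qed
    have "A *v (A *v ?y2) + A *v (A *v ?y2) = (\<zeta> + s) *s (A *v ?y2)"
      using arg_cong[OF e3, of "\<lambda>u. A *v u"] by (simp only: matrix_vector_right_distrib mv_scale)
    then have f: "(\<zeta> + s) *s (A *v ?y2) = (2 * (\<zeta> * s)) *s ?y2"
      unfolding v(1) by (simp add: vec_eq_iff algebra_simps)
    have "((\<zeta> - s) * (\<zeta> - s)) *s ?y2 = (\<zeta> + s) *s ((\<zeta> + s) *s ?y2) - (2 * 2 * (\<zeta> * s)) *s ?y2"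
      by (simp add: vec_eq_iff algebra_simps)
    also have "(\<zeta> + s) *s ((\<zeta> + s) *s ?y2) = (\<zeta> + s) *s (A *v ?y2) + (\<zeta> + s) *s (A *v ?y2)"
      unfolding e3[symmetric] by (simp only: vec.scale_right_distrib)
    finally have "((\<zeta> - s) * (\<zeta> - s)) *s ?y2 = 0" unfolding f by (simp add: vec_eq_iff algebra_simps)
    then have y2: "?y2 = 0" using ne by simp
    then have y1: "?y1 = 0" using e1 by simp
    have px: "p *v x = 0" by (rule D_ker[OF y1])
    have "p *v (Zi *v x) = 0" by (rule D_ker[OF y2])
    then have "Zi *v x = 0" using v(14)[of x] px by simp
    then have "x = 0" using v(13)[of x] by simp
    then show "x' = x''" by (simp add: x_def)
  qed
  then have "invertible T" using matrix_left_invertible_injective invertible_left_inverse by blast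
  moreover have "W ** T = T ** Wb"
    by (intro matrix_eqI) (simp add: mult_mv T mv_simps WD v)
  moreover have Tp: "T *v (p *v x) = D *v x" for x by (simp add: T Dp D_Zip)
  then have "Z ** (T ** p) = T ** p" by (intro matrix_eqI) (simp add: mult_mv ZD)
  moreover have "T ** (Zb ** p) = A ** (T ** p)"
  proof (intro matrix_eqI)
    fix x
    have "T *v (Zb *v (p *v x)) = D *v (Zb *v x - p *v (Zb *v x)) + A *v (D *v (Zi *v (Zb *v (p *v x))))"
      unfolding T v(9) ..
    also have "\<dots> = A *v (D *v x)" unfolding D_q v(12) Dp by simp
    finally show "(T ** (Zb ** p)) *v x = (A ** (T ** p)) *v x" by (simp add: mult_mv Tp)
  qed
  ultimately show ?thesis by blast
qed

lemma poly_det: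
  fixes M :: "'k::field poly^'n^'n"
  shows "poly (det M) x = det (\<chi> i j. poly (M $ i $ j) x)"
proof -
  have "poly (of_int k) x = of_int k" for k :: int
    by (cases k rule: int_cases2) (simp_all add: poly_of_nat)
  then show ?thesis unfolding det_def by (simp add: poly_sum poly_prod)
qed

context quadratic_ext
begin

lemma map_matrix_mult: "map_matrix \<iota> (A ** B) = map_matrix \<iota> A ** map_matrix \<iota> B" for A B :: "'f^'n^'n"
proof -
  have "\<iota> (sum f S) = (\<Sum>x\<in>S. \<iota> (f x))" for f :: "'n \<Rightarrow> 'f" and S
    by (induction S rule: infinite_finite_induct) (simp_all add: iota_hom)
  then show ?thesis by (simp add: vec_eq_iff map_matrix_def matrix_matrix_mult_def iota_hom)
qed

lemma map_matrix_add: "map_matrix \<iota> (A + B) = map_matrix \<iota> A + map_matrix \<iota> B"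
  and map_matrix_diff: "map_matrix \<iota> (A - B) = map_matrix \<iota> A - map_matrix \<iota> B"
  and map_matrix_mat: "map_matrix \<iota> (mat c) = mat (\<iota> c)"
  for A B :: "'f^'n^'n"
  by (simp_all add: vec_eq_iff map_matrix_def mat_def iota_simps)

lemma det_map_matrix: "det (map_matrix \<iota> A) = \<iota> (det A)" for A :: "'f^'n^'n"
proof -
  have sum: "\<iota> (sum f S) = (\<Sum>x\<in>S. \<iota> (f x))" for f :: "('n \<Rightarrow> 'n) \<Rightarrow> 'f" and S
    by (induction S rule: infinite_finite_induct) (simp_all add: iota_hom)
  have prod: "\<iota> (prod f S) = (\<Prod>x\<in>S. \<iota> (f x))" for f :: "'n \<Rightarrow> 'f" and S
    by (induction S rule: infinite_finite_induct) (simp_all add: iota_hom)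
  have int: "\<iota> (of_int k) = of_int k" for k
  proof -
    have "\<iota> (of_nat m) = of_nat m" for m by (induction m) (simp_all add: iota_hom)
    then show ?thesis by (cases k rule: int_cases2) (simp_all add: iota_minus)
  qed
  show ?thesis unfolding det_def by (simp add: sum prod int iota_hom map_matrix_def)
qed

text \<open>
  The two coordinate matrices \<open>T\<^sub>0, T\<^sub>1\<close> of the given solution are solutions over \<open>F\<close>, and so is \<open>T\<^sub>0 + c T\<^sub>1\<close>. Its
  determinant is a polynomial in \<open>c\<close> that does not vanish at the generator, so it does not vanish at some
  \<open>c\<close> in the infinite field \<open>F\<close>.
\<close>

lemma descend_solution:
  fixes T :: "'k^'n^'n" and S :: "(('f^'n^'n) \<times> ('f^'n^'n) \<times> ('f^'n^'n) \<times> ('f^'n^'n)) set"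
  assumes T: "invertible T"
    and sol: "\<And>A B C D. (A, B, C, D) \<in> S \<Longrightarrow>
      map_matrix \<iota> A ** T ** map_matrix \<iota> B = map_matrix \<iota> C ** T ** map_matrix \<iota> D"
  shows "\<exists>T'. invertible T' \<and> (\<forall>(A, B, C, D)\<in>S. A ** T' ** B = C ** T' ** D)"
proof -
  obtain g where g: "g \<notin> range \<iota>" using generator_exists by blast
  obtain cx cy where c: "\<And>z. z = \<iota> (cx z) + \<iota> (cy z) * g" using generator_spans[OF g] by metis
  define T0 T1 where "T0 = (\<chi> i j. cx (T $ i $ j))" and "T1 = (\<chi> i j. cy (T $ i $ j))"
  have T01: "T = map_matrix \<iota> T0 + mat g ** map_matrix \<iota> T1"
    using c by (simp add: vec_eq_iff T0_def T1_def map_matrix_def mat_entry mult.commute)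
  have expand: "map_matrix \<iota> A ** T ** map_matrix \<iota> B = map_matrix \<iota> (A ** T0 ** B) + mat g ** map_matrix \<iota> (A ** T1 ** B)" for A B :: "'f^'n^'n"
    unfolding T01 by (simp add: map_matrix_mult matrix_eq mv_simps)
  have sol': "A ** T0 ** B = C ** T0 ** D \<and> A ** T1 ** B = C ** T1 ** D" if "(A, B, C, D) \<in> S" for A B C D
  proof -
    have "map_matrix \<iota> (A ** T0 ** B) + mat g ** map_matrix \<iota> (A ** T1 ** B) =
        map_matrix \<iota> (C ** T0 ** D) + mat g ** map_matrix \<iota> (C ** T1 ** D)"
      using sol[OF that] unfolding expand .
    then have "\<iota> ((A ** T0 ** B) $ i $ j) + \<iota> ((A ** T1 ** B) $ i $ j) * g = \<iota> ((C ** T0 ** D) $ i $ j) + \<iota> ((C ** T1 ** D) $ i $ j) * g" for i j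
      by (simp add: vec_eq_iff map_matrix_def mat_entry mult.commute)
    then have "(A ** T0 ** B) $ i $ j = (C ** T0 ** D) $ i $ j \<and> (A ** T1 ** B) $ i $ j = (C ** T1 ** D) $ i $ j" for i j
      using generator_unique[OF g] by blast
    then show ?thesis by (simp add: vec_eq_iff)
  qed
  \<comment> \<open>The matrix \<open>T\<^sub>0 + X T\<^sub>1\<close> over the polynomial ring.\<close>
  define M where "M = (\<chi> i j. [:\<iota> (T0 $ i $ j), \<iota> (T1 $ i $ j):])"
  have "poly (det M) g = det T"
    unfolding poly_det by (rule arg_cong[of _ _ det]) (simp add: T01 M_def vec_eq_iff map_matrix_def mat_entry)
  then have "det M \<noteq> 0" using T by (auto simp: invertible_det_nz)
  then have "finite {x. poly (det M) x = 0}" by (rule poly_roots_finite)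
  moreover have "infinite (range \<iota>)"
    using infinite_nonarch_local_field[where ?'f='f] finite_imageD[of \<iota> UNIV] by (auto simp: inj_on_def)
  ultimately obtain e where e: "poly (det M) (\<iota> e) \<noteq> 0" by (metis (mono_tags, lifting) finite_subset imageE mem_Collect_eq subsetI)
  let ?T = "T0 + mat e ** T1"
  have "poly (det M) (\<iota> e) = \<iota> (det ?T)"
    unfolding poly_det det_map_matrix[symmetric]
    by (rule arg_cong[of _ _ det]) (simp add: M_def vec_eq_iff map_matrix_def mat_entry iota_hom)
  then have "invertible ?T" using e by (simp add: invertible_det_nz)
  moreover have "A ** ?T ** B = C ** ?T ** D" if "(A, B, C, D) \<in> S" for A B C D
  proof -
    have "A' ** ?T ** B' = A' ** T0 ** B' + mat e ** (A' ** T1 ** B')" for A' B' :: "'f^'n^'n"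
      by (simp add: matrix_eq mv_simps)
    then show ?thesis using sol'[OF that] by simp
  qed
  ultimately show ?thesis by blast
qed

end

section \<open>The correspondence of lattices\<close>

text \<open>
  The situation after descent: \<open>u z\<close> is the semilinear involution attached to \<open>a, b\<close>, and \<open>T\<close> maps the
  image of \<open>p\<close> to the space fixed by it and the image of \<open>1 - p\<close> to the translate of that space by \<open>a\<close>.
\<close>

locale matched_pairs =
  A: local_quaternion_pair a b t1 n1 t2 n2 +
  B: local_quaternion_pair p b3 1 0 "t1 * t2" "n1 * t2 ^ 2 + t1 ^ 2 * n2 - 4 * n1 * n2"
  for a b p b3 :: "'f::nonarch_local_field^'n^'n" and t1 n1 t2 n2 +
  fixes u v T :: "'f^'n^'n"
  assumes uv: "v ** u = mat 1"
    and Z: "(u ** A.z) ** (u ** A.z) = mat 1" "(u ** A.z) ** a = (mat t1 - a) ** (u ** A.z)"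
    and uv_stable: "\<And>\<Lambda>. \<Lambda> \<in> lattices \<Longrightarrow> a \<in> stabilizers \<Lambda> \<Longrightarrow> A.w \<in> stabilizers \<Lambda> \<Longrightarrow> u \<in> stabilizers \<Lambda> \<and> v \<in> stabilizers \<Lambda>"
    and T: "invertible T" "A.w ** T = T ** B.w" "(u ** A.z) ** (T ** p) = T ** p" "T ** (B.z ** p) = a ** (T ** p)"
    and det_z: "aval (det B.z) = 1"
begin

lemma p_idem: "p *v (p *v x) = p *v x"
  using B.aav[of x] by simp

lemma vecs:
  "(u ** A.z) *v (T *v (p *v x)) = T *v (p *v x)"
  "T *v (B.z *v (p *v x)) = a *v (T *v (p *v x))"
  "A.w *v (T *v x) = T *v (B.w *v x)"
  "(u ** A.z) *v (a *v x) = t1 *s ((u ** A.z) *v x) - a *v ((u ** A.z) *v x)"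
  "B.z *v (p *v x) = B.z *v x - p *v (B.z *v x)"
proof -
  have comm: "C *v (D *v x) = C' *v (D' *v x)" if "C ** D = C' ** D'" for C D C' D' :: "'f^'n^'n" and x
    using that by (simp add: matrix_vector_mul_assoc)
  show "(u ** A.z) *v (T *v (p *v x)) = T *v (p *v x)" using arg_cong[OF T(3), of "\<lambda>M. M *v x"] by (simp add: mult_mv)
  show "T *v (B.z *v (p *v x)) = a *v (T *v (p *v x))" using arg_cong[OF T(4), of "\<lambda>M. M *v x"] by (simp add: mult_mv)
  show "A.w *v (T *v x) = T *v (B.w *v x)" by (rule comm[OF T(2)])
  show "(u ** A.z) *v (a *v x) = t1 *s ((u ** A.z) *v x) - a *v ((u ** A.z) *v x)"
    using comm[OF Z(2), of x] by (simp add: mv_simps)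
  show "B.z *v (p *v x) = B.z *v x - p *v (B.z *v x)" using comm[OF B.z_a, of x] by (simp add: mv_simps)
qed

lemma Bz_invertible: "invertible B.z"
  using det_z by (auto simp: invertible_det_nz)

text \<open>
  Since \<open>z\<close> is invertible and exchanges \<open>p\<close> with \<open>1 - p\<close>, it maps the image of \<open>p\<close> onto the kernel of \<open>p\<close>.
\<close>

lemma kernel_part:
  fixes x defines "y \<equiv> matrix_inv B.z *v (x - p *v x)"
  shows "p *v y = y" "x = p *v x + B.z *v (p *v y)"
proof -
  have zy: "B.z *v y = x - p *v x" using Bz_invertible by (simp add: y_def)
  have "B.z *v (p *v y) = B.z *v y" by (simp add: vecs(5) zy mv_simps p_idem)
  then have "matrix_inv B.z *v (B.z *v (p *v y)) = matrix_inv B.z *v (B.z *v y)" by simp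
  then show py: "p *v y = y" using Bz_invertible by simp
  show "x = p *v x + B.z *v (p *v y)" unfolding py zy by simp
qed

lemma image_decomposition:
  "T *v x = T *v (p *v x) + a *v (T *v (p *v (matrix_inv B.z *v (x - p *v x))))"
  by (subst (1) kernel_part(2)[of x]) (simp only: matrix_vector_right_distrib vecs(2))

lemma z_square_intertwines: "T *v (B.z *v (B.z *v x)) = A.z *v (A.z *v (T *v x))"
proof -
  have "B.z *v (B.z *v x) = B.w *v (B.w *v x) - (t1 * t2) *s (B.w *v x) + (n1 * t2 ^ 2 + t1 ^ 2 * n2 - 4 * n1 * n2) *s x"
    using arg_cong[OF B.z_square, of "\<lambda>M. M *v x"] by (simp add: mv_simps)
  moreover have "A.z *v (A.z *v y) = A.w *v (A.w *v y) - (t1 * t2) *s (A.w *v y) + (n1 * t2 ^ 2 + t1 ^ 2 * n2 - 4 * n1 * n2) *s y" for y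
    using arg_cong[OF A.z_square, of "\<lambda>M. M *v y"] by (simp add: mv_simps mult.commute)
  ultimately show ?thesis by (simp only: mv_simps mv_scale vecs(3))
qed

text \<open>
  The element \<open>z\<close> preserves a lattice that is stable under \<open>p\<close> and \<open>b\<^sub>3\<close>, bijectively because its
  determinant is a unit.
\<close>

lemma beta_z_image:
  assumes L: "\<Lambda> \<in> lattices" "p \<in> stabilizers \<Lambda>" "b3 \<in> stabilizers \<Lambda>"
  shows "(*v) B.z ` \<Lambda> = \<Lambda>"
  using image_lattice_eq[OF L(1) _ det_z] B.stable_iff[OF L(1,2)] L(3) by blast

text \<open>
  With \<open>N\<close> the image of \<open>\<Lambda>\<close> under \<open>p\<close> the lattice is \<open>N + z N\<close>, and its image is \<open>T N + a T N\<close>, on which \<open>a\<close> and the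
  involution \<open>u z\<close> act through the integral coefficients of the polynomial of \<open>a\<close>.
\<close>

lemma stable_image:
  assumes L: "\<Lambda> \<in> lattices" "p \<in> stabilizers \<Lambda>" "b3 \<in> stabilizers \<Lambda>"
  shows "a \<in> stabilizers ((*v) T ` \<Lambda>) \<and> b \<in> stabilizers ((*v) T ` \<Lambda>)"
proof -
  let ?M = "(*v) T ` \<Lambda>"
  have M: "?M \<in> lattices" by (rule lattice_image[OF T(1) L(1)])
  have wz: "B.w \<in> stabilizers \<Lambda>" "B.z \<in> stabilizers \<Lambda>" using B.stable_iff[OF L(1,2)] L(3) by blast+
  have mem: "T *v (p *v x) + a *v (T *v (p *v y)) \<in> ?M" if "x \<in> \<Lambda>" "y \<in> \<Lambda>" for x y
  proof -
    have "p *v x + B.z *v (p *v y) \<in> \<Lambda>" using that L(2) wz(2) lattice_add[OF L(1)] by (auto simp: stabilizers_def)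
    then have "T *v (p *v x + B.z *v (p *v y)) \<in> ?M" by blast
    then show ?thesis by (simp add: matrix_vector_right_distrib vecs(2))
  qed
  have form: "\<exists>x\<in>\<Lambda>. \<exists>y\<in>\<Lambda>. m = T *v (p *v x) + a *v (T *v (p *v y))" if m: "m \<in> ?M" for m
  proof -
    obtain x where x: "x \<in> \<Lambda>" "m = T *v x" using m by blast
    have "x - p *v x \<in> \<Lambda>" using x L(2) lattice_diff[OF L(1)] by (auto simp: stabilizers_def)
    then obtain y where "y \<in> \<Lambda>" "B.z *v y = x - p *v x" using beta_z_image[OF L] by (metis imageE)
    then have "matrix_inv B.z *v (x - p *v x) \<in> \<Lambda>" using Bz_invertible by (metis matrix_inv_mv(1))
    then show ?thesis using x image_decomposition[of x] by blast
  qed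
  have a: "a \<in> stabilizers ?M"
    unfolding stabilizers_iff
  proof
    fix m assume "m \<in> ?M"
    then obtain x y where xy: "x \<in> \<Lambda>" "y \<in> \<Lambda>" "m = T *v (p *v x) + a *v (T *v (p *v y))" using form by blast
    have "a *v m = T *v (p *v (- (n1 *s y))) + a *v (T *v (p *v (x + t1 *s y)))"
      by (simp add: xy(3) mv_simps A.aav vec_eq_iff algebra_simps)
    moreover have "- (n1 *s y) \<in> \<Lambda>" "x + t1 *s y \<in> \<Lambda>"
      using xy A.int lattice_minus[OF L(1)] lattice_scale[OF L(1)] lattice_add[OF L(1)] by blast+
    ultimately show "a *v m \<in> ?M" using mem by simp
  qed
  have w: "A.w \<in> stabilizers ?M"
    unfolding stabilizers_iff using wz(1) by (auto simp: stabilizers_def vecs(3))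
  have "u ** A.z \<in> stabilizers ?M"
    unfolding stabilizers_iff
  proof
    fix m assume "m \<in> ?M"
    then obtain x y where xy: "x \<in> \<Lambda>" "y \<in> \<Lambda>" "m = T *v (p *v x) + a *v (T *v (p *v y))" using form by blast
    have "(u ** A.z) *v m = T *v (p *v (x + t1 *s y)) + a *v (T *v (p *v (- y)))"
      by (simp only: xy(3) matrix_vector_right_distrib vecs(4) vecs(1)) (simp add: mv_simps)
    moreover have "- y \<in> \<Lambda>" "x + t1 *s y \<in> \<Lambda>"
      using xy A.int lattice_minus[OF L(1)] lattice_scale[OF L(1)] lattice_add[OF L(1)] by blast+
    ultimately show "(u ** A.z) *v m \<in> ?M" using mem by simp
  qed
  moreover have "v \<in> stabilizers ?M" using uv_stable[OF M a w] by blast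
  ultimately have "v ** (u ** A.z) \<in> stabilizers ?M" using stabilizers_mult by blast
  then have "A.z \<in> stabilizers ?M" using uv by (simp add: matrix_mul_assoc)
  then show ?thesis using a w A.stable_iff[OF M a] by blast
qed

text \<open>
  A lattice stable under \<open>a\<close> and the involution contains, with \<open>m = x + a y\<close>, where \<open>x\<close> and \<open>y\<close> are fixed by the
  involution, also \<open>y\<close> and \<open>x\<close>. This is descent along an unramified extension: the formula for \<open>y\<close> has the unit
  discriminant of \<open>a\<close> as denominator.
\<close>

lemma stable_preimage:
  assumes L: "\<Lambda> \<in> lattices" and ab: "a \<in> stabilizers ((*v) T ` \<Lambda>)" "b \<in> stabilizers ((*v) T ` \<Lambda>)"
  shows "p \<in> stabilizers \<Lambda> \<and> b3 \<in> stabilizers \<Lambda>"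
proof -
  let ?M = "(*v) T ` \<Lambda>"
  have M: "?M \<in> lattices" by (rule lattice_image[OF T(1) L])
  have wz: "A.w \<in> stabilizers ?M" "A.z \<in> stabilizers ?M" using A.stable_iff[OF M ab(1)] ab(2) by blast+
  have reflect: "x \<in> \<Lambda>" if "T *v x \<in> ?M" for x
    using that inj_matrix_vector_mult[OF T(1)] by (simp add: inj_image_mem_iff)
  have Zst: "u ** A.z \<in> stabilizers ?M"
    using uv_stable[OF M ab(1) wz(1)] wz(2) by (intro stabilizers_mult) auto
  have parts: "T *v (p *v x) \<in> ?M \<and> T *v (p *v (matrix_inv B.z *v (x - p *v x))) \<in> ?M" if x: "x \<in> \<Lambda>" for x
  proof -
    let ?d = "t1 ^ 2 - 4 * n1"
    define A B m where "A = T *v (p *v x)" and "B = T *v (p *v (matrix_inv B.z *v (x - p *v x)))" and "m = T *v x"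
    have m: "m = A + a *v B" unfolding m_def A_def B_def by (rule image_decomposition)
    have "(u ** A.z) *v m = A + (t1 *s B - a *v B)"
      unfolding m matrix_vector_right_distrib vecs(4) by (simp only: A_def B_def vecs(1))
    then have d: "m - (u ** A.z) *v m = 2 *s (a *v B) - t1 *s B"
      by (simp add: m vec_eq_iff algebra_simps)
    have mM: "m \<in> ?M" using x by (simp add: m_def)
    then have e: "m - (u ** A.z) *v m \<in> ?M" using Zst lattice_diff[OF M] by (auto simp: stabilizers_def)
    have "inverse ?d *s (2 *s (a *v (m - (u ** A.z) *v m)) - t1 *s (m - (u ** A.z) *v m)) = inverse ?d *s (?d *s B)"
      unfolding d by (simp add: mv_simps A.aav vec_eq_iff power2_eq_square algebra_simps)
    also have "\<dots> = B" by (simp only: vec.scale_scale left_inverse[OF A.disc_nonzero] vec.scale_one)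
    finally have "B = inverse ?d *s (2 *s (a *v (m - (u ** A.z) *v m)) - t1 *s (m - (u ** A.z) *v m))" by simp
    moreover have "inverse ?d \<in> int_ring" using A.disc by (simp add: int_ring_def aval_inverse)
    moreover have "a *v (m - (u ** A.z) *v m) \<in> ?M" using e ab(1) unfolding stabilizers_iff by blast
    moreover have "inverse ?d *s (2 *s x - t1 *s y) \<in> ?M"
      if "x \<in> ?M" "y \<in> ?M" "inverse ?d \<in> int_ring" for x y
      using that A.int(1) by (intro lattice_scale[OF M] lattice_diff[OF M] int_ring_numeral)
    ultimately have B: "B \<in> ?M" using e by metis
    have "A = m - a *v B" unfolding m by simp
    then have "A \<in> ?M" using B mM ab(1) lattice_diff[OF M] by (auto simp: stabilizers_def)
    then show ?thesis using B by (simp add: A_def B_def)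
  qed
  have p: "p \<in> stabilizers \<Lambda>" unfolding stabilizers_iff using parts reflect by blast
  have w: "B.w \<in> stabilizers \<Lambda>"
    unfolding stabilizers_iff
  proof
    fix x assume "x \<in> \<Lambda>"
    then have "A.w *v (T *v x) \<in> ?M" using wz(1) by (auto simp: stabilizers_def)
    then show "B.w *v x \<in> \<Lambda>" unfolding vecs(3) by (rule reflect)
  qed
  have "B.z \<in> stabilizers \<Lambda>"
    unfolding stabilizers_iff
  proof
    fix x assume x: "x \<in> \<Lambda>"
    let ?y = "p *v (matrix_inv B.z *v (x - p *v x))"
    have "T *v (B.z *v x) = T *v (B.z *v (p *v x)) + T *v (B.z *v (B.z *v ?y))"
      by (subst (1) kernel_part(2)[of x]) (simp only: matrix_vector_right_distrib)
    also have "\<dots> = a *v (T *v (p *v x)) + A.z *v (A.z *v (T *v ?y))"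
      by (simp only: vecs(2) z_square_intertwines)
    also have "\<dots> \<in> ?M"
    proof (rule lattice_add[OF M])
      show "a *v (T *v (p *v x)) \<in> ?M" using parts[OF x] ab(1) unfolding stabilizers_iff by blast
      show "A.z *v (A.z *v (T *v ?y)) \<in> ?M" using parts[OF x] wz(2) unfolding stabilizers_iff by blast
    qed
    finally show "B.z *v x \<in> \<Lambda>" by (rule reflect)
  qed
  then show ?thesis using p w B.stable_iff[OF L p] by blast
qed

end

section \<open>Orbital integrals as lattice counts\<close>

definition matrix_group :: "('f::field^'m^'m) set \<Rightarrow> bool" where
  "matrix_group H \<longleftrightarrow> mat 1 \<in> H \<and> (\<forall>g\<in>H. invertible g \<and> matrix_inv g \<in> H) \<and> (\<forall>g\<in>H. \<forall>h\<in>H. g ** h \<in> H)"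

lemma matrix_groupD:
  assumes "matrix_group H"
  shows "mat 1 \<in> H" "g \<in> H \<Longrightarrow> invertible g" "g \<in> H \<Longrightarrow> matrix_inv g \<in> H" "g \<in> H \<Longrightarrow> h \<in> H \<Longrightarrow> g ** h \<in> H"
  using assms by (auto simp: matrix_group_def)

lemma matrix_group_centralizer: "matrix_group (centralizer A \<gamma>)"
proof -
  have "matrix_inv g ** \<gamma> x = \<gamma> x ** matrix_inv g" if "invertible g" "g ** \<gamma> x = \<gamma> x ** g" for g x
    using that by (rule matrix_inv_commute)
  moreover have "g ** h ** \<gamma> x = \<gamma> x ** (g ** h)" if "g ** \<gamma> x = \<gamma> x ** g" "h ** \<gamma> x = \<gamma> x ** h" for g h x
    using that by (metis matrix_mul_assoc)
  ultimately show ?thesis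
    unfolding matrix_group_def centralizer_def
    by (auto simp: invertible_mat_1 invertible_matrix_inv invertible_mult)
qed

lemma mat_units_group:
  assumes one: "mat 1 \<in> R" and mult: "\<And>x y. x \<in> R \<Longrightarrow> y \<in> R \<Longrightarrow> x ** y \<in> R"
  shows "matrix_group (mat_units R :: ('f::field^'m^'m) set)"
  unfolding matrix_group_def
proof (intro conjI ballI)
  show "mat 1 \<in> mat_units R" using one by (auto simp: mat_units_def)
next
  fix g :: "'f^'m^'m" assume "g \<in> mat_units R"
  then obtain y where y: "g \<in> R" "y \<in> R" "g ** y = mat 1" "y ** g = mat 1" by (auto simp: mat_units_def)
  then show "invertible g" by (auto simp: invertible_def)
  have "matrix_inv g = y" using y by (intro matrix_inv_unique)
  then show "matrix_inv g \<in> mat_units R" using y by (auto simp: mat_units_def)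
next
  fix g h :: "'f^'m^'m" assume "g \<in> mat_units R" "h \<in> mat_units R"
  then obtain y y' where y: "g \<in> R" "y \<in> R" "g ** y = mat 1" "y ** g = mat 1"
      "h \<in> R" "y' \<in> R" "h ** y' = mat 1" "y' ** h = mat 1" by (auto simp: mat_units_def)
  have "g ** h ** (y' ** y) = g ** (h ** y') ** y" "y' ** y ** (g ** h) = y' ** (y ** g) ** h"
    by (simp_all only: matrix_mul_assoc)
  then have "g ** h ** (y' ** y) = mat 1" "y' ** y ** (g ** h) = mat 1" using y by simp_all
  then show "g ** h \<in> mat_units R" using y mult by (auto simp: mat_units_def intro!: bexI[of _ "y' ** y"])
qed

lemma mat_units_adjoin_group: "matrix_group (mat_units (adjoin w))"
  by (intro mat_units_group adjoin_mat_1 adjoin_mult)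

lemma mat_units_order_group: "matrix_group (mat_units (adjoin_max_order w))"
proof (intro mat_units_group)
  show "mat 1 \<in> adjoin_max_order w" by (simp add: adjoin_max_order_iff adjoin_mat_1 power_bounded_mat_1)
  show "x ** y \<in> adjoin_max_order w" if "x \<in> adjoin_max_order w" "y \<in> adjoin_max_order w" for x y
    using that by (auto simp: adjoin_max_order_iff intro: adjoin_mult power_bounded_mult adjoin_commute_adjoin)
qed

text \<open>
  The \<open>h\<close> in \<open>H\<close> for which \<open>g h\<close> is a basis of \<open>\<Lambda>\<close>. They are a coset of the subgroup \<open>H \<inter> GL_int\<close> or there
  are none.
\<close>

definition position_coset :: "('f::nonarch_local_field^'m^'m) set \<Rightarrow> 'f^'m^'m \<Rightarrow> ('f^'m) set \<Rightarrow> ('f^'m^'m) set" where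
  "position_coset H g \<Lambda> = {h \<in> H. lattice_of (g ** h) = \<Lambda>}"

lemma position_coset_measure:
  fixes H :: "('f::nonarch_local_field^'m^'m) set"
  assumes mu: "haar_measure H (H \<inter> GL_int) \<mu>" and H: "matrix_group H" and g: "invertible g"
  shows "position_coset H g \<Lambda> \<in> sets \<mu>"
    and "position_coset H g \<Lambda> \<noteq> {} \<Longrightarrow> emeasure \<mu> (position_coset H g \<Lambda>) = 1"
proof -
  have "position_coset H g \<Lambda> \<in> sets \<mu> \<and> emeasure \<mu> (position_coset H g \<Lambda>) = 1" if ne: "position_coset H g \<Lambda> \<noteq> {}"
  proof -
    obtain k where k: "k \<in> H" "lattice_of (g ** k) = \<Lambda>" using ne by (auto simp: position_coset_def)
    have U: "H \<inter> GL_int \<in> sets \<mu>" "emeasure \<mu> (H \<inter> GL_int) = 1"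
      using mu emeasure_notin_sets[of "H \<inter> GL_int" \<mu>] by (auto simp: haar_measure_def)
    have "position_coset H g \<Lambda> = (**) k ` (H \<inter> GL_int)"
    proof (rule Set.set_eqI)
      fix h
      have "h \<in> position_coset H g \<Lambda> \<longleftrightarrow> h \<in> H \<and> matrix_inv k ** h \<in> GL_int"
      proof (cases "h \<in> H")
        case True
        then have "lattice_of (g ** h) = \<Lambda> \<longleftrightarrow> matrix_inv (g ** k) ** (g ** h) \<in> GL_int"
          using lattice_of_eq_iff[of "g ** k" "g ** h"] k g matrix_groupD(2)[OF H] by (auto simp: invertible_mult)
        also have "matrix_inv (g ** k) ** (g ** h) = matrix_inv k ** h"
          using g k(1) matrix_groupD(2)[OF H k(1)]
          by (simp add: matrix_inv_mult) (metis matrix_inv_left matrix_mul_assoc matrix_mul_lid)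
        finally show ?thesis using True by (simp add: position_coset_def)
      qed (simp add: position_coset_def)
      also have "\<dots> \<longleftrightarrow> h \<in> (**) k ` (H \<inter> GL_int)"
      proof
        assume h: "h \<in> H \<and> matrix_inv k ** h \<in> GL_int"
        have "h = k ** (matrix_inv k ** h)"
          using k(1) matrix_groupD(2)[OF H] by (metis matrix_inv_right matrix_mul_assoc matrix_mul_lid)
        then show "h \<in> (**) k ` (H \<inter> GL_int)" using h k(1) matrix_groupD[OF H] by blast
      next
        assume "h \<in> (**) k ` (H \<inter> GL_int)"
        then obtain x where x: "x \<in> H" "x \<in> GL_int" "h = k ** x" by blast
        have "matrix_inv k ** h = x"
          using k(1) x(3) matrix_groupD(2)[OF H] by (metis matrix_inv_left matrix_mul_assoc matrix_mul_lid)
        then show "h \<in> H \<and> matrix_inv k ** h \<in> GL_int" using x k(1) matrix_groupD(4)[OF H] by simp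
      qed
      finally show "h \<in> position_coset H g \<Lambda> \<longleftrightarrow> h \<in> (**) k ` (H \<inter> GL_int)" .
    qed
    moreover have "emeasure \<mu> ((**) k ` (H \<inter> GL_int)) = 1"
      using mu U k(1) unfolding haar_measure_def by metis
    ultimately show ?thesis using emeasure_notin_sets[of "position_coset H g \<Lambda>" \<mu>] by fastforce
  qed
  then show "position_coset H g \<Lambda> \<in> sets \<mu>"
    and "position_coset H g \<Lambda> \<noteq> {} \<Longrightarrow> emeasure \<mu> (position_coset H g \<Lambda>) = 1"
    by (cases "position_coset H g \<Lambda> = {}"; simp)+
qed

text \<open>
  There are countably many lattices, so \<open>H\<close> is a countable union of cosets of volume 1.
\<close>

lemma haar_sigma_finite:
  fixes H :: "('f::nonarch_local_field^'m^'m) set"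
  assumes mu: "haar_measure H (H \<inter> GL_int) \<mu>" and H: "matrix_group H"
  shows "sigma_finite_measure \<mu>"
proof
  let ?A = "position_coset H (mat 1) ` lattices"
  note pc = position_coset_measure[OF mu H invertible_mat_1]
  have "\<Union>?A = H"
  proof (intro equalityI subsetI)
    fix h assume h: "h \<in> H"
    then have "lattice_of h \<in> lattices" using matrix_groupD(2)[OF H] by (auto simp: lattices_def)
    then show "h \<in> \<Union>?A" using h by (auto simp: position_coset_def)
  qed (auto simp: position_coset_def)
  moreover have "emeasure \<mu> (position_coset H (mat 1) \<Lambda>) \<noteq> \<infinity>" for \<Lambda>
    using pc(2)[of \<Lambda>] by (cases "position_coset H (mat 1) \<Lambda> = {}") auto
  ultimately show "\<exists>A. countable A \<and> A \<subseteq> sets \<mu> \<and> \<Union>A = space \<mu> \<and> (\<forall>a\<in>A. emeasure \<mu> a \<noteq> \<infinity>)"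
    using pc(1) countable_lattices mu by (intro exI[of _ ?A]) (auto simp: haar_measure_def)
qed

lemma image_matrix_mult: "(*v) (A ** B) ` S = (*v) A ` ((*v) B ` S)" for A B :: "'f::field^'m^'m"
  by (simp add: image_image mult_mv)

lemma image_matrix_inv:
  assumes "invertible (l :: 'f::field^'m^'m)"
  shows "(*v) l ` S = S' \<longleftrightarrow> S = (*v) (matrix_inv l) ` S'"
  using assms by (auto simp: image_image matrix_inv_mv)

text \<open>
  The data of an orbital integral, with the centralizers replaced by arbitrary matrix groups that contain
  the conjugates of \<open>L\<^sup>\<times>\<close>.
\<close>

locale orbital_unfolding =
  fixes H1 H2 :: "('f::nonarch_local_field^'m^'m) set" and g1 g2 w :: "'f^'m^'m"
    and \<mu>1 \<mu>2 \<nu> :: "('f^'m^'m) measure" and Q :: "(('f^'m^'m) \<times> ('f^'m^'m)) set measure"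
  assumes H1: "matrix_group H1" and H2: "matrix_group H2"
    and g1: "invertible g1" and g2: "invertible g2"
    and \<mu>1: "haar_measure H1 (H1 \<inter> GL_int) \<mu>1" and \<mu>2: "haar_measure H2 (H2 \<inter> GL_int) \<mu>2"
    and \<nu>: "haar_measure (mat_units (adjoin w)) (mat_units (adjoin_max_order w)) \<nu>"
    and Q: "quotient_measure (pair_action g1 g2) \<nu> (\<mu>1 \<Otimes>\<^sub>M \<mu>2) Q"
    and act1: "l \<in> mat_units (adjoin w) \<Longrightarrow> matrix_inv g1 ** l ** g1 \<in> H1"
    and act2: "l \<in> mat_units (adjoin w) \<Longrightarrow> matrix_inv g2 ** l ** g2 \<in> H2"
begin

abbreviation units where "units \<equiv> mat_units (adjoin w)"
abbreviation int_units where "int_units \<equiv> mat_units (adjoin_max_order w)"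
abbreviation act where "act \<equiv> pair_action g1 g2"

text \<open>
  The pairs \<open>(h\<^sub>1, h\<^sub>2)\<close> at which the integrand is supported are partitioned by the common lattice
  \<open>g\<^sub>1 h\<^sub>1 O\<^sup>m = g\<^sub>2 h\<^sub>2 O\<^sup>m\<close>. Each part is a product of cosets of volume 1.
\<close>

definition box where "box \<Lambda> = position_coset H1 g1 \<Lambda> \<times> position_coset H2 g2 \<Lambda>"

definition common_lattices where
  "common_lattices = {\<Lambda>. position_coset H1 g1 \<Lambda> \<noteq> {} \<and> position_coset H2 g2 \<Lambda> \<noteq> {}}"

definition equal_positions where "equal_positions = (\<Union>\<Lambda>. box \<Lambda>)"

definition equal_orbits where "equal_orbits = {C \<in> space Q. C \<subseteq> equal_positions}"

lemmas group = mat_units_adjoin_group[of w] mat_units_order_group[of w]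
lemmas groupD = matrix_groupD[OF group(1)]
lemmas int_groupD = matrix_groupD[OF group(2)]

lemma int_units_sub: "int_units \<subseteq> units"
  by (auto simp: mat_units_def adjoin_max_order_iff)

lemma units_commute: "k \<in> units \<Longrightarrow> l \<in> units \<Longrightarrow> k ** l = l ** k"
  by (rule adjoin_commute_adjoin[of _ w]) (auto simp: mat_units_def)

lemma common_lattices_sub: "common_lattices \<subseteq> lattices"
proof
  fix \<Lambda> assume "\<Lambda> \<in> common_lattices"
  then obtain h where "h \<in> H1" "lattice_of (g1 ** h) = \<Lambda>" by (auto simp: common_lattices_def position_coset_def)
  then show "\<Lambda> \<in> lattices" using invertible_mult[OF g1] matrix_groupD(2)[OF H1] by (auto simp: lattices_def)
qed

lemma countable_common: "countable common_lattices"
  using countable_subset[OF common_lattices_sub countable_lattices] .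

lemma box_iff: "(h1, h2) \<in> box \<Lambda> \<longleftrightarrow> h1 \<in> H1 \<and> h2 \<in> H2 \<and> lattice_of (g1 ** h1) = \<Lambda> \<and> lattice_of (g2 ** h2) = \<Lambda>"
  by (auto simp: box_def position_coset_def)

lemma box_common: "x \<in> box \<Lambda> \<Longrightarrow> \<Lambda> \<in> common_lattices"
  by (auto simp: box_def common_lattices_def)

lemma box_unique: "x \<in> box \<Lambda> \<Longrightarrow> x \<in> box \<Lambda>' \<Longrightarrow> \<Lambda> = \<Lambda>'"
  by (cases x) (auto simp: box_iff)

lemma spaces: "space (\<mu>1 \<Otimes>\<^sub>M \<mu>2) = H1 \<times> H2" "space \<nu> = units"
  using \<mu>1 \<mu>2 \<nu> by (auto simp: haar_measure_def space_pair_measure)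

lemma space_Q: "space Q = (\<lambda>x. (\<lambda>l. act l x) ` units) ` (H1 \<times> H2)"
  using Q by (simp add: quotient_measure_def orbit_space_def spaces)

lemma sets_Q: "S \<in> sets Q \<longleftrightarrow> S \<subseteq> space Q \<and> \<Union>S \<in> sets (\<mu>1 \<Otimes>\<^sub>M \<mu>2)"
proof -
  have "sets Q = {S. S \<subseteq> space Q \<and> \<Union>S \<in> sets (\<mu>1 \<Otimes>\<^sub>M \<mu>2)}"
    using Q unfolding quotient_measure_def by (elim conjE)
  then show ?thesis by simp
qed

lemma box_measure: "box \<Lambda> \<in> sets (\<mu>1 \<Otimes>\<^sub>M \<mu>2)"
    "\<Lambda> \<in> common_lattices \<Longrightarrow> emeasure (\<mu>1 \<Otimes>\<^sub>M \<mu>2) (box \<Lambda>) = 1"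
proof -
  interpret sigma_finite_measure \<mu>2 by (rule haar_sigma_finite[OF \<mu>2 H2])
  note m = position_coset_measure[OF \<mu>1 H1 g1, of \<Lambda>] position_coset_measure[OF \<mu>2 H2 g2, of \<Lambda>]
  show "box \<Lambda> \<in> sets (\<mu>1 \<Otimes>\<^sub>M \<mu>2)" unfolding box_def using m by auto
  show "emeasure (\<mu>1 \<Otimes>\<^sub>M \<mu>2) (box \<Lambda>) = 1" if "\<Lambda> \<in> common_lattices"
    unfolding box_def using m that by (simp add: emeasure_pair_measure_Times common_lattices_def)
qed

lemma act_pair: "act l (h1, h2) = (matrix_inv g1 ** l ** g1 ** h1, matrix_inv g2 ** l ** g2 ** h2)"
  by (simp add: pair_action_def)

lemma act_mem: "l \<in> units \<Longrightarrow> x \<in> H1 \<times> H2 \<Longrightarrow> act l x \<in> H1 \<times> H2"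
  using matrix_groupD(4)[OF H1 act1] matrix_groupD(4)[OF H2 act2] by (auto simp: act_pair)

lemma conjugate_mult: "invertible g \<Longrightarrow> matrix_inv g ** k ** g ** (matrix_inv g ** l ** g ** h) = matrix_inv g ** (k ** l) ** g ** h"
  for g k l h :: "'f^'m^'m"
proof -
  assume g: "invertible g"
  have "matrix_inv g ** k ** g ** (matrix_inv g ** l ** g ** h) =
      matrix_inv g ** k ** (g ** matrix_inv g) ** l ** g ** h"
    by (simp only: matrix_mul_assoc)
  also have "\<dots> = matrix_inv g ** (k ** l) ** g ** h"
    using g by (simp add: matrix_inv_right matrix_mul_assoc)
  finally show ?thesis .
qed

lemma act_act: "act k (act l x) = act (k ** l) x"
  by (cases x) (simp add: act_pair conjugate_mult g1 g2)

lemma act_1: "act (mat 1) x = x"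
  by (cases x) (simp add: act_pair matrix_inv_left g1 g2)

lemma conjugate_position: "invertible g \<Longrightarrow> lattice_of (g ** (matrix_inv g ** l ** g ** h)) = (*v) l ` lattice_of (g ** h)"
  for g l h :: "'f^'m^'m"
proof -
  assume "invertible g"
  then have "g ** (matrix_inv g ** l ** g ** h) = l ** (g ** h)"
    by (metis matrix_inv_right matrix_mul_assoc matrix_mul_lid)
  then show ?thesis by (simp add: image_lattice_of)
qed

text \<open>
  The action of \<open>L\<^sup>\<times>\<close> on pairs becomes the natural action on lattices.
\<close>

lemma act_box: "l \<in> units \<Longrightarrow> x \<in> box \<Lambda> \<Longrightarrow> act l x \<in> box ((*v) l ` \<Lambda>)"
  using matrix_groupD(4)[OF H1 act1] matrix_groupD(4)[OF H2 act2]
  by (cases x) (auto simp: act_pair box_iff conjugate_position[OF g1] conjugate_position[OF g2])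

lemma units_common: "l \<in> units \<Longrightarrow> \<Lambda> \<in> common_lattices \<Longrightarrow> (*v) l ` \<Lambda> \<in> common_lattices"
proof -
  assume l: "l \<in> units" and "\<Lambda> \<in> common_lattices"
  then obtain x where "x \<in> box \<Lambda>" by (auto simp: common_lattices_def box_def)
  then show ?thesis using act_box[OF l] box_common by blast
qed

lemma act_box_iff:
  assumes l: "l \<in> units"
  shows "act l x \<in> box \<Lambda> \<longleftrightarrow> x \<in> box ((*v) (matrix_inv l) ` \<Lambda>)"
proof
  assume "act l x \<in> box \<Lambda>"
  then have "act (matrix_inv l) (act l x) \<in> box ((*v) (matrix_inv l) ` \<Lambda>)"
    using act_box[OF groupD(3)[OF l]] by blast
  then show "x \<in> box ((*v) (matrix_inv l) ` \<Lambda>)" using groupD(2)[OF l] by (simp add: act_act act_1 matrix_inv_left)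
next
  assume "x \<in> box ((*v) (matrix_inv l) ` \<Lambda>)"
  then have "act l x \<in> box ((*v) l ` (*v) (matrix_inv l) ` \<Lambda>)" using act_box[OF l] by blast
  then show "act l x \<in> box \<Lambda>" using groupD(2)[OF l] by (simp add: image_image)
qed

lemma orbit_eq:
  assumes "C \<in> space Q" "x \<in> C"
  shows "C = (\<lambda>l. act l x) ` units" "x \<in> H1 \<times> H2"
proof -
  obtain y k where y: "y \<in> H1 \<times> H2" "C = (\<lambda>l. act l y) ` units" "k \<in> units" "x = act k y"
    using assms by (auto simp: space_Q)
  show "x \<in> H1 \<times> H2" using y act_mem by blast
  have "act l y = act (l ** matrix_inv k) x" for l
    using groupD(2)[OF y(3)] by (simp add: y(4) act_act matrix_inv_left flip: matrix_mul_assoc)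
  then have "C \<subseteq> (\<lambda>l. act l x) ` units" using y groupD(3)[OF y(3)] groupD(4) by blast
  moreover have "(\<lambda>l. act l x) ` units \<subseteq> C" using y groupD(4) by (auto simp: act_act)
  ultimately show "C = (\<lambda>l. act l x) ` units" by blast
qed

definition transporter where "transporter \<Lambda> \<Lambda>' = {l \<in> units. (*v) l ` \<Lambda> = \<Lambda>'}"

lemma transporter_sets:
  assumes "\<Lambda> \<in> lattices"
  shows "transporter \<Lambda> \<Lambda>' \<in> sets \<nu>"
proof (cases "\<Lambda>' \<in> lattices")
  case True
  obtain g g' where g: "invertible g" "\<Lambda> = lattice_of g" "invertible g'" "\<Lambda>' = lattice_of g'"
    using assms True by (auto simp: lattices_def)
  let ?S = "(\<lambda>l. l ** g) -` {h. invertible h \<and> lattice_of h = lattice_of g'}"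
  have "open ?S" by (intro open_vimage open_lattice_of_eq g continuous_intros)
  then have "units \<inter> ?S \<in> sets \<nu>" using \<nu> by (auto simp: haar_measure_def sets_restrict_space)
  also have "units \<inter> ?S = transporter \<Lambda> \<Lambda>'"
    using groupD(2) invertible_mult[OF _ g(1)] by (auto simp: transporter_def g image_lattice_of)
  finally show ?thesis .
next
  case False
  then have "transporter \<Lambda> \<Lambda>' = {}" using lattice_image[OF groupD(2) assms] by (auto simp: transporter_def)
  then show ?thesis by simp
qed

lemma transporter_translate:
  assumes k: "k \<in> units"
  shows "transporter \<Lambda> ((*v) k ` \<Lambda>') = (**) k ` transporter \<Lambda> \<Lambda>'"
proof (rule Set.set_eqI)
  fix l
  have inv: "invertible k" using groupD(2)[OF k] .
  have "l \<in> (**) k ` transporter \<Lambda> \<Lambda>'" if l: "l \<in> transporter \<Lambda> ((*v) k ` \<Lambda>')"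
  proof (rule image_eqI)
    show "l = k ** (matrix_inv k ** l)" using inv by (simp add: matrix_mul_assoc matrix_inv_right)
    show "matrix_inv k ** l \<in> transporter \<Lambda> \<Lambda>'"
      using l groupD(3)[OF k] groupD(4) inv by (auto simp: transporter_def image_matrix_mult image_image)
  qed
  moreover have "l \<in> transporter \<Lambda> ((*v) k ` \<Lambda>')" if "l \<in> (**) k ` transporter \<Lambda> \<Lambda>'"
  proof -
    from that obtain x where x: "x \<in> units" "(*v) x ` \<Lambda> = \<Lambda>'" "l = k ** x"
      unfolding transporter_def by (elim imageE CollectE conjE)
    then have "(*v) l ` \<Lambda> = (*v) k ` \<Lambda>'" by (simp only: image_matrix_mult)
    then show ?thesis using x groupD(4)[OF k x(1)] by (simp add: transporter_def)
  qed
  ultimately show "l \<in> transporter \<Lambda> ((*v) k ` \<Lambda>') \<longleftrightarrow> l \<in> (**) k ` transporter \<Lambda> \<Lambda>'" by blast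
qed

lemma transporter_measure:
  assumes "\<Lambda> \<in> lattices" "k \<in> units"
  shows "emeasure \<nu> (transporter \<Lambda> ((*v) k ` \<Lambda>')) = emeasure \<nu> (transporter \<Lambda> \<Lambda>')"
  using \<nu> assms transporter_sets[OF assms(1), of \<Lambda>']
  unfolding transporter_translate[OF assms(2)] haar_measure_def by blast

text \<open>
  A matrix that preserves a lattice is bounded with all its powers, hence integral.
\<close>

lemma stabilizer_int: "\<Lambda> \<in> lattices \<Longrightarrow> transporter \<Lambda> \<Lambda> \<subseteq> int_units"
proof
  fix l assume L: "\<Lambda> \<in> lattices" and l: "l \<in> transporter \<Lambda> \<Lambda>"
  then have lu: "l \<in> units" "(*v) l ` \<Lambda> = \<Lambda>" by (auto simp: transporter_def)
  have inv: "invertible l" "matrix_inv l \<in> units" using groupD(2,3)[OF lu(1)] by auto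
  have "(*v) (matrix_inv l) ` \<Lambda> = \<Lambda>" using lu(2) inv(1) image_matrix_inv by metis
  then have "power_bounded l" "power_bounded (matrix_inv l)"
    using lu(2) by (intro stabilizer_power_bounded[OF L]; fastforce simp: stabilizers_iff)+
  then show "l \<in> int_units"
    using lu(1) inv by (auto simp: mat_units_def adjoin_max_order_iff matrix_inv_left matrix_inv_right
        intro!: bexI[of _ "matrix_inv l"])
qed

text \<open>
  The maximal compact subgroup \<open>O\<^sub>L\<^sup>\<times>\<close>, of volume one, is cut into translates of the stabilizer
  of the lattice, one for each lattice in its orbit.
\<close>

lemma stabilizer_measure:
  assumes L: "\<Lambda> \<in> lattices"
  shows "emeasure \<nu> (transporter \<Lambda> \<Lambda>) * emeasure (count_space UNIV) ((\<lambda>l. (*v) l ` \<Lambda>) ` int_units) = 1"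
proof -
  let ?I = "(\<lambda>l. (*v) l ` \<Lambda>) ` int_units"
  have inv: "l \<in> units" if "l \<in> int_units" for l using that int_units_sub by blast
  have "?I \<subseteq> lattices" using lattice_image[OF int_groupD(2) L] by (rule image_subsetI)
  then have count: "countable ?I" by (rule countable_subset[OF _ countable_lattices])
  have "int_units = (\<Union>\<Lambda>'\<in>?I. transporter \<Lambda> \<Lambda>')"
  proof (intro equalityI subsetI)
    fix l assume l: "l \<in> int_units"
    then have "l \<in> transporter \<Lambda> ((*v) l ` \<Lambda>)" using inv by (simp add: transporter_def)
    then show "l \<in> (\<Union>\<Lambda>'\<in>?I. transporter \<Lambda> \<Lambda>')" using l by blast
  next
    fix l assume "l \<in> (\<Union>\<Lambda>'\<in>?I. transporter \<Lambda> \<Lambda>')"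
    then obtain k where k: "k \<in> int_units" "l \<in> transporter \<Lambda> ((*v) k ` \<Lambda>)" by blast
    then obtain x where "x \<in> transporter \<Lambda> \<Lambda>" "l = k ** x"
      unfolding transporter_translate[OF inv[OF k(1)]] by (elim imageE)
    then show "l \<in> int_units" using stabilizer_int[OF L] int_groupD(4)[OF k(1)] by blast
  qed
  then have "1 = emeasure \<nu> (\<Union>\<Lambda>'\<in>?I. transporter \<Lambda> \<Lambda>')" using \<nu> by (simp add: haar_measure_def)
  also have "\<dots> = (\<integral>\<^sup>+\<Lambda>'. emeasure \<nu> (transporter \<Lambda> \<Lambda>') \<partial>count_space ?I)"
    by (rule emeasure_UN_countable[OF transporter_sets[OF L] count]) (auto simp: disjoint_family_on_def transporter_def)
  also have "\<dots> = (\<integral>\<^sup>+\<Lambda>'. emeasure \<nu> (transporter \<Lambda> \<Lambda>) \<partial>count_space ?I)"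
    by (intro nn_integral_cong) (auto simp: transporter_measure[OF L inv])
  also have "\<dots> = emeasure \<nu> (transporter \<Lambda> \<Lambda>) * emeasure (count_space UNIV) ?I"
    by (simp add: emeasure_count_space)
  finally show ?thesis by simp
qed

definition orbits_through where "orbits_through \<Lambda> = {C \<in> space Q. C \<inter> box \<Lambda> \<noteq> {}}"

lemma Union_orbits_through: "\<Union>(orbits_through \<Lambda>) = (\<Union>\<Lambda>'\<in>(\<lambda>l. (*v) l ` \<Lambda>) ` units. box \<Lambda>')"
proof (intro equalityI subsetI)
  fix x assume "x \<in> \<Union>(orbits_through \<Lambda>)"
  then obtain C y where C: "C \<in> space Q" "x \<in> C" "y \<in> C" "y \<in> box \<Lambda>" by (auto simp: orbits_through_def)
  then obtain l where "l \<in> units" "x = act l y" using orbit_eq(1)[OF C(1,3)] by blast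
  then show "x \<in> (\<Union>\<Lambda>'\<in>(\<lambda>l. (*v) l ` \<Lambda>) ` units. box \<Lambda>')" using act_box C(4) by blast
next
  fix x assume "x \<in> (\<Union>\<Lambda>'\<in>(\<lambda>l. (*v) l ` \<Lambda>) ` units. box \<Lambda>')"
  then obtain l where l: "l \<in> units" "x \<in> box ((*v) l ` \<Lambda>)" by blast
  have x: "x \<in> H1 \<times> H2" using l(2) by (auto simp: box_def position_coset_def)
  have il: "matrix_inv l \<in> units" using groupD(3)[OF l(1)] .
  have "act (matrix_inv l) x \<in> box \<Lambda>"
    using act_box[OF il l(2)] groupD(2)[OF l(1)] by (simp add: image_image)
  moreover have "x \<in> (\<lambda>l. act l x) ` units" using groupD(1) act_1 by (metis image_eqI)
  moreover have "(\<lambda>l. act l x) ` units \<in> space Q" using x by (auto simp: space_Q)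
  ultimately show "x \<in> \<Union>(orbits_through \<Lambda>)" using il unfolding orbits_through_def by blast
qed

lemma orbits_through_sets:
  assumes "\<Lambda> \<in> lattices"
  shows "orbits_through \<Lambda> \<in> sets Q"
proof -
  have "(\<lambda>l. (*v) l ` \<Lambda>) ` units \<subseteq> lattices" using lattice_image[OF groupD(2) assms] by (rule image_subsetI)
  then have "countable ((\<lambda>l. (*v) l ` \<Lambda>) ` units)" by (rule countable_subset[OF _ countable_lattices])
  then have "(\<Union>\<Lambda>'\<in>(\<lambda>l. (*v) l ` \<Lambda>) ` units. box \<Lambda>') \<in> sets (\<mu>1 \<Otimes>\<^sub>M \<mu>2)"
    using box_measure(1) by (intro sets.countable_UN') auto
  then show ?thesis by (auto simp: sets_Q Union_orbits_through) (auto simp: orbits_through_def)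
qed

lemma descend_eq:
  assumes "C \<in> space Q" "\<And>x. x \<in> C \<Longrightarrow> \<phi> x = y"
  shows "descend \<phi> C = y"
proof -
  have "C \<noteq> {}" using assms(1) groupD(1) by (auto simp: space_Q)
  then show ?thesis unfolding descend_def using assms(2) by (intro the_equality) auto
qed

text \<open>
  For \<open>x\<close> in the box of \<open>k\<^sup>-\<^sup>1 \<Lambda>\<close>, the elements of \<open>L\<^sup>\<times>\<close> that move \<open>x\<close> into the box of \<open>\<Lambda>\<close> form the translate of
  the stabilizer of \<open>\<Lambda>\<close> by \<open>k\<close>.
\<close>

lemma fibre_measure:
  assumes L: "\<Lambda> \<in> lattices" and C: "C \<in> space Q"
  shows "descend (\<lambda>x. \<integral>\<^sup>+l. indicator (box \<Lambda>) (act l x) \<partial>\<nu>) C =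
    emeasure \<nu> (transporter \<Lambda> \<Lambda>) * indicator (orbits_through \<Lambda>) C"
proof (rule descend_eq[OF C])
  fix x assume x: "x \<in> C"
  have "(\<integral>\<^sup>+l. indicator (box \<Lambda>) (act l x) \<partial>\<nu>) = (\<integral>\<^sup>+l. indicator {l \<in> units. act l x \<in> box \<Lambda>} l \<partial>\<nu>)"
    by (intro nn_integral_cong) (auto simp: indicator_def spaces)
  also have "\<dots> = emeasure \<nu> (transporter \<Lambda> \<Lambda>) * indicator (orbits_through \<Lambda>) C"
  proof (cases "C \<in> orbits_through \<Lambda>")
    case True
    then obtain k where k: "k \<in> units" "act k x \<in> box \<Lambda>"
      using orbit_eq(1)[OF C x] by (auto simp: orbits_through_def)
    have ik: "matrix_inv k \<in> units" "invertible k" using groupD(2,3)[OF k(1)] by auto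
    have xb: "x \<in> box ((*v) (matrix_inv k) ` \<Lambda>)" using k act_box_iff by blast
    have "act l x \<in> box \<Lambda> \<longleftrightarrow> (*v) (matrix_inv l) ` \<Lambda> = (*v) (matrix_inv k) ` \<Lambda>" if "l \<in> units" for l
      using act_box_iff[OF that] xb box_unique[OF xb] by metis
    then have "{l \<in> units. act l x \<in> box \<Lambda>} = {l \<in> units. (*v) (matrix_inv l) ` \<Lambda> = (*v) (matrix_inv k) ` \<Lambda>}"
      by blast
    also have "\<dots> = transporter \<Lambda> ((*v) k ` \<Lambda>)"
    proof -
      have "(*v) (matrix_inv l) ` \<Lambda> = (*v) (matrix_inv k) ` \<Lambda> \<longleftrightarrow> (*v) l ` \<Lambda> = (*v) k ` \<Lambda>" if l: "l \<in> units" for l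
      proof -
        have il: "invertible l" using groupD(2)[OF l] .
        have "(*v) (matrix_inv l) ` \<Lambda> = (*v) (matrix_inv k) ` \<Lambda> \<longleftrightarrow> \<Lambda> = (*v) (matrix_inv k) ` (*v) l ` \<Lambda>"
          using il matrix_inv_commute[OF ik(2) units_commute[OF k(1) l]]
          by (metis image_matrix_mult image_matrix_inv invertible_matrix_inv matrix_inv_inv)
        also have "\<dots> \<longleftrightarrow> (*v) l ` \<Lambda> = (*v) k ` \<Lambda>" using image_matrix_inv[OF ik(2)] by metis
        finally show ?thesis .
      qed
      then show ?thesis unfolding transporter_def by blast
    qed
    finally have "{l \<in> units. act l x \<in> box \<Lambda>} = transporter \<Lambda> ((*v) k ` \<Lambda>)" .
    then show ?thesis using True transporter_sets[OF L] transporter_measure[OF L k(1)] by simp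
  next
    case False
    then have "{l \<in> units. act l x \<in> box \<Lambda>} = {}" using orbit_eq(1)[OF C x] C by (auto simp: orbits_through_def)
    then show ?thesis using False by simp
  qed
  finally show "(\<integral>\<^sup>+l. indicator (box \<Lambda>) (act l x) \<partial>\<nu>) =
      emeasure \<nu> (transporter \<Lambda> \<Lambda>) * indicator (orbits_through \<Lambda>) C" .
qed

text \<open>
  Weil's formula for the indicator of a box, of volume 1, shows that the set of orbits through the box
  has the inverse of the volume of the stabilizer as measure. The same inverse is the size of the orbit
  of \<open>\<Lambda>\<close> under the units of \<open>O\<^sub>L\<close>.
\<close>

lemma orbits_through_measure:
  assumes "\<Lambda> \<in> common_lattices"
  shows "emeasure Q (orbits_through \<Lambda>) = emeasure (count_space UNIV) ((\<lambda>l. (*v) l ` \<Lambda>) ` int_units)"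
proof -
  have L: "\<Lambda> \<in> lattices" using assms common_lattices_sub by blast
  let ?s = "emeasure \<nu> (transporter \<Lambda> \<Lambda>)" and ?n = "emeasure (count_space UNIV) ((\<lambda>l. (*v) l ` \<Lambda>) ` int_units)"
  have "1 = (\<integral>\<^sup>+x. indicator (box \<Lambda>) x \<partial>(\<mu>1 \<Otimes>\<^sub>M \<mu>2))"
    using box_measure[of \<Lambda>] assms by simp
  also have "\<dots> = (\<integral>\<^sup>+C. descend (\<lambda>x. \<integral>\<^sup>+l. indicator (box \<Lambda>) (act l x) \<partial>\<nu>) C \<partial>Q)"
    using Q box_measure(1)[of \<Lambda>] unfolding quotient_measure_def
    by (elim conjE ballE[where x = "indicator (box \<Lambda>)"]) (auto simp: borel_measurable_indicator)
  also have "\<dots> = (\<integral>\<^sup>+C. ?s * indicator (orbits_through \<Lambda>) C \<partial>Q)"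
    by (intro nn_integral_cong fibre_measure[OF L])
  also have "\<dots> = ?s * emeasure Q (orbits_through \<Lambda>)"
    by (rule nn_integral_cmult_indicator[OF orbits_through_sets[OF L]])
  finally have "?s * emeasure Q (orbits_through \<Lambda>) = 1" by simp
  then have "emeasure Q (orbits_through \<Lambda>) = emeasure Q (orbits_through \<Lambda>) * (?s * ?n)"
    using stabilizer_measure[OF L] by simp
  also have "\<dots> = (?s * emeasure Q (orbits_through \<Lambda>)) * ?n" by (simp add: ac_simps)
  also have "\<dots> = ?n" using \<open>?s * emeasure Q (orbits_through \<Lambda>) = 1\<close> by simp
  finally show ?thesis .
qed

text \<open>
  An orbit in the support passes through the box of exactly one representative lattice.
\<close>

lemma equal_orbits_measure:
  assumes R: "R \<subseteq> common_lattices"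
    and repr: "\<And>\<Lambda>. \<Lambda> \<in> common_lattices \<Longrightarrow> \<exists>!\<Lambda>'. \<Lambda>' \<in> R \<and> (\<exists>l\<in>units. \<Lambda> = (*v) l ` \<Lambda>')"
  shows "equal_orbits \<in> sets Q"
    and "emeasure Q equal_orbits =
      (\<integral>\<^sup>+\<Lambda>. emeasure (count_space UNIV) ((\<lambda>l. (*v) l ` \<Lambda>) ` int_units) \<partial>count_space R)"
proof -
  have eq: "equal_orbits = (\<Union>\<Lambda>\<in>R. orbits_through \<Lambda>)"
  proof (intro equalityI subsetI)
    fix C assume C: "C \<in> equal_orbits"
    then have Cs: "C \<in> space Q" by (simp add: equal_orbits_def)
    then have "C \<noteq> {}" using groupD(1) by (auto simp: space_Q)
    then obtain x where x: "x \<in> C" "C \<in> space Q" using Cs by blast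
    then obtain \<Lambda> where xb: "x \<in> box \<Lambda>" using C by (auto simp: equal_orbits_def equal_positions_def)
    obtain \<Lambda>' l where l: "\<Lambda>' \<in> R" "l \<in> units" "\<Lambda> = (*v) l ` \<Lambda>'" using repr[OF box_common[OF xb]] by blast
    have "act (matrix_inv l) x \<in> box \<Lambda>'"
      using act_box[OF groupD(3)[OF l(2)] xb] groupD(2)[OF l(2)] by (simp add: l(3) image_image)
    then have "C \<in> orbits_through \<Lambda>'"
      using orbit_eq(1)[OF x(2,1)] x(2) groupD(3)[OF l(2)] by (auto simp: orbits_through_def)
    then show "C \<in> (\<Union>\<Lambda>\<in>R. orbits_through \<Lambda>)" using l(1) by blast
  next
    fix C assume "C \<in> (\<Union>\<Lambda>\<in>R. orbits_through \<Lambda>)"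
    then obtain \<Lambda> where "C \<in> orbits_through \<Lambda>" by blast
    then have "C \<in> space Q" "C \<subseteq> equal_positions"
      using Union_orbits_through[of \<Lambda>] by (auto simp: orbits_through_def equal_positions_def)
    then show "C \<in> equal_orbits" by (simp add: equal_orbits_def)
  qed
  have sets: "orbits_through \<Lambda> \<in> sets Q" if "\<Lambda> \<in> R" for \<Lambda>
    using that R common_lattices_sub orbits_through_sets by blast
  have count: "countable R" using countable_subset[OF R countable_common] .
  show "equal_orbits \<in> sets Q" unfolding eq using sets count by (intro sets.countable_UN') auto
  have disj: "disjoint_family_on orbits_through R"
    unfolding disjoint_family_on_def
  proof (intro ballI impI equals0I)
    fix \<Lambda> \<Lambda>' C assume R2: "\<Lambda> \<in> R" "\<Lambda>' \<in> R" "\<Lambda> \<noteq> \<Lambda>'" and C: "C \<in> orbits_through \<Lambda> \<inter> orbits_through \<Lambda>'"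
    then obtain x where x: "C \<in> space Q" "x \<in> C" "x \<in> box \<Lambda>" by (auto simp: orbits_through_def)
    then have "x \<in> \<Union>(orbits_through \<Lambda>')" using C by blast
    then obtain l where l: "l \<in> units" "x \<in> box ((*v) l ` \<Lambda>')"
      unfolding Union_orbits_through by (elim UN_E imageE) simp
    moreover from l have "\<Lambda> = (*v) l ` \<Lambda>'" using box_unique[OF x(3)] by blast
    moreover have "\<Lambda> = (*v) (mat 1) ` \<Lambda>" by simp
    ultimately show False using repr[of \<Lambda>] R2 R groupD(1) by blast
  qed
  have "emeasure Q equal_orbits = (\<integral>\<^sup>+\<Lambda>. emeasure Q (orbits_through \<Lambda>) \<partial>count_space R)"
    unfolding eq by (rule emeasure_UN_countable[OF sets count disj])
  also have "\<dots> = (\<integral>\<^sup>+\<Lambda>. emeasure (count_space UNIV) ((\<lambda>l. (*v) l ` \<Lambda>) ` int_units) \<partial>count_space R)"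
    using R orbits_through_measure by (intro nn_integral_cong) auto
  finally show "emeasure Q equal_orbits =
      (\<integral>\<^sup>+\<Lambda>. emeasure (count_space UNIV) ((\<lambda>l. (*v) l ` \<Lambda>) ` int_units) \<partial>count_space R)" .
qed

text \<open>
  The integrand is the indicator of the support, which is a union of orbits.
\<close>

lemma integral_equal_positions:
  assumes sets: "equal_orbits \<in> sets Q"
    and f: "\<And>h1 h2. h1 \<in> H1 \<Longrightarrow> h2 \<in> H2 \<Longrightarrow>
      f (h1, h2) = (if lattice_of (g1 ** h1) = lattice_of (g2 ** h2) then 1 else 0)"
  shows "(\<integral>C. descend f C \<partial>Q) = complex_of_real (measure Q equal_orbits)"
proof -
  have ep: "f x = (if x \<in> equal_positions then 1 else 0)" if "x \<in> H1 \<times> H2" for x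
  proof -
    from that obtain h1 h2 where h: "x = (h1, h2)" "h1 \<in> H1" "h2 \<in> H2" by (elim SigmaE)
    have "x \<in> equal_positions \<longleftrightarrow> lattice_of (g1 ** h1) = lattice_of (g2 ** h2)"
      unfolding equal_positions_def UN_iff h(1) box_iff using h(2,3) by blast
    then show ?thesis using f[OF h(2,3)] by (simp add: h(1))
  qed
  have inv: "act l x \<in> equal_positions" if "l \<in> units" "x \<in> equal_positions" for l x
    using that act_box[OF that(1)] unfolding equal_positions_def by blast
  have "descend f C = complex_of_real (indicator equal_orbits C)" if C: "C \<in> space Q" for C
  proof (rule descend_eq[OF C])
    fix x assume x: "x \<in> C"
    note o = orbit_eq[OF C x]
    have "C \<in> equal_orbits \<longleftrightarrow> x \<in> equal_positions"
    proof
      assume "x \<in> equal_positions"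
      then have "act l x \<in> equal_positions" if "l \<in> units" for l using inv[OF that] by blast
      then have "(\<lambda>l. act l x) ` units \<subseteq> equal_positions" by (rule image_subsetI)
      then show "C \<in> equal_orbits" using C o(1) by (simp add: equal_orbits_def)
    qed (use x in \<open>auto simp: equal_orbits_def\<close>)
    then show "f x = complex_of_real (indicator equal_orbits C)" using ep[OF o(2)] by (auto simp: indicator_def)
  qed
  then have "(\<integral>C. descend f C \<partial>Q) = (\<integral>C. complex_of_real (indicator equal_orbits C) \<partial>Q)"
    by (intro Bochner_Integration.integral_cong) auto
  also have "\<dots> = complex_of_real (measure Q equal_orbits)"
    using sets.sets_into_space[OF sets] by (simp add: Int_absorb2)
  finally show ?thesis .
qed

lemma position_coset_indicator:
  assumes "h1 \<in> H1" "h2 \<in> H2"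
  shows "indicator GL_int (matrix_inv h1 ** matrix_inv g1 ** g2 ** h2) =
    (if lattice_of (g1 ** h1) = lattice_of (g2 ** h2) then 1 else 0 :: complex)"
proof -
  have i: "invertible h1" "invertible h2" using assms matrix_groupD(2)[OF H1] matrix_groupD(2)[OF H2] by auto
  have "lattice_of (g1 ** h1) = lattice_of (g2 ** h2) \<longleftrightarrow> matrix_inv (g1 ** h1) ** (g2 ** h2) \<in> GL_int"
    by (intro lattice_of_eq_iff invertible_mult g1 g2 i)
  also have "matrix_inv (g1 ** h1) ** (g2 ** h2) = matrix_inv h1 ** matrix_inv g1 ** g2 ** h2"
    using g1 i by (simp add: matrix_inv_mult matrix_mul_assoc)
  finally show ?thesis by (simp add: indicator_def)
qed

end

lemma orbit_representatives:
  assumes "matrix_group (G :: ('f::field^'m^'m) set)"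
    and "\<And>l \<Lambda>. l \<in> G \<Longrightarrow> \<Lambda> \<in> S \<Longrightarrow> (*v) l ` \<Lambda> \<in> S"
  shows "\<exists>R\<subseteq>S. \<forall>\<Lambda>\<in>S. \<exists>!\<Lambda>'. \<Lambda>' \<in> R \<and> (\<exists>l\<in>G. \<Lambda> = (*v) l ` \<Lambda>')"
proof -
  note G = matrix_groupD[OF assms(1)]
  define orb where "orb \<Lambda> = (\<lambda>l. (*v) l ` \<Lambda>) ` G" for \<Lambda> :: "('f^'m) set"
  define rep where "rep \<Lambda> = (SOME \<Lambda>'. \<Lambda>' \<in> orb \<Lambda>)" for \<Lambda>
  have self: "\<Lambda> \<in> orb \<Lambda>" for \<Lambda>
    unfolding orb_def using G(1) by (intro image_eqI[of _ _ "mat 1"]) auto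
  have rep: "rep \<Lambda> \<in> orb \<Lambda>" for \<Lambda> unfolding rep_def using self by (rule someI)
  have sub: "orb ((*v) l ` \<Lambda>) \<subseteq> orb \<Lambda>" if "l \<in> G" for l \<Lambda>
    using that G(4) unfolding orb_def by (auto simp: image_iff) (metis image_matrix_mult)
  have eq: "orb ((*v) l ` \<Lambda>) = orb \<Lambda>" if "l \<in> G" for l \<Lambda>
  proof
    have "\<Lambda> = (*v) (matrix_inv l) ` (*v) l ` \<Lambda>" using G(2)[OF that] by (simp add: image_image)
    then show "orb \<Lambda> \<subseteq> orb ((*v) l ` \<Lambda>)" using sub[OF G(3)[OF that], of "(*v) l ` \<Lambda>"] by simp
  qed (rule sub[OF that])
  show ?thesis
  proof (intro exI[of _ "rep ` S"] conjI ballI)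
    show "rep ` S \<subseteq> S" using rep assms(2) by (auto simp: orb_def image_iff) metis
    fix \<Lambda> assume L: "\<Lambda> \<in> S"
    obtain l where l: "l \<in> G" "rep \<Lambda> = (*v) l ` \<Lambda>" using rep[of \<Lambda>] by (auto simp: orb_def)
    have "\<Lambda> = (*v) (matrix_inv l) ` rep \<Lambda>" using l G(2)[OF l(1)] by (simp add: image_image)
    then have ex: "rep \<Lambda> \<in> rep ` S \<and> (\<exists>l\<in>G. \<Lambda> = (*v) l ` rep \<Lambda>)" using L G(3)[OF l(1)] by blast
    have uniq: "\<Lambda>' = rep \<Lambda>" if "\<Lambda>' \<in> rep ` S \<and> (\<exists>l\<in>G. \<Lambda> = (*v) l ` \<Lambda>')" for \<Lambda>'
    proof -
      from that obtain M k where M: "\<Lambda>' = rep M" "k \<in> G" "\<Lambda> = (*v) k ` \<Lambda>'" by (elim conjE imageE bexE)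
      have "orb \<Lambda> = orb \<Lambda>'" unfolding M(3) by (rule eq[OF M(2)])
      also have "\<dots> = orb M"
      proof -
        obtain x where "x \<in> G" "rep M = (*v) x ` M" using rep[of M] unfolding orb_def by (elim imageE)
        then show ?thesis using eq[of x M] by (simp add: M(1))
      qed
      finally show ?thesis using M(1) by (simp add: rep_def)
    qed
    show "\<exists>!\<Lambda>'. \<Lambda>' \<in> rep ` S \<and> (\<exists>l\<in>G. \<Lambda> = (*v) l ` \<Lambda>')" using ex uniq by (rule ex1I)
  qed
qed

section \<open>Generators of the two quadratic orders\<close>

context quadratic_ext
begin

lemma trace_norm_eq: "\<sigma> g = \<iota> t - g \<Longrightarrow> Tr g = t" "g * \<sigma> g = \<iota> n \<Longrightarrow> Nm g = n"
proof -
  show "Tr g = t" if "\<sigma> g = \<iota> t - g"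
  proof -
    have "\<iota> (Tr g) = \<iota> t" by (simp add: Tr that)
    then show ?thesis by simp
  qed
  show "Nm g = n" if "g * \<sigma> g = \<iota> n"
  proof -
    have "\<iota> (Nm g) = \<iota> n" by (simp add: Nm that)
    then show ?thesis by simp
  qed
qed

lemma integral_generator_trace_norm:
  assumes "g \<notin> range \<iota>" "g \<in> norm_ring"
  shows "\<exists>t n. \<sigma> g = \<iota> t - g \<and> g * \<sigma> g = \<iota> n \<and> no_root t n \<and> t \<in> int_ring \<and> n \<in> int_ring"
proof -
  obtain t n where t: "\<sigma> g = \<iota> t - g" "g * \<sigma> g = \<iota> n" "no_root t n" by (rule generator_trace_norm[OF assms(1)])
  then show ?thesis using assms(2) trace_norm_eq Tr_bound[of g] by (auto simp: norm_ring_def int_ring_def)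
qed

lemma norm_ring_unit: "x \<in> ring_units norm_ring \<Longrightarrow> aval (Nm x) = 1"
proof -
  assume "x \<in> ring_units norm_ring"
  then obtain y where y: "aval (Nm x) \<le> 1" "aval (Nm y) \<le> 1" "x * y = 1" by (auto simp: ring_units_def norm_ring_def)
  have "Nm 1 = 1" using Nm_iota[of 1] by (simp add: iota_hom)
  then have "aval (Nm x) * aval (Nm y) = 1" using y(3) by (simp flip: aval_mult Nm_mult)
  then show ?thesis using y(1,2) by (metis mult_left_le mult.commute order_antisym zero_le_dist)
qed

text \<open>
  The norm of \<open>(\<zeta> - \<zeta>') (\<zeta> + \<zeta>')\<close> is, up to sign, the discriminant times the square of the trace. Both
  factors are integral, so both are units.
\<close>

lemma unit_discriminant_generator:
  assumes \<zeta>: "\<zeta> \<in> norm_ring" "(\<zeta> - \<sigma> \<zeta>) * (\<zeta> + \<sigma> \<zeta>) \<in> ring_units norm_ring"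
  shows "\<zeta> \<notin> range \<iota> \<and> (\<exists>t n. \<sigma> \<zeta> = \<iota> t - \<zeta> \<and> \<zeta> * \<sigma> \<zeta> = \<iota> n \<and> no_root t n \<and>
    t \<in> int_ring \<and> n \<in> int_ring \<and> aval t = 1 \<and> aval (t ^ 2 - 4 * n) = 1)"
proof -
  have N: "aval (Nm (\<zeta> - \<sigma> \<zeta>)) * aval (Nm (\<zeta> + \<sigma> \<zeta>)) = 1"
    using norm_ring_unit[OF \<zeta>(2)] by (simp add: Nm_mult aval_mult)
  have r: "\<zeta> \<notin> range \<iota>"
  proof
    assume "\<zeta> \<in> range \<iota>"
    then have "\<zeta> - \<sigma> \<zeta> = \<iota> 0" by auto
    then show False using N Nm_iota[of 0] by simp
  qed
  obtain t n where t: "\<sigma> \<zeta> = \<iota> t - \<zeta>" "\<zeta> * \<sigma> \<zeta> = \<iota> n" "no_root t n" and i: "t \<in> int_ring" "n \<in> int_ring"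
    using integral_generator_trace_norm[OF r \<zeta>(1)] by blast
  have "\<iota> (Nm (\<zeta> - \<sigma> \<zeta>)) = \<iota> (- (t ^ 2 - 4 * n))"
  proof -
    have "\<iota> (Nm (\<zeta> - \<sigma> \<zeta>)) = - ((\<zeta> + \<sigma> \<zeta>) ^ 2 - 4 * (\<zeta> * \<sigma> \<zeta>))"
      by (simp add: Nm sigma_hom sigma_diff sigma_sigma power2_eq_square algebra_simps)
    also have "\<dots> = \<iota> (- (t ^ 2 - 4 * n))" unfolding t(2) by (simp add: t(1) iota_simps)
    finally show ?thesis .
  qed
  then have "Nm (\<zeta> - \<sigma> \<zeta>) = - (t ^ 2 - 4 * n)" by (simp only: iota_eq)
  moreover have "Nm (\<zeta> + \<sigma> \<zeta>) = t ^ 2" using Nm_iota[of t] by (simp add: t(1))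
  ultimately have "aval (t ^ 2 - 4 * n) * (aval t) ^ 2 = 1" using N by (simp add: aval_minus aval_power del: minus_diff_eq)
  moreover have "aval (t ^ 2 - 4 * n) \<le> 1"
  proof -
    have "t ^ 2 - 4 * n \<in> int_ring" using i by (intro int_ring_intros)
    then show ?thesis by (simp add: int_ring_def)
  qed
  moreover have "(aval t) ^ 2 \<le> 1" using i by (simp add: int_ring_def power_le_one)
  ultimately have "(aval t) ^ 2 = 1" "aval (t ^ 2 - 4 * n) = 1"
    by (metis mult_left_le mult.commute order_antisym zero_le_dist zero_le_power)+
  then have "aval t = 1" by (simp add: power2_eq_1_iff) (smt (verit) zero_le_dist)
  then show ?thesis using r t i \<open>aval (t ^ 2 - 4 * n) = 1\<close> by blast
qed

text \<open>
  Higher powers of \<open>g\<close> are reduced by its integral quadratic equation.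
\<close>

lemma int_adjoin_coords:
  assumes t: "\<sigma> g = \<iota> t - g" "g * \<sigma> g = \<iota> n" and i: "t \<in> int_ring" "n \<in> int_ring" and p: "int_coeffs p"
  shows "\<exists>x\<in>int_ring. \<exists>y\<in>int_ring. poly (map_poly \<iota> p) g = \<iota> x + \<iota> y * g"
  using p
proof (induction p)
  case 0
  then show ?case using int_ring_intros by (intro bexI[of _ 0]) auto
next
  case (pCons c p)
  have "int_coeffs p" using pCons.prems by (metis coeff_pCons_Suc)
  then obtain x y where xy: "x \<in> int_ring" "y \<in> int_ring" "poly (map_poly \<iota> p) g = \<iota> x + \<iota> y * g"
    using pCons.IH by blast
  have c: "c \<in> int_ring" using pCons.prems by (metis coeff_pCons_0)
  have gg: "g * g = \<iota> t * g - \<iota> n" using t by (metis add_diff_cancel_left' diff_add_cancel distrib_left left_diff_distrib mult.commute right_diff_distrib')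
  have "poly (map_poly \<iota> (pCons c p)) g = \<iota> c + g * (\<iota> x + \<iota> y * g)"
    using xy(3) by (simp add: map_poly_pCons)
  also have "\<dots> = \<iota> c + \<iota> x * g + \<iota> y * (g * g)" by (simp add: algebra_simps)
  also have "\<dots> = \<iota> (c - y * n) + \<iota> (x + y * t) * g" unfolding gg by (simp add: iota_simps algebra_simps)
  finally have "poly (map_poly \<iota> (pCons c p)) g = \<iota> (c - y * n) + \<iota> (x + y * t) * g" .
  moreover have "c - y * n \<in> int_ring" "x + y * t \<in> int_ring" using xy c i by (auto intro!: int_ring_intros)
  ultimately show ?case by blast
qed

text \<open>
  An element of integral norm is an integral polynomial in \<open>g\<close>, so its coordinates are integral. This
  is the defining property of a maximal polynomial.
\<close>

lemma maximal_order_generator: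
  assumes g: "norm_ring = int_adjoin \<iota> g"
  shows "g \<notin> range \<iota> \<and> (\<exists>t n. \<sigma> g = \<iota> t - g \<and> g * \<sigma> g = \<iota> n \<and> no_root t n \<and> maximal_quadratic t n)"
proof -
  have r: "g \<notin> range \<iota>"
  proof
    assume "g \<in> range \<iota>"
    then obtain c where c: "g = \<iota> c" by blast
    have "poly (map_poly \<iota> p) g \<in> range \<iota>" for p
    proof (induction p)
      case (pCons d p)
      then obtain e where "poly (map_poly \<iota> p) g = \<iota> e" by blast
      then have "poly (map_poly \<iota> (pCons d p)) g = \<iota> (d + c * e)" by (simp add: map_poly_pCons c iota_simps)
      then show ?case by blast
    qed (metis iota_0 map_poly_0 poly_0 rangeI)
    then have sub: "norm_ring \<subseteq> range \<iota>" unfolding g int_adjoin_def by blast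
    obtain h where h: "h \<notin> range \<iota>" using generator_exists by blast
    then have h0: "h \<noteq> 0" by (metis iota_0 rangeI)
    have "Nm 1 = 1" using Nm_iota[of 1] by (simp add: iota_hom)
    then have "aval (Nm h) * aval (Nm (1 / h)) = 1" using h0 by (simp flip: aval_mult Nm_mult)
    then have "aval (Nm h) \<le> 1 \<or> aval (Nm (1 / h)) \<le> 1"
      by (smt (verit) mult_less_cancel_left2 zero_le_dist)
    then have "1 / h \<in> range \<iota>" using h sub by (auto simp: norm_ring_def)
    then obtain d where d: "1 / h = \<iota> d" by blast
    then have "\<iota> (1 / d) * \<iota> d = 1" using h0 by (simp flip: iota_hom) (metis div_by_1 divide_eq_0_iff iota_0 iota_hom(1) nonzero_eq_divide_eq zero_neq_one)
    then have "h = \<iota> (1 / d)" using h0 d by (metis mult_cancel_right nonzero_eq_divide_eq mult.commute iota_0 mult_zero_right zero_neq_one)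
    then show False using h by blast
  qed
  have "g = poly (map_poly \<iota> [:0, 1:]) g" by (simp add: map_poly_pCons iota_hom)
  moreover have "int_coeffs [:0, 1:]" by (auto simp: coeff_pCons int_ring_intros split: nat.split)
  ultimately have gn: "g \<in> norm_ring" unfolding g int_adjoin_def by blast
  obtain t n where t: "\<sigma> g = \<iota> t - g" "g * \<sigma> g = \<iota> n" "no_root t n" and i: "t \<in> int_ring" "n \<in> int_ring"
    using integral_generator_trace_norm[OF r gn] by blast
  have "x \<in> int_ring \<and> y \<in> int_ring" if "aval (x ^ 2 + x * y * t + y ^ 2 * n) \<le> 1" for x y
  proof -
    have "\<iota> x + \<iota> y * g \<in> norm_ring" using that by (simp add: norm_ring_def coord_Nm_Tr[OF t(1,2)])
    then obtain p where "int_coeffs p" "\<iota> x + \<iota> y * g = poly (map_poly \<iota> p) g"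
      unfolding g int_adjoin_def by blast
    then obtain x' y' where "x' \<in> int_ring" "y' \<in> int_ring" "\<iota> x + \<iota> y * g = \<iota> x' + \<iota> y' * g"
      using int_adjoin_coords[OF t(1,2) i] by metis
    then show ?thesis using generator_unique[OF r] by blast
  qed
  then show ?thesis using r t i unfolding maximal_quadratic_def by blast
qed

end

section \<open>Descent of the matching isomorphism\<close>

text \<open>
  The matrix \<open>P\<close> of the matching isomorphism intertwines the base changes of \<open>\<zeta>\<^sub>0\<close> and \<open>\<pi>\<^sub>3\<close> with \<open>p\<close> and \<open>b\<^sub>3\<close>.
  Solving for \<open>a\<close> and \<open>b\<close> expresses the conjugates \<open>P\<^sup>-\<^sup>1 a P\<close> and \<open>P\<^sup>-\<^sup>1 b P\<close> by \<open>p\<close> and \<open>b\<^sub>3\<close>, and a computation shows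
  that \<open>P\<close> intertwines the elements \<open>w\<close> and \<open>z\<close> of the two pairs.
\<close>

lemma (in quadratic_ext) matching_operator:
  fixes a b p b3 :: "'f^'m^'m" and P :: "'k^'m^'m"
  assumes \<zeta>: "\<zeta> \<notin> range \<iota>" "\<sigma> \<zeta> = \<iota> t1 - \<zeta>" "\<zeta> * \<sigma> \<zeta> = \<iota> n1"
    and pairs: "local_quaternion_pair a b t1 n1 t2 n2"
      "local_quaternion_pair p b3 1 0 (t1 * t2) (n1 * t2 ^ 2 + t1 ^ 2 * n2 - 4 * n1 * n2)"
    and t1: "aval t1 = 1" and z: "b ** a - a ** b \<in> GL_int"
    and r: "r \<in> int_ring" "aval (t2 - 2 * r) < 1" "aval (n2 - r ^ 2) < 1"
    and P: "invertible P"
      "(mat (- (\<sigma> \<zeta> / (\<zeta> - \<sigma> \<zeta>))) + mat (1 / (\<zeta> - \<sigma> \<zeta>)) ** map_matrix \<iota> a) ** P = P ** map_matrix \<iota> p"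
      "(mat (\<sigma> \<zeta> * \<iota> t2) + mat (\<zeta> - \<sigma> \<zeta>) ** map_matrix \<iota> b) ** P = P ** map_matrix \<iota> b3"
  shows "\<exists>u v T. matched_pairs a b p b3 t1 n1 t2 n2 u v T"
proof -
  interpret A: local_quaternion_pair a b t1 n1 t2 n2 by (rule pairs(1))
  interpret B: local_quaternion_pair p b3 1 0 "t1 * t2" "n1 * t2 ^ 2 + t1 ^ 2 * n2 - 4 * n1 * n2" by (rule pairs(2))
  define s \<delta> where "s = \<sigma> \<zeta>" and "\<delta> = \<zeta> - \<sigma> \<zeta>"
  define Am Bm pm b3m where "Am = map_matrix \<iota> a" and "Bm = map_matrix \<iota> b"
    and "pm = map_matrix \<iota> p" and "b3m = map_matrix \<iota> b3"
  have \<delta>: "\<delta> \<noteq> 0" using \<zeta>(1) fixed by (auto simp: \<delta>_def)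
  have \<zeta>s: "\<zeta> = s + \<delta>" "\<iota> t1 = s + s + \<delta>" "\<iota> n1 = (s + \<delta>) * s"
    using \<zeta> by (simp_all add: s_def \<delta>_def)
  have Pp: "P *v (pm *v x) = (- (s / \<delta>)) *s (P *v x) + (1 / \<delta>) *s (Am *v (P *v x))" for x
  proof -
    have "P *v (pm *v x) = (P ** map_matrix \<iota> p) *v x" by (simp add: mv_simps pm_def)
    also have "\<dots> = (- (s / \<delta>)) *s (P *v x) + (1 / \<delta>) *s (Am *v (P *v x))"
      unfolding P(2)[symmetric] by (simp add: mv_simps s_def \<delta>_def Am_def)
    finally show ?thesis .
  qed
  have Pb: "P *v (b3m *v x) = (s * \<iota> t2) *s (P *v x) + \<delta> *s (Bm *v (P *v x))" for x
  proof -
    have "P *v (b3m *v x) = (P ** map_matrix \<iota> b3) *v x" by (simp add: mv_simps b3m_def)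
    also have "\<dots> = (s * \<iota> t2) *s (P *v x) + \<delta> *s (Bm *v (P *v x))"
      unfolding P(3)[symmetric] by (simp add: mv_simps s_def \<delta>_def Bm_def)
    finally show ?thesis .
  qed
  have AP: "Am *v (P *v x) = s *s (P *v x) + \<delta> *s (P *v (pm *v x))" for x
    unfolding Pp using \<delta> by (simp add: vec_eq_iff field_simps)
  have BP: "Bm *v (P *v x) = (1 / \<delta>) *s (P *v (b3m *v x)) - (s * \<iota> t2 / \<delta>) *s (P *v x)" for x
    unfolding Pb using \<delta> by (simp add: vec_eq_iff field_simps)
  have wP: "map_matrix \<iota> A.w ** P = P ** map_matrix \<iota> B.w"
  proof (rule matrix_eqI)
    fix x
    have "(map_matrix \<iota> A.w ** P) *v x =
        Am *v (Bm *v (P *v x)) + (\<iota> t2) *s ((\<iota> t1) *s (P *v x) - Am *v (P *v x)) - Bm *v ((\<iota> t1) *s (P *v x) - Am *v (P *v x))"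
      by (simp add: A.w_def map_matrix_mult map_matrix_add map_matrix_diff map_matrix_mat mv_simps Am_def Bm_def)
    also have "\<dots> = P *v (pm *v (b3m *v x)) + P *v (\<iota> (t1 * t2) *s (x - pm *v x)) - P *v (b3m *v (x - pm *v x))"
      using \<delta> by (simp add: AP BP matrix_vector_mult_diff_distrib matrix_vector_right_distrib \<zeta>s iota_hom vec_eq_iff field_simps)
    also have "\<dots> = (P ** map_matrix \<iota> B.w) *v x"
      by (simp add: B.w_def map_matrix_mult map_matrix_add map_matrix_diff map_matrix_mat mv_simps pm_def b3m_def
          iota_hom matrix_vector_mult_diff_distrib matrix_vector_right_distrib)
    finally show "(map_matrix \<iota> A.w ** P) *v x = (P ** map_matrix \<iota> B.w) *v x" .
  qed
  have zP: "map_matrix \<iota> A.z ** P = P ** map_matrix \<iota> B.z"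
  proof (rule matrix_eqI)
    fix x
    have "(map_matrix \<iota> A.z ** P) *v x = Bm *v (Am *v (P *v x)) - Am *v (Bm *v (P *v x))"
      by (simp add: A.z_def map_matrix_mult map_matrix_diff mv_simps Am_def Bm_def)
    also have "\<dots> = P *v (b3m *v (pm *v x)) - P *v (pm *v (b3m *v x))"
      using \<delta> by (simp add: AP BP matrix_vector_mult_diff_distrib matrix_vector_right_distrib vec_eq_iff field_simps)
    also have "\<dots> = (P ** map_matrix \<iota> B.z) *v x"
      by (simp add: B.z_def map_matrix_mult map_matrix_diff mv_simps pm_def b3m_def matrix_vector_mult_diff_distrib)
    finally show "(map_matrix \<iota> A.z ** P) *v x = (P ** map_matrix \<iota> B.z) *v x" .
  qed
  have zG: "A.z \<in> GL_int" using z by (simp add: A.z_def)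
  have "\<iota> (det A.z) = \<iota> (det B.z)"
    using arg_cong[OF zP, of det] P(1) by (simp add: det_mul det_map_matrix invertible_det_nz)
  then have det_z: "aval (det B.z) = 1" using zG by (simp add: GL_int_iff)
  then have Bz: "invertible B.z" by (auto simp: invertible_det_nz)
  obtain u v where uv: "u ** v = mat 1" "v ** u = mat 1" and Z: "(u ** A.z) ** (u ** A.z) = mat 1"
    "(u ** A.z) ** a = (mat t1 - a) ** (u ** A.z)" "(u ** A.z) ** A.w = A.w ** (u ** A.z)"
    and stab: "\<And>\<Lambda>. \<Lambda> \<in> lattices \<Longrightarrow> a \<in> stabilizers \<Lambda> \<Longrightarrow> A.w \<in> stabilizers \<Lambda> \<Longrightarrow> u \<in> stabilizers \<Lambda> \<and> v \<in> stabilizers \<Lambda>"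
    using A.semilinear_involution[OF t1 zG r] by metis
  let ?m = "map_matrix \<iota> :: 'f^'m^'m \<Rightarrow> _"
  note m = map_matrix_mult map_matrix_diff map_matrix_mat
  have "\<exists>T. invertible T \<and> ?m A.w ** T = T ** ?m B.w \<and> ?m (u ** A.z) ** (T ** ?m p) = T ** ?m p \<and>
      T ** (?m B.z ** ?m p) = ?m a ** (T ** ?m p)"
  proof (rule intertwiner_exists[where \<zeta> = \<zeta> and s = s and P = P and Zi = "?m (matrix_inv B.z)"])
    show "\<zeta> \<noteq> s" using \<delta> by (simp add: s_def \<delta>_def)
    have ts: "\<iota> t1 = \<zeta> + s" "\<iota> n1 = \<zeta> * s" using \<zeta> by (simp_all add: s_def)
    show "?m a ** ?m a = mat (\<zeta> + s) ** ?m a - mat (\<zeta> * s)"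
      using arg_cong[OF A.aa, of ?m] by (simp add: m ts)
    show "?m (u ** A.z) ** ?m (u ** A.z) = mat 1" using arg_cong[OF Z(1), of ?m] by (simp add: m iota_hom)
    show "?m (u ** A.z) ** ?m a = (mat (\<zeta> + s) - ?m a) ** ?m (u ** A.z)"
      using arg_cong[OF Z(2), of ?m] by (simp add: m ts)
    show "?m (u ** A.z) ** ?m A.w = ?m A.w ** ?m (u ** A.z)" using arg_cong[OF Z(3), of ?m] by (simp add: m)
    show "?m A.w ** ?m a = ?m a ** ?m A.w" using arg_cong[OF A.w_a, of ?m] by (simp add: m)
    show "?m a ** P = P ** (mat s + mat (\<zeta> - s) ** ?m p)"
      by (rule matrix_eqI) (use AP in \<open>simp add: mv_simps Am_def pm_def s_def \<delta>_def matrix_vector_right_distrib\<close>)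
    show "?m p ** ?m p = ?m p" using arg_cong[OF B.aa, of ?m] by (simp add: m iota_hom)
    show "?m B.z ** ?m p = (mat 1 - ?m p) ** ?m B.z" using arg_cong[OF B.z_a, of ?m] by (simp add: m iota_hom)
    show "?m B.w ** ?m p = ?m p ** ?m B.w" using arg_cong[OF B.w_a, of ?m] by (simp add: m)
    show "?m B.w ** ?m B.z = ?m B.z ** ?m B.w" using arg_cong[OF B.w_z, of ?m] by (simp add: m)
    show "?m (matrix_inv B.z) ** ?m B.z = mat 1" "?m B.z ** ?m (matrix_inv B.z) = mat 1"
      using Bz by (simp_all add: matrix_inv_left matrix_inv_right map_matrix_mat iota_hom flip: map_matrix_mult)
  qed (rule P(1), rule wP)
  then obtain T0 where T0: "invertible T0" "?m A.w ** T0 = T0 ** ?m B.w"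
      "?m (u ** A.z) ** (T0 ** ?m p) = T0 ** ?m p" "T0 ** (?m B.z ** ?m p) = ?m a ** (T0 ** ?m p)" by blast
  define S where "S = {(A.w, mat 1, mat 1, B.w), (u ** A.z, p, mat 1, p), (mat 1, B.z ** p, a, p)}"
  have m1: "?m (mat 1) = mat 1" by (simp add: map_matrix_mat iota_hom)
  have "\<exists>T. invertible T \<and> (\<forall>(A, B, C, D)\<in>S. A ** T ** B = C ** T ** D)"
  proof (rule descend_solution[OF T0(1)])
    fix A B C D assume "(A, B, C, D) \<in> S"
    then show "?m A ** T0 ** ?m B = ?m C ** T0 ** ?m D"
      using T0(2-4) m1 by (auto simp: S_def map_matrix_mult matrix_mul_assoc)
  qed
  then obtain T where T: "invertible T" "A.w ** T = T ** B.w" "(u ** A.z) ** (T ** p) = T ** p" "T ** (B.z ** p) = a ** (T ** p)"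
    by (auto simp: S_def matrix_mul_assoc)
  have "matched_pairs a b p b3 t1 n1 t2 n2 u v T"
    by unfold_locales (use uv Z stab T det_z in blast)+
  then show ?thesis by blast
qed

section \<open>Stable lattices as double coset data\<close>

text \<open>
  The reference embedding is integral, so \<open>g h O\<^sup>m\<close> is stable for \<open>h\<close> in the centralizer. The converse is the
  transitivity of the centralizer on stable lattices, applied to \<open>g O\<^sup>m\<close>. A matrix that commutes with the
  generator \<open>\<theta>\<close> commutes with the whole algebra.
\<close>

lemma position_coset_nonempty:
  fixes \<rho> :: "'a \<Rightarrow> 'f::nonarch_local_field^'m^'m" and g c :: "'f^'m^'m"
  assumes g: "invertible g" and c: "c = g ** \<rho> \<theta> ** matrix_inv g" and \<theta>: "\<theta> \<in> A" "\<rho> \<theta> \<in> mat_over int_ring"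
    and spans: "\<And>x. x \<in> A \<Longrightarrow> \<exists>k d. \<rho> x = mat k + mat d ** \<rho> \<theta>"
    and trans: "\<And>\<Lambda> \<Lambda>'. \<Lambda> \<in> lattices \<Longrightarrow> c \<in> stabilizers \<Lambda> \<Longrightarrow> \<Lambda>' \<in> lattices \<Longrightarrow> c \<in> stabilizers \<Lambda>' \<Longrightarrow>
      \<exists>h. invertible h \<and> h ** c = c ** h \<and> (*v) h ` \<Lambda> = \<Lambda>'"
  shows "position_coset (centralizer A \<rho>) g \<Lambda> \<noteq> {} \<longleftrightarrow> \<Lambda> \<in> lattices \<and> c \<in> stabilizers \<Lambda>"
    and "invertible l \<Longrightarrow> l ** c = c ** l \<Longrightarrow> matrix_inv g ** l ** g \<in> centralizer A \<rho>"
proof -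
  have conj: "matrix_inv g ** c ** g = \<rho> \<theta>"
  proof -
    have "matrix_inv g ** c ** g = (matrix_inv g ** g) ** \<rho> \<theta> ** (matrix_inv g ** g)"
      by (simp only: c matrix_mul_assoc)
    then show ?thesis using g by (simp add: matrix_inv_left)
  qed
  show central: "matrix_inv g ** l ** g \<in> centralizer A \<rho>" if l: "invertible l" "l ** c = c ** l" for l
  proof -
    let ?k = "matrix_inv g ** l ** g"
    have *: "(matrix_inv g ** M ** g) ** (matrix_inv g ** N ** g) = matrix_inv g ** (M ** N) ** g" for M N
    proof -
      have "(matrix_inv g ** M ** g) ** (matrix_inv g ** N ** g) = matrix_inv g ** M ** (g ** matrix_inv g) ** N ** g"
        by (simp only: matrix_mul_assoc)
      then show ?thesis using g by (simp add: matrix_inv_right matrix_mul_assoc)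
    qed
    have com: "?k ** \<rho> \<theta> = \<rho> \<theta> ** ?k" unfolding conj[symmetric] * l(2) ..
    have "?k ** \<rho> x = \<rho> x ** ?k" if "x \<in> A" for x
    proof -
      obtain k d where x: "\<rho> x = mat k + mat d ** \<rho> \<theta>" using spans[OF \<open>x \<in> A\<close>] by blast
      have "?k ** (mat d ** \<rho> \<theta>) = (?k ** mat d) ** \<rho> \<theta>" by (rule matrix_mul_assoc)
      also have "\<dots> = (mat d ** ?k) ** \<rho> \<theta>" by (simp only: mat_central[of ?k d])
      also have "\<dots> = mat d ** (?k ** \<rho> \<theta>)" by (rule matrix_mul_assoc[symmetric])
      also have "\<dots> = (mat d ** \<rho> \<theta>) ** ?k" by (simp only: com matrix_mul_assoc)
      finally show ?thesis
        unfolding x by (simp only: matrix_add_ldistrib matrix_add_rdist mat_central[of ?k k])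
    qed
    then show ?thesis using l(1) g by (auto simp: centralizer_def invertible_mult invertible_matrix_inv)
  qed
  have stab: "c \<in> stabilizers (lattice_of (g ** h))" if h: "h \<in> centralizer A \<rho>" for h
  proof -
    have hi: "invertible h" "h ** \<rho> \<theta> = \<rho> \<theta> ** h" using h \<theta>(1) by (auto simp: centralizer_def)
    have "matrix_inv (g ** h) ** c ** (g ** h) = matrix_inv h ** (matrix_inv g ** c ** g) ** h"
      using g hi(1) by (simp add: matrix_inv_mult matrix_mul_assoc)
    also have "\<dots> = matrix_inv h ** h ** \<rho> \<theta>" unfolding conj by (simp add: hi(2) flip: matrix_mul_assoc)
    also have "\<dots> = \<rho> \<theta>" using hi(1) by (simp add: matrix_inv_left)
    finally show ?thesis using \<theta>(2) stabilizers_lattice_of[of "g ** h" c] g hi(1) by (simp add: invertible_mult)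
  qed
  show "position_coset (centralizer A \<rho>) g \<Lambda> \<noteq> {} \<longleftrightarrow> \<Lambda> \<in> lattices \<and> c \<in> stabilizers \<Lambda>"
  proof
    assume "position_coset (centralizer A \<rho>) g \<Lambda> \<noteq> {}"
    then obtain h where h: "h \<in> centralizer A \<rho>" "lattice_of (g ** h) = \<Lambda>" by (auto simp: position_coset_def)
    then have "invertible (g ** h)" using g by (auto simp: centralizer_def invertible_mult)
    then show "\<Lambda> \<in> lattices \<and> c \<in> stabilizers \<Lambda>" using stab[OF h(1)] h(2) by (auto simp: lattices_def)
  next
    assume L: "\<Lambda> \<in> lattices \<and> c \<in> stabilizers \<Lambda>"
    have "mat 1 \<in> centralizer A \<rho>" by (auto simp: centralizer_def invertible_mat_1)
    then have "c \<in> stabilizers (lattice_of g)" using stab[of "mat 1"] by simp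
    moreover have "lattice_of g \<in> lattices" using g by (auto simp: lattices_def)
    ultimately obtain h where h: "invertible h" "h ** c = c ** h" "(*v) h ` lattice_of g = \<Lambda>"
      using trans L by blast
    have "g ** (matrix_inv g ** h ** g) = h ** g" using g by (simp add: matrix_mul_assoc matrix_inv_right)
    then have "lattice_of (g ** (matrix_inv g ** h ** g)) = \<Lambda>" using h(3) by (simp add: image_lattice_of)
    then show "position_coset (centralizer A \<rho>) g \<Lambda> \<noteq> {}"
      using central[OF h(1,2)] by (auto simp: position_coset_def)
  qed
qed

section \<open>Transport of the count along an intertwiner\<close>

lemma emeasure_count_image: "inj f \<Longrightarrow> emeasure (count_space UNIV) (f ` S) = emeasure (count_space UNIV) S"
  using inj_on_subset[of f UNIV S] by (simp add: emeasure_count_space card_image finite_image_iff)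

lemma mat_units_conjugate:
  assumes T: "invertible (T :: 'f::field^'m^'m)"
  shows "mat_units ((\<lambda>x. matrix_inv T ** x ** T) ` R) = (\<lambda>x. matrix_inv T ** x ** T) ` mat_units R"
proof -
  let ?c = "\<lambda>x. matrix_inv T ** x ** T"
  have mult: "?c x ** ?c y = ?c (x ** y)" for x y
  proof -
    have "?c x ** ?c y = matrix_inv T ** x ** (T ** matrix_inv T) ** y ** T" by (simp only: matrix_mul_assoc)
    then show ?thesis using T by (simp add: matrix_inv_right matrix_mul_assoc)
  qed
  have one: "?c x = mat 1 \<longleftrightarrow> x = mat 1" for x
  proof
    assume "?c x = mat 1"
    then have "T ** ?c x ** matrix_inv T = mat 1" using T by (simp add: matrix_inv_right)
    moreover have "T ** ?c x ** matrix_inv T = (T ** matrix_inv T) ** x ** (T ** matrix_inv T)"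
      by (simp only: matrix_mul_assoc)
    ultimately show "x = mat 1" using T by (simp add: matrix_inv_right)
  qed (use T in \<open>simp add: matrix_inv_left\<close>)
  show ?thesis unfolding mat_units_def by (auto simp: mult one; blast)
qed

text \<open>
  Conjugation by \<open>T\<close> commutes with the evaluation of polynomials.
\<close>

lemma adjoin_conjugate:
  fixes w w' T :: "'f::nonarch_local_field^'m^'m"
  assumes T: "invertible T" "w ** T = T ** w'"
  shows "adjoin w' = (\<lambda>x. matrix_inv T ** x ** T) ` adjoin w"
    and "adjoin_max_order w' = (\<lambda>x. matrix_inv T ** x ** T) ` adjoin_max_order w"
proof -
  let ?c = "\<lambda>x. matrix_inv T ** x ** T"
  have conj: "mat_poly q x' = ?c (mat_poly q x)" if "x ** T = T ** x'" for q and x x' :: "'f^'m^'m"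
  proof -
    have "?c (mat_poly q x) = matrix_inv T ** (T ** mat_poly q x')"
      using mat_poly_intertwine[OF that[symmetric], of q] by (simp flip: matrix_mul_assoc)
    then show ?thesis using T(1) by (simp add: matrix_mul_assoc matrix_inv_left)
  qed
  show adj: "adjoin w' = ?c ` adjoin w" unfolding adjoin_def image_image conj[OF T(2)] ..
  have zero: "?c x = 0 \<longleftrightarrow> x = 0" for x
  proof
    assume "?c x = 0"
    then have "T ** ?c x ** matrix_inv T = 0" by simp
    moreover have "T ** ?c x ** matrix_inv T = (T ** matrix_inv T) ** x ** (T ** matrix_inv T)"
      by (simp only: matrix_mul_assoc)
    ultimately show "x = 0" using T by (simp add: matrix_inv_right)
  qed simp
  have "mat_poly q (?c x) = 0 \<longleftrightarrow> mat_poly q x = 0" for q x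
    using conj[of x "?c x" q] T(1) zero by (simp add: matrix_mul_assoc matrix_inv_right)
  then show "adjoin_max_order w' = ?c ` adjoin_max_order w"
    unfolding adjoin_max_order_def adj by blast
qed

text \<open>
  Representatives and the sizes of their orbits correspond under \<open>\<Lambda> \<mapsto> T \<Lambda>\<close>, because \<open>T\<close> conjugates the
  groups acting on both sides into each other.
\<close>

lemma equal_orbits_transport:
  fixes w w' T :: "'f::nonarch_local_field^'m^'m"
  assumes U: "orbital_unfolding H1 H2 g1 g2 w \<mu>1 \<mu>2 \<nu> Q" and U': "orbital_unfolding H1' H2' g1' g2' w' \<mu>1' \<mu>2' \<nu>' Q'"
    and T: "invertible T" "w ** T = T ** w'"
    and lat: "\<And>\<Lambda>. \<Lambda> \<in> lattices \<Longrightarrow>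
      (*v) T ` \<Lambda> \<in> orbital_unfolding.common_lattices H1 H2 g1 g2 \<longleftrightarrow>
      \<Lambda> \<in> orbital_unfolding.common_lattices H1' H2' g1' g2'"
  shows "orbital_unfolding.equal_orbits H1 H2 g1 g2 Q \<in> sets Q"
    and "orbital_unfolding.equal_orbits H1' H2' g1' g2' Q' \<in> sets Q'"
    and "measure Q (orbital_unfolding.equal_orbits H1 H2 g1 g2 Q) =
      measure Q' (orbital_unfolding.equal_orbits H1' H2' g1' g2' Q')"
proof -
  interpret U: orbital_unfolding H1 H2 g1 g2 w \<mu>1 \<mu>2 \<nu> Q by (rule U)
  interpret U': orbital_unfolding H1' H2' g1' g2' w' \<mu>1' \<mu>2' \<nu>' Q' by (rule U')
  let ?c = "\<lambda>x. matrix_inv T ** x ** T" and ?T = "\<lambda>\<Lambda>. (*v) T ` \<Lambda>"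
  have units: "U'.units = ?c ` U.units" "U'.int_units = ?c ` U.int_units"
    unfolding adjoin_conjugate[OF T] by (rule mat_units_conjugate[OF T(1)])+
  have Tc: "?T ((*v) (?c l) ` \<Lambda>) = (*v) l ` ?T \<Lambda>" for l \<Lambda>
  proof -
    have "T ** ?c l = l ** T" using T(1) by (simp add: matrix_mul_assoc matrix_inv_right)
    then show ?thesis by (simp only: image_matrix_mult[symmetric])
  qed
  have inj: "inj ?T"
    using inj_matrix_vector_mult[OF T(1)] by (intro injI) (simp add: inj_image_eq_iff)
  have "\<exists>R'\<subseteq>U'.common_lattices. \<forall>\<Lambda>\<in>U'.common_lattices. \<exists>!\<Lambda>'. \<Lambda>' \<in> R' \<and> (\<exists>l\<in>U'.units. \<Lambda> = (*v) l ` \<Lambda>')"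
    by (rule orbit_representatives[OF U'.group(1)]) (rule U'.units_common)
  then obtain R' where R': "R' \<subseteq> U'.common_lattices"
    "\<forall>\<Lambda>\<in>U'.common_lattices. \<exists>!\<Lambda>'. \<Lambda>' \<in> R' \<and> (\<exists>l\<in>U'.units. \<Lambda> = (*v) l ` \<Lambda>')"
    by (elim exE conjE)
  define R where "R = ?T ` R'"
  have R: "R \<subseteq> U.common_lattices" using R'(1) lat U'.common_lattices_sub by (auto simp: R_def)
  have repr: "\<exists>!M'. M' \<in> R \<and> (\<exists>l\<in>U.units. M = (*v) l ` M')" if M: "M \<in> U.common_lattices" for M
  proof -
    define \<Lambda> where "\<Lambda> = (*v) (matrix_inv T) ` M"
    have M_eq: "M = ?T \<Lambda>" unfolding \<Lambda>_def using T(1) by (simp add: image_image)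
    have "M \<in> lattices" using M U.common_lattices_sub by blast
    then have "\<Lambda> \<in> lattices" unfolding \<Lambda>_def by (intro lattice_image invertible_matrix_inv T(1))
    then have L: "\<Lambda> \<in> U'.common_lattices" using lat M M_eq by blast
    have iff: "(\<exists>l\<in>U'.units. \<Lambda> = (*v) l ` \<Lambda>') \<longleftrightarrow> (\<exists>l\<in>U.units. M = (*v) l ` ?T \<Lambda>')" for \<Lambda>'
      unfolding units bex_simps M_eq Tc[symmetric] using inj by (simp add: inj_eq)
    obtain \<Lambda>' where \<Lambda>': "\<Lambda>' \<in> R'" "\<exists>l\<in>U'.units. \<Lambda> = (*v) l ` \<Lambda>'"
      and uniq: "\<And>\<Lambda>''. \<Lambda>'' \<in> R' \<Longrightarrow> \<exists>l\<in>U'.units. \<Lambda> = (*v) l ` \<Lambda>'' \<Longrightarrow> \<Lambda>'' = \<Lambda>'"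
      using R'(2) L by metis
    show ?thesis
    proof (rule ex1I)
      show "?T \<Lambda>' \<in> R \<and> (\<exists>l\<in>U.units. M = (*v) l ` ?T \<Lambda>')" using \<Lambda>' iff by (simp add: R_def)
      fix M' assume M': "M' \<in> R \<and> (\<exists>l\<in>U.units. M = (*v) l ` M')"
      then obtain \<Lambda>'' where "\<Lambda>'' \<in> R'" "M' = ?T \<Lambda>''" unfolding R_def by blast
      then show "M' = ?T \<Lambda>'" using uniq[of \<Lambda>''] iff[of \<Lambda>''] M' by blast
    qed
  qed
  note m = U.equal_orbits_measure[OF R repr]
  have repr': "\<exists>!\<Lambda>'. \<Lambda>' \<in> R' \<and> (\<exists>l\<in>U'.units. \<Lambda> = (*v) l ` \<Lambda>')" if "\<Lambda> \<in> U'.common_lattices" for \<Lambda>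
    using R'(2) that by (rule bspec)
  note m' = U'.equal_orbits_measure[OF R'(1) repr']
  show "U.equal_orbits \<in> sets Q" by (rule m(1))
  show "U'.equal_orbits \<in> sets Q'" by (rule m'(1))
  have bij: "bij_betw ?T R' R" unfolding R_def using inj by (intro bij_betw_imageI) (auto intro: inj_on_subset)
  have "emeasure Q U.equal_orbits =
      (\<integral>\<^sup>+\<Lambda>. emeasure (count_space UNIV) ((\<lambda>l. (*v) l ` ?T \<Lambda>) ` U.int_units) \<partial>count_space R')"
    using m(2) nn_integral_bij_count_space[OF bij, of "\<lambda>M. emeasure (count_space UNIV) ((\<lambda>l. (*v) l ` M) ` U.int_units)"]
    by (simp only:)
  also have "\<dots> = (\<integral>\<^sup>+\<Lambda>. emeasure (count_space UNIV) ((\<lambda>l. (*v) l ` \<Lambda>) ` U'.int_units) \<partial>count_space R')"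
  proof (rule nn_integral_cong)
    fix \<Lambda>
    have "(\<lambda>l. (*v) l ` ?T \<Lambda>) ` U.int_units = ?T ` (\<lambda>l. (*v) l ` \<Lambda>) ` U'.int_units"
      unfolding units image_image[of ?T] image_image[of _ ?c] Tc ..
    then show "emeasure (count_space UNIV) ((\<lambda>l. (*v) l ` ?T \<Lambda>) ` U.int_units) =
        emeasure (count_space UNIV) ((\<lambda>l. (*v) l ` \<Lambda>) ` U'.int_units)"
      by (simp only: emeasure_count_image[OF inj])
  qed
  finally show "measure Q U.equal_orbits = measure Q' U'.equal_orbits"
    by (simp add: measure_def m'(2))
qed

section \<open>The transfer factor on stable lattices\<close>

text \<open>
  Finiteness is part of the claim, since infinite sets have cardinality 0: the residue cardinality is the base of a complex power, and 0 to the
  power 0 is 0 for \<open>powr\<close>.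
\<close>

lemma residue_card_gt_1: "1 < residue_card TYPE('f::nonarch_local_field)"
proof -
  let ?C = "(\<lambda>x. (+) x ` max_ideal) ` (int_ring :: 'f set)"
  obtain S :: "'f set" where S: "finite S" "S \<subseteq> int_ring" "\<forall>x\<in>int_ring. \<exists>!t\<in>S. aval (x - t) < 1"
    using residue_representatives by blast
  have coset: "(+) x ` max_ideal = {y. aval (y - x) < 1}" for x :: 'f
  proof (intro equalityI subsetI)
    fix y assume "y \<in> {y. aval (y - x) < 1}"
    then show "y \<in> (+) x ` max_ideal" by (intro image_eqI[of _ _ "y - x"]) (auto simp: max_ideal_def)
  qed (auto simp: max_ideal_def)
  have "?C \<subseteq> (\<lambda>x. (+) x ` max_ideal) ` S"
  proof
    fix C assume "C \<in> ?C"
    then obtain x where x: "x \<in> int_ring" "C = (+) x ` max_ideal" by blast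
    obtain t where t: "t \<in> S" "aval (x - t) < 1" using S(3) x(1) by blast
    have "aval (y - x) < 1 \<longleftrightarrow> aval (y - t) < 1" for y
    proof -
      have "aval (t - x) < 1" using t(2) by (metis aval_minus minus_diff_eq)
      then show ?thesis
        using aval_add_less[of "y - x" 1 "x - t"] aval_add_less[of "y - t" 1 "t - x"] t(2) by auto
    qed
    then have "C = (+) t ` max_ideal" unfolding x(2) coset by blast
    then show "C \<in> (\<lambda>x. (+) x ` max_ideal) ` S" using t(1) by blast
  qed
  then have fin: "finite ?C" using S(1) finite_surj by blast
  have "(+) (0::'f) ` max_ideal \<noteq> (+) 1 ` max_ideal"
  proof
    assume eq: "(+) (0::'f) ` max_ideal = (+) 1 ` max_ideal"
    have "(0::'f) \<in> (+) 0 ` max_ideal" unfolding coset by simp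
    then have "(0::'f) \<in> (+) 1 ` max_ideal" by (simp only: eq)
    then have "aval (0 - 1 :: 'f) < 1" unfolding coset by simp
    then show False using aval_mult[of "1::'f" 1] by simp
  qed
  moreover have "{(+) (0::'f) ` max_ideal, (+) 1 ` max_ideal} \<subseteq> ?C" using int_ring_intros by blast
  ultimately have "card {(+) (0::'f) ` max_ideal, (+) 1 ` max_ideal} \<le> card ?C" "card {(+) (0::'f) ` max_ideal, (+) 1 ` max_ideal} = 2"
    using card_mono[OF fin] by (blast, simp)
  then show ?thesis unfolding residue_card_def quot_card_def by linarith
qed

text \<open>
  Since \<open>z\<close> preserves \<open>\<Lambda>\<close> and exchanges \<open>p\<close> and \<open>1 - p\<close>, the two lattices \<open>\<Lambda>\<^sub>-\<close> and \<open>z \<Lambda>\<^sub>+\<close> coincide and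
  their index is 1.
\<close>

lemma Omega_1:
  fixes p z :: "'f::nonarch_local_field^'m^'m"
  assumes L: "\<Lambda> \<in> lattices" and z: "z ** p = (mat 1 - p) ** z" "(*v) z ` \<Lambda> = \<Lambda>"
  shows "Omega p (mat 1 - p) z \<Lambda> 0 = 1"
proof -
  let ?M = "(*v) (mat 1 - p) ` \<Lambda>"
  have "(*v) z ` (*v) p ` \<Lambda> = (*v) (mat 1 - p) ` (*v) z ` \<Lambda>" by (simp only: image_matrix_mult[symmetric] z(1))
  then have zp: "(*v) z ` (*v) p ` \<Lambda> = ?M" using z(2) by simp
  have closed: "x + y \<in> ?M" if "x \<in> ?M" "y \<in> ?M" for x y
    using that lattice_add[OF L] by (auto simp flip: matrix_vector_right_distrib)
  have minus: "- x \<in> ?M" if "x \<in> ?M" for x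
    using that lattice_minus[OF L] by (auto simp flip: mv_minus)
  have zero: "0 \<in> ?M" using lattice_0[OF L] by (intro image_eqI[of _ _ 0]) auto
  have "(+) x ` ?M = ?M" if x: "x \<in> ?M" for x
  proof (intro equalityI subsetI)
    fix y assume "y \<in> ?M"
    then have "- x + y \<in> ?M" using minus[OF x] closed by blast
    moreover have "y = x + (- x + y)" by simp
    ultimately show "y \<in> (+) x ` ?M" by blast
  qed (use closed[OF x] in auto)
  then have "(\<lambda>x. (+) x ` ?M) ` ?M = {?M}" using zero by blast
  then have index: "lattice_index ?M ?M = 1" by (simp add: lattice_index_def quot_card_def)
  let ?q = "residue_card TYPE('f)"
  have q: "1 < ?q" by (rule residue_card_gt_1)
  have "(THE m::int. real ?q powi m = 1) = 0"
  proof (rule the_equality)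
    fix m :: int assume m: "real ?q powi m = 1"
    show "m = 0"
    proof (rule ccontr)
      assume "m \<noteq> 0"
      then consider "0 < m" | "m < 0" by linarith
      then show False
      proof cases
        case 1
        then have "1 < real ?q ^ nat m" using q by (intro one_less_power) auto
        then show False using m 1 by (simp add: power_int_def)
      next
        case 2
        then have "1 < real ?q ^ nat (- m)" using q by (intro one_less_power) auto
        then show False using m 2 by (simp add: power_int_def power_inverse)
      qed
    qed
  qed simp
  then show ?thesis using q by (simp add: Omega_def Let_def zp index)
qed

section \<open>Embeddings of an algebra with one generator\<close>

lemma alg_embedding_generator:
  assumes "alg_embedding A \<iota> \<gamma>" "\<iota> c \<in> A" "\<iota> d \<in> A" "\<theta> \<in> A" "\<iota> d * \<theta> \<in> A"
  shows "\<gamma> (\<iota> c + \<iota> d * \<theta>) = mat c + mat d ** \<gamma> \<theta>"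
  using assms by (simp add: alg_embedding_def)

context tensor_pair
begin

lemma fixed_scalar: "i (\<iota> c) \<in> tensor_fixed i j \<sigma> \<sigma>'"
  using mem_tensor_fixed_iff[of "\<iota> c" 0] L.sigma_iota[of 0] by simp

lemma fixed_scale: "s \<in> tensor_fixed i j \<sigma> \<sigma>' \<Longrightarrow> i (\<iota> d) * s \<in> tensor_fixed i j \<sigma> \<sigma>'"
proof -
  assume s: "s \<in> tensor_fixed i j \<sigma> \<sigma>'"
  obtain x y where xy: "s = i x + i y * j g" using decomposition by blast
  have "i (\<iota> d) * s = i (\<iota> d * x) + i (\<iota> d * y) * j g" by (simp add: xy i_hom algebra_simps)
  moreover have "\<iota> d * y = - \<sigma> (\<iota> d * y) \<and> \<iota> d * x = \<sigma> (\<iota> d * x) + \<sigma> (\<iota> d * y) * \<iota> t"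
  proof -
    have "y = - \<sigma> y" "x = \<sigma> x + \<sigma> y * \<iota> t" using s unfolding xy mem_tensor_fixed_iff by blast+
    from this(1) have y: "\<iota> d * y = \<iota> d * (- \<sigma> y)" by (rule arg_cong)
    from \<open>x = \<sigma> x + \<sigma> y * \<iota> t\<close> have x: "\<iota> d * x = \<iota> d * (\<sigma> x + \<sigma> y * \<iota> t)" by (rule arg_cong)
    show ?thesis
      unfolding L.sigma_hom L.sigma_iota
      using y x by (intro conjI) (simp_all only: mult_minus_right distrib_left mult.assoc)
  qed
  ultimately show ?thesis by (simp only: mem_tensor_fixed_iff)
qed

end

text \<open>
  The relations are stated for a subalgebra \<open>A\<close> and are applied to \<open>K\<^sub>1\<close>, \<open>K\<^sub>2\<close>, \<open>K\<^sub>0\<close> and \<open>K\<^sub>3\<close>. The idempotent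
  \<open>\<zeta>\<^sub>0\<close> counts as an element of trace 1 and norm 0.
\<close>

lemma embedding_quadratic:
  fixes \<gamma> :: "'a::comm_ring_1 \<Rightarrow> 'f::field^'m^'m"
  assumes \<gamma>: "alg_embedding A \<iota> \<gamma>"
    and A: "\<theta> \<in> A" "\<And>c. \<iota> c \<in> A" "\<And>c. \<iota> c * \<theta> \<in> A" and hom: "\<And>c. \<iota> (- c) = - \<iota> c" "\<iota> 1 = 1"
    and sq: "\<theta> * \<theta> = \<iota> t * \<theta> - \<iota> n"
  shows "\<gamma> \<theta> ** \<gamma> \<theta> = mat t ** \<gamma> \<theta> - mat n" and "\<gamma> (\<iota> t - \<theta>) = mat t - \<gamma> \<theta>"
proof -
  note gen = alg_embedding_generator[OF \<gamma> A(2) A(2) A(1) A(3)]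
  have neg: "mat (- c) = - (mat c :: 'f^'m^'m)" for c by (simp add: vec_eq_iff mat_def)
  have "\<gamma> \<theta> ** \<gamma> \<theta> = \<gamma> (\<theta> * \<theta>)" using \<gamma> A(1) by (simp add: alg_embedding_def)
  also have "\<theta> * \<theta> = \<iota> (- n) + \<iota> t * \<theta>" by (simp add: sq hom)
  also have "\<gamma> \<dots> = mat t ** \<gamma> \<theta> - mat n" by (simp add: gen neg)
  finally show "\<gamma> \<theta> ** \<gamma> \<theta> = mat t ** \<gamma> \<theta> - mat n" .
  have "\<iota> t - \<theta> = \<iota> t + \<iota> (- 1) * \<theta>" by (simp add: hom)
  then have "\<gamma> (\<iota> t - \<theta>) = mat t + mat (- 1) ** \<gamma> \<theta>" by (simp only: gen)
  then show "\<gamma> (\<iota> t - \<theta>) = mat t - \<gamma> \<theta>" by (simp add: neg matrix_mul_minus)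
qed

lemma integral_over_quadratic:
  assumes hom: "\<iota> 0 = 0" "\<iota> 1 = 1" "\<iota> (- t) = - \<iota> t" and sq: "\<theta> * \<theta> = \<iota> t * \<theta> - \<iota> n"
    and i: "t \<in> int_ring" "n \<in> int_ring"
  shows "integral_over \<iota> \<theta>"
  unfolding integral_over_def
proof (intro exI[of _ "[:n, - t, 1:]"] conjI allI)
  show "Polynomial.coeff [:n, - t, 1:] k \<in> int_ring" for k
    using i by (auto simp: coeff_pCons int_ring_intros split: nat.split)
  show "poly (map_poly \<iota> [:n, - t, 1:]) \<theta> = 0"
    using sq hom by (simp add: map_poly_pCons algebra_simps)
qed simp

section \<open>The comparison of orbital integrals\<close>

theorem theorem1p5:
  fixes \<iota>\<^sub>1 :: "'f::nonarch_local_field \<Rightarrow> 'k1::field" and \<iota>\<^sub>2 :: "'f \<Rightarrow> 'k2::field"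
    and \<sigma>\<^sub>1 :: "'k1 \<Rightarrow> 'k1" and \<sigma>\<^sub>2 :: "'k2 \<Rightarrow> 'k2"
    and \<zeta>\<^sub>1 :: 'k1 and \<pi>\<^sub>2 :: 'k2
    and i j :: "'k1 \<Rightarrow> 'k1k1::comm_ring_1"
    and i' :: "'k1 \<Rightarrow> 'k1k2::comm_ring_1" and j' :: "'k2 \<Rightarrow> 'k1k2"
    and \<alpha>\<^sub>1 \<rho>\<^sub>1 :: "'k1 \<Rightarrow> 'f^'m^'m" and \<alpha>\<^sub>2 \<rho>\<^sub>2 :: "'k2 \<Rightarrow> 'f^'m^'m"
    and \<beta>\<^sub>0 \<rho>\<^sub>0 :: "'k1k1 \<Rightarrow> 'f^'m^'m" and \<beta>\<^sub>3 \<rho>\<^sub>3 :: "'k1k2 \<Rightarrow> 'f^'m^'m"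
    and g\<^sub>0 g\<^sub>1 g\<^sub>2 g\<^sub>3 :: "'f^'m^'m"
    and Q\<^sub>\<alpha> Q\<^sub>\<beta> :: "(('f^'m^'m) \<times> ('f^'m^'m)) set measure"
    and O\<^sub>1 :: "'k1 set" and O\<^sub>2 :: "'k2 set" and K\<^sub>0 O\<^sub>0 :: "'k1k1 set" and K\<^sub>3 O\<^sub>3 :: "'k1k2 set"
    and \<iota>\<^sub>0 :: "'f \<Rightarrow> 'k1k1" and \<iota>\<^sub>3 :: "'f \<Rightarrow> 'k1k2"
    and \<zeta>\<^sub>0 \<zeta>\<^sub>0' :: 'k1k1 and \<pi>\<^sub>3 \<pi>\<^sub>3' :: 'k1k2
    and w\<^sub>\<alpha> z\<^sub>\<alpha> w\<^sub>\<beta> z\<^sub>\<beta> :: "'f^'m^'m"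
  assumes defs: "O\<^sub>1 = max_order UNIV \<iota>\<^sub>1" "O\<^sub>2 = max_order UNIV \<iota>\<^sub>2"
      "K\<^sub>0 = tensor_fixed i j \<sigma>\<^sub>1 \<sigma>\<^sub>1" "K\<^sub>3 = tensor_fixed i' j' \<sigma>\<^sub>1 \<sigma>\<^sub>2"
      "\<iota>\<^sub>0 = i \<circ> \<iota>\<^sub>1" "\<iota>\<^sub>3 = i' \<circ> \<iota>\<^sub>1"
      "O\<^sub>0 = K0_order \<iota>\<^sub>1 i j \<sigma>\<^sub>1" "O\<^sub>3 = max_order K\<^sub>3 \<iota>\<^sub>3"
      "\<zeta>\<^sub>0 = K0_elem i j \<sigma>\<^sub>1 (1, 0)" "\<zeta>\<^sub>0' = K0_elem i j \<sigma>\<^sub>1 (0, 1)"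
      "\<pi>\<^sub>3 = i' \<zeta>\<^sub>1 * j' \<pi>\<^sub>2 + i' (\<sigma>\<^sub>1 \<zeta>\<^sub>1) * j' (\<sigma>\<^sub>2 \<pi>\<^sub>2)"
      "\<pi>\<^sub>3' = i' (\<sigma>\<^sub>1 \<zeta>\<^sub>1) * j' \<pi>\<^sub>2 + i' \<zeta>\<^sub>1 * j' (\<sigma>\<^sub>2 \<pi>\<^sub>2)"
      "w\<^sub>\<alpha> = w_elem \<alpha>\<^sub>1 \<alpha>\<^sub>2 \<zeta>\<^sub>1 (\<sigma>\<^sub>1 \<zeta>\<^sub>1) \<pi>\<^sub>2 (\<sigma>\<^sub>2 \<pi>\<^sub>2)"
      "z\<^sub>\<alpha> = z_elem \<alpha>\<^sub>1 \<alpha>\<^sub>2 \<zeta>\<^sub>1 \<pi>\<^sub>2"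
      "w\<^sub>\<beta> = w_elem \<beta>\<^sub>0 \<beta>\<^sub>3 \<zeta>\<^sub>0 \<zeta>\<^sub>0' \<pi>\<^sub>3 \<pi>\<^sub>3'"
      "z\<^sub>\<beta> = z_elem \<beta>\<^sub>0 \<beta>\<^sub>3 \<zeta>\<^sub>0 \<pi>\<^sub>3"
    and dim: "CARD('m) = 2 * CARD('n::finite)"
    and K1: "quadratic_galois \<iota>\<^sub>1 \<sigma>\<^sub>1" "unramified \<iota>\<^sub>1"
    and K2: "quadratic_galois \<iota>\<^sub>2 \<sigma>\<^sub>2" "\<not> alg_isomorphic \<iota>\<^sub>1 \<iota>\<^sub>2"
    and zeta1: "\<zeta>\<^sub>1 \<in> O\<^sub>1" "(\<zeta>\<^sub>1 - \<sigma>\<^sub>1 \<zeta>\<^sub>1) * (\<zeta>\<^sub>1 + \<sigma>\<^sub>1 \<zeta>\<^sub>1) \<in> ring_units O\<^sub>1"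
    and pi2: "O\<^sub>2 = int_adjoin \<iota>\<^sub>2 \<pi>\<^sub>2"
    and tensor: "is_tensor_product \<iota>\<^sub>1 \<iota>\<^sub>1 i j" "is_tensor_product \<iota>\<^sub>1 \<iota>\<^sub>2 i' j'"
    and alpha: "free_embedding TYPE('n) UNIV \<iota>\<^sub>1 \<alpha>\<^sub>1" "free_embedding TYPE('n) UNIV \<iota>\<^sub>2 \<alpha>\<^sub>2"
    and beta: "free_embedding TYPE('n) K\<^sub>0 \<iota>\<^sub>0 \<beta>\<^sub>0" "free_embedding TYPE('n) K\<^sub>3 \<iota>\<^sub>3 \<beta>\<^sub>3"
    and rss: "regular_semisimple TYPE('n) UNIV \<iota>\<^sub>1 \<alpha>\<^sub>1 w\<^sub>\<alpha> z\<^sub>\<alpha>"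
      "regular_semisimple TYPE('n) K\<^sub>0 \<iota>\<^sub>0 \<beta>\<^sub>0 w\<^sub>\<beta> z\<^sub>\<beta>"
    and match: "matching \<iota>\<^sub>1 \<sigma>\<^sub>1 \<sigma>\<^sub>2 i j i' j' \<alpha>\<^sub>1 \<alpha>\<^sub>2 \<beta>\<^sub>0 \<beta>\<^sub>3"
    and z_unit: "z\<^sub>\<alpha> \<in> GL_int"
    and ref_alpha: "reference_embedding TYPE('n) UNIV O\<^sub>1 \<iota>\<^sub>1 \<rho>\<^sub>1" "conjugate_by UNIV g\<^sub>1 \<rho>\<^sub>1 \<alpha>\<^sub>1"
      "reference_embedding TYPE('n) UNIV O\<^sub>2 \<iota>\<^sub>2 \<rho>\<^sub>2" "conjugate_by UNIV g\<^sub>2 \<rho>\<^sub>2 \<alpha>\<^sub>2"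
    and ref_beta: "reference_embedding TYPE('n) K\<^sub>0 O\<^sub>0 \<iota>\<^sub>0 \<rho>\<^sub>0" "conjugate_by K\<^sub>0 g\<^sub>0 \<rho>\<^sub>0 \<beta>\<^sub>0"
      "reference_embedding TYPE('n) K\<^sub>3 O\<^sub>3 \<iota>\<^sub>3 \<rho>\<^sub>3" "conjugate_by K\<^sub>3 g\<^sub>3 \<rho>\<^sub>3 \<beta>\<^sub>3"
    and measures: "orbital_measure UNIV \<rho>\<^sub>1 UNIV \<rho>\<^sub>2 w\<^sub>\<alpha> g\<^sub>1 g\<^sub>2 Q\<^sub>\<alpha>"
      "orbital_measure K\<^sub>0 \<rho>\<^sub>0 K\<^sub>3 \<rho>\<^sub>3 w\<^sub>\<beta> g\<^sub>0 g\<^sub>3 Q\<^sub>\<beta>"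
  shows "Orb Q\<^sub>\<alpha> (indicator GL_int) g\<^sub>1 g\<^sub>2 =
         Orb_s Q\<^sub>\<beta> (indicator GL_int) g\<^sub>0 g\<^sub>3 (\<beta>\<^sub>0 \<zeta>\<^sub>0) (\<beta>\<^sub>0 \<zeta>\<^sub>0') z\<^sub>\<beta> 0"
proof -
  interpret K1: quadratic_ext \<iota>\<^sub>1 \<sigma>\<^sub>1 by unfold_locales (rule K1(1))
  interpret K2: quadratic_ext \<iota>\<^sub>2 \<sigma>\<^sub>2 by unfold_locales (rule K2(1))
  have O: "O\<^sub>1 = K1.norm_ring" "O\<^sub>2 = K2.norm_ring"
    by (simp_all add: defs(1,2) K1.max_order_eq_norm_ring K2.max_order_eq_norm_ring)
  obtain t1 n1 where \<zeta>: "\<zeta>\<^sub>1 \<notin> range \<iota>\<^sub>1" "\<sigma>\<^sub>1 \<zeta>\<^sub>1 = \<iota>\<^sub>1 t1 - \<zeta>\<^sub>1" "\<zeta>\<^sub>1 * \<sigma>\<^sub>1 \<zeta>\<^sub>1 = \<iota>\<^sub>1 n1"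
    and nr1: "no_root t1 n1" and i1: "t1 \<in> int_ring" "n1 \<in> int_ring" and d1: "aval t1 = 1" "aval (t1 ^ 2 - 4 * n1) = 1"
    using K1.unit_discriminant_generator[of \<zeta>\<^sub>1] zeta1 unfolding O by blast
  obtain t2 n2 where \<pi>: "\<pi>\<^sub>2 \<notin> range \<iota>\<^sub>2" "\<sigma>\<^sub>2 \<pi>\<^sub>2 = \<iota>\<^sub>2 t2 - \<pi>\<^sub>2" "\<pi>\<^sub>2 * \<sigma>\<^sub>2 \<pi>\<^sub>2 = \<iota>\<^sub>2 n2"
    and nr2: "no_root t2 n2" and mq2: "maximal_quadratic t2 n2"
    using K2.maximal_order_generator[of \<pi>\<^sub>2] pi2 unfolding O by blast
  have i2: "t2 \<in> int_ring" "n2 \<in> int_ring" using mq2 by (auto simp: maximal_quadratic_def)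
  have emb: "alg_embedding UNIV \<iota>\<^sub>1 \<alpha>\<^sub>1" "alg_embedding UNIV \<iota>\<^sub>2 \<alpha>\<^sub>2" "alg_embedding K\<^sub>0 \<iota>\<^sub>0 \<beta>\<^sub>0" "alg_embedding K\<^sub>3 \<iota>\<^sub>3 \<beta>\<^sub>3"
    using alpha beta by (auto simp: free_embedding_def)
  have emb_ref: "alg_embedding UNIV \<iota>\<^sub>1 \<rho>\<^sub>1" "alg_embedding UNIV \<iota>\<^sub>2 \<rho>\<^sub>2" "alg_embedding K\<^sub>0 \<iota>\<^sub>0 \<rho>\<^sub>0" "alg_embedding K\<^sub>3 \<iota>\<^sub>3 \<rho>\<^sub>3"
    using ref_alpha ref_beta by (auto simp: free_embedding_def reference_embedding_def)
  obtain r where r: "r \<in> int_ring" "aval (t2 - 2 * r) < 1" "aval (n2 - r ^ 2) < 1"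
    using K1.residually_square[OF \<zeta> nr1 i1 d1(2) emb(1) K2 \<pi> nr2 i2] by blast
  define t3 n3 where "t3 = t1 * t2" and "n3 = n1 * t2 ^ 2 + t1 ^ 2 * n2 - 4 * n1 * n2"
  have mq1: "maximal_quadratic t1 n1" by (rule maximal_quadratic_unit_disc[OF nr1 i1 d1(2)])
  have mq3: "maximal_quadratic t3 n3" unfolding t3_def n3_def by (rule maximal_quadratic_third[OF i1 d1(2) mq2 r])
  then have i3: "t3 \<in> int_ring" "n3 \<in> int_ring" by (auto simp: maximal_quadratic_def)
  \<comment> \<open>The rings \<open>K\<^sub>0\<close> and \<open>K\<^sub>3\<close> are spanned by 1 and one generator, with explicit quadratic equations.\<close>
  interpret S: tensor_square \<iota>\<^sub>1 \<sigma>\<^sub>1 i j \<zeta>\<^sub>1 t1 n1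
    by unfold_locales (rule tensor(1), (rule \<zeta>)+)
  interpret T: tensor_pair \<iota>\<^sub>1 \<sigma>\<^sub>1 \<iota>\<^sub>2 \<sigma>\<^sub>2 i' j' \<pi>\<^sub>2 t2 n2
    by unfold_locales (rule tensor(2), (rule \<pi>)+)
  have hom0: "\<iota>\<^sub>0 0 = 0" "\<iota>\<^sub>0 1 = 1" "\<And>c. \<iota>\<^sub>0 (- c) = - \<iota>\<^sub>0 c" "\<And>c. \<iota>\<^sub>0 c = i (\<iota>\<^sub>1 c)"
    by (simp_all add: defs(5) K1.iota_hom K1.iota_minus S.i_hom S.i_minus)
  have hom3: "\<iota>\<^sub>3 0 = 0" "\<iota>\<^sub>3 1 = 1" "\<And>c. \<iota>\<^sub>3 (- c) = - \<iota>\<^sub>3 c" "\<And>c. \<iota>\<^sub>3 c = i' (\<iota>\<^sub>1 c)"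
    by (simp_all add: defs(6) K1.iota_hom K1.iota_minus T.i_hom T.i_minus)
  have \<zeta>0: "\<zeta>\<^sub>0 = S.idem" "\<zeta>\<^sub>0' = 1 - \<zeta>\<^sub>0" by (simp_all add: defs(9,10) S.K0_elem_10 S.K0_elem_01)
  have K0: "\<zeta>\<^sub>0 \<in> K\<^sub>0" "\<And>c. \<iota>\<^sub>0 c \<in> K\<^sub>0" "\<And>c. \<iota>\<^sub>0 c * \<zeta>\<^sub>0 \<in> K\<^sub>0"
    using S.idem_fixed S.fixed_scalar S.fixed_scale[OF S.idem_fixed] by (simp_all add: defs(3) \<zeta>0(1) hom0(4))
  have K0_spans: "\<exists>c d. x = \<iota>\<^sub>0 c + \<iota>\<^sub>0 d * \<zeta>\<^sub>0" if "x \<in> K\<^sub>0" for x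
    using S.fixed_spans that by (simp add: defs(3) \<zeta>0(1) hom0(4))
  have sq0: "\<zeta>\<^sub>0 * \<zeta>\<^sub>0 = \<iota>\<^sub>0 1 * \<zeta>\<^sub>0 - \<iota>\<^sub>0 0" by (simp add: \<zeta>0(1) S.idem_idem hom0(1,2))
  note \<theta> = T.fixed_ring[OF \<zeta>, folded defs(11)]
  have K3: "\<pi>\<^sub>3 \<in> K\<^sub>3" "\<And>c. \<iota>\<^sub>3 c \<in> K\<^sub>3" "\<And>c. \<iota>\<^sub>3 c * \<pi>\<^sub>3 \<in> K\<^sub>3"
    using \<theta>(2) T.fixed_scalar T.fixed_scale[OF \<theta>(2)] by (simp_all add: defs(4) hom3(4))
  have K3_spans: "\<exists>c d. x = \<iota>\<^sub>3 c + \<iota>\<^sub>3 d * \<pi>\<^sub>3" if "x \<in> K\<^sub>3" for x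
    using \<theta>(3) that by (simp add: defs(4) hom3(4))
  have sq3: "\<pi>\<^sub>3 * \<pi>\<^sub>3 = \<iota>\<^sub>3 t3 * \<pi>\<^sub>3 - \<iota>\<^sub>3 n3" using \<theta>(4) by (simp only: hom3(4) t3_def n3_def)
  have \<pi>3': "\<pi>\<^sub>3' = \<iota>\<^sub>3 t3 - \<pi>\<^sub>3" using \<theta>(5) by (simp only: hom3(4) t3_def defs(12))
  have sq1: "\<zeta>\<^sub>1 * \<zeta>\<^sub>1 = \<iota>\<^sub>1 t1 * \<zeta>\<^sub>1 - \<iota>\<^sub>1 n1" by (rule S.g_square)
  have sq2: "\<pi>\<^sub>2 * \<pi>\<^sub>2 = \<iota>\<^sub>2 t2 * \<pi>\<^sub>2 - \<iota>\<^sub>2 n2" by (rule T.g_square)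

  define a b p b3 where "a = \<alpha>\<^sub>1 \<zeta>\<^sub>1" and "b = \<alpha>\<^sub>2 \<pi>\<^sub>2" and "p = \<beta>\<^sub>0 \<zeta>\<^sub>0" and "b3 = \<beta>\<^sub>3 \<pi>\<^sub>3"
  note ea = embedding_quadratic[OF emb(1) _ _ _ K1.iota_minus K1.iota_hom(1) sq1, simplified, folded a_def]
  note eb = embedding_quadratic[OF emb(2) _ _ _ K2.iota_minus K2.iota_hom(1) sq2, simplified, folded b_def]
  note ep = embedding_quadratic[OF emb(3) K0 hom0(3) hom0(2) sq0, folded p_def]
  note e3 = embedding_quadratic[OF emb(4) K3 hom3(3) hom3(2) sq3, folded b3_def]
  have p': "\<beta>\<^sub>0 \<zeta>\<^sub>0' = mat 1 - p" using ep(2) by (simp add: \<zeta>0(2) hom0(2))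
  have p_idem: "p ** p = p" using ep(1) by simp
  interpret A: local_quaternion_pair a b t1 n1 t2 n2
    by unfold_locales (rule ea(1) eb(1) i1 i2 d1(2))+
  interpret B: local_quaternion_pair p b3 1 0 t3 n3
  proof unfold_locales
    show "aval (1 ^ 2 - 4 * 0 :: 'f) = 1" by simp
  qed (rule ep(1) e3(1) i3 int_ring_intros)+
  have wz_a: "w\<^sub>\<alpha> = A.w" "z\<^sub>\<alpha> = A.z"
    by (simp_all only: defs(13,14) w_elem_def z_elem_def A.w_def A.z_def \<zeta>(2) \<pi>(2) ea(2) eb(2) a_def[symmetric] b_def[symmetric])
  have wz_b: "w\<^sub>\<beta> = B.w" "z\<^sub>\<beta> = B.z"
    by (simp_all only: defs(15,16) w_elem_def z_elem_def B.w_def B.z_def \<pi>3' p' e3(2) p_def[symmetric] b3_def[symmetric])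

  \<comment> \<open>The matching isomorphism is inner, and its matrix descends to an operator over \<open>F\<close>.\<close>
  obtain J where J: "mat_automorphism J" "J (map_matrix \<iota>\<^sub>1 p) = base_change \<iota>\<^sub>1 i j \<alpha>\<^sub>1 S.idem"
      "J (map_matrix \<iota>\<^sub>1 b3) = base_change \<iota>\<^sub>1 i' j' \<alpha>\<^sub>2 \<pi>\<^sub>3"
    using match S.idem_fixed \<theta>(2) unfolding matching_def p_def b3_def \<zeta>0(1) by blast
  obtain P where P: "invertible P" "\<And>M. J M ** P = P ** M" using automorphism_inner[OF J(1)] by blast
  have P0: "(mat (- (\<sigma>\<^sub>1 \<zeta>\<^sub>1 / (\<zeta>\<^sub>1 - \<sigma>\<^sub>1 \<zeta>\<^sub>1))) + mat (1 / (\<zeta>\<^sub>1 - \<sigma>\<^sub>1 \<zeta>\<^sub>1)) ** map_matrix \<iota>\<^sub>1 a) ** P = P ** map_matrix \<iota>\<^sub>1 p"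
    using P(2)[of "map_matrix \<iota>\<^sub>1 p"] unfolding J(2) S.idem_def S.base_change_eq[OF emb(1)] a_def .
  have P3: "(mat (\<sigma>\<^sub>1 \<zeta>\<^sub>1 * \<iota>\<^sub>1 t2) + mat (\<zeta>\<^sub>1 - \<sigma>\<^sub>1 \<zeta>\<^sub>1) ** map_matrix \<iota>\<^sub>1 b) ** P = P ** map_matrix \<iota>\<^sub>1 b3"
    using P(2)[of "map_matrix \<iota>\<^sub>1 b3"] unfolding J(3) \<theta>(1) T.base_change_eq[OF emb(2)] b_def .
  have z_int: "b ** a - a ** b \<in> GL_int" using z_unit by (simp add: wz_a A.z_def)
  obtain u v T where "matched_pairs a b p b3 t1 n1 t2 n2 u v T"
    using K1.matching_operator[OF \<zeta> A.local_quaternion_pair_axioms B.local_quaternion_pair_axioms[unfolded t3_def n3_def]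
      d1(1) z_int r P(1) P0 P3] by blast
  then interpret M: matched_pairs a b p b3 t1 n1 t2 n2 u v T
    rewrites "t1 * t2 = t3" and "n1 * t2 ^ 2 + t1 ^ 2 * n2 - 4 * n1 * n2 = n3"
    by (simp_all add: t3_def n3_def)

  have inv: "invertible g\<^sub>1" "invertible g\<^sub>2" "invertible g\<^sub>0" "invertible g\<^sub>3"
    using ref_alpha ref_beta by (auto simp: conjugate_by_def)
  have conj: "a = g\<^sub>1 ** \<rho>\<^sub>1 \<zeta>\<^sub>1 ** matrix_inv g\<^sub>1" "b = g\<^sub>2 ** \<rho>\<^sub>2 \<pi>\<^sub>2 ** matrix_inv g\<^sub>2"
      "p = g\<^sub>0 ** \<rho>\<^sub>0 \<zeta>\<^sub>0 ** matrix_inv g\<^sub>0" "b3 = g\<^sub>3 ** \<rho>\<^sub>3 \<pi>\<^sub>3 ** matrix_inv g\<^sub>3"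
    using ref_alpha ref_beta K0(1) K3(1) by (auto simp: conjugate_by_def a_def b_def p_def b3_def)
  have "\<pi>\<^sub>2 \<in> O\<^sub>2" using i2(2) by (simp add: O K2.norm_ring_def K2.trace_norm_eq(2)[OF \<pi>(3)] int_ring_def)
  moreover have "\<zeta>\<^sub>0 \<in> O\<^sub>0"
  proof -
    have "(1, 0) \<in> (\<iota>\<^sub>1 ` int_ring) \<times> (\<iota>\<^sub>1 ` int_ring)"
      using imageI[of 1 int_ring \<iota>\<^sub>1] imageI[of 0 int_ring \<iota>\<^sub>1] by (simp add: K1.iota_hom int_ring_intros)
    then show ?thesis using S.idem_fixed by (simp add: defs(7) K0_order_def \<zeta>0(1) S.idem_coords)
  qed
  moreover have "\<pi>\<^sub>3 \<in> O\<^sub>3"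
    using K3(1) integral_over_quadratic[OF hom3(1,2,3) sq3 i3] by (simp add: defs(8) max_order_def)
  ultimately have int: "\<rho>\<^sub>1 \<zeta>\<^sub>1 \<in> mat_over int_ring" "\<rho>\<^sub>2 \<pi>\<^sub>2 \<in> mat_over int_ring"
      "\<rho>\<^sub>0 \<zeta>\<^sub>0 \<in> mat_over int_ring" "\<rho>\<^sub>3 \<pi>\<^sub>3 \<in> mat_over int_ring"
    using ref_alpha ref_beta zeta1(1) by (auto simp: reference_embedding_def)
  have sp1: "\<exists>k d. \<rho>\<^sub>1 x = mat k + mat d ** \<rho>\<^sub>1 \<zeta>\<^sub>1" for x
    using K1.generator_spans[OF \<zeta>(1), of x] alg_embedding_generator[OF emb_ref(1)] by blast
  have sp2: "\<exists>k d. \<rho>\<^sub>2 x = mat k + mat d ** \<rho>\<^sub>2 \<pi>\<^sub>2" for x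
    using K2.generator_spans[OF \<pi>(1), of x] alg_embedding_generator[OF emb_ref(2)] by blast
  have sp0: "\<exists>k d. \<rho>\<^sub>0 x = mat k + mat d ** \<rho>\<^sub>0 \<zeta>\<^sub>0" if "x \<in> K\<^sub>0" for x
    using K0_spans[OF that] alg_embedding_generator[OF emb_ref(3) K0(2) K0(2) K0(1) K0(3)] by blast
  have sp3: "\<exists>k d. \<rho>\<^sub>3 x = mat k + mat d ** \<rho>\<^sub>3 \<pi>\<^sub>3" if "x \<in> K\<^sub>3" for x
    using K3_spans[OF that] alg_embedding_generator[OF emb_ref(4) K3(2) K3(2) K3(1) K3(3)] by blast
  have tr: "\<exists>h. invertible h \<and> h ** c = c ** h \<and> (*v) h ` \<Lambda> = \<Lambda>'"
    if "maximal_quadratic t n" "c ** c = mat t ** c - mat n"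
      "\<Lambda> \<in> lattices" "c \<in> stabilizers \<Lambda>" "\<Lambda>' \<in> lattices" "c \<in> stabilizers \<Lambda>'" for t n \<Lambda> \<Lambda>' and c :: "'f^'m^'m"
    using transitive_quadratic[OF that] by metis
  have tr0: "\<exists>h. invertible h \<and> h ** p = p ** h \<and> (*v) h ` \<Lambda> = \<Lambda>'"
    if "\<Lambda> \<in> lattices" "p \<in> stabilizers \<Lambda>" "\<Lambda>' \<in> lattices" "p \<in> stabilizers \<Lambda>'" for \<Lambda> \<Lambda>'
    using transitive_idempotent[OF p_idem that] by metis
  \<comment> \<open>The lattices that occur in the two integrals are exactly the stable ones.\<close>
  note pc1 = position_coset_nonempty[where A = UNIV and \<rho> = \<rho>\<^sub>1 and \<theta> = \<zeta>\<^sub>1 and g = g\<^sub>1 and c = a,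
    OF inv(1) conj(1) UNIV_I int(1) sp1 tr[OF mq1 ea(1)]]
  note pc2 = position_coset_nonempty[where A = UNIV and \<rho> = \<rho>\<^sub>2 and \<theta> = \<pi>\<^sub>2 and g = g\<^sub>2 and c = b,
    OF inv(2) conj(2) UNIV_I int(2) sp2 tr[OF mq2 eb(1)]]
  note pc0 = position_coset_nonempty[where A = K\<^sub>0 and \<rho> = \<rho>\<^sub>0 and \<theta> = \<zeta>\<^sub>0 and g = g\<^sub>0 and c = p,
    OF inv(3) conj(3) K0(1) int(3) sp0 tr0]
  note pc3 = position_coset_nonempty[where A = K\<^sub>3 and \<rho> = \<rho>\<^sub>3 and \<theta> = \<pi>\<^sub>3 and g = g\<^sub>3 and c = b3,
    OF inv(4) conj(4) K3(1) int(4) sp3 tr[OF mq3 e3(1)]]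

  have unit: "invertible l" "c ** w = w ** c \<Longrightarrow> l ** c = c ** l"
    if "l \<in> mat_units (adjoin w)" for l c w :: "'f^'m^'m"
    using that matrix_groupD(2)[OF mat_units_adjoin_group] adjoin_commute[of c w l] by (auto simp: mat_units_def)
  have comA: "l ** a = a ** l" "l ** b = b ** l" if "l \<in> mat_units (adjoin A.w)" for l
    using unit(2)[OF that] A.w_a A.w_b by (simp_all only:)
  have comB: "l ** p = p ** l" "l ** b3 = b3 ** l" if "l \<in> mat_units (adjoin B.w)" for l
    using unit(2)[OF that] B.w_a B.w_b by (simp_all only:)
  obtain \<mu>1 \<mu>2 \<nu> where m: "haar_measure (centralizer UNIV \<rho>\<^sub>1) (centralizer UNIV \<rho>\<^sub>1 \<inter> GL_int) \<mu>1"
      "haar_measure (centralizer UNIV \<rho>\<^sub>2) (centralizer UNIV \<rho>\<^sub>2 \<inter> GL_int) \<mu>2"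
      "haar_measure (mat_units (adjoin A.w)) (mat_units (adjoin_max_order A.w)) \<nu>"
      "quotient_measure (pair_action g\<^sub>1 g\<^sub>2) \<nu> (\<mu>1 \<Otimes>\<^sub>M \<mu>2) Q\<^sub>\<alpha>"
    using measures(1) unfolding orbital_measure_def wz_a by blast
  obtain \<mu>0 \<mu>3 \<nu>' where m': "haar_measure (centralizer K\<^sub>0 \<rho>\<^sub>0) (centralizer K\<^sub>0 \<rho>\<^sub>0 \<inter> GL_int) \<mu>0"
      "haar_measure (centralizer K\<^sub>3 \<rho>\<^sub>3) (centralizer K\<^sub>3 \<rho>\<^sub>3 \<inter> GL_int) \<mu>3"
      "haar_measure (mat_units (adjoin B.w)) (mat_units (adjoin_max_order B.w)) \<nu>'"
      "quotient_measure (pair_action g\<^sub>0 g\<^sub>3) \<nu>' (\<mu>0 \<Otimes>\<^sub>M \<mu>3) Q\<^sub>\<beta>"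
    using measures(2) unfolding orbital_measure_def wz_b by blast
  interpret UA: orbital_unfolding "centralizer UNIV \<rho>\<^sub>1" "centralizer UNIV \<rho>\<^sub>2" g\<^sub>1 g\<^sub>2 A.w \<mu>1 \<mu>2 \<nu> Q\<^sub>\<alpha>
    by (intro orbital_unfolding.intro matrix_group_centralizer inv m pc1(2) pc2(2))
      (simp_all add: unit(1) comA)
  interpret UB: orbital_unfolding "centralizer K\<^sub>0 \<rho>\<^sub>0" "centralizer K\<^sub>3 \<rho>\<^sub>3" g\<^sub>0 g\<^sub>3 B.w \<mu>0 \<mu>3 \<nu>' Q\<^sub>\<beta>
    by (intro orbital_unfolding.intro matrix_group_centralizer inv m' pc0(2) pc3(2))
      (simp_all add: unit(1) comB)
  have common: "\<Lambda> \<in> UA.common_lattices \<longleftrightarrow> \<Lambda> \<in> lattices \<and> a \<in> stabilizers \<Lambda> \<and> b \<in> stabilizers \<Lambda>"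
      "\<Lambda> \<in> UB.common_lattices \<longleftrightarrow> \<Lambda> \<in> lattices \<and> p \<in> stabilizers \<Lambda> \<and> b3 \<in> stabilizers \<Lambda>" for \<Lambda>
    using pc1(1)[of \<Lambda>] pc2(1)[of \<Lambda>] pc0(1)[of \<Lambda>] pc3(1)[of \<Lambda>]
    unfolding UA.common_lattices_def UB.common_lattices_def by blast+
  have lat: "(*v) T ` \<Lambda> \<in> UA.common_lattices \<longleftrightarrow> \<Lambda> \<in> UB.common_lattices" if L: "\<Lambda> \<in> lattices" for \<Lambda>
    using M.stable_image[OF L] M.stable_preimage[OF L] lattice_image[OF M.T(1) L] L unfolding common by blast
  have tp: "UA.equal_orbits \<in> sets Q\<^sub>\<alpha>" "UB.equal_orbits \<in> sets Q\<^sub>\<beta>"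
      "measure Q\<^sub>\<alpha> UA.equal_orbits = measure Q\<^sub>\<beta> UB.equal_orbits"
    by (rule equal_orbits_transport[OF UA.orbital_unfolding_axioms UB.orbital_unfolding_axioms M.T(1,2)], erule lat)+
  have Omega: "Omega p (mat 1 - p) B.z \<Lambda> 0 = 1" if L: "\<Lambda> \<in> UB.common_lattices" for \<Lambda>
    using L M.beta_z_image B.z_a unfolding common by (intro Omega_1) auto
  have "Orb Q\<^sub>\<alpha> (indicator GL_int) g\<^sub>1 g\<^sub>2 = complex_of_real (measure Q\<^sub>\<alpha> UA.equal_orbits)"
    unfolding Orb_def
    by (rule UA.integral_equal_positions[OF tp(1)], unfold prod.case) (rule UA.position_coset_indicator)
  also have "\<dots> = complex_of_real (measure Q\<^sub>\<beta> UB.equal_orbits)" by (simp only: tp(3))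
  also have "\<dots> = Orb_s Q\<^sub>\<beta> (indicator GL_int) g\<^sub>0 g\<^sub>3 p (mat 1 - p) B.z 0"
    unfolding Orb_s_def
  proof (rule UB.integral_equal_positions[OF tp(2), symmetric], unfold prod.case)
    fix h0 h3 assume h: "h0 \<in> centralizer K\<^sub>0 \<rho>\<^sub>0" "h3 \<in> centralizer K\<^sub>3 \<rho>\<^sub>3"
    show "indicator GL_int (matrix_inv h0 ** matrix_inv g\<^sub>0 ** g\<^sub>3 ** h3) *
        Omega p (mat 1 - p) B.z ((*v) (g\<^sub>0 ** h0) ` std_lattice) 0 =
        (if lattice_of (g\<^sub>0 ** h0) = lattice_of (g\<^sub>3 ** h3) then 1 else 0)"
    proof (cases "lattice_of (g\<^sub>0 ** h0) = lattice_of (g\<^sub>3 ** h3)")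
      case True
      then have "lattice_of (g\<^sub>0 ** h0) \<in> UB.common_lattices"
        using h by (auto simp: UB.common_lattices_def position_coset_def)
      then show ?thesis
        using True unfolding UB.position_coset_indicator[OF h] lattice_of_def[symmetric] by (simp add: Omega)
    qed (unfold UB.position_coset_indicator[OF h], simp)
  qed
  finally show ?thesis unfolding p' wz_b p_def[symmetric] .
qed

end
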